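(* Let $\lambda,\mu>0$. For $n\ge1$ let $Z^{\sharp}_n$ be the normalized queue-length process of the initially empty M/M/$\infty$ queue, and let $Z^\sharp$ be the limiting Gaussian process, both defined in the context. For any $T>0$ there exists a constant $c_T>0$ such that for all integers $n\ge 3$, $$\mathrm{d}_{\Sigma}\left(Z^{\sharp}_n,Z^{\sharp}\right)\le\frac{c_T\,\log n}{\log\log n\ \sqrt n},$$ where the processes are considered on $[0,T]$.
   Context: Rescaled queue. For $n\ge1$, let $N_{\lambda n}$ be a Poisson process of intensity $\lambda n$ and $(N^i_\mu)_{i\ge1}$ independent Poisson processes of intensity $\mu$, independent of $N_{\lambda n}$. The rescaled infinite-server queue, initially empty, is the solution of $$\overline{L^{\sharp}_n}(t)=\frac{N_{\lambda n}(t)}{n}-\frac1n\sum_{i=1}^{\infty}\int_0^t\mathbf 1_{\{\overline{L^{\sharp}_n}(s^-)\ge i/n\}}\,dN^i_\mu(s),\quad t\ge 0,$$ i.e. $n\overline{L^\sharp_n}$ is the number of customers in an M/M/$\infty$ queue with arrival rate $\lambda n$ and service rate $\mu$. With $\rho=\lambda/\mu$, put $\overline{L^\sharp}(t)=\rho-\rho e^{-\mu t}$ and $Z^\sharp_n(t)=\sqrt n\left(\overline{L^\sharp_n}(t)-\overline{L^\sharp}(t)\right)$. The limit process is $$Z^\sharp(t)=\int_0^t e^{-\mu(t-s)}\sqrt{h(s)}\,dB(s),\qquad h(t)=\lambda(2-e^{-\mu t}),$$ with $B$ a standard Brownian motion (so $Z^\sharp(0)=0$). Distance. $\mathbb D$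 is the space of càdlàg functions $[0,T]\to\mathbb R$, $W$ is the space of continuous functions $[0,T]\to\mathbb R$, and $\|f\|_W=\sup_{t\in[0,T]}|f(t)|$. $H$ is the Hilbert space of functions $h(t)=\int_0^t h'(s)\,ds$ with $h'\in L^2([0,T])$, with scalar product $\langle h,g\rangle_H=\int_0^T h'(s)g'(s)\,ds$. A function $f$ is twice $H$-differentiable if for every $w\in W$, $h\in H$ the map $\varepsilon\mapsto f(w+\varepsilon h)$ is twice differentiable in a neighborhood of $0$; its second order gradient $D^{(2)}f(w)$ is given by $$\langle D^{(2)}f(w),h_1\otimes h_2\rangle_{H^{\otimes(2)}}=\left.\frac{\partial^2}{\partial\varepsilon_1\partial\varepsilon_2}f(w+\varepsilon_1h_1+\varepsilon_2h_2)\right|_{\varepsilon_1=\varepsilon_2=0},\quad h_1,h_2\in H.$$ $\Sigma$ is the set of (measurable) functions $F:\mathbb D\to\mathbb R$ that are $1$-Lipschitz for the sup norm, whose restriction to $W$ is twice $H$-differentiable, and such that for all $g\in W$ and $h,k\in H$, $$\sup_{w\in W}\left|\langle D^{(2)}F(w)-D^{(2)}F(w+g),h\otimes k\rangle_{H^{\otimes(2)}}\right|\le\|g\|_W\|h\|_{L^2}\|k\|_{L^2},$$ where $\|h\|_{L^2}^2=\int_0^T h(s)^2ds$. For random elements $U,V$ of $\mathbb D$, $\mathrm d_\Sigma(U,V)=\sup_{F\in\Sigma}|\mathbf E[F(U)]-\mathbf E[F(V)]|$. *)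

theory Defs
  imports "HOL-Probability.Probability"
begin

section \<open>Path spaces on a bounded time interval\<close>

text \<open>
  Functions on \<open>[0,T]\<close> are represented extensionally (they are \<^const>\<open>undefined\<close> off
  \<open>{0..T}\<close>), as in the product space \<open>PiM {0..T} (\<lambda>_. borel)\<close>. Linear combinations are
  therefore restricted to \<open>{0..T}\<close> explicitly.
\<close>

text \<open>At an end point of \<open>S\<close> the filter on the missing side is trivial and imposes nothing.\<close>

definition cadlag_on :: "real set \<Rightarrow> (real \<Rightarrow> real) \<Rightarrow> bool" where
  "cadlag_on S f \<longleftrightarrow>
     (\<forall>t\<in>S. (f \<longlongrightarrow> f t) (at t within S \<inter> {t<..})) \<and>
     (\<forall>t\<in>S. \<exists>l. (f \<longlongrightarrow> l) (at t within S \<inter> {..<t}))"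

definition D_space :: "real \<Rightarrow> (real \<Rightarrow> real) set" where
  "D_space T = {f \<in> extensional {0..T}. cadlag_on {0..T} f}"

definition W_space :: "real \<Rightarrow> (real \<Rightarrow> real) set" where
  "W_space T = {f \<in> extensional {0..T}. continuous_on {0..T} f}"

definition H_space :: "real \<Rightarrow> (real \<Rightarrow> real) set" where
  "H_space T = {h \<in> extensional {0..T}. \<exists>h'.
     set_borel_measurable lborel {0..T} h' \<and>
     set_integrable lborel {0..T} (\<lambda>s. (h' s)\<^sup>2) \<and>
     (\<forall>t\<in>{0..T}. h t = (LINT s:{0..t}|lborel. h' s))}"

definition sup_norm :: "real \<Rightarrow> (real \<Rightarrow> real) \<Rightarrow> real" where
  "sup_norm T f = (SUP t\<in>{0..T}. \<bar>f t\<bar>)"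

definition L2_norm :: "real \<Rightarrow> (real \<Rightarrow> real) \<Rightarrow> real" where
  "L2_norm T f = sqrt (LINT s:{0..T}|lborel. (f s)\<^sup>2)"

text \<open>
  The sigma-algebra generated by the coordinate maps, which is also the Borel sigma-algebra of the
  Skorokhod topology; it is strictly smaller than that of the sup norm.
\<close>

definition D_algebra :: "real \<Rightarrow> (real \<Rightarrow> real) measure" where
  "D_algebra T = restrict_space (PiM {0..T} (\<lambda>_. borel)) (D_space T)"


section \<open>Test functionals and the distance\<close>

definition twice_H_differentiable :: "real \<Rightarrow> ((real \<Rightarrow> real) \<Rightarrow> real) \<Rightarrow> bool" where
  "twice_H_differentiable T F \<longleftrightarrow>
     (\<forall>w\<in>W_space T. \<forall>h\<in>H_space T.
        let \<phi> = (\<lambda>\<epsilon>::real. F (\<lambda>t\<in>{0..T}. w t + \<epsilon> * h t)) in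
        \<forall>\<^sub>F \<epsilon> in nhds 0. \<phi> differentiable (at \<epsilon>) \<and> deriv \<phi> differentiable (at \<epsilon>))"

text \<open>
  \<open>D2 T F w h k\<close> is the pairing of the second order gradient of \<open>F\<close> at \<open>w\<close> with the tensor
  \<open>h \<otimes> k\<close>, that is the mixed partial derivative defining it. Since \<^const>\<open>deriv\<close> is a total function,
  \<open>has_D2\<close> records that this derivative exists; the inner derivative exists as soon as \<open>F\<close> is
  twice H-differentiable.
\<close>

definition D2 :: "real \<Rightarrow> ((real \<Rightarrow> real) \<Rightarrow> real) \<Rightarrow>
    (real \<Rightarrow> real) \<Rightarrow> (real \<Rightarrow> real) \<Rightarrow> (real \<Rightarrow> real) \<Rightarrow> real" where
  "D2 T F w h k =
     deriv (\<lambda>\<epsilon>\<^sub>1::real. deriv (\<lambda>\<epsilon>\<^sub>2::real. F (\<lambda>t\<in>{0..T}. w t + \<epsilon>\<^sub>1 * h t + \<epsilon>\<^sub>2 * k t)) 0) 0"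

definition has_D2 :: "real \<Rightarrow> ((real \<Rightarrow> real) \<Rightarrow> real) \<Rightarrow>
    (real \<Rightarrow> real) \<Rightarrow> (real \<Rightarrow> real) \<Rightarrow> (real \<Rightarrow> real) \<Rightarrow> bool" where
  "has_D2 T F w h k \<longleftrightarrow>
     (\<lambda>\<epsilon>\<^sub>1::real. deriv (\<lambda>\<epsilon>\<^sub>2::real. F (\<lambda>t\<in>{0..T}. w t + \<epsilon>\<^sub>1 * h t + \<epsilon>\<^sub>2 * k t)) 0)
       differentiable (at 0)"

definition Sigma_class :: "real \<Rightarrow> ((real \<Rightarrow> real) \<Rightarrow> real) set" where
  "Sigma_class T = {F.
     F \<in> borel_measurable (D_algebra T) \<and>
     (\<forall>f\<in>D_space T. \<forall>g\<in>D_space T. \<bar>F f - F g\<bar> \<le> sup_norm T (\<lambda>t. f t - g t)) \<and>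
     twice_H_differentiable T F \<and>
     (\<forall>w\<in>W_space T. \<forall>h\<in>H_space T. \<forall>k\<in>H_space T. has_D2 T F w h k) \<and>
     (\<forall>g\<in>W_space T. \<forall>h\<in>H_space T. \<forall>k\<in>H_space T. \<forall>w\<in>W_space T.
        \<bar>D2 T F w h k - D2 T F (\<lambda>t\<in>{0..T}. w t + g t) h k\<bar>
          \<le> sup_norm T g * L2_norm T h * L2_norm T k)}"

definition sample_path :: "real \<Rightarrow> (real \<Rightarrow> 'a \<Rightarrow> real) \<Rightarrow> 'a \<Rightarrow> real \<Rightarrow> real" where
  "sample_path T X \<omega> = (\<lambda>t\<in>{0..T}. X t \<omega>)"

text \<open>
  The two processes may live on different probability spaces. The supremum is taken in the
  extended reals, so that it is meaningful without a boundedness assumption.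
\<close>

definition dist_Sigma ::
  "real \<Rightarrow> 'a measure \<Rightarrow> (real \<Rightarrow> 'a \<Rightarrow> real) \<Rightarrow> 'b measure \<Rightarrow> (real \<Rightarrow> 'b \<Rightarrow> real) \<Rightarrow> ereal" where
  "dist_Sigma T M U M' V =
     (SUP F\<in>Sigma_class T. ereal \<bar>(\<integral>\<omega>. F (sample_path T U \<omega>) \<partial>M) - (\<integral>\<omega>. F (sample_path T V \<omega>) \<partial>M')\<bar>)"


section \<open>Poisson processes and Brownian motion\<close>

definition (in prob_space) indep_increments :: "(real \<Rightarrow> 'a \<Rightarrow> real) \<Rightarrow> bool" where
  "indep_increments X \<longleftrightarrow>
     (\<forall>(t::nat \<Rightarrow> real) k. 0 \<le> t 0 \<and> mono t \<longrightarrow>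
        indep_vars (\<lambda>_. borel) (\<lambda>i \<omega>. X (t (Suc i)) \<omega> - X (t i) \<omega>) {..<k})"

text \<open>The time index is of type \<^typ>\<open>real\<close>, but only non-negative times matter.\<close>

locale poisson_process = prob_space M
  for M :: "'a measure" and r :: real and N :: "real \<Rightarrow> 'a \<Rightarrow> nat" +
  assumes measurable_N: "\<And>t. 0 \<le> t \<Longrightarrow> N t \<in> measurable M (count_space UNIV)"
    and counting_paths: "AE \<omega> in M. N 0 \<omega> = 0 \<and> mono_on {0..} (\<lambda>t. N t \<omega>) \<and>
           cadlag_on {0..} (\<lambda>t. real (N t \<omega>))"
    and indep_increments_N: "indep_increments (\<lambda>t \<omega>. real (N t \<omega>))"
    and poisson_increments: "\<And>s t. 0 \<le> s \<Longrightarrow> s < t \<Longrightarrow>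
           distr M (count_space UNIV) (\<lambda>\<omega>. N t \<omega> - N s \<omega>) = measure_pmf (poisson_pmf (r * (t - s)))"

locale brownian_motion = prob_space M
  for M :: "'a measure" and B :: "real \<Rightarrow> 'a \<Rightarrow> real" +
  assumes measurable_B: "\<And>t. 0 \<le> t \<Longrightarrow> B t \<in> borel_measurable M"
    and continuous_paths: "AE \<omega> in M. B 0 \<omega> = 0 \<and> continuous_on {0..} (\<lambda>t. B t \<omega>)"
    and indep_increments_B: "indep_increments B"
    and normal_increments: "\<And>s t. 0 \<le> s \<Longrightarrow> s < t \<Longrightarrow>
           distributed M lborel (\<lambda>\<omega>. B t \<omega> - B s \<omega>) (normal_density 0 (sqrt (t - s)))"


section \<open>The rescaled infinite-server queue\<close>

text \<open>
  Pathwise Lebesgue-Stieltjes integral over \<open>(0,t]\<close> (a Poisson process does not charge \<open>0\<close>). The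
  \<open>max\<close> extends the path by its value at \<open>0\<close> to negative times, because
  \<^const>\<open>interval_measure\<close> expects a distribution function on the whole line.
\<close>

definition stieltjes_integral :: "(real \<Rightarrow> nat) \<Rightarrow> real \<Rightarrow> (real \<Rightarrow> real) \<Rightarrow> real" where
  "stieltjes_integral N t g = (LINT s:{0<..t}|interval_measure (\<lambda>s. real (N (max 0 s))). g s)"

text \<open>
  \<open>A\<close> is the arrival process, \<open>S i\<close> for \<open>i \<ge> 1\<close> is the service process of index \<open>i\<close> (\<open>S 0\<close> is
  unused) and \<open>L\<close> is the solution of the queueing equation. Independence is that of the processes
  as random elements of the product space over all times \<open>t \<ge> 0\<close>. The series is stated with
  \<open>sums\<close>, so that its convergence is part of the equation.
\<close>

locale rescaled_queue = prob_space M
  for M :: "'a measure" and lam \<mu> :: real and n :: nat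
    and A :: "real \<Rightarrow> 'a \<Rightarrow> nat" and S :: "nat \<Rightarrow> real \<Rightarrow> 'a \<Rightarrow> nat" and L :: "real \<Rightarrow> 'a \<Rightarrow> real" +
  assumes arrivals: "poisson_process M (lam * real n) A"
    and services: "\<And>i. 1 \<le> i \<Longrightarrow> poisson_process M \<mu> (S i)"
    and independence: "indep_vars (\<lambda>_. PiM {0..} (\<lambda>_. count_space UNIV))
           (\<lambda>i \<omega>. \<lambda>t\<in>{0..}. (if i = 0 then A else S i) t \<omega>) UNIV"
    and measurable_L: "\<And>t. 0 \<le> t \<Longrightarrow> L t \<in> borel_measurable M"
    and cadlag_L: "\<And>\<omega>. \<omega> \<in> space M \<Longrightarrow> cadlag_on {0..} (\<lambda>t. L t \<omega>)"
    and equation: "AE \<omega> in M. \<forall>t\<ge>0.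
           (\<lambda>i. stieltjes_integral (\<lambda>s. S (Suc i) s \<omega>) t
                  (\<lambda>s. if Lim (at_left s) (\<lambda>u. L u \<omega>) \<ge> real (Suc i) / real n then 1 else 0))
           sums (real n * (real (A t \<omega>) / real n - L t \<omega>))"

definition fluid_limit :: "real \<Rightarrow> real \<Rightarrow> real \<Rightarrow> real" where
  "fluid_limit lam \<mu> t = (let \<rho> = lam / \<mu> in \<rho> - \<rho> * exp (- \<mu> * t))"

definition Z_n :: "real \<Rightarrow> real \<Rightarrow> nat \<Rightarrow> (real \<Rightarrow> 'a \<Rightarrow> real) \<Rightarrow> real \<Rightarrow> 'a \<Rightarrow> real" where
  "Z_n lam \<mu> n L t \<omega> = sqrt (real n) * (L t \<omega> - fluid_limit lam \<mu> t)"


section \<open>The limit process\<close>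

text \<open>
  \<open>X\<close> is the Wiener integral of the deterministic function \<open>f\<close> over \<open>[0,t]\<close>: the limit in mean
  square of the integrals of step functions that converge to \<open>f\<close> in \<open>L\<^sup>2([0,t])\<close>. By the Wiener
  isometry \<open>X\<close> is almost surely unique. Extended nonnegative integrals are used
  so that non-integrable squares cannot count as zero.
\<close>

definition step_fun :: "nat \<Rightarrow> (nat \<Rightarrow> real) \<Rightarrow> (nat \<Rightarrow> real) \<Rightarrow> real \<Rightarrow> real" where
  "step_fun k p a s = (\<Sum>j<k. a j * indicator {p j<..p (Suc j)} s)"

definition step_integral ::
  "(real \<Rightarrow> 'a \<Rightarrow> real) \<Rightarrow> nat \<Rightarrow> (nat \<Rightarrow> real) \<Rightarrow> (nat \<Rightarrow> real) \<Rightarrow> 'a \<Rightarrow> real" where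
  "step_integral B k p a \<omega> = (\<Sum>j<k. a j * (B (p (Suc j)) \<omega> - B (p j) \<omega>))"

definition is_wiener_integral ::
  "'a measure \<Rightarrow> (real \<Rightarrow> 'a \<Rightarrow> real) \<Rightarrow> real \<Rightarrow> (real \<Rightarrow> real) \<Rightarrow> ('a \<Rightarrow> real) \<Rightarrow> bool" where
  "is_wiener_integral M B t f X \<longleftrightarrow>
     set_borel_measurable lborel {0..t} f \<and> X \<in> borel_measurable M \<and>
     (\<exists>(k::nat \<Rightarrow> nat) (p::nat \<Rightarrow> nat \<Rightarrow> real) (a::nat \<Rightarrow> nat \<Rightarrow> real).
        (\<forall>m. mono (p m) \<and> range (p m) \<subseteq> {0..t}) \<and>
        (\<lambda>m. \<integral>\<^sup>+s\<in>{0..t}. ennreal ((f s - step_fun (k m) (p m) (a m) s)\<^sup>2) \<partial>lborel)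
          \<longlonglongrightarrow> 0 \<and>
        (\<lambda>m. \<integral>\<^sup>+\<omega>. ennreal ((X \<omega> - step_integral B (k m) (p m) (a m) \<omega>)\<^sup>2) \<partial>M)
          \<longlonglongrightarrow> 0)"

definition h_fun :: "real \<Rightarrow> real \<Rightarrow> real \<Rightarrow> real" where
  "h_fun lam \<mu> t = lam * (2 - exp (- \<mu> * t))"

text \<open>
  A stochastic integral is defined only up to null sets for each \<open>t\<close>; \<open>Z\<close> is its continuous
  version.
\<close>

locale limit_process = brownian_motion M B
  for M :: "'a measure" and lam \<mu> T :: real
    and B :: "real \<Rightarrow> 'a \<Rightarrow> real" and Z :: "real \<Rightarrow> 'a \<Rightarrow> real" +
  assumes continuous_Z: "\<And>\<omega>. \<omega> \<in> space M \<Longrightarrow> continuous_on {0..T} (\<lambda>t. Z t \<omega>)"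
    and wiener_Z: "\<And>t. t \<in> {0..T} \<Longrightarrow>
           is_wiener_integral M B t (\<lambda>s. exp (- \<mu> * (t - s)) * sqrt (h_fun lam \<mu> s)) (Z t)"

end

(* Let N be a power of two and divide [0,T] into N cells. For fixed n, exp(mu t) Z_n(t) is
   approximated at the grid points by the partial sums of the martingale increments of an Euler scheme,
   in which the servers active during a cell are those active at its beginning. As soon as every cell
   contains at most one jump of the driving Poisson processes, which happens almost surely for N large
   (Borel-Cantelli along dyadic grids), the scheme reproduces the queue exactly at the grid points, and the
   interpolated scheme stays within one jump, 1/sqrt n, of Z_n.

   In the same way exp(mu t) Z(t) is approximated by sums of weighted Brownian increments, by the
   Wiener isometry. The increments of the two sums are exchanged one at a time (Lindeberg). A functional F in
   Sigma has along every basis function a second order expansion with bounded second coefficient and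
   cubic remainder. The first order terms vanish. Conditionally on the past the noise of the scheme
   is a combination of independent centred Poisson variables, whose conditional variance differs from that of the
   Gaussian increment by a multiple of L_n - L, of mean O(1/sqrt n); the third moments add up to
   O(1/sqrt n) uniformly in N. Letting N tend to infinity gives the rate 1/sqrt n, which is stronger
   than the stated one because ln n / ln ln n is at least 1. *)
theory Submission
  imports Defs
begin


section \<open>Moments of Poisson variables\<close>

text \<open>Refining the grid at fixed \<open>n\<close> is what removes the logarithms: with a mesh
  tied to \<open>n\<close> the interpolation error is the largest Poisson count over the cells. The
  price is that every one-cell error must sum to a bound free of \<open>N\<close>. It does, because
  the conditional variance \<open>v\<close> of a cell is proportional to its length and the third
  absolute moment of the noise is at most \<open>v + 2 v^2\<close>. As the function h of the limit
  is lam + \<mu> * fluid limit, the two variances differ through the gap between the queue and n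
  times its fluid limit; up to an error vanishing with the mesh, that gap is a weighted sum of the
  noise, with mean square of order n. Two features of the test class shape the proof. Derivatives
  exist only at continuous paths and along \<open>H_space\<close>, so both processes become
  combinations of the functions \<open>ebasis\<close> before anything is differentiated. Functionals
  are Lipschitz but unbounded, so limits need integrable envelopes: \<open>load\<close> for the
  queue, a Doob bound for the Gaussian process. The processes may live on different spaces, hence
  the exchange takes place on a product space carrying the increments of both.\<close>

lemma poisson_nn_integral_shift:
  fixes f :: "nat \<Rightarrow> ennreal"
  assumes "r > 0"
  shows "(\<integral>\<^sup>+k. of_nat k * f k \<partial>poisson_pmf r) = ennreal r * (\<integral>\<^sup>+k. f (Suc k) \<partial>poisson_pmf r)"
proof -
  \<comment> \<open>The Poisson weights satisfy \<open>(k + 1) p (k + 1) = r p k\<close>; summed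
    against \<open>f\<close> this is the Stein-Chen identity.\<close>
  have *: "ennreal (pmf (poisson_pmf r) (Suc k)) * (of_nat (Suc k) * f (Suc k))
      = ennreal r * (ennreal (pmf (poisson_pmf r) k) * f (Suc k))" for k
  proof -
    have "pmf (poisson_pmf r) (Suc k) * real (Suc k) = r * pmf (poisson_pmf r) k"
      using assms by (simp add: fact_Suc del: of_nat_Suc)
    then have "ennreal (pmf (poisson_pmf r) (Suc k)) * of_nat (Suc k)
        = ennreal r * ennreal (pmf (poisson_pmf r) k)"
      using assms by (metis ennreal_mult ennreal_of_nat_eq_real_of_nat of_nat_0_le_iff pmf_nonneg less_imp_le)
    then show ?thesis by (metis mult.assoc)
  qed
  let ?g = "\<lambda>k. ennreal (pmf (poisson_pmf r) k) * (of_nat k * f k)"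
  have "(\<integral>\<^sup>+k. of_nat k * f k \<partial>poisson_pmf r) = (\<Sum>k. ?g k)"
    by (simp only: nn_integral_measure_pmf nn_integral_count_space_nat)
  also have "\<dots> = (\<Sum>k. ?g (Suc k))"
  proof -
    have "?g sums ((\<Sum>k. ?g (Suc k)) + ?g 0)"
      by (rule sums_Suc) (rule summable_sums, simp)
    then show ?thesis by (simp add: sums_iff)
  qed
  also have "\<dots> = ennreal r * (\<Sum>k. ennreal (pmf (poisson_pmf r) k) * f (Suc k))"
    unfolding * by simp
  also have "\<dots> = ennreal r * (\<integral>\<^sup>+k. f (Suc k) \<partial>poisson_pmf r)"
    by (simp only: nn_integral_measure_pmf nn_integral_count_space_nat)
  finally show ?thesis .
qed

text \<open>Each moment comes from the previous ones by the shift identity with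
  \<open>f k = k ^ j\<close> and the expansion of \<open>(k + 1) ^ j\<close>. The form
  \<open>has_bochner_integral\<close> carries integrability through the recursion.\<close>

lemma poisson_moments:
  assumes r: "r > 0"
  shows "has_bochner_integral (poisson_pmf r) (\<lambda>k. real k) r"
    and "has_bochner_integral (poisson_pmf r) (\<lambda>k. real k ^ 2) (r + r ^ 2)"
    and "has_bochner_integral (poisson_pmf r) (\<lambda>k. real k ^ 3) (r + 3 * r ^ 2 + r ^ 3)"
    and "has_bochner_integral (poisson_pmf r) (\<lambda>k. real k ^ 4) (r + 7 * r ^ 2 + 6 * r ^ 3 + r ^ 4)"
proof -
  have shift: "has_bochner_integral (poisson_pmf r) (\<lambda>k. real k * f k) (r * v)"
    if f: "\<And>k. f k \<ge> 0" "has_bochner_integral (poisson_pmf r) (\<lambda>k. f (Suc k)) v"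
    for f :: "nat \<Rightarrow> real" and v
  proof (rule has_bochner_integral_nn_integral)
    have v: "v = (\<integral>k. f (Suc k) \<partial>poisson_pmf r)" "integrable (poisson_pmf r) (\<lambda>k. f (Suc k))"
      using f(2) by (auto simp: has_bochner_integral_iff)
    then show "0 \<le> r * v" using f(1) r by (auto intro!: integral_nonneg_AE)
    have "(\<integral>\<^sup>+k. ennreal (real k * f k) \<partial>poisson_pmf r)
        = (\<integral>\<^sup>+k. of_nat k * ennreal (f k) \<partial>poisson_pmf r)"
      using f(1) by (simp add: ennreal_mult ennreal_of_nat_eq_real_of_nat)
    also have "\<dots> = ennreal r * (\<integral>\<^sup>+k. ennreal (f (Suc k)) \<partial>poisson_pmf r)"
      by (rule poisson_nn_integral_shift[OF r])
    also have "\<dots> = ennreal r * ennreal v"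
      using v f(1) by (simp add: nn_integral_eq_integral)
    finally show "(\<integral>\<^sup>+k. ennreal (real k * f k) \<partial>poisson_pmf r) = ennreal (r * v)"
      using r by (simp add: ennreal_mult')
  qed (use f(1) in auto)
  have m0: "has_bochner_integral (poisson_pmf r) (\<lambda>k. 1) (1::real)"
    by (simp add: has_bochner_integral_iff)
  have "has_bochner_integral (poisson_pmf r) (\<lambda>k. real k * 1) (r * 1)"
    by (rule shift) (use m0 in auto)
  then show m1: "has_bochner_integral (poisson_pmf r) (\<lambda>k. real k) r" by simp
  have "has_bochner_integral (poisson_pmf r) (\<lambda>k. real k * real k) (r * (r + 1))"
    by (rule shift) (use has_bochner_integral_add[OF m1 m0] in \<open>auto simp: add_ac\<close>)
  then show m2: "has_bochner_integral (poisson_pmf r) (\<lambda>k. real k ^ 2) (r + r ^ 2)"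
    by (simp add: power2_eq_square algebra_simps)
  have "has_bochner_integral (poisson_pmf r) (\<lambda>k. real k * real k ^ 2) (r * ((r + r^2) + 2 * r + 1))"
  proof (rule shift)
    show "has_bochner_integral (poisson_pmf r) (\<lambda>k. real (Suc k) ^ 2) ((r + r^2) + 2 * r + 1)"
      using has_bochner_integral_add[OF has_bochner_integral_add[OF m2
            has_bochner_integral_mult_right[OF m1, of 2]] m0]
      by (simp add: power2_eq_square algebra_simps)
  qed simp
  then show m3: "has_bochner_integral (poisson_pmf r) (\<lambda>k. real k ^ 3) (r + 3 * r ^ 2 + r ^ 3)"
    by (simp add: power2_eq_square power3_eq_cube algebra_simps)
  have "has_bochner_integral (poisson_pmf r) (\<lambda>k. real k * real k ^ 3)
          (r * ((r + 3 * r ^ 2 + r ^ 3) + 3 * (r + r^2) + 3 * r + 1))"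
  proof (rule shift)
    show "has_bochner_integral (poisson_pmf r) (\<lambda>k. real (Suc k) ^ 3)
        ((r + 3 * r ^ 2 + r ^ 3) + 3 * (r + r^2) + 3 * r + 1)"
      using has_bochner_integral_add[OF has_bochner_integral_add[OF has_bochner_integral_add[OF m3
            has_bochner_integral_mult_right[OF m2, of 3]]
            has_bochner_integral_mult_right[OF m1, of 3]] m0]
      by (simp add: power2_eq_square power3_eq_cube algebra_simps)
  qed simp
  then show "has_bochner_integral (poisson_pmf r) (\<lambda>k. real k ^ 4) (r + 7 * r ^ 2 + 6 * r ^ 3 + r ^ 4)"
    by (simp add: power2_eq_square power3_eq_cube power4_eq_xxxx algebra_simps)
qed

text \<open>Moments of a centred Poisson variable of parameter \<open>v\<close>; this relation between the second and
  the fourth moment is preserved by sums and differences of independent variables.\<close>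

definition poisson_like :: "'a measure \<Rightarrow> real \<Rightarrow> ('a \<Rightarrow> real) \<Rightarrow> bool" where
  "poisson_like M v X \<longleftrightarrow> X \<in> borel_measurable M \<and> integrable M (\<lambda>\<omega>. X \<omega> ^ 4) \<and>
     (\<integral>\<omega>. X \<omega> \<partial>M) = 0 \<and> (\<integral>\<omega>. X \<omega> ^ 2 \<partial>M) = v \<and> (\<integral>\<omega>. X \<omega> ^ 4 \<partial>M) = v + 3 * v ^ 2"

lemma abs_power_le_one_plus_power4:
  fixes x :: real
  assumes "j \<le> 4"
  shows "\<bar>x ^ j\<bar> \<le> 1 + x ^ 4"
proof (cases "\<bar>x\<bar> \<le> 1")
  case True
  then have "\<bar>x ^ j\<bar> \<le> 1" by (simp add: power_abs power_le_one)
  then show ?thesis by (simp add: add_increasing2)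
next
  case False
  then have "\<bar>x\<bar> ^ j \<le> \<bar>x\<bar> ^ 4" using assms by (intro power_increasing) auto
  then show ?thesis by (simp add: power_abs)
qed

lemma integrable_mult_of_squares:
  fixes f g :: "'a \<Rightarrow> real"
  assumes "f \<in> borel_measurable M" "g \<in> borel_measurable M"
    "integrable M (\<lambda>x. f x ^ 2)" "integrable M (\<lambda>x. g x ^ 2)"
  shows "integrable M (\<lambda>x. f x * g x)"
proof (rule Bochner_Integration.integrable_bound)
  show "integrable M (\<lambda>x. f x ^ 2 + g x ^ 2)" using assms by simp
  have "\<bar>x * y\<bar> \<le> x ^ 2 + y ^ 2" for x y :: real
    using sum_squares_bound[of x y] sum_squares_bound[of x "- y"] by (simp add: abs_if)
  then show "AE x in M. norm (f x * g x) \<le> norm (f x ^ 2 + g x ^ 2)" by auto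
qed (use assms in auto)

lemma (in prob_space) integrable_power_le4:
  fixes X :: "'a \<Rightarrow> real"
  assumes "X \<in> borel_measurable M" "integrable M (\<lambda>\<omega>. X \<omega> ^ 4)" "j \<le> 4"
  shows "integrable M (\<lambda>\<omega>. X \<omega> ^ j)"
  using assms(1) abs_power_le_one_plus_power4[OF assms(3)]
  by (intro Bochner_Integration.integrable_bound[OF Bochner_Integration.integrable_add[OF
        integrable_const[of "1::real"] assms(2)]]) (auto simp: abs_le_iff intro: order_trans)

lemma (in prob_space) poisson_like_integrable:
  assumes "poisson_like M v X"
  shows "integrable M X" "integrable M (\<lambda>\<omega>. X \<omega> ^ 2)" "integrable M (\<lambda>\<omega>. X \<omega> ^ 3)"
    "integrable M (\<lambda>\<omega>. \<bar>X \<omega>\<bar> ^ 3)"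
proof -
  have *: "X \<in> borel_measurable M" "integrable M (\<lambda>\<omega>. X \<omega> ^ 4)"
    using assms by (auto simp: poisson_like_def)
  show "integrable M X" "integrable M (\<lambda>\<omega>. X \<omega> ^ 2)" "integrable M (\<lambda>\<omega>. X \<omega> ^ 3)"
    using integrable_power_le4[OF *, of 1] integrable_power_le4[OF *, of 2]
      integrable_power_le4[OF *, of 3] by auto
  then show "integrable M (\<lambda>\<omega>. \<bar>X \<omega>\<bar> ^ 3)"
    by (metis (no_types, lifting) integrable_abs Bochner_Integration.integrable_cong power_abs)
qed

text \<open>The inequality \<open>\<bar>x\<bar> ^ 3 \<le> (x ^ 2 + x ^ 4) / 2\<close> reduces the
  claim to the two recorded moments. A bound that is linear in small \<open>v\<close> is what keeps
  the sum over all cells bounded as the mesh vanishes.\<close>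

lemma (in prob_space) poisson_like_third:
  assumes "poisson_like M v X"
  shows "(\<integral>\<omega>. \<bar>X \<omega>\<bar> ^ 3 \<partial>M) \<le> v + 2 * v ^ 2"
proof -
  have le: "\<bar>x\<bar> ^ 3 \<le> (x ^ 2 + x ^ 4) / 2" for x :: real
  proof -
    have "0 \<le> \<bar>x\<bar>^2 * (1 - \<bar>x\<bar>) ^ 2" by simp
    also have "\<dots> = \<bar>x\<bar>^2 + \<bar>x\<bar>^4 - 2 * \<bar>x\<bar>^3"
      by (simp only: power2_eq_square power3_eq_cube power4_eq_xxxx) (simp add: algebra_simps)
    finally show ?thesis by simp
  qed
  have "(\<integral>\<omega>. \<bar>X \<omega>\<bar> ^ 3 \<partial>M) \<le> (\<integral>\<omega>. (X \<omega> ^ 2 + X \<omega> ^ 4) / 2 \<partial>M)"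
    using poisson_like_integrable[OF assms] assms le
    by (intro integral_mono) (auto simp: poisson_like_def)
  also have "\<dots> = (v + (v + 3 * v ^ 2)) / 2"
    using poisson_like_integrable[OF assms] assms by (simp add: poisson_like_def)
  also have "\<dots> \<le> v + 2 * v ^ 2" by (simp add: field_simps)
  finally show ?thesis .
qed

lemma (in prob_space) poisson_like_zero: "poisson_like M 0 (\<lambda>_. 0)"
  by (simp add: poisson_like_def)

lemma (in prob_space) poisson_like_uminus:
  "poisson_like M v X \<Longrightarrow> poisson_like M v (\<lambda>\<omega>. - X \<omega>)"
  by (simp add: poisson_like_def)

text \<open>The value \<open>v + 3 v ^ 2\<close> says that the fourth cumulant equals the variance,
  and cumulants add under independence. In the expansion the terms containing a first power vanish
  by centring, and \<open>6 u v\<close> completes \<open>3 u ^ 2 + 3 v ^ 2\<close> to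
  \<open>3 (u + v) ^ 2\<close>.\<close>

lemma (in prob_space) poisson_like_add:
  assumes X: "poisson_like M u X" and Y: "poisson_like M v Y" and ind: "indep_var borel X borel Y"
  shows "poisson_like M (u + v) (\<lambda>\<omega>. X \<omega> + Y \<omega>)"
proof -
  note iX = poisson_like_integrable[OF X] and iY = poisson_like_integrable[OF Y]
  have mX: "integrable M (\<lambda>\<omega>. X \<omega> ^ 4)" "X \<in> borel_measurable M" "expectation X = 0"
      "expectation (\<lambda>\<omega>. X \<omega> ^ 2) = u" "expectation (\<lambda>\<omega>. X \<omega> ^ 4) = u + 3 * u ^ 2"
    and mY: "integrable M (\<lambda>\<omega>. Y \<omega> ^ 4)" "Y \<in> borel_measurable M" "expectation Y = 0"
      "expectation (\<lambda>\<omega>. Y \<omega> ^ 2) = v" "expectation (\<lambda>\<omega>. Y \<omega> ^ 4) = v + 3 * v ^ 2"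
    using X Y by (auto simp: poisson_like_def)
  have iP: "indep_var borel (\<lambda>\<omega>. X \<omega> ^ i) borel (\<lambda>\<omega>. Y \<omega> ^ j)" for i j
    using indep_var_compose[OF ind, of "\<lambda>x. x ^ i" borel "\<lambda>x. x ^ j" borel] by (simp add: o_def)
  have h: "has_bochner_integral M (\<lambda>\<omega>. X \<omega> ^ i * Y \<omega> ^ j)
      (expectation (\<lambda>\<omega>. X \<omega> ^ i) * expectation (\<lambda>\<omega>. Y \<omega> ^ j))" if "i \<le> 4" "j \<le> 4" for i j
    using indep_var_integrable[OF iP] indep_var_lebesgue_integral[OF iP]
      integrable_power_le4[OF mX(2,1)] integrable_power_le4[OF mY(2,1)] that
    by (auto simp: has_bochner_integral_iff)
  have "has_bochner_integral M (\<lambda>\<omega>. X \<omega> ^ 2 + Y \<omega> ^ 2 + 2 * (X \<omega> ^ 1 * Y \<omega> ^ 1)) (u + v + 2 * (0 * 0))"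
    using h[of 1 1] iX iY mX mY
    by (intro has_bochner_integral_add has_bochner_integral_mult_right) (auto simp: has_bochner_integral_iff)
  then have 2: "expectation (\<lambda>\<omega>. (X \<omega> + Y \<omega>) ^ 2) = u + v"
    by (simp add: has_bochner_integral_iff power2_sum mult.assoc)
  have "has_bochner_integral M (\<lambda>\<omega>. X \<omega> ^ 4 + Y \<omega> ^ 4 + 4 * (X \<omega> ^ 3 * Y \<omega> ^ 1) + 4 * (X \<omega> ^ 1 * Y \<omega> ^ 3)
      + 6 * (X \<omega> ^ 2 * Y \<omega> ^ 2))
      ((u + 3 * u ^ 2) + (v + 3 * v ^ 2) + 4 * (expectation (\<lambda>\<omega>. X \<omega> ^ 3) * 0)
        + 4 * (0 * expectation (\<lambda>\<omega>. Y \<omega> ^ 3)) + 6 * (u * v))"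
    using h[of 3 1] h[of 1 3] h[of 2 2] iX iY mX mY
    by (intro has_bochner_integral_add has_bochner_integral_mult_right) (auto simp: has_bochner_integral_iff)
  moreover have "(x + y) ^ 4 = x ^ 4 + y ^ 4 + 4 * (x ^ 3 * y ^ 1) + 4 * (x ^ 1 * y ^ 3) + 6 * (x ^ 2 * y ^ 2)"
    for x y :: real
    by (simp only: power2_eq_square power3_eq_cube power4_eq_xxxx) (simp add: algebra_simps)
  ultimately have 4: "has_bochner_integral M (\<lambda>\<omega>. (X \<omega> + Y \<omega>) ^ 4) ((u + v) + 3 * (u + v) ^ 2)"
    by (simp add: power2_sum algebra_simps)
  show ?thesis
    using 2 4 mX mY iX iY by (auto simp: poisson_like_def has_bochner_integral_iff)
qed

lemma (in prob_space) poisson_like_sum: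
  assumes "finite J" "indep_vars (\<lambda>_. borel) X J" "\<And>j. j \<in> J \<Longrightarrow> poisson_like M (v j) (X j)"
  shows "poisson_like M (\<Sum>j\<in>J. v j) (\<lambda>\<omega>. \<Sum>j\<in>J. X j \<omega>)"
  using assms
proof (induction J rule: finite_induct)
  case empty
  then show ?case by (simp add: poisson_like_zero)
next
  case (insert j J)
  have "indep_var borel (X j) borel (\<lambda>\<omega>. \<Sum>i\<in>J. X i \<omega>)"
    by (rule indep_vars_sum) (use insert in auto)
  then show ?case
    using insert indep_vars_subset[OF insert.prems(1), of J] by (auto intro!: poisson_like_add)
qed

lemma (in prob_space) poisson_like_centred_poisson:
  assumes "N \<in> measurable M (count_space UNIV)" "distr M (count_space UNIV) N = measure_pmf (poisson_pmf r)"
    and r: "r > 0"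
  shows "poisson_like M r (\<lambda>\<omega>. real (N \<omega>) - r)"
proof -
  have tr: "has_bochner_integral M (\<lambda>\<omega>. f (N \<omega>)) v \<longleftrightarrow> has_bochner_integral (poisson_pmf r) f v"
    for f :: "nat \<Rightarrow> real" and v
    unfolding assms(2)[symmetric] using assms(1)
    by (auto simp: has_bochner_integral_iff integrable_distr_eq integral_distr)
  note m = poisson_moments[OF r]
  have m0: "has_bochner_integral (poisson_pmf r) (\<lambda>k. 1) (1::real)"
    by (simp add: has_bochner_integral_iff)
  note mr = has_bochner_integral_mult_right
  have "has_bochner_integral (poisson_pmf r) (\<lambda>k. real k - r * 1) (r - r * 1)"
    by (intro has_bochner_integral_diff m mr m0)
  then have 1: "has_bochner_integral M (\<lambda>\<omega>. real (N \<omega>) - r) 0"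
    by (subst tr) simp
  have "has_bochner_integral (poisson_pmf r) (\<lambda>k. real k ^ 2 - (2 * r) * real k + r^2 * 1) (r + r^2 - (2 * r) * r + r^2 * 1)"
    by (intro has_bochner_integral_diff has_bochner_integral_add m mr m0)
  then have 2: "has_bochner_integral M (\<lambda>\<omega>. (real (N \<omega>) - r) ^ 2) r"
    by (subst tr) (simp add: power2_eq_square algebra_simps)
  have "has_bochner_integral (poisson_pmf r) (\<lambda>k. real k ^ 4 - (4 * r) * real k ^ 3 + (6 * r^2) * real k ^ 2 - (4 * r^3) * real k + r^4 * 1)
     ((r + 7 * r ^ 2 + 6 * r ^ 3 + r ^ 4) - (4 * r) * (r + 3 * r ^ 2 + r ^ 3) + (6 * r^2) * (r + r^2) - (4 * r^3) * r + r^4 * 1)"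
    by (intro has_bochner_integral_diff has_bochner_integral_add m mr m0)
  moreover have "real k ^ 4 - (4 * r) * real k ^ 3 + (6 * r^2) * real k ^ 2 - (4 * r^3) * real k + r^4 * 1 = (real k - r)^4" for k
    by (simp only: power2_eq_square power3_eq_cube power4_eq_xxxx) (simp add: algebra_simps)
  moreover have "(r + 7 * r ^ 2 + 6 * r ^ 3 + r ^ 4) - (4 * r) * (r + 3 * r ^ 2 + r ^ 3) + (6 * r^2) * (r + r^2) - (4 * r^3) * r + r^4 * 1 = r + 3 * r^2"
    by (simp only: power2_eq_square power3_eq_cube power4_eq_xxxx) (simp add: algebra_simps)
  ultimately have 4: "has_bochner_integral M (\<lambda>\<omega>. (real (N \<omega>) - r) ^ 4) (r + 3 * r ^ 2)"
    by (simp only: tr[of "\<lambda>k. (real k - r) ^ 4"])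
  show ?thesis
    using 1 2 4 assms(1) by (auto simp: poisson_like_def has_bochner_integral_iff)
qed


section \<open>Independence\<close>

text \<open>Fubini on the product of the two laws, pulled back so that both integrals are over
  \<open>M\<close>. This replaces conditional expectations: \<open>X\<close> is frozen and only
  \<open>Y\<close> is averaged.\<close>

lemma (in prob_space) indep_var_integral_iterated:
  fixes f :: "'b \<times> 'b \<Rightarrow> real"
  assumes ind: "indep_var S X T Y" and f: "f \<in> borel_measurable (S \<Otimes>\<^sub>M T)"
    and int: "integrable M (\<lambda>\<omega>. f (X \<omega>, Y \<omega>))"
  shows "integrable M (\<lambda>\<omega>. \<integral>\<omega>'. f (X \<omega>, Y \<omega>') \<partial>M)"
    and "(\<integral>\<omega>. f (X \<omega>, Y \<omega>) \<partial>M) = (\<integral>\<omega>. (\<integral>\<omega>'. f (X \<omega>, Y \<omega>') \<partial>M) \<partial>M)"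
proof -
  have rv[measurable]: "X \<in> measurable M S" "Y \<in> measurable M T"
    and eq: "distr M S X \<Otimes>\<^sub>M distr M T Y = distr M (S \<Otimes>\<^sub>M T) (\<lambda>x. (X x, Y x))"
    using ind by (auto simp: indep_var_distribution_eq)
  note f[measurable]
  interpret A: prob_space "distr M S X" by (rule prob_space_distr) simp
  interpret B: prob_space "distr M T Y" by (rule prob_space_distr) simp
  interpret AB: pair_prob_space "distr M S X" "distr M T Y" ..
  have i1: "integrable (distr M S X \<Otimes>\<^sub>M distr M T Y) f"
    unfolding eq by (subst integrable_distr_eq) (use int in auto)
  have m: "(\<lambda>x. \<integral>y. f (x, y) \<partial>distr M T Y) \<in> borel_measurable S"
    by measurable
  have inner: "(\<integral>y. f (X \<omega>, y) \<partial>distr M T Y) = (\<integral>\<omega>'. f (X \<omega>, Y \<omega>') \<partial>M)" if "\<omega> \<in> space M" for \<omega>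
  proof (rule integral_distr)
    have "X \<omega> \<in> space S" using rv(1) that by (rule measurable_space)
    then show "(\<lambda>y. f (X \<omega>, y)) \<in> borel_measurable T" by measurable
  qed simp
  have i2: "integrable (distr M S X) (\<lambda>x. \<integral>y. f (x, y) \<partial>distr M T Y)"
    by (rule AB.integrable_fst'[OF i1])
  then have "integrable M (\<lambda>\<omega>. \<integral>y. f (X \<omega>, y) \<partial>distr M T Y)"
    by (subst (asm) integrable_distr_eq) (use m in auto)
  then show "integrable M (\<lambda>\<omega>. \<integral>\<omega>'. f (X \<omega>, Y \<omega>') \<partial>M)"
    by (subst Bochner_Integration.integrable_cong[OF refl inner[symmetric]]) auto
  have "(\<integral>\<omega>. f (X \<omega>, Y \<omega>) \<partial>M) = integral\<^sup>L (distr M S X \<Otimes>\<^sub>M distr M T Y) f"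
    unfolding eq by (subst integral_distr) auto
  also have "\<dots> = (\<integral>x. (\<integral>y. f (x, y) \<partial>distr M T Y) \<partial>distr M S X)"
    by (rule AB.integral_fst'[OF i1, symmetric])
  also have "\<dots> = (\<integral>\<omega>. (\<integral>y. f (X \<omega>, y) \<partial>distr M T Y) \<partial>M)"
    by (rule integral_distr) (use m in auto)
  also have "\<dots> = (\<integral>\<omega>. (\<integral>\<omega>'. f (X \<omega>, Y \<omega>') \<partial>M) \<partial>M)"
    by (rule Bochner_Integration.integral_cong) (use inner in auto)
  finally show "(\<integral>\<omega>. f (X \<omega>, Y \<omega>) \<partial>M) = (\<integral>\<omega>. (\<integral>\<omega>'. f (X \<omega>, Y \<omega>') \<partial>M) \<partial>M)" .
qed

text \<open>For nonnegative functions no integrability has to be known beforehand, so this version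
  serves to prove it, for the squared noise and for sums with a random number of terms.\<close>

lemma (in prob_space) indep_var_nn_integral_iterated:
  fixes f :: "'b \<times> 'b \<Rightarrow> ennreal"
  assumes ind: "indep_var S X T Y" and f: "f \<in> borel_measurable (S \<Otimes>\<^sub>M T)"
  shows "(\<integral>\<^sup>+\<omega>. f (X \<omega>, Y \<omega>) \<partial>M) = (\<integral>\<^sup>+\<omega>. (\<integral>\<^sup>+\<omega>'. f (X \<omega>, Y \<omega>') \<partial>M) \<partial>M)"
proof -
  have rv[measurable]: "X \<in> measurable M S" "Y \<in> measurable M T"
    and eq: "distr M S X \<Otimes>\<^sub>M distr M T Y = distr M (S \<Otimes>\<^sub>M T) (\<lambda>x. (X x, Y x))"
    using ind by (auto simp: indep_var_distribution_eq)
  note f[measurable]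
  interpret A: prob_space "distr M S X" by (rule prob_space_distr) simp
  interpret B: prob_space "distr M T Y" by (rule prob_space_distr) simp
  interpret AB: pair_prob_space "distr M S X" "distr M T Y" ..
  have inner: "(\<integral>\<^sup>+y. f (X \<omega>, y) \<partial>distr M T Y) = (\<integral>\<^sup>+\<omega>'. f (X \<omega>, Y \<omega>') \<partial>M)" if "\<omega> \<in> space M" for \<omega>
  proof (rule nn_integral_distr)
    have "X \<omega> \<in> space S" using rv(1) that by (rule measurable_space)
    then show "(\<lambda>y. f (X \<omega>, y)) \<in> borel_measurable (distr M T Y)" by measurable
  qed simp
  have "(\<integral>\<^sup>+\<omega>. f (X \<omega>, Y \<omega>) \<partial>M) = integral\<^sup>N (distr M S X \<Otimes>\<^sub>M distr M T Y) f"
    unfolding eq by (subst nn_integral_distr) auto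
  also have "\<dots> = (\<integral>\<^sup>+x. (\<integral>\<^sup>+y. f (x, y) \<partial>distr M T Y) \<partial>distr M S X)"
    by (rule B.nn_integral_fst[symmetric]) (use f in simp)
  also have "\<dots> = (\<integral>\<^sup>+\<omega>. (\<integral>\<^sup>+y. f (X \<omega>, y) \<partial>distr M T Y) \<partial>M)"
    by (rule nn_integral_distr) auto
  also have "\<dots> = (\<integral>\<^sup>+\<omega>. (\<integral>\<^sup>+\<omega>'. f (X \<omega>, Y \<omega>') \<partial>M) \<partial>M)"
    by (rule nn_integral_cong) (use inner in auto)
  finally show ?thesis .
qed

text \<open>The probability of a finite intersection factors first over the rows, which are
  independent as random elements, and then inside each row. Rows will be the clocks and columns the
  cells of the grid.\<close>

lemma (in prob_space) indep_vars_nested: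
  fixes X :: "'i \<times> 'j \<Rightarrow> 'a \<Rightarrow> 'b"
  assumes rows: "indep_vars (\<lambda>i. PiM (J i) (\<lambda>j. N (i, j))) (\<lambda>i \<omega>. \<lambda>j\<in>J i. X (i, j) \<omega>) I"
    and cols: "\<And>i. i \<in> I \<Longrightarrow> indep_vars (\<lambda>j. N (i, j)) (\<lambda>j. X (i, j)) (J i)"
  shows "indep_vars N X (Sigma I J)"
proof -
  have rv: "X p \<in> measurable M (N p)" if "p \<in> Sigma I J" for p
    using cols[of "fst p"] that by (auto simp: indep_vars_def2)
  show ?thesis
    unfolding indep_vars_def2
  proof (intro conjI ballI indep_setsI)
    fix p assume "p \<in> Sigma I J"
    then show "random_variable (N p) (X p)" by (rule rv)
    show "{X p -` A \<inter> space M |A. A \<in> sets (N p)} \<subseteq> events"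
      using measurable_sets[OF rv[OF \<open>p \<in> _\<close>]] by auto
  next
    fix A K assume K: "K \<noteq> {}" "K \<subseteq> Sigma I J" "finite K"
      and A: "\<forall>p\<in>K. A p \<in> {X p -` A \<inter> space M |A. A \<in> sets (N p)}"
    have "\<forall>p\<in>K. \<exists>B. A p = X p -` B \<inter> space M \<and> B \<in> sets (N p)"
      using A by blast
    from bchoice[OF this] obtain B
      where B: "\<And>p. p \<in> K \<Longrightarrow> A p = X p -` B p \<inter> space M" "\<And>p. p \<in> K \<Longrightarrow> B p \<in> sets (N p)"
      by blast
    \<comment> \<open>\<open>R\<close> lists the rows met by \<open>K\<close> and \<open>C i\<close>
      the columns met in row \<open>i\<close>, so that \<open>K = Sigma R C\<close> with
      \<open>C i\<close> nonempty for every row in \<open>R\<close>.\<close>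
    define R where "R = fst ` K"
    define C where "C i = {j. (i, j) \<in> K}" for i
    have "C i \<subseteq> snd ` K" for i by (force simp: C_def)
    then have fin: "finite R" "finite (C i)" for i
      using K(3) finite_subset[OF _ finite_imageI[OF K(3), of snd]] by (auto simp: R_def)
    have Keq: "K = Sigma R C" by (force simp: R_def C_def)
    have CJ: "C i \<subseteq> J i" "R \<subseteq> I" for i using K(2) by (auto simp: R_def C_def)
    \<comment> \<open>The event of row \<open>i\<close>, written as a preimage under the whole row
      so that \<open>rows\<close> applies to it.\<close>
    define E where "E i = (\<lambda>\<omega>. \<lambda>j\<in>J i. X (i, j) \<omega>) -`
        {f \<in> space (PiM (J i) (\<lambda>j. N (i, j))). \<forall>j\<in>C i. f j \<in> B (i, j)} \<inter> space M" for i
    have Eeq: "E i = (\<Inter>j\<in>C i. X (i, j) -` B (i, j) \<inter> space M)" if "i \<in> R" for i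
    proof -
      have ne: "C i \<noteq> {}" using that by (auto simp: R_def C_def)
      have sp: "(\<lambda>j\<in>J i. X (i, j) \<omega>) \<in> space (PiM (J i) (\<lambda>j. N (i, j)))" if "\<omega> \<in> space M" for \<omega>
        unfolding space_PiM
      proof (rule PiE_I)
        fix j assume "j \<in> J i"
        then show "(\<lambda>j\<in>J i. X (i, j) \<omega>) j \<in> space (N (i, j))"
          using measurable_space[OF rv that, of "(i, j)"] \<open>i \<in> R\<close> CJ(2) by auto
      qed simp
      have "\<omega> \<in> E i \<longleftrightarrow> \<omega> \<in> space M \<and> (\<forall>j\<in>C i. X (i, j) \<omega> \<in> B (i, j))" for \<omega>
        using sp[of \<omega>] CJ(1)[of i] by (simp add: E_def subset_iff conj_commute cong: conj_cong)
      then show ?thesis using ne by auto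
    qed
    have meas: "{f \<in> space (PiM (J i) (\<lambda>j. N (i, j))). \<forall>j\<in>C i. f j \<in> B (i, j)}
        \<in> sets (PiM (J i) (\<lambda>j. N (i, j)))" if "i \<in> R" for i
    proof (rule sets.sets_Collect_finite_All[OF _ fin(2)])
      fix j assume j: "j \<in> C i"
      have "B (i, j) \<in> sets (N (i, j))" using B(2)[of "(i, j)"] j by (simp add: C_def)
      then show "{f \<in> space (PiM (J i) (\<lambda>j. N (i, j))). f j \<in> B (i, j)} \<in> sets (PiM (J i) (\<lambda>j. N (i, j)))"
        using j CJ(1) measurable_sets[OF measurable_component_singleton[of j "J i" "\<lambda>j. N (i, j)"]]
        by (auto simp: vimage_def Int_def conj_commute)
    qed
    have "prob (\<Inter>p\<in>K. A p) = prob (\<Inter>i\<in>R. E i)"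
    proof -
      have "(\<Inter>p\<in>K. A p) = (\<Inter>i\<in>R. E i)"
      proof -
        have "(\<Inter>p\<in>K. A p) = (\<Inter>i\<in>R. \<Inter>j\<in>C i. A (i, j))"
          by (subst Keq) auto
        also have "\<dots> = (\<Inter>i\<in>R. E i)"
          by (intro INF_cong refl) (simp add: Eeq B(1) C_def)
        finally show ?thesis .
      qed
      then show ?thesis by simp
    qed
    also have "\<dots> = (\<Prod>i\<in>R. prob (E i))"
      using K(1) fin(1) CJ(2) meas
      unfolding E_def
      by (intro indep_varsD[OF rows]) (auto simp: R_def)
    also have "\<dots> = (\<Prod>i\<in>R. \<Prod>j\<in>C i. prob (A (i, j)))"
    proof (rule prod.cong[OF refl])
      fix i assume i: "i \<in> R"
      then have ne: "C i \<noteq> {}" by (auto simp: R_def C_def)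
      have "prob (E i) = prob (\<Inter>j\<in>C i. X (i, j) -` B (i, j) \<inter> space M)"
        by (simp add: Eeq[OF i])
      also have "\<dots> = (\<Prod>j\<in>C i. prob (X (i, j) -` B (i, j) \<inter> space M))"
        by (rule indep_varsD[OF cols]) (use i ne fin(2) CJ B(2) in \<open>auto simp: C_def\<close>)
      also have "\<dots> = (\<Prod>j\<in>C i. prob (A (i, j)))"
        by (rule prod.cong) (auto simp: C_def B(1))
      finally show "prob (E i) = (\<Prod>j\<in>C i. prob (A (i, j)))" .
    qed
    also have "\<dots> = (\<Prod>p\<in>K. prob (A p))"
      unfolding Keq by (subst prod.Sigma) (use fin in auto)
    finally show "prob (\<Inter>p\<in>K. A p) = (\<Prod>p\<in>K. prob (A p))" .
  qed
qed

text \<open>Under independence the marginal laws determine the joint law, so the expectation of a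
  functional of the whole array can be computed on any space with the same marginals.\<close>

lemma indep_vars_transfer:
  assumes "prob_space M" "prob_space M'" and I: "I \<noteq> {}"
    and X: "prob_space.indep_vars M N X I" and Y: "prob_space.indep_vars M' N Y I"
    and law: "\<And>i. i \<in> I \<Longrightarrow> distr M (N i) (X i) = distr M' (N i) (Y i)"
    and f: "f \<in> borel_measurable (PiM I N)"
  shows "(\<integral>\<omega>. f (\<lambda>i\<in>I. X i \<omega>) \<partial>M) = (\<integral>\<omega>. f (\<lambda>i\<in>I. Y i \<omega>) \<partial>M' :: real)"
proof -
  interpret M: prob_space M by fact
  interpret M': prob_space M' by fact
  have rX: "X i \<in> measurable M (N i)" and rY: "Y i \<in> measurable M' (N i)" if "i \<in> I" for i
    using X Y that by (auto simp: M.indep_vars_def2 M'.indep_vars_def2)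
  have "distr M (PiM I N) (\<lambda>\<omega>. \<lambda>i\<in>I. X i \<omega>) = PiM I (\<lambda>i. distr M (N i) (X i))"
    using X M.indep_vars_iff_distr_eq_PiM'[OF I, of X N] rX by auto
  also have "\<dots> = PiM I (\<lambda>i. distr M' (N i) (Y i))"
    by (rule PiM_cong) (use law in auto)
  also have "\<dots> = distr M' (PiM I N) (\<lambda>\<omega>. \<lambda>i\<in>I. Y i \<omega>)"
    using Y M'.indep_vars_iff_distr_eq_PiM'[OF I, of Y N] rY by auto
  finally have eq: "distr M (PiM I N) (\<lambda>\<omega>. \<lambda>i\<in>I. X i \<omega>) = distr M' (PiM I N) (\<lambda>\<omega>. \<lambda>i\<in>I. Y i \<omega>)" .
  have mX: "(\<lambda>\<omega>. \<lambda>i\<in>I. X i \<omega>) \<in> measurable M (PiM I N)" by (rule measurable_restrict[OF rX])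
  have mY: "(\<lambda>\<omega>. \<lambda>i\<in>I. Y i \<omega>) \<in> measurable M' (PiM I N)" by (rule measurable_restrict[OF rY])
  show "(\<integral>\<omega>. f (\<lambda>i\<in>I. X i \<omega>) \<partial>M) = (\<integral>\<omega>. f (\<lambda>i\<in>I. Y i \<omega>) \<partial>M')"
    using integral_distr[OF mX f] integral_distr[OF mY f] eq by simp
qed


section \<open>Test functionals along interpolated paths\<close>

lemma W_space_subset_D_space: "W_space T \<subseteq> D_space T"
  unfolding W_space_def D_space_def cadlag_on_def continuous_on_def
  by (auto intro: tendsto_within_subset)

lemma Sigma_class_lipschitz:
  assumes "F \<in> Sigma_class T" "T > 0" "f \<in> D_space T" "g \<in> D_space T"
    "\<And>t. t \<in> {0..T} \<Longrightarrow> \<bar>f t - g t\<bar> \<le> b"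
  shows "\<bar>F f - F g\<bar> \<le> b"
proof -
  have "\<bar>F f - F g\<bar> \<le> sup_norm T (\<lambda>t. f t - g t)"
    using assms by (auto simp: Sigma_class_def)
  also have "\<dots> \<le> b"
    unfolding sup_norm_def using assms by (intro cSUP_least) auto
  finally show ?thesis .
qed

lemma Sigma_class_measurable:
  assumes "F \<in> Sigma_class T"
    and "\<And>t. t \<in> {0..T} \<Longrightarrow> X t \<in> borel_measurable M"
    and "\<And>\<omega>. \<omega> \<in> space M \<Longrightarrow> (\<lambda>t\<in>{0..T}. X t \<omega>) \<in> D_space T"
  shows "(\<lambda>\<omega>. F (\<lambda>t\<in>{0..T}. X t \<omega>)) \<in> borel_measurable M"
proof -
  have "(\<lambda>\<omega>. \<lambda>t\<in>{0..T}. X t \<omega>) \<in> measurable M (D_algebra T)"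
    unfolding D_algebra_def
    by (rule measurable_restrict_space2) (use assms in \<open>auto intro!: measurable_restrict\<close>)
  moreover have "F \<in> borel_measurable (D_algebra T)" using assms(1) by (simp add: Sigma_class_def)
  ultimately show ?thesis by (rule measurable_compose)
qed

lemma deriv_shift_real: "deriv (\<lambda>x::real. f (a + x)) b = deriv f (a + b :: real)"
  unfolding deriv_def using DERIV_shift[of f _ b a] by (simp add: add.commute)

text \<open>The test class controls the oscillation of the second derivative but not its size. The
  Lipschitz bound gives a first derivative at most 1, the mean value theorem on the unit interval
  then finds a point where the second derivative is at most 2, and \<open>C\<close> pays for moving
  that point to 0. The cubic remainder is the Lagrange form of Taylor's formula.\<close>

lemma second_order_expansion:
  fixes \<psi> :: "real \<Rightarrow> real"
  assumes d1: "\<And>r. \<psi> differentiable (at r)" and d2: "\<And>r. deriv \<psi> differentiable (at r)"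
    and lip: "\<And>r s. \<bar>\<psi> r - \<psi> s\<bar> \<le> \<bar>r - s\<bar>"
    and lip2: "\<And>r s. \<bar>deriv (deriv \<psi>) r - deriv (deriv \<psi>) s\<bar> \<le> C * \<bar>r - s\<bar>" and C: "C \<ge> 0"
  shows "\<bar>deriv (deriv \<psi>) 0\<bar> \<le> 2 + C"
    and "\<bar>\<psi> r - \<psi> 0 - deriv \<psi> 0 * r - deriv (deriv \<psi>) 0 * r\<^sup>2 / 2\<bar> \<le> C * \<bar>r\<bar> ^ 3"
proof -
  have D1: "(\<psi> has_real_derivative deriv \<psi> r) (at r)" for r
    using d1 by (meson DERIV_deriv_iff_real_differentiable)
  have D2: "(deriv \<psi> has_real_derivative deriv (deriv \<psi>) r) (at r)" for r
    using d2 by (meson DERIV_deriv_iff_real_differentiable)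
  have bound1: "\<bar>deriv \<psi> r\<bar> \<le> 1" for r
  proof -
    have "((\<lambda>h. (\<psi> (r + h) - \<psi> r) / h) \<longlongrightarrow> deriv \<psi> r) (at 0)"
      using D1[of r] by (simp add: DERIV_def)
    then have "((\<lambda>h. \<bar>(\<psi> (r + h) - \<psi> r) / h\<bar>) \<longlongrightarrow> \<bar>deriv \<psi> r\<bar>) (at 0)"
      by (rule tendsto_rabs)
    moreover have "\<bar>(\<psi> (r + h) - \<psi> r) / h\<bar> \<le> 1" for h
      using lip[of "r + h" r] by (cases "h = 0") (auto simp: divide_simps)
    ultimately show ?thesis
      by (intro tendsto_upperbound[of _ _ "at (0::real)" 1]) auto
  qed
  obtain z where z: "0 < z" "z < 1" "deriv \<psi> 1 - deriv \<psi> 0 = (1 - 0) * deriv (deriv \<psi>) z"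
    using MVT2[of 0 1 "deriv \<psi>" "deriv (deriv \<psi>)"] D2 by auto
  have "\<bar>deriv (deriv \<psi>) 0\<bar> \<le> \<bar>deriv (deriv \<psi>) z\<bar> + C * \<bar>0 - z\<bar>"
    using lip2[of 0 z] by linarith
  also have "C * \<bar>0 - z\<bar> \<le> C" using z C by (simp add: mult_left_le)
  also have "\<bar>deriv (deriv \<psi>) z\<bar> \<le> 2"
  proof -
    have "deriv (deriv \<psi>) z = deriv \<psi> 1 - deriv \<psi> 0" using z(3) by simp
    then show ?thesis using bound1[of 0] bound1[of 1] by linarith
  qed
  finally show "\<bar>deriv (deriv \<psi>) 0\<bar> \<le> 2 + C" by simp
  show "\<bar>\<psi> r - \<psi> 0 - deriv \<psi> 0 * r - deriv (deriv \<psi>) 0 * r\<^sup>2 / 2\<bar> \<le> C * \<bar>r\<bar> ^ 3"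
  proof (cases "r = 0")
    case False
    define diff where "diff m = (if m = (0::nat) then \<psi> else if m = 1 then deriv \<psi> else deriv (deriv \<psi>))" for m
    have "\<forall>m t. m < 2 \<and> min 0 r \<le> t \<and> t \<le> max 0 r \<longrightarrow> (diff m has_real_derivative diff (Suc m) t) (at t)"
      using D1 D2 by (auto simp: diff_def less_Suc_eq numeral_2_eq_2)
    with Taylor[of 2 diff \<psi> "min 0 r" "max 0 r" 0 r] False obtain t
      where t: "(if r < 0 then r < t \<and> t < 0 else 0 < t \<and> t < r)"
        "\<psi> r = (\<Sum>m<2. diff m 0 / fact m * (r - 0) ^ m) + diff 2 t / fact 2 * (r - 0)^2"
      by (auto simp: diff_def)
    then have eq: "\<psi> r - \<psi> 0 - deriv \<psi> 0 * r - deriv (deriv \<psi>) 0 * r\<^sup>2 / 2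
        = (deriv (deriv \<psi>) t - deriv (deriv \<psi>) 0) * r\<^sup>2 / 2"
      by (simp add: diff_def numeral_2_eq_2 algebra_simps diff_divide_distrib)
    have "\<bar>deriv (deriv \<psi>) t - deriv (deriv \<psi>) 0\<bar> \<le> C * \<bar>t - 0\<bar>" by (rule lip2)
    also have "\<dots> \<le> C * \<bar>r\<bar>" using t(1) C by (intro mult_left_mono) (auto split: if_splits)
    finally have "\<bar>deriv (deriv \<psi>) t - deriv (deriv \<psi>) 0\<bar> * r\<^sup>2 / 2 \<le> C * \<bar>r\<bar> * r\<^sup>2 / 2"
      by (intro divide_right_mono mult_right_mono) auto
    also have "\<dots> \<le> C * \<bar>r\<bar> * r\<^sup>2" using C by simp
    also have "\<dots> = C * \<bar>r\<bar> ^ 3" by (simp add: power3_eq_cube power2_eq_square mult.assoc)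
    finally show ?thesis unfolding eq by (simp add: abs_mult)
  qed simp
qed

lemma W_space_add_scaled:
  "w \<in> W_space T \<Longrightarrow> e \<in> W_space T \<Longrightarrow> (\<lambda>t\<in>{0..T}. w t + r * e t) \<in> W_space T"
  unfolding W_space_def
  by (auto intro!: continuous_intros cong: continuous_on_cong_simp)

lemma L2_norm_square_le:
  assumes "e \<in> W_space T" "T > 0" "\<And>t. t \<in> {0..T} \<Longrightarrow> \<bar>e t\<bar> \<le> 1"
  shows "L2_norm T e * L2_norm T e \<le> T"
proof -
  have c: "continuous_on {0..T} (\<lambda>s. (e s)\<^sup>2)"
    using assms(1) by (auto simp: W_space_def intro!: continuous_intros)
  then have i: "set_integrable lborel {0..T} (\<lambda>s. (e s)\<^sup>2)"
    by (rule borel_integrable_atLeastAtMost')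
  have "(LINT s:{0..T}|lborel. (e s)\<^sup>2) \<le> (LINT s:{0..T}|lborel. 1)"
    using assms(2,3) by (intro set_integral_mono i) (auto simp: set_integrable_def abs_square_le_1)
  also have "\<dots> = T" using assms(2) by (simp add: set_lebesgue_integral_def)
  finally have "(LINT s:{0..T}|lborel. (e s)\<^sup>2) \<le> T" .
  moreover have "0 \<le> (LINT s:{0..T}|lborel. (e s)\<^sup>2)"
    by (auto simp: set_lebesgue_integral_def intro!: integral_nonneg_AE)
  ultimately show ?thesis by (simp add: L2_norm_def)
qed

text \<open>On the line through \<open>w\<close> in direction \<open>e\<close> the functional is a
  function of one real variable. With the shift \<open>g = (s - r) * e\<close>, the condition on
  \<open>D2\<close> becomes a Lipschitz bound with constant \<open>T\<close>, because
  \<open>e\<close> is at most 1 and its squared \<open>L2_norm\<close> at most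
  \<open>T\<close>.\<close>

lemma Sigma_class_taylor:
  assumes F: "F \<in> Sigma_class T" and T: "T > 0" and w: "w \<in> W_space T"
    and e: "e \<in> W_space T" "e \<in> H_space T" "\<And>t. t \<in> {0..T} \<Longrightarrow> \<bar>e t\<bar> \<le> 1"
  shows "\<exists>D H. \<bar>H\<bar> \<le> 2 + T \<and>
    (\<forall>r. \<bar>F (\<lambda>t\<in>{0..T}. w t + r * e t) - F w - D * r - H * r\<^sup>2 / 2\<bar> \<le> T * \<bar>r\<bar> ^ 3)"
proof -
  define W where "W r = (\<lambda>t\<in>{0..T}. w t + r * e t)" for r
  define \<psi> where "\<psi> r = F (W r)" for r
  have WW: "W r \<in> W_space T" for r unfolding W_def by (rule W_space_add_scaled[OF w e(1)])
  have Wadd: "(\<lambda>t\<in>{0..T}. W r t + s * e t) = W (r + s)" for r s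
    by (auto simp: W_def fun_eq_iff algebra_simps)
  have Wadd2: "(\<lambda>t\<in>{0..T}. W r t + s * e t + s' * e t) = W ((r + s) + s')" for r s s'
    by (auto simp: W_def fun_eq_iff algebra_simps)
  have lip: "\<bar>\<psi> r - \<psi> s\<bar> \<le> \<bar>r - s\<bar>" for r s
    unfolding \<psi>_def
  proof (rule Sigma_class_lipschitz[OF F T])
    fix t assume t: "t \<in> {0..T}"
    have "\<bar>W r t - W s t\<bar> = \<bar>r - s\<bar> * \<bar>e t\<bar>"
      using t by (simp add: W_def flip: abs_mult) (simp add: algebra_simps)
    then show "\<bar>W r t - W s t\<bar> \<le> \<bar>r - s\<bar>" using e(3)[OF t] by (simp add: mult_left_le)
  qed (use WW W_space_subset_D_space in auto)
  \<comment> \<open>Differentiability is granted only near the parameter 0; moving the base point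
    along the line to \<open>W r\<close> gives it at every \<open>r\<close>.\<close>
  have diff: "\<psi> differentiable (at r)" "deriv \<psi> differentiable (at r)" for r
  proof -
    have "twice_H_differentiable T F" using F by (simp add: Sigma_class_def)
    then have "\<forall>\<^sub>F \<epsilon> in nhds 0. (\<lambda>\<epsilon>. \<psi> (r + \<epsilon>)) differentiable (at \<epsilon>) \<and>
        deriv (\<lambda>\<epsilon>. \<psi> (r + \<epsilon>)) differentiable (at \<epsilon>)"
      using WW[of r] e(2) unfolding twice_H_differentiable_def Let_def \<psi>_def Wadd[symmetric] by blast
    then have "(\<lambda>\<epsilon>. \<psi> (r + \<epsilon>)) differentiable (at 0) \<and> deriv (\<lambda>\<epsilon>. \<psi> (r + \<epsilon>)) differentiable (at 0)"
      by (rule eventually_nhds_x_imp_x)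
    moreover have "deriv (\<lambda>\<epsilon>. \<psi> (r + \<epsilon>)) = (\<lambda>\<epsilon>. deriv \<psi> (r + \<epsilon>))"
      by (rule ext, rule deriv_shift_real)
    moreover have "(\<lambda>\<epsilon>. f (r + \<epsilon>)) differentiable (at 0) \<longleftrightarrow> f differentiable (at r)" for f :: "real \<Rightarrow> real"
      using DERIV_shift[of f _ 0 r] by (simp add: real_differentiable_def add.commute)
    ultimately show "\<psi> differentiable (at r)" "deriv \<psi> differentiable (at r)" by auto
  qed
  \<comment> \<open>With equal directions the two parameters of the mixed derivative add up, so it
    is an ordinary second derivative.\<close>
  have D2eq: "D2 T F (W r) e e = deriv (deriv \<psi>) r" for r
    unfolding D2_def Wadd2 \<psi>_def[symmetric] deriv_shift_real by (simp add: deriv_shift_real)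
  have lip2: "\<bar>deriv (deriv \<psi>) r - deriv (deriv \<psi>) s\<bar> \<le> T * \<bar>r - s\<bar>" for r s
  proof -
    define g where "g = (\<lambda>t\<in>{0..T}. (s - r) * e t)"
    have g: "g \<in> W_space T" using e(1) unfolding g_def W_space_def
      by (auto intro!: continuous_intros cong: continuous_on_cong_simp)
    have Wg: "(\<lambda>t\<in>{0..T}. W r t + g t) = W s"
      by (auto simp: W_def g_def fun_eq_iff algebra_simps)
    have sg: "sup_norm T g \<le> \<bar>r - s\<bar>" unfolding sup_norm_def
    proof (rule cSUP_least)
      fix t assume t: "t \<in> {0..T}"
      then have "\<bar>g t\<bar> = \<bar>r - s\<bar> * \<bar>e t\<bar>" by (simp add: g_def abs_mult abs_minus_commute)
      then show "\<bar>g t\<bar> \<le> \<bar>r - s\<bar>" using e(3)[OF t] by (simp add: mult_left_le)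
    qed (use T in auto)
    have L0: "L2_norm T e * L2_norm T e \<ge> 0" by simp
    have "\<bar>D2 T F (W r) e e - D2 T F (\<lambda>t\<in>{0..T}. W r t + g t) e e\<bar>
        \<le> sup_norm T g * L2_norm T e * L2_norm T e"
      using F g e(2) WW[of r] by (auto simp: Sigma_class_def)
    also have "\<dots> \<le> \<bar>r - s\<bar> * (L2_norm T e * L2_norm T e)"
      using sg L0 by (simp only: mult.assoc) (rule mult_right_mono)
    also have "\<dots> \<le> \<bar>r - s\<bar> * T"
      using L2_norm_square_le[OF e(1) T e(3)] by (intro mult_left_mono) auto
    finally show ?thesis unfolding Wg D2eq by (simp add: mult.commute)
  qed
  have W0: "W 0 = w" using w by (auto simp: W_def W_space_def extensional_def fun_eq_iff)
  have F_eq: "F (\<lambda>t\<in>{0..T}. w t + r * e t) = \<psi> r" "F w = \<psi> 0" for r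
    unfolding \<psi>_def W0 by (simp_all add: W_def)
  show ?thesis
    unfolding F_eq
    by (rule exI[of _ "deriv \<psi> 0"], rule exI[of _ "deriv (deriv \<psi>) 0"])
      (use second_order_expansion[OF diff lip lip2] T in simp)
qed

section \<open>Interpolated paths on a uniform grid\<close>

definition grid :: "real \<Rightarrow> nat \<Rightarrow> nat \<Rightarrow> real" where
  "grid T N k = real k * (T / real N)"

text \<open>For positive \<open>T\<close> and \<open>N\<close> the ramp climbs linearly from 0 to 1
  across cell \<open>k\<close> and stays 1 afterwards, so the coefficients in \<open>ipath\<close>
  are increments and not values at the grid points.\<close>

definition ramp :: "real \<Rightarrow> nat \<Rightarrow> nat \<Rightarrow> real \<Rightarrow> real" where
  "ramp T N k t = max 0 (min 1 ((t - grid T N k) * (real N / T)))"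

text \<open>The exponential undoes the factor \<open>exp (\<mu> t)\<close> that turns the processes
  into sums of martingale increments. The path is linear in \<open>y\<close>: changing one
  coefficient moves it along a single \<open>ebasis\<close>.\<close>

definition ipath :: "real \<Rightarrow> real \<Rightarrow> nat \<Rightarrow> (nat \<Rightarrow> real) \<Rightarrow> real \<Rightarrow> real" where
  "ipath \<mu> T N y = (\<lambda>t\<in>{0..T}. exp (- \<mu> * t) * (\<Sum>k<N. y k * ramp T N k t))"

definition ebasis :: "real \<Rightarrow> real \<Rightarrow> nat \<Rightarrow> nat \<Rightarrow> real \<Rightarrow> real" where
  "ebasis \<mu> T N k = (\<lambda>t\<in>{0..T}. exp (- \<mu> * t) * ramp T N k t)"

lemma ramp_bounds: "0 \<le> ramp T N k t" "ramp T N k t \<le> 1"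
  by (auto simp: ramp_def)

lemma ramp_eq_0: "T > 0 \<Longrightarrow> t \<le> grid T N k \<Longrightarrow> ramp T N k t = 0"
  using mult_nonpos_nonneg[of "t - grid T N k" "real N / T"] by (simp add: ramp_def)

lemma grid_mono: "T > 0 \<Longrightarrow> j \<le> k \<Longrightarrow> grid T N j \<le> grid T N k"
  unfolding grid_def by (rule mult_right_mono) auto

lemma grid_0 [simp]: "grid T N 0 = 0" by (simp add: grid_def)

lemma grid_nonneg: "T > 0 \<Longrightarrow> 0 \<le> grid T N k" by (simp add: grid_def)

lemma grid_last: "N > 0 \<Longrightarrow> grid T N N = T" by (simp add: grid_def)

lemma grid_le: "T > 0 \<Longrightarrow> k \<le> N \<Longrightarrow> grid T N k \<le> T"
  using grid_mono[of T k N N] by (cases "N = 0") (auto simp: grid_last grid_def)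

lemma grid_Suc: "grid T N (Suc k) = grid T N k + T / N"
  by (simp add: grid_def algebra_simps add_divide_distrib)

lemma ramp_eq_1:
  assumes "T > 0" "N > 0" "grid T N (Suc k) \<le> t"
  shows "ramp T N k t = 1"
proof -
  have "(T / N) * (N / T) \<le> (t - grid T N k) * (N / T)"
    using assms by (intro mult_right_mono) (auto simp: grid_Suc)
  then show ?thesis using assms by (simp add: ramp_def)
qed

lemma grid_cell:
  assumes "T > 0" "N > 0" "t \<in> {0..T}"
  obtains j where "j < N" "grid T N j \<le> t" "t \<le> grid T N (Suc j)"
proof (cases "t = T")
  \<comment> \<open>At the right end point the floor used below would give the cell number
    \<open>N\<close>, so the last cell is chosen by hand.\<close>
  case True
  then show ?thesis
    using that[of "N - 1"] assms grid_last[of N T] grid_le[of T "N - 1" N] by auto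
next
  case False
  define j where "j = nat \<lfloor>t * N / T\<rfloor>"
  have *: "real j \<le> t * N / T" "t * N / T < real j + 1"
    unfolding j_def using assms by (auto simp: of_nat_nat)
  have "t * N / T < N" using assms False by (simp add: divide_simps)
  then have "j < N" using * by simp
  moreover have "grid T N j \<le> t" "t \<le> grid T N (Suc j)"
    using * assms by (auto simp: grid_def field_simps)
  ultimately show ?thesis using that by blast
qed

lemma ipath_cong: "(\<And>k. k < N \<Longrightarrow> x k = y k) \<Longrightarrow> ipath \<mu> T N x = ipath \<mu> T N y"
  unfolding ipath_def by (intro restrict_ext arg_cong2[of _ _ _ _ "(*)"] sum.cong) auto

text \<open>Within cell \<open>j\<close> the earlier ramps have already reached 1 and the later ones
  are still 0.\<close>

lemma sum_ramp_eq:
  assumes "T > 0" "j < N" "grid T N j \<le> t" "t \<le> grid T N (Suc j)"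
  shows "(\<Sum>k<N. y k * ramp T N k t) = (\<Sum>k<j. y k) + y j * ramp T N j t"
proof -
  have "(\<Sum>k<N. y k * ramp T N k t) = (\<Sum>k\<in>{..<j} \<union> {j} \<union> {Suc j..<N}. y k * ramp T N k t)"
    using assms(2) by (intro sum.cong) auto
  also have "\<dots> = (\<Sum>k<j. y k * ramp T N k t) + y j * ramp T N j t + (\<Sum>k=Suc j..<N. y k * ramp T N k t)"
    by (subst sum.union_disjoint; auto)+
  also have "(\<Sum>k<j. y k * ramp T N k t) = (\<Sum>k<j. y k)"
  proof (rule sum.cong[OF refl])
    fix k assume "k \<in> {..<j}"
    then have "grid T N (Suc k) \<le> t" using grid_mono[of T "Suc k" j N] assms by auto
    then show "y k * ramp T N k t = y k" using ramp_eq_1 assms by simp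
  qed
  also have "(\<Sum>k=Suc j..<N. y k * ramp T N k t) = 0"
  proof (rule sum.neutral, rule ballI)
    fix k assume "k \<in> {Suc j..<N}"
    then have "t \<le> grid T N k" using grid_mono[of T "Suc j" k N] assms by auto
    then show "y k * ramp T N k t = 0" using ramp_eq_0 assms by simp
  qed
  finally show ?thesis by simp
qed

text \<open>On a cell the interpolation is a convex combination of its two end values.\<close>

lemma ipath_close:
  assumes T: "T > 0" "N > 0" and t: "t \<in> {0..T}"
    and c: "\<And>j. j < N \<Longrightarrow> grid T N j \<le> t \<Longrightarrow> t \<le> grid T N (Suc j) \<Longrightarrow>
      \<bar>f t - exp (- \<mu> * t) * (\<Sum>k<j. y k)\<bar> \<le> b \<and> \<bar>f t - exp (- \<mu> * t) * (\<Sum>k<Suc j. y k)\<bar> \<le> b"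
  shows "\<bar>f t - ipath \<mu> T N y t\<bar> \<le> b"
proof -
  obtain j where j: "j < N" "grid T N j \<le> t" "t \<le> grid T N (Suc j)"
    by (rule grid_cell[OF T t])
  define r where "r = ramp T N j t"
  have r: "0 \<le> r" "r \<le> 1" using ramp_bounds by (auto simp: r_def)
  define A B where "A = f t - exp (- \<mu> * t) * (\<Sum>k<j. y k)" and "B = f t - exp (- \<mu> * t) * (\<Sum>k<Suc j. y k)"
  have ab: "\<bar>A\<bar> \<le> b" "\<bar>B\<bar> \<le> b" using c[OF j] by (auto simp: A_def B_def)
  have "f t - ipath \<mu> T N y t = (1 - r) * A + r * B"
    using t by (simp add: ipath_def sum_ramp_eq[OF T(1) j] A_def B_def r_def algebra_simps)
  also have "\<bar>\<dots>\<bar> \<le> (1 - r) * \<bar>A\<bar> + r * \<bar>B\<bar>"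
    using abs_triangle_ineq[of "(1 - r) * A" "r * B"] r by (simp add: abs_mult)
  also have "\<dots> \<le> (1 - r) * b + r * b" using ab r by (intro add_mono mult_left_mono) auto
  finally show ?thesis by (simp add: algebra_simps)
qed

lemma ramp_continuous: "continuous_on A (ramp T N k)"
proof -
  have "continuous_on A (\<lambda>t. max 0 (min 1 ((t - a) * c)))" for a c :: real
    by (intro continuous_intros)
  then show ?thesis unfolding ramp_def[abs_def] .
qed

lemma ebasis_W: "ebasis \<mu> T N k \<in> W_space T"
  unfolding W_space_def ebasis_def
  by (auto intro!: continuous_intros ramp_continuous cong: continuous_on_cong_simp)

lemma ipath_W: "ipath \<mu> T N y \<in> W_space T"
  unfolding W_space_def ipath_def
  by (auto intro!: continuous_intros ramp_continuous cong: continuous_on_cong_simp)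

lemma ebasis_le_1: "\<mu> > 0 \<Longrightarrow> t \<in> {0..T} \<Longrightarrow> \<bar>ebasis \<mu> T N k t\<bar> \<le> 1"
  using ramp_bounds[of T N k t] by (auto simp: ebasis_def abs_mult intro!: mult_le_one)

text \<open>An explicit square integrable derivative has to be produced. The ramp is differentiable
  except at the two ends of its cell, and the fundamental theorem of calculus tolerates finitely
  many exceptional points for a continuous function.\<close>

lemma ebasis_H:
  assumes T: "T > 0" "\<mu> > 0" "N > 0"
  shows "ebasis \<mu> T N k \<in> H_space T"
proof -
  define a b c where "a = grid T N k" and "b = grid T N (Suc k)" and "c = real N / T"
  have c: "c > 0" using T by (simp add: c_def)
  have ab: "0 \<le> a" "a < b" "(b - a) * c = 1"
    using T by (auto simp: a_def b_def c_def grid_nonneg grid_Suc)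
  have ra: "ramp T N k x = max 0 (min 1 ((x - a) * c))" for x by (simp add: ramp_def a_def c_def)
  define h' where "h' s = exp (- \<mu> * s) * (indicator {a..b} s * c) - \<mu> * exp (- \<mu> * s) * ramp T N k s" for s
  have meas[measurable]: "h' \<in> borel_measurable borel"
    unfolding h'_def ramp_def by measurable
  have bnd: "\<bar>h' s\<bar> \<le> c + \<mu>" if "0 \<le> s" for s
  proof -
    have e: "exp (- \<mu> * s) \<le> 1" using that T by simp
    have "\<bar>h' s\<bar> \<le> \<bar>exp (- \<mu> * s) * (indicator {a..b} s * c)\<bar> + \<bar>\<mu> * exp (- \<mu> * s) * ramp T N k s\<bar>"
      unfolding h'_def by (rule abs_triangle_ineq4)
    also have "\<dots> \<le> 1 * c + \<mu> * 1 * 1"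
      unfolding abs_mult using e c T ramp_bounds[of T N k s]
      by (intro add_mono mult_mono) (auto simp: indicator_def)
    finally show ?thesis by simp
  qed
  have bnd2: "(h' s)\<^sup>2 \<le> (c + \<mu>)\<^sup>2" if "0 \<le> s" for s
    using bnd[OF that] c T by (simp add: power2_le_iff_abs_le)
  have si: "set_integrable lborel {0..t} h'" for t
    unfolding set_integrable_def
    by (rule integrableI_bounded_set_indicator[where B="c + \<mu>"]) (use bnd in \<open>auto simp: emeasure_lborel_Icc_eq\<close>)
  have si2: "set_integrable lborel {0..T} (\<lambda>s. (h' s)\<^sup>2)"
    unfolding set_integrable_def
    by (rule integrableI_bounded_set_indicator[where B="(c + \<mu>)\<^sup>2"])
       (use bnd2 in \<open>auto simp: emeasure_lborel_Icc_eq\<close>)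
  have main: "ebasis \<mu> T N k t = (LINT s:{0..t}|lborel. h' s)" if t: "t \<in> {0..T}" for t
  proof -
    have "(h' has_integral (exp (- \<mu> * t) * ramp T N k t - exp (- \<mu> * 0) * ramp T N k 0)) {0..t}"
    proof (rule fundamental_theorem_of_calculus_interior_strong[where S="{a, b}"])
      fix x assume x: "x \<in> {0<..<t} - {a, b}"
      have "(ramp T N k has_real_derivative indicator {a..b} x * c) (at x)"
      proof -
        consider "x < a" | "a < x" "x < b" | "x > b" using x by force
        then show ?thesis
        proof cases
          case 1
          have "((\<lambda>x. 0) has_real_derivative 0) (at x)" by simp
          then have "(ramp T N k has_real_derivative 0) (at x)"
          proof (rule DERIV_cong_ev[OF refl _ refl, THEN iffD1, rotated])
            show "\<forall>\<^sub>F x in nhds x. 0 = ramp T N k x"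
              by (rule eventually_mono[OF eventually_nhds_in_open[of "{..<a}" x]])
                (use 1 ramp_eq_0[OF T(1)] in \<open>auto simp: a_def\<close>)
          qed
          then show ?thesis using 1 by simp
        next
          case 2
          have "((\<lambda>x. (x - a) * c) has_real_derivative c) (at x)" by (auto intro!: derivative_eq_intros)
          then have "(ramp T N k has_real_derivative c) (at x)"
          proof (rule DERIV_cong_ev[OF refl _ refl, THEN iffD1, rotated])
            have le: "(y - a) * c \<le> 1" if "y < b" for y
              using ab(3) c mult_right_mono[of "y - a" "b - a" c] that by simp
            show "\<forall>\<^sub>F x in nhds x. (x - a) * c = ramp T N k x"
              by (rule eventually_mono[OF eventually_nhds_in_open[of "{a<..<b}" x]])
                (use 2 le c in \<open>auto simp: ra max_def min_def intro: antisym\<close>)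
          qed
          then show ?thesis using 2 by simp
        next
          case 3
          have "((\<lambda>x. 1) has_real_derivative 0) (at x)" by simp
          then have "(ramp T N k has_real_derivative 0) (at x)"
          proof (rule DERIV_cong_ev[OF refl _ refl, THEN iffD1, rotated])
            show "\<forall>\<^sub>F x in nhds x. 1 = ramp T N k x"
              by (rule eventually_mono[OF eventually_nhds_in_open[of "{b<..}" x]])
                (use 3 ramp_eq_1[OF T(1,3)] in \<open>auto simp: b_def\<close>)
          qed
          then show ?thesis using 3 by simp
        qed
      qed
      then show "((\<lambda>t. exp (- \<mu> * t) * ramp T N k t) has_vector_derivative h' x) (at x)"
        unfolding has_real_derivative_iff_has_vector_derivative[symmetric] h'_def
        by (auto intro!: derivative_eq_intros)
    qed (use t in \<open>auto intro!: continuous_intros ramp_continuous\<close>)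
    then have "integral {0..t} h' = exp (- \<mu> * t) * ramp T N k t"
      using ramp_eq_0[OF T(1), of 0 N k] grid_nonneg[OF T(1)] by (simp add: integral_unique)
    then show ?thesis
      using set_borel_integral_eq_integral(2)[OF si[of t]] t by (simp add: ebasis_def)
  qed
  show ?thesis
    unfolding H_space_def
    using main si2 meas by (auto intro!: exI[of _ h'] simp: set_borel_measurable_def ebasis_def[of \<mu> T N k])
qed

lemma ipath_upd:
  assumes "k < N"
  shows "ipath \<mu> T N (y(k := r)) = (\<lambda>t\<in>{0..T}. ipath \<mu> T N (y(k := 0)) t + r * ebasis \<mu> T N k t)"
proof
  fix t
  have "(\<Sum>j<N. (y(k := r)) j * ramp T N j t) = r * ramp T N k t + (\<Sum>j\<in>{..<N} - {k}. y j * ramp T N j t)" for r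
    using assms by (subst sum.remove[of _ k]) auto
  then show "ipath \<mu> T N (y(k := r)) t = (\<lambda>t\<in>{0..T}. ipath \<mu> T N (y(k := 0)) t + r * ebasis \<mu> T N k t) t"
    by (simp add: ipath_def ebasis_def algebra_simps)
qed

text \<open>The bounds on \<open>H\<close> and on the remainder depend on \<open>T\<close> alone,
  neither on the grid nor on the remaining coefficients; this uniformity allows the errors of the
  single exchanges to be added up.\<close>

lemma ipath_taylor:
  assumes "F \<in> Sigma_class T" "T > 0" "\<mu> > 0" "k < N"
  shows "\<exists>D H. \<bar>H\<bar> \<le> 2 + T \<and> (\<forall>r. \<bar>F (ipath \<mu> T N (y(k := r))) - F (ipath \<mu> T N (y(k := 0)))
    - D * r - H * r\<^sup>2 / 2\<bar> \<le> T * \<bar>r\<bar> ^ 3)"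
proof -
  define w where "w = ipath \<mu> T N (y(k := 0))"
  have eq: "ipath \<mu> T N (y(k := r)) = (\<lambda>t\<in>{0..T}. w t + r * ebasis \<mu> T N k t)" for r
    unfolding w_def by (rule ipath_upd[OF assms(4)])
  have w: "w \<in> W_space T" unfolding w_def by (rule ipath_W)
  show ?thesis
    using Sigma_class_taylor[OF assms(1,2) w ebasis_W ebasis_H[OF assms(2,3)] ebasis_le_1[OF assms(3)], of N k] assms(4)
    unfolding w_def[symmetric] eq[symmetric] by simp
qed

lemma ipath_diff_le:
  assumes "\<mu> > 0" "t \<in> {0..T}"
  shows "\<bar>ipath \<mu> T N x t - ipath \<mu> T N y t\<bar> \<le> (\<Sum>k<N. \<bar>x k - y k\<bar>)"
proof -
  have "\<bar>ipath \<mu> T N x t - ipath \<mu> T N y t\<bar> = exp (- \<mu> * t) * \<bar>\<Sum>k<N. (x k - y k) * ramp T N k t\<bar>"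
    using assms(2) by (simp add: ipath_def abs_mult flip: right_diff_distrib left_diff_distrib sum_subtractf)
  also have "\<dots> \<le> 1 * (\<Sum>k<N. \<bar>x k - y k\<bar>)"
  proof (intro mult_mono)
    have "\<bar>\<Sum>k<N. (x k - y k) * ramp T N k t\<bar> \<le> (\<Sum>k<N. \<bar>(x k - y k) * ramp T N k t\<bar>)" by (rule sum_abs)
    also have "\<dots> \<le> (\<Sum>k<N. \<bar>x k - y k\<bar>)"
      using ramp_bounds by (intro sum_mono) (auto simp: abs_mult mult_left_le)
    finally show "\<bar>\<Sum>k<N. (x k - y k) * ramp T N k t\<bar> \<le> (\<Sum>k<N. \<bar>x k - y k\<bar>)" .
  qed (use assms in auto)
  finally show ?thesis by simp
qed

lemma ipath_D: "ipath \<mu> T N y \<in> D_space T"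
  using ipath_W W_space_subset_D_space by blast

lemma Sigma_class_ipath_lipschitz:
  assumes "F \<in> Sigma_class T" "T > 0" "\<mu> > 0"
  shows "\<bar>F (ipath \<mu> T N x) - F (ipath \<mu> T N y)\<bar> \<le> (\<Sum>k<N. \<bar>x k - y k\<bar>)"
  by (rule Sigma_class_lipschitz[OF assms(1,2) ipath_D ipath_D ipath_diff_le[OF assms(3)]])

lemma Sigma_class_ipath_measurable:
  assumes "F \<in> Sigma_class T" "\<And>k. k < N \<Longrightarrow> y k \<in> borel_measurable M"
  shows "(\<lambda>\<omega>. F (ipath \<mu> T N (\<lambda>k. y k \<omega>))) \<in> borel_measurable M"
proof -
  have "(\<lambda>\<omega>. F (\<lambda>t\<in>{0..T}. exp (- \<mu> * t) * (\<Sum>k<N. y k \<omega> * ramp T N k t))) \<in> borel_measurable M"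
  proof (rule Sigma_class_measurable[OF assms(1)])
    show "(\<lambda>t\<in>{0..T}. exp (- \<mu> * t) * (\<Sum>k<N. y k \<omega> * ramp T N k t)) \<in> D_space T" for \<omega>
      using ipath_D[of \<mu> T N "\<lambda>k. y k \<omega>"] by (simp only: ipath_def)
  qed (use assms(2) in auto)
  then show ?thesis by (simp only: ipath_def)
qed

lemma (in prob_space) ipath_integrable:
  assumes F: "F \<in> Sigma_class T" "T > 0" "\<mu> > 0" and y: "\<And>k. k < m \<Longrightarrow> integrable M (y k)"
  shows "integrable M (\<lambda>\<omega>. F (ipath \<mu> T m (\<lambda>k. y k \<omega>)))"
proof (rule Bochner_Integration.integrable_bound)
  show "integrable M (\<lambda>\<omega>. \<bar>F (ipath \<mu> T m (\<lambda>_. 0))\<bar> + (\<Sum>k<m. \<bar>y k \<omega>\<bar>))"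
    by (intro Bochner_Integration.integrable_add integrable_const Bochner_Integration.integrable_sum
        integrable_abs y) simp
  show "(\<lambda>\<omega>. F (ipath \<mu> T m (\<lambda>k. y k \<omega>))) \<in> borel_measurable M"
    by (rule Sigma_class_ipath_measurable[OF F(1)]) (use y in auto)
  have "\<bar>F (ipath \<mu> T m (\<lambda>k. y k \<omega>)) - F (ipath \<mu> T m (\<lambda>_. 0))\<bar> \<le> (\<Sum>k<m. \<bar>y k \<omega> - 0\<bar>)" for \<omega>
    by (rule Sigma_class_ipath_lipschitz[OF F])
  then show "AE \<omega> in M. norm (F (ipath \<mu> T m (\<lambda>k. y k \<omega>)))
      \<le> norm (\<bar>F (ipath \<mu> T m (\<lambda>_. 0))\<bar> + (\<Sum>k<m. \<bar>y k \<omega>\<bar>))"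
    by (intro AE_I2) (smt (verit) diff_zero real_norm_def sum.cong sum_nonneg abs_ge_zero)
qed


section \<open>The Lindeberg step and the Euler scheme\<close>

text \<open>The linear term of the expansion integrates to zero because \<open>X\<close> is centred,
  which leaves the variance and the third absolute moment.\<close>

lemma (in prob_space) taylor_expectation:
  fixes X :: "'a \<Rightarrow> real"
  assumes X: "integrable M X" "integrable M (\<lambda>\<omega>. X \<omega> ^ 2)" "integrable M (\<lambda>\<omega>. \<bar>X \<omega>\<bar> ^ 3)"
    and \<phi>: "\<phi> \<in> borel_measurable borel" and mean: "expectation X = 0"
    and taylor: "\<And>z. \<bar>\<phi> z - \<phi> 0 - D * z - H * z\<^sup>2 / 2\<bar> \<le> C * \<bar>z\<bar> ^ 3"
  shows "integrable M (\<lambda>\<omega>. \<phi> (X \<omega>))"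
    and "\<bar>expectation (\<lambda>\<omega>. \<phi> (X \<omega>)) - \<phi> 0 - H * expectation (\<lambda>\<omega>. X \<omega> ^ 2) / 2\<bar>
      \<le> C * expectation (\<lambda>\<omega>. \<bar>X \<omega>\<bar> ^ 3)"
proof -
  have mX[measurable]: "X \<in> borel_measurable M" using X(1) by auto
  note \<phi>[measurable]
  define e where "e \<omega> = \<phi> (X \<omega>) - \<phi> 0 - D * X \<omega> - H * (X \<omega>)\<^sup>2 / 2" for \<omega>
  have e_le: "\<bar>e \<omega>\<bar> \<le> C * \<bar>X \<omega>\<bar> ^ 3" for \<omega> unfolding e_def by (rule taylor)
  have me: "e \<in> borel_measurable M" unfolding e_def[abs_def] by measurable
  have ie: "integrable M e"
    by (rule Bochner_Integration.integrable_bound[of _ "\<lambda>\<omega>. C * \<bar>X \<omega>\<bar> ^ 3"])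
       (use X(3) e_le me in \<open>auto intro: order_trans[OF _ abs_ge_self]\<close>)
  have eq: "\<phi> (X \<omega>) = e \<omega> + \<phi> 0 + D * X \<omega> + H * (X \<omega>)\<^sup>2 / 2" for \<omega> by (simp add: e_def)
  show i: "integrable M (\<lambda>\<omega>. \<phi> (X \<omega>))" unfolding eq using ie X by simp
  have "expectation (\<lambda>\<omega>. \<phi> (X \<omega>)) = expectation e + \<phi> 0 + H * expectation (\<lambda>\<omega>. X \<omega> ^ 2) / 2"
    unfolding eq using ie X mean by (simp add: prob_space)
  moreover have "\<bar>expectation e\<bar> \<le> expectation (\<lambda>\<omega>. C * \<bar>X \<omega>\<bar> ^ 3)"
    by (rule order_trans[OF integral_abs_bound integral_mono[OF integrable_abs[OF ie] _ e_le]]) (use X(3) in simp)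
  ultimately show "\<bar>expectation (\<lambda>\<omega>. \<phi> (X \<omega>)) - \<phi> 0 - H * expectation (\<lambda>\<omega>. X \<omega> ^ 2) / 2\<bar>
      \<le> C * expectation (\<lambda>\<omega>. \<bar>X \<omega>\<bar> ^ 3)"
    by simp
qed

text \<open>One exchange: \<open>R\<close> is the past, \<open>f (R \<omega>) (U \<omega>)\<close>
  the queue noise of the current cell and \<open>g (G \<omega>)\<close> its Gaussian substitute.
  Independence allows \<open>R\<close> to be frozen, after which the noise has the moments of a
  centred Poisson variable whose parameter \<open>v\<close> depends on the past.\<close>

lemma (in prob_space) lindeberg_step:
  fixes \<Phi> :: "'b \<Rightarrow> real \<Rightarrow> real" and f :: "'b \<Rightarrow> 'b \<Rightarrow> real" and g :: "'b \<Rightarrow> real"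
  assumes RU: "indep_var S R TU U" and RG: "indep_var S R TG G"
    and f: "(\<lambda>p. f (fst p) (snd p)) \<in> borel_measurable (S \<Otimes>\<^sub>M TU)" and g: "g \<in> borel_measurable TG"
    and \<Phi>: "(\<lambda>p. \<Phi> (fst p) (snd p)) \<in> borel_measurable (S \<Otimes>\<^sub>M borel)"
    and taylor: "\<And>r. r \<in> space S \<Longrightarrow>
      \<exists>D H. \<bar>H\<bar> \<le> C2 \<and> (\<forall>z. \<bar>\<Phi> r z - \<Phi> r 0 - D * z - H * z\<^sup>2 / 2\<bar> \<le> C3 * \<bar>z\<bar> ^ 3)"
    and fU: "\<And>r. r \<in> space S \<Longrightarrow> poisson_like M (v r) (\<lambda>\<omega>. f r (U \<omega>))"
    and gG: "integrable M (\<lambda>\<omega>. g (G \<omega>) ^ 4)" "expectation (\<lambda>\<omega>. g (G \<omega>)) = 0"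
      "expectation (\<lambda>\<omega>. g (G \<omega>) ^ 2) = s" "expectation (\<lambda>\<omega>. \<bar>g (G \<omega>)\<bar> ^ 3) \<le> t"
    and int: "integrable M (\<lambda>\<omega>. \<Phi> (R \<omega>) (\<kappa> * f (R \<omega>) (U \<omega>)))" "integrable M (\<lambda>\<omega>. \<Phi> (R \<omega>) (g (G \<omega>)))"
      "integrable M (\<lambda>\<omega>. v (R \<omega>))" "integrable M (\<lambda>\<omega>. v (R \<omega>) ^ 2)"
    and C: "C3 \<ge> 0" "\<kappa> \<ge> 0"
  shows "\<bar>expectation (\<lambda>\<omega>. \<Phi> (R \<omega>) (\<kappa> * f (R \<omega>) (U \<omega>))) - expectation (\<lambda>\<omega>. \<Phi> (R \<omega>) (g (G \<omega>)))\<bar>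
    \<le> expectation (\<lambda>\<omega>. C2 / 2 * \<bar>\<kappa>\<^sup>2 * v (R \<omega>) - s\<bar>
        + C3 * (\<kappa> ^ 3 * (v (R \<omega>) + 2 * v (R \<omega>) ^ 2) + t))"
proof -
  note f[measurable] g[measurable] \<Phi>[measurable]
  have mR[measurable]: "R \<in> measurable M S" and mU[measurable]: "U \<in> measurable M TU"
    and mG[measurable]: "G \<in> measurable M TG"
    using RU RG by (auto simp: indep_var_distribution_eq)
  \<comment> \<open>The two conditional expectations given the past, with \<open>R\<close> frozen
    and the present averaged.\<close>
  define A B where "A \<omega> = expectation (\<lambda>\<omega>'. \<Phi> (R \<omega>) (\<kappa> * f (R \<omega>) (U \<omega>')))"
    and "B \<omega> = expectation (\<lambda>\<omega>'. \<Phi> (R \<omega>) (g (G \<omega>')))" for \<omega>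
  have mA: "(\<lambda>p. \<Phi> (fst p) (\<kappa> * f (fst p) (snd p))) \<in> borel_measurable (S \<Otimes>\<^sub>M TU)"
    using measurable_compose[OF _ \<Phi>, of "\<lambda>p. (fst p, \<kappa> * f (fst p) (snd p))" "S \<Otimes>\<^sub>M TU"] by simp
  have mB: "(\<lambda>p. \<Phi> (fst p) (g (snd p))) \<in> borel_measurable (S \<Otimes>\<^sub>M TG)"
    using measurable_compose[OF _ \<Phi>, of "\<lambda>p. (fst p, g (snd p))" "S \<Otimes>\<^sub>M TG"] by simp
  have A: "integrable M A" "expectation (\<lambda>\<omega>. \<Phi> (R \<omega>) (\<kappa> * f (R \<omega>) (U \<omega>))) = expectation A"
    unfolding A_def using indep_var_integral_iterated[OF RU mA] int(1) by auto
  have B: "integrable M B" "expectation (\<lambda>\<omega>. \<Phi> (R \<omega>) (g (G \<omega>))) = expectation B"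
    unfolding B_def using indep_var_integral_iterated[OF RG mB] int(2) by auto
  have mgG: "(\<lambda>\<omega>. g (G \<omega>)) \<in> borel_measurable M" by measurable
  have ig: "integrable M (\<lambda>\<omega>. g (G \<omega>))" "integrable M (\<lambda>\<omega>. g (G \<omega>) ^ 2)" "integrable M (\<lambda>\<omega>. \<bar>g (G \<omega>)\<bar> ^ 3)"
    using integrable_power_le4[OF mgG gG(1), of 1] integrable_power_le4[OF mgG gG(1), of 2]
      integrable_abs[OF integrable_power_le4[OF mgG gG(1), of 3]] by (auto simp: power_abs)
  \<comment> \<open>Both sides are expanded at \<open>\<Phi> (R \<omega>) 0\<close> with the same
    \<open>D\<close> and \<open>H\<close>, so only the difference of the variances times
    \<open>H / 2\<close> and the two cubic remainders are left.\<close>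
  have bound: "\<bar>A \<omega> - B \<omega>\<bar> \<le> C2 / 2 * \<bar>\<kappa>\<^sup>2 * v (R \<omega>) - s\<bar>
      + C3 * (\<kappa> ^ 3 * (v (R \<omega>) + 2 * v (R \<omega>) ^ 2) + t)" if "\<omega> \<in> space M" for \<omega>
  proof -
    have r: "R \<omega> \<in> space S" using mR that by (rule measurable_space)
    obtain D H where DH: "\<bar>H\<bar> \<le> C2"
      "\<And>z. \<bar>\<Phi> (R \<omega>) z - \<Phi> (R \<omega>) 0 - D * z - H * z\<^sup>2 / 2\<bar> \<le> C3 * \<bar>z\<bar> ^ 3"
      using taylor[OF r] by blast
    have m: "\<Phi> (R \<omega>) \<in> borel_measurable borel"
      using measurable_compose[OF _ \<Phi>, of "\<lambda>z. (R \<omega>, z)" borel] r by simp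
    define Y where "Y = (\<lambda>\<omega>'. f (R \<omega>) (U \<omega>'))"
    note fU' = fU[OF r, folded Y_def]
    note iY = poisson_like_integrable[OF fU']
    have Y: "expectation Y = 0" "expectation (\<lambda>\<omega>'. Y \<omega>' ^ 2) = v (R \<omega>)"
      "expectation (\<lambda>\<omega>'. \<bar>Y \<omega>'\<bar> ^ 3) \<le> v (R \<omega>) + 2 * v (R \<omega>) ^ 2"
      using fU' poisson_like_third[OF fU'] by (auto simp: poisson_like_def)
    have 1: "\<bar>A \<omega> - \<Phi> (R \<omega>) 0 - H * (\<kappa>\<^sup>2 * v (R \<omega>)) / 2\<bar> \<le> C3 * (\<kappa> ^ 3 * (v (R \<omega>) + 2 * v (R \<omega>) ^ 2))"
    proof -
      have "\<bar>A \<omega> - \<Phi> (R \<omega>) 0 - H * expectation (\<lambda>\<omega>'. (\<kappa> * Y \<omega>') ^ 2) / 2\<bar>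
          \<le> C3 * expectation (\<lambda>\<omega>'. \<bar>\<kappa> * Y \<omega>'\<bar> ^ 3)"
        unfolding A_def Y_def[symmetric]
        using taylor_expectation(2)[of "\<lambda>\<omega>'. \<kappa> * Y \<omega>'" "\<Phi> (R \<omega>)" D H C3] iY Y m DH(2)
        unfolding Y_def by (simp add: power_mult_distrib abs_mult)
      also have "expectation (\<lambda>\<omega>'. (\<kappa> * Y \<omega>') ^ 2) = \<kappa>\<^sup>2 * v (R \<omega>)"
        using Y by (simp add: power_mult_distrib)
      also have "expectation (\<lambda>\<omega>'. \<bar>\<kappa> * Y \<omega>'\<bar> ^ 3) = \<kappa> ^ 3 * expectation (\<lambda>\<omega>'. \<bar>Y \<omega>'\<bar> ^ 3)"
        using C by (simp add: power_mult_distrib abs_mult)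
      also have "C3 * (\<kappa> ^ 3 * expectation (\<lambda>\<omega>'. \<bar>Y \<omega>'\<bar> ^ 3)) \<le> C3 * (\<kappa> ^ 3 * (v (R \<omega>) + 2 * v (R \<omega>) ^ 2))"
        using C Y by (intro mult_left_mono) auto
      finally show ?thesis .
    qed
    have 2: "\<bar>B \<omega> - \<Phi> (R \<omega>) 0 - H * s / 2\<bar> \<le> C3 * t"
      using taylor_expectation(2)[OF ig m gG(2) DH(2), unfolded gG(3)] mult_left_mono[OF gG(4) C(1)]
      unfolding B_def by linarith
    have "\<bar>A \<omega> - B \<omega>\<bar> \<le> \<bar>A \<omega> - \<Phi> (R \<omega>) 0 - H * (\<kappa>\<^sup>2 * v (R \<omega>)) / 2\<bar>
        + \<bar>H * (\<kappa>\<^sup>2 * v (R \<omega>)) / 2 - H * s / 2\<bar> + \<bar>B \<omega> - \<Phi> (R \<omega>) 0 - H * s / 2\<bar>"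
      by linarith
    moreover have "\<bar>H * (\<kappa>\<^sup>2 * v (R \<omega>)) / 2 - H * s / 2\<bar> = \<bar>H\<bar> / 2 * \<bar>\<kappa>\<^sup>2 * v (R \<omega>) - s\<bar>"
      by (simp add: abs_mult flip: right_diff_distrib diff_divide_distrib)
    moreover have "\<bar>H\<bar> / 2 * \<bar>\<kappa>\<^sup>2 * v (R \<omega>) - s\<bar> \<le> C2 / 2 * \<bar>\<kappa>\<^sup>2 * v (R \<omega>) - s\<bar>"
      using DH(1) by (intro mult_right_mono) auto
    ultimately show ?thesis using 1 2 by (simp add: distrib_left)
  qed
  have "\<bar>expectation A - expectation B\<bar> = \<bar>expectation (\<lambda>\<omega>. A \<omega> - B \<omega>)\<bar>"
    using A B by simp
  also have "\<dots> \<le> expectation (\<lambda>\<omega>. \<bar>A \<omega> - B \<omega>\<bar>)" by (rule integral_abs_bound)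
  also have "\<dots> \<le> expectation (\<lambda>\<omega>. C2 / 2 * \<bar>\<kappa>\<^sup>2 * v (R \<omega>) - s\<bar>
        + C3 * (\<kappa> ^ 3 * (v (R \<omega>) + 2 * v (R \<omega>) ^ 2) + t))"
    using A(1) B(1) int(3,4) bound by (intro integral_mono) auto
  finally show ?thesis using A B by simp
qed

text \<open>Euler scheme of the queue: \<open>d 0 k\<close> is the number of arrivals and \<open>d i k\<close> the number of ticks
  of the \<open>i\<close>-th service clock in the \<open>k\<close>-th cell. The scheme \<open>euler\<close> may become negative, in which
  case no server is active; \<open>noise\<close> is its martingale increment.\<close>

primrec euler :: "(nat \<Rightarrow> nat \<Rightarrow> real) \<Rightarrow> nat \<Rightarrow> real" where
  "euler d 0 = 0"
| "euler d (Suc k) = euler d k + d 0 k - (\<Sum>i\<in>{1..nat \<lfloor>euler d k\<rfloor>}. d i k)"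

definition noise :: "real \<Rightarrow> real \<Rightarrow> (nat \<Rightarrow> nat \<Rightarrow> real) \<Rightarrow> nat \<Rightarrow> real" where
  "noise a b d k = (d 0 k - a) - (\<Sum>i\<in>{1..nat \<lfloor>euler d k\<rfloor>}. d i k - b)"

lemma euler_cong: "(\<And>i j. j < k \<Longrightarrow> d i j = d' i j) \<Longrightarrow> euler d k = euler d' k"
  by (induction k) auto

lemma noise_cong: "(\<And>i j. j \<le> k \<Longrightarrow> d i j = d' i j) \<Longrightarrow> noise a b d k = noise a b d' k"
  unfolding noise_def using euler_cong[of k d d'] by auto

text \<open>The upper summation limit takes countably many values, and for each fixed value the sum
  is measurable.\<close>

lemma measurable_random_sum:
  fixes q :: "'a \<Rightarrow> real"
  assumes [measurable]: "q \<in> borel_measurable M" and "\<And>i. (\<lambda>\<omega>. d \<omega> i) \<in> borel_measurable M"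
  shows "(\<lambda>\<omega>. \<Sum>i\<in>{1..nat \<lfloor>q \<omega>\<rfloor>}. d \<omega> i :: real) \<in> borel_measurable M"
proof -
  have "(\<lambda>\<omega>. nat \<lfloor>q \<omega>\<rfloor>) \<in> measurable M (count_space UNIV)" by measurable
  then show ?thesis
    by (rule measurable_compose_countable[rotated]) (use assms(2) in auto)
qed

lemma euler_measurable:
  assumes "\<And>i j. j < k \<Longrightarrow> (\<lambda>\<omega>. d \<omega> i j) \<in> borel_measurable M"
  shows "(\<lambda>\<omega>. euler (d \<omega>) k) \<in> borel_measurable M"
  using assms
proof (induction k)
  case (Suc k)
  note [measurable] = Suc.IH[OF Suc.prems, OF less_SucI] Suc.prems[OF lessI]
  show ?case using measurable_random_sum[of "\<lambda>\<omega>. euler (d \<omega>) k" M "\<lambda>\<omega> i. d \<omega> i k"] by simp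
qed simp

lemma noise_measurable:
  assumes "\<And>i j. j \<le> k \<Longrightarrow> (\<lambda>\<omega>. d \<omega> i j) \<in> borel_measurable M"
  shows "(\<lambda>\<omega>. noise a b (d \<omega>) k) \<in> borel_measurable M"
proof -
  have [measurable]: "(\<lambda>\<omega>. euler (d \<omega>) k) \<in> borel_measurable M" "\<And>i. (\<lambda>\<omega>. d \<omega> i k) \<in> borel_measurable M"
    using assms euler_measurable[of k d M] by auto
  show ?thesis unfolding noise_def using measurable_random_sum[of "\<lambda>\<omega>. euler (d \<omega>) k" M "\<lambda>\<omega> i. d \<omega> i k - b"]
    by simp
qed

lemma euler_le_arrivals:
  assumes "\<And>i j. j < k \<Longrightarrow> 0 \<le> d i j"
  shows "euler d k \<le> (\<Sum>j<k. d 0 j)"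
  using assms
proof (induction k)
  case (Suc k)
  have "0 \<le> (\<Sum>i\<in>{1..nat \<lfloor>euler d k\<rfloor>}. d i k)" using Suc.prems by (intro sum_nonneg) auto
  then show ?case using Suc by simp
qed simp

lemma nat_floor_euler_le_arrivals:
  assumes "\<And>i j. j < k \<Longrightarrow> 0 \<le> d i j"
  shows "real (nat \<lfloor>euler d k\<rfloor>) \<le> (\<Sum>j<k. d 0 j)"
proof -
  have "0 \<le> (\<Sum>j<k. d 0 j)" using assms by (intro sum_nonneg) auto
  moreover have "euler d k \<le> (\<Sum>j<k. d 0 j)" by (rule euler_le_arrivals[OF assms])
  ultimately show ?thesis by (cases "0 \<le> \<lfloor>euler d k\<rfloor>") (auto simp: of_nat_nat intro: order_trans[OF of_int_floor_le])
qed

section \<open>Exchange of the noise for Gaussian increments, cell by cell\<close>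

text \<open>\<open>X (0, k)\<close> is a Brownian increment, \<open>X (Suc i, k)\<close> an increment of the arrival process
  (\<open>i = 0\<close>) or of the \<open>i\<close>-th service clock.\<close>

locale euler_space = prob_space P for P :: "'p measure" +
  fixes X :: "nat \<times> nat \<Rightarrow> 'p \<Rightarrow> real" and N :: nat and a b \<delta> :: real
  assumes indep: "indep_vars (\<lambda>_. borel) X (UNIV \<times> {..<N})"
    and arrival: "\<And>k. k < N \<Longrightarrow> poisson_like P a (\<lambda>\<omega>. X (1, k) \<omega> - a)"
    and service: "\<And>i k. k < N \<Longrightarrow> poisson_like P b (\<lambda>\<omega>. X (Suc (Suc i), k) \<omega> - b)"
    and gauss: "\<And>k. k < N \<Longrightarrow> integrable P (\<lambda>\<omega>. X (0, k) \<omega> ^ 4)"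
      "\<And>k. k < N \<Longrightarrow> (\<integral>\<omega>. X (0, k) \<omega> \<partial>P) = 0"
      "\<And>k. k < N \<Longrightarrow> (\<integral>\<omega>. X (0, k) \<omega> ^ 2 \<partial>P) = \<delta>"
      "\<And>k. k < N \<Longrightarrow> (\<integral>\<omega>. \<bar>X (0, k) \<omega>\<bar> ^ 3 \<partial>P) \<le> 2 * sqrt \<delta> ^ 3"
    and nonneg: "AE \<omega> in P. \<forall>i k. k < N \<longrightarrow> 0 \<le> X (Suc i, k) \<omega>"
    and pos: "a > 0" "b > 0" "\<delta> > 0"
begin

definition data :: "'p \<Rightarrow> nat \<Rightarrow> nat \<Rightarrow> real" where
  "data \<omega> i j = X (Suc i, j) \<omega>"

definition active :: "nat \<Rightarrow> 'p \<Rightarrow> real" where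
  "active k \<omega> = real (nat \<lfloor>euler (data \<omega>) k\<rfloor>)"

definition xi :: "nat \<Rightarrow> 'p \<Rightarrow> real" where
  "xi k \<omega> = noise a b (data \<omega>) k"

lemma X_measurable: "k < N \<Longrightarrow> X (i, k) \<in> borel_measurable P"
  using indep by (auto simp: indep_vars_def2)

lemma active_measurable: "k \<le> N \<Longrightarrow> active k \<in> borel_measurable P"
proof -
  assume k: "k \<le> N"
  have [measurable]: "(\<lambda>\<omega>. euler (data \<omega>) k) \<in> borel_measurable P"
    by (rule euler_measurable) (use k X_measurable in \<open>auto simp: data_def\<close>)
  show ?thesis unfolding active_def[abs_def] by measurable
qed

lemma xi_measurable: "k < N \<Longrightarrow> xi k \<in> borel_measurable P"
  unfolding xi_def[abs_def] by (rule noise_measurable) (use X_measurable in \<open>auto simp: data_def\<close>)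

text \<open>The number of active servers lies between 0 and the number of arrivals in the first
  \<open>k\<close> cells. That number, once centred, is \<open>poisson_like\<close> with parameter
  \<open>k * a\<close>, which makes its first two moments explicit.\<close>

lemma active_moments:
  assumes k: "k \<le> N"
  shows "integrable P (active k)" "integrable P (\<lambda>\<omega>. active k \<omega> ^ 2)"
    "expectation (active k) \<le> real k * a" "expectation (\<lambda>\<omega>. active k \<omega> ^ 2) \<le> real k * a + (real k * a) ^ 2"
proof -
  define Y where "Y \<omega> = (\<Sum>j<k. X (1, j) \<omega> - a)" for \<omega>
  have "poisson_like P (\<Sum>p\<in>{1::nat} \<times> {..<k}. a) (\<lambda>\<omega>. \<Sum>p\<in>{1::nat} \<times> {..<k}. X p \<omega> - a)"
  proof (rule poisson_like_sum)
    have "indep_vars (\<lambda>_. borel) X ({1::nat} \<times> {..<k})"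
      by (rule indep_vars_subset[OF indep]) (use k in auto)
    then show "indep_vars (\<lambda>_. borel) (\<lambda>p \<omega>. X p \<omega> - a) ({1::nat} \<times> {..<k})"
      by (rule indep_vars_compose2) auto
  qed (use arrival k in auto)
  moreover have "(\<Sum>p\<in>{1::nat} \<times> {..<k}. f p) = (\<Sum>j<k. f (1, j))" for f :: "nat \<times> nat \<Rightarrow> real"
    by (rule sum.reindex_bij_witness[of _ "\<lambda>j. (1, j)" snd]) auto
  ultimately have Y: "poisson_like P (real k * a) Y"
    by (simp add: Y_def[abs_def])
  define S where "S \<omega> = (\<Sum>j<k. X (1, j) \<omega>)" for \<omega>
  have S: "S = (\<lambda>\<omega>. Y \<omega> + real k * a)" by (auto simp: S_def Y_def sum_subtractf)
  note iY = poisson_like_integrable[OF Y]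
  have iS: "integrable P S" "integrable P (\<lambda>\<omega>. S \<omega> ^ 2)"
    unfolding S power2_sum using iY by (auto intro!: integrable_mult_left integrable_mult_right Bochner_Integration.integrable_add)
  have eS: "expectation S = real k * a" "expectation (\<lambda>\<omega>. S \<omega> ^ 2) = real k * a + (real k * a) ^ 2"
    unfolding S power2_sum using iY Y by (auto simp: poisson_like_def prob_space)
  have le: "AE \<omega> in P. 0 \<le> active k \<omega> \<and> active k \<omega> \<le> S \<omega>"
    using nonneg
  proof eventually_elim
    case (elim \<omega>)
    then show ?case
      using nat_floor_euler_le_arrivals[of k "data \<omega>"] k by (auto simp: active_def S_def data_def)
  qed
  have le2: "AE \<omega> in P. active k \<omega> ^ 2 \<le> S \<omega> ^ 2"
    using le by eventually_elim (auto intro: power_mono)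
  note [measurable] = active_measurable[OF k]
  show i1: "integrable P (active k)"
    by (rule Bochner_Integration.integrable_bound[OF iS(1)]) (use le in auto)
  show i2: "integrable P (\<lambda>\<omega>. active k \<omega> ^ 2)"
    by (rule Bochner_Integration.integrable_bound[OF iS(2)]) (use le2 in auto)
  show "expectation (active k) \<le> real k * a"
    unfolding eS(1)[symmetric] by (rule integral_mono_AE[OF i1 iS(1)]) (use le in auto)
  show "expectation (\<lambda>\<omega>. active k \<omega> ^ 2) \<le> real k * a + (real k * a) ^ 2"
    unfolding eS(2)[symmetric] by (rule integral_mono_AE[OF i2 iS(2) le2])
qed

text \<open>The conditional variance of \<open>xi k\<close> given the past: \<open>a\<close> from
  the arrivals and \<open>b\<close> from each active server.\<close>

definition var :: "nat \<Rightarrow> 'p \<Rightarrow> real" where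
  "var k \<omega> = a + b * active k \<omega>"

lemma var_moments:
  assumes k: "k < N"
  shows "integrable P (var k)" "integrable P (\<lambda>\<omega>. var k \<omega> ^ 2)"
    "expectation (var k) \<le> a + b * (real k * a)"
    "expectation (\<lambda>\<omega>. var k \<omega> ^ 2) \<le> 2 * a ^ 2 + 2 * b ^ 2 * (real k * a + (real k * a) ^ 2)"
proof -
  note m = active_moments[OF less_imp_le[OF k]]
  show i1: "integrable P (var k)" unfolding var_def[abs_def] using m by simp
  show i2: "integrable P (\<lambda>\<omega>. var k \<omega> ^ 2)"
    unfolding var_def[abs_def] power2_sum power_mult_distrib using m by simp
  show "expectation (var k) \<le> a + b * (real k * a)"
    using m pos by (simp add: var_def[abs_def] prob_space)
  have "expectation (\<lambda>\<omega>. var k \<omega> ^ 2) \<le> expectation (\<lambda>\<omega>. 2 * a ^ 2 + 2 * b ^ 2 * active k \<omega> ^ 2)"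
  proof (rule integral_mono[OF i2])
    fix \<omega>
    have "0 \<le> (a - b * active k \<omega>)\<^sup>2" by simp
    then show "var k \<omega> ^ 2 \<le> 2 * a ^ 2 + 2 * b ^ 2 * active k \<omega> ^ 2"
      by (simp add: var_def power2_sum power2_diff power_mult_distrib)
  qed (use m in simp)
  also have "\<dots> \<le> 2 * a ^ 2 + 2 * b ^ 2 * (real k * a + (real k * a) ^ 2)"
    using m by (simp add: prob_space mult_left_mono)
  finally show "expectation (\<lambda>\<omega>. var k \<omega> ^ 2) \<le> 2 * a ^ 2 + 2 * b ^ 2 * (real k * a + (real k * a) ^ 2)" .
qed

text \<open>Conditioning on the past, the noise is a sum of independent centred Poisson variables.\<close>

definition past :: "nat \<Rightarrow> (nat \<times> nat) set" where
  "past k = {(Suc i, j) |i j. j < k} \<union> {(0, j) |j. k < j \<and> j < N}"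

definition present :: "nat \<Rightarrow> (nat \<times> nat) set" where
  "present k = {(Suc i, k) |i. True}"

text \<open>Besides the earlier clock data it contains the Gaussian increments of the later cells:
  at exchange \<open>k\<close> these fill the coefficients that have not been replaced yet.\<close>

definition pastR :: "nat \<Rightarrow> 'p \<Rightarrow> nat \<times> nat \<Rightarrow> real" where
  "pastR k \<omega> = (\<lambda>p\<in>past k. X p \<omega>)"

definition presentU :: "nat \<Rightarrow> 'p \<Rightarrow> nat \<times> nat \<Rightarrow> real" where
  "presentU k \<omega> = (\<lambda>p\<in>present k. X p \<omega>)"

text \<open>The noise as a function of two separate arguments: the past \<open>r\<close> fixes the
  number of active servers and \<open>u\<close> supplies the ticks of the current cell. This is the
  form needed to freeze the past.\<close>

definition rnoise :: "nat \<Rightarrow> (nat \<times> nat \<Rightarrow> real) \<Rightarrow> (nat \<times> nat \<Rightarrow> real) \<Rightarrow> real" where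
  "rnoise k r u = (u (1, k) - a) - (\<Sum>i\<in>{1..nat \<lfloor>euler (\<lambda>i j. r (Suc i, j)) k\<rfloor>}. u (Suc i, k) - b)"

definition ractive :: "nat \<Rightarrow> (nat \<times> nat \<Rightarrow> real) \<Rightarrow> real" where
  "ractive k r = real (nat \<lfloor>euler (\<lambda>i j. r (Suc i, j)) k\<rfloor>)"

lemma past_present_indep:
  assumes k: "k < N"
  shows "indep_var (PiM (past k) (\<lambda>_. borel)) (pastR k) (PiM (present k) (\<lambda>_. borel)) (presentU k)"
  unfolding pastR_def[abs_def] presentU_def[abs_def]
  by (rule indep_var_restrict[OF indep]) (use k in \<open>auto simp: past_def present_def\<close>)

lemma past_gauss_indep:
  assumes k: "k < N"
  shows "indep_var (PiM (past k) (\<lambda>_. borel)) (pastR k) (PiM {(0, k)} (\<lambda>_. borel)) (\<lambda>\<omega>. \<lambda>p\<in>{(0, k)}. X p \<omega>)"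
  unfolding pastR_def[abs_def]
  by (rule indep_var_restrict[OF indep]) (use k in \<open>auto simp: past_def present_def\<close>)

lemma euler_pastR: "j \<le> k \<Longrightarrow> euler (\<lambda>i j. pastR k \<omega> (Suc i, j)) j = euler (data \<omega>) j"
  by (rule euler_cong) (auto simp: pastR_def past_def data_def)

lemma noise_pastR: "j < k \<Longrightarrow> noise a b (\<lambda>i j. pastR k \<omega> (Suc i, j)) j = xi j \<omega>"
  unfolding xi_def by (rule noise_cong) (auto simp: pastR_def past_def data_def)

lemma ractive_pastR: "ractive k (pastR k \<omega>) = active k \<omega>"
  by (simp add: ractive_def active_def euler_pastR)

lemma rnoise_past_present: "rnoise k (pastR k \<omega>) (presentU k \<omega>) = xi k \<omega>"
  unfolding rnoise_def xi_def noise_def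
  by (simp add: euler_pastR) (simp add: presentU_def present_def data_def)

lemma past_euler_measurable:
  "j \<le> k \<Longrightarrow> (\<lambda>r. euler (\<lambda>i j. r (Suc i, j)) j) \<in> borel_measurable (PiM (past k) (\<lambda>_. borel))"
  by (rule euler_measurable) (auto simp: past_def intro!: measurable_component_singleton)

lemma past_noise_measurable:
  "j < k \<Longrightarrow> (\<lambda>r. noise a b (\<lambda>i j. r (Suc i, j)) j) \<in> borel_measurable (PiM (past k) (\<lambda>_. borel))"
  by (rule noise_measurable) (auto simp: past_def intro!: measurable_component_singleton)

lemma rnoise_measurable:
  "(\<lambda>p. rnoise k (fst p) (snd p)) \<in> borel_measurable (PiM (past k) (\<lambda>_. borel) \<Otimes>\<^sub>M PiM (present k) (\<lambda>_. borel))"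
proof -
  let ?M = "PiM (past k) (\<lambda>_. borel) \<Otimes>\<^sub>M PiM (present k) (\<lambda>_. borel) :: ((nat \<times> nat \<Rightarrow> real) \<times> (nat \<times> nat \<Rightarrow> real)) measure"
  have u[measurable]: "(\<lambda>p. snd p (Suc i, k)) \<in> borel_measurable ?M" for i
    by (rule measurable_compose[OF measurable_snd measurable_component_singleton]) (auto simp: present_def)
  have e: "(\<lambda>p. euler (\<lambda>i j. fst p (Suc i, j)) k) \<in> borel_measurable ?M"
    by (rule measurable_compose[OF measurable_fst past_euler_measurable]) simp
  have "(\<lambda>p. \<Sum>i\<in>{1..nat \<lfloor>euler (\<lambda>i j. fst p (Suc i, j)) k\<rfloor>}. snd p (Suc i, k) - b) \<in> borel_measurable ?M"
    by (rule measurable_random_sum[OF e]) measurable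
  moreover have "(\<lambda>p. snd p (1, k)) \<in> borel_measurable ?M" using u[of 0] by simp
  ultimately show ?thesis unfolding rnoise_def by measurable
qed

text \<open>For a fixed past the number of active servers is a constant, so the noise is a finite
  sum of independent centred variables, with reversed sign for the services; sums and sign changes
  preserve \<open>poisson_like\<close>.\<close>

lemma rnoise_poisson_like:
  assumes k: "k < N"
  shows "poisson_like P (a + b * ractive k r) (\<lambda>\<omega>. rnoise k r (presentU k \<omega>))"
proof -
  define m where "m = nat \<lfloor>euler (\<lambda>i j. r (Suc i, j)) k\<rfloor>"
  \<comment> \<open>First index 1 is the arrival process, first indices 2 up to \<open>m + 1\<close>
    are the active service clocks.\<close>
  define J where "J = (\<lambda>i. (Suc i, k)) ` {0..m}"
  define v where "v p = (if fst p = 1 then a else b)" for p :: "nat \<times> nat"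
  define Y where "Y p = (\<lambda>x. if fst p = 1 then x - a else - (x - b))" for p :: "nat \<times> nat"
  have "poisson_like P (\<Sum>p\<in>J. v p) (\<lambda>\<omega>. \<Sum>p\<in>J. Y p (X p \<omega>))"
  proof (rule poisson_like_sum)
    have "indep_vars (\<lambda>_. borel) X J"
      by (rule indep_vars_subset[OF indep]) (use k in \<open>auto simp: J_def\<close>)
    then show "indep_vars (\<lambda>_. borel) (\<lambda>p \<omega>. Y p (X p \<omega>)) J"
      by (rule indep_vars_compose2) (auto simp: Y_def)
    fix p assume "p \<in> J"
    then obtain i where p: "p = (Suc i, k)" by (auto simp: J_def)
    show "poisson_like P (v p) (\<lambda>\<omega>. Y p (X p \<omega>))"
      using arrival[OF k] poisson_like_uminus[OF service[OF k]]
      by (cases i) (simp_all add: p v_def Y_def)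
  qed (simp add: J_def)
  moreover have "(\<Sum>p\<in>J. f p) = f (1, k) + (\<Sum>i\<in>{1..m}. f (Suc i, k))" for f :: "nat \<times> nat \<Rightarrow> real"
    unfolding J_def by (subst sum.reindex) (auto simp: inj_on_def sum.atLeast_Suc_atMost)
  moreover have "ractive k r = real m" by (simp add: ractive_def m_def)
  moreover have "rnoise k r (presentU k \<omega>) = (X (1, k) \<omega> - a) + (\<Sum>i\<in>{1..m}. - (X (Suc i, k) \<omega> - b))" for \<omega>
    unfolding rnoise_def m_def[symmetric]
    by (simp only: sum_negf) (simp add: presentU_def present_def)
  ultimately show ?thesis by (simp add: v_def Y_def mult.commute)
qed

lemma var_pastR: "a + b * ractive k (pastR k \<omega>) = var k \<omega>"
  by (simp add: var_def ractive_pastR)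

text \<open>Averaging the present with the past frozen turns \<open>xi k ^ 2\<close> into
  \<open>var k\<close>. Carrying this out for nonnegative integrals gives integrability together
  with the value.\<close>

lemma xi_square:
  assumes k: "k < N"
  shows "integrable P (\<lambda>\<omega>. xi k \<omega> ^ 2)" "expectation (\<lambda>\<omega>. xi k \<omega> ^ 2) = expectation (var k)"
proof -
  note m = var_moments[OF k]
  have nn: "0 \<le> var k \<omega>" for \<omega> using pos by (simp add: var_def active_def)
  have "(\<integral>\<^sup>+\<omega>. ennreal (xi k \<omega> ^ 2) \<partial>P) = (\<integral>\<^sup>+\<omega>. \<integral>\<^sup>+\<omega>'. ennreal (rnoise k (pastR k \<omega>) (presentU k \<omega>') ^ 2) \<partial>P \<partial>P)"
    using indep_var_nn_integral_iterated[OF past_present_indep[OF k], of "\<lambda>p. ennreal (rnoise k (fst p) (snd p) ^ 2)"]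
      rnoise_measurable by (simp add: rnoise_past_present)
  also have "\<dots> = (\<integral>\<^sup>+\<omega>. ennreal (var k \<omega>) \<partial>P)"
  proof (rule nn_integral_cong)
    fix \<omega>
    note pl = rnoise_poisson_like[OF k, of "pastR k \<omega>"]
    show "(\<integral>\<^sup>+\<omega>'. ennreal (rnoise k (pastR k \<omega>) (presentU k \<omega>') ^ 2) \<partial>P) = ennreal (var k \<omega>)"
      using pl poisson_like_integrable(2)[OF pl]
      by (subst nn_integral_eq_integral) (auto simp: poisson_like_def var_pastR)
  qed
  also have "\<dots> = ennreal (expectation (var k))"
    using m nn by (intro nn_integral_eq_integral) auto
  finally have *: "(\<integral>\<^sup>+\<omega>. ennreal (xi k \<omega> ^ 2) \<partial>P) = ennreal (expectation (var k))" .
  have "has_bochner_integral P (\<lambda>\<omega>. xi k \<omega> ^ 2) (expectation (var k))"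
    using xi_measurable[OF k] * nn by (intro has_bochner_integral_nn_integral) (auto intro!: integral_nonneg_AE)
  then show "integrable P (\<lambda>\<omega>. xi k \<omega> ^ 2)" "expectation (\<lambda>\<omega>. xi k \<omega> ^ 2) = expectation (var k)"
    by (auto simp: has_bochner_integral_iff)
qed

lemma xi_integrable: "k < N \<Longrightarrow> integrable P (xi k)"
  using square_integrable_imp_integrable[of "xi k"] xi_square(1) xi_measurable by auto

text \<open>Orthogonality of martingale increments: the partial sum is a function of the past, and
  with the past frozen the next noise term has mean zero, so the mixed term vanishes.\<close>

lemma weighted_noise_square:
  assumes k: "k \<le> N"
  shows "integrable P (\<lambda>\<omega>. (\<Sum>j<k. w j * xi j \<omega>) ^ 2)"
    "expectation (\<lambda>\<omega>. (\<Sum>j<k. w j * xi j \<omega>) ^ 2) = (\<Sum>j<k. w j ^ 2 * expectation (var j))"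
proof -
  have "integrable P (\<lambda>\<omega>. (\<Sum>j<k. w j * xi j \<omega>) ^ 2) \<and>
    expectation (\<lambda>\<omega>. (\<Sum>j<k. w j * xi j \<omega>) ^ 2) = (\<Sum>j<k. w j ^ 2 * expectation (var j))"
    using k
  proof (induction k)
    case (Suc k)
    define S where "S \<omega> = (\<Sum>j<k. w j * xi j \<omega>)" for \<omega>
    define s where "s r = (\<Sum>j<k. w j * noise a b (\<lambda>i j. r (Suc i, j)) j)" for r :: "nat \<times> nat \<Rightarrow> real"
    have k: "k < N" using Suc.prems by simp
    have IH: "integrable P (\<lambda>\<omega>. S \<omega> ^ 2)" "expectation (\<lambda>\<omega>. S \<omega> ^ 2) = (\<Sum>j<k. w j ^ 2 * expectation (var j))"
      using Suc unfolding S_def by auto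
    have mS: "S \<in> borel_measurable P" unfolding S_def[abs_def] using xi_measurable k by auto
    have ms[measurable]: "s \<in> borel_measurable (PiM (past k) (\<lambda>_. borel))"
      unfolding s_def[abs_def] using past_noise_measurable by auto
    have sS: "s (pastR k \<omega>) = S \<omega>" for \<omega> by (simp add: s_def S_def noise_pastR)
    note [measurable] = rnoise_measurable
    have ic: "integrable P (\<lambda>\<omega>. S \<omega> * xi k \<omega>)"
      by (rule integrable_mult_of_squares[OF mS xi_measurable[OF k] IH(1) xi_square(1)[OF k]])
    have "expectation (\<lambda>\<omega>. S \<omega> * xi k \<omega>) = expectation (\<lambda>\<omega>. expectation (\<lambda>\<omega>'. s (pastR k \<omega>) * rnoise k (pastR k \<omega>) (presentU k \<omega>')))"
      using indep_var_integral_iterated(2)[OF past_present_indep[OF k], of "\<lambda>p. s (fst p) * rnoise k (fst p) (snd p)"] ic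
      by (simp add: rnoise_past_present sS)
    also have "\<dots> = 0"
      using rnoise_poisson_like[OF k] by (simp add: poisson_like_def)
    finally have 0: "expectation (\<lambda>\<omega>. S \<omega> * xi k \<omega>) = 0" .
    have eq: "(\<Sum>j<Suc k. w j * xi j \<omega>) ^ 2 = S \<omega> ^ 2 + w k ^ 2 * xi k \<omega> ^ 2 + 2 * w k * (S \<omega> * xi k \<omega>)" for \<omega>
      by (simp add: S_def power2_sum power_mult_distrib algebra_simps)
    show ?case
      unfolding eq using IH ic 0 xi_square[OF k] by auto
  qed simp
  then show "integrable P (\<lambda>\<omega>. (\<Sum>j<k. w j * xi j \<omega>) ^ 2)"
    "expectation (\<lambda>\<omega>. (\<Sum>j<k. w j * xi j \<omega>) ^ 2) = (\<Sum>j<k. w j ^ 2 * expectation (var j))"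
    by auto
qed

lemma gauss_integrable: "k < N \<Longrightarrow> integrable P (X (0, k))"
  using integrable_power_le4[OF X_measurable gauss(1), of k 1] by simp

text \<open>A telescoping sum over hybrid paths. Two consecutive hybrids differ in one coefficient
  only, and each difference is an instance of \<open>lindeberg_step\<close> with the constants of
  \<open>ipath_taylor\<close>.\<close>

lemma lindeberg:
  assumes F: "F \<in> Sigma_class T" "T > 0" "\<mu> > 0"
    and nn: "\<And>k. w k \<ge> 0" "\<And>k. c k \<ge> 0"
  shows "\<bar>expectation (\<lambda>\<omega>. F (ipath \<mu> T N (\<lambda>k. w k * xi k \<omega>)))
      - expectation (\<lambda>\<omega>. F (ipath \<mu> T N (\<lambda>k. c k * X (0, k) \<omega>)))\<bar>
    \<le> (\<Sum>k<N. expectation (\<lambda>\<omega>. (2 + T) / 2 * \<bar>(w k)\<^sup>2 * var k \<omega> - (c k)\<^sup>2 * \<delta>\<bar>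
        + T * (w k ^ 3 * (var k \<omega> + 2 * var k \<omega> ^ 2) + c k ^ 3 * (2 * sqrt \<delta> ^ 3))))"
    (is "_ \<le> (\<Sum>k<N. ?B k)")
proof -
  \<comment> \<open>Hybrid number \<open>k\<close>: queue noise in the first \<open>k\<close> cells,
    Gaussian increments in the others.\<close>
  define y where "y k j \<omega> = (if j < k then w j * xi j \<omega> else c j * X (0, j) \<omega>)" for k j \<omega>
  define E where "E k = expectation (\<lambda>\<omega>. F (ipath \<mu> T N (\<lambda>j. y k j \<omega>)))" for k
  have iy: "integrable P (y k j)" if "j < N" for k j
    unfolding y_def[abs_def] using xi_integrable gauss_integrable that by (cases "j < k") auto
  have step: "\<bar>E (Suc k) - E k\<bar> \<le> ?B k" if k: "k < N" for k
  proof -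
    let ?S = "PiM (past k) (\<lambda>_. borel) :: (nat \<times> nat \<Rightarrow> real) measure"
    define y0 where "y0 r j = (if j < k then w j * noise a b (\<lambda>i j. r (Suc i, j)) j else c j * r (0, j))"
      for r :: "nat \<times> nat \<Rightarrow> real" and j
    define \<Phi> where "\<Phi> r z = F (ipath \<mu> T N ((y0 r)(k := z)))" for r z
    have \<Phi>1: "\<Phi> (pastR k \<omega>) (w k * rnoise k (pastR k \<omega>) (presentU k \<omega>)) = F (ipath \<mu> T N (\<lambda>j. y (Suc k) j \<omega>))" for \<omega>
      unfolding \<Phi>_def
      by (rule arg_cong[of _ _ F], rule ipath_cong)
        (auto simp: y0_def y_def noise_pastR rnoise_past_present, simp add: pastR_def past_def)
    have \<Phi>2: "\<Phi> (pastR k \<omega>) (c k * (\<lambda>p\<in>{(0, k)}. X p \<omega>) (0, k)) = F (ipath \<mu> T N (\<lambda>j. y k j \<omega>))" for \<omega>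
      unfolding \<Phi>_def
      by (rule arg_cong[of _ _ F], rule ipath_cong)
        (auto simp: y0_def y_def noise_pastR, simp add: pastR_def past_def)
    have "\<bar>expectation (\<lambda>\<omega>. \<Phi> (pastR k \<omega>) (w k * rnoise k (pastR k \<omega>) (presentU k \<omega>)))
        - expectation (\<lambda>\<omega>. \<Phi> (pastR k \<omega>) (c k * (\<lambda>p\<in>{(0, k)}. X p \<omega>) (0, k)))\<bar>
      \<le> expectation (\<lambda>\<omega>. (2 + T) / 2 * \<bar>(w k)\<^sup>2 * (a + b * ractive k (pastR k \<omega>)) - (c k)\<^sup>2 * \<delta>\<bar>
        + T * (w k ^ 3 * ((a + b * ractive k (pastR k \<omega>)) + 2 * (a + b * ractive k (pastR k \<omega>)) ^ 2)
            + c k ^ 3 * (2 * sqrt \<delta> ^ 3)))"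
    proof (rule lindeberg_step[OF past_present_indep[OF k] past_gauss_indep[OF k], where g="\<lambda>u. c k * u (0, k)"])
      show "(\<lambda>p. rnoise k (fst p) (snd p)) \<in> borel_measurable (?S \<Otimes>\<^sub>M PiM (present k) (\<lambda>_. borel))"
        by (rule rnoise_measurable)
      show "(\<lambda>u. c k * u (0, k)) \<in> borel_measurable (PiM {(0, k)} (\<lambda>_. borel))"
        by (intro borel_measurable_times borel_measurable_const measurable_component_singleton) simp
      show "(\<lambda>p. \<Phi> (fst p) (snd p)) \<in> borel_measurable (?S \<Otimes>\<^sub>M borel)"
        unfolding \<Phi>_def
      proof (rule Sigma_class_ipath_measurable[OF F(1)])
        fix j assume j: "j < N"
        have 1: "(\<lambda>p. noise a b (\<lambda>i j. fst p (Suc i, j)) j) \<in> borel_measurable (?S \<Otimes>\<^sub>M (borel :: real measure))" if "j < k"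
          by (rule measurable_compose[OF measurable_fst past_noise_measurable[OF that]])
        have 2: "(\<lambda>p. fst p (0, j)) \<in> borel_measurable (?S \<Otimes>\<^sub>M (borel :: real measure))" if "k < j"
          by (rule measurable_compose[OF measurable_fst measurable_component_singleton]) (use that j in \<open>auto simp: past_def\<close>)
        consider "j < k" | "j = k" | "k < j" by linarith
        then show "(\<lambda>p. ((y0 (fst p))(k := snd p)) j) \<in> borel_measurable (?S \<Otimes>\<^sub>M borel)"
          by cases (use 1 2 in \<open>auto simp: y0_def\<close>)
      qed
      fix r assume "r \<in> space ?S"
      show "\<exists>D H. \<bar>H\<bar> \<le> 2 + T \<and> (\<forall>z. \<bar>\<Phi> r z - \<Phi> r 0 - D * z - H * z\<^sup>2 / 2\<bar> \<le> T * \<bar>z\<bar> ^ 3)"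
        unfolding \<Phi>_def by (rule ipath_taylor[OF F k])
      show "poisson_like P (a + b * ractive k r) (\<lambda>\<omega>. rnoise k r (presentU k \<omega>))"
        by (rule rnoise_poisson_like[OF k])
    next
      show "integrable P (\<lambda>\<omega>. \<Phi> (pastR k \<omega>) (w k * rnoise k (pastR k \<omega>) (presentU k \<omega>)))"
        unfolding \<Phi>1 by (rule ipath_integrable[OF F iy])
      show "integrable P (\<lambda>\<omega>. \<Phi> (pastR k \<omega>) (c k * (\<lambda>p\<in>{(0, k)}. X p \<omega>) (0, k)))"
        unfolding \<Phi>2 by (rule ipath_integrable[OF F iy])
      show "expectation (\<lambda>\<omega>. \<bar>c k * (\<lambda>p\<in>{(0, k)}. X p \<omega>) (0, k)\<bar> ^ 3) \<le> c k ^ 3 * (2 * sqrt \<delta> ^ 3)"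
        using gauss(4)[OF k] nn(2)[of k] by (simp add: abs_mult power_mult_distrib mult_left_mono)
    qed (use gauss[OF k] var_moments[OF k] F nn in \<open>simp_all add: var_pastR power_mult_distrib\<close>)
    then show ?thesis
      unfolding \<Phi>1 \<Phi>2 var_pastR E_def .
  qed
  have "E N - E 0 = (\<Sum>k<N. E (Suc k) - E k)" by (rule sum_lessThan_telescope[symmetric])
  also have "\<bar>\<dots>\<bar> \<le> (\<Sum>k<N. \<bar>E (Suc k) - E k\<bar>)" by (rule sum_abs)
  also have "\<dots> \<le> (\<Sum>k<N. ?B k)" using step by (intro sum_mono) auto
  finally have "\<bar>E N - E 0\<bar> \<le> (\<Sum>k<N. ?B k)" .
  moreover have "E N = expectation (\<lambda>\<omega>. F (ipath \<mu> T N (\<lambda>k. w k * xi k \<omega>)))"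
    unfolding E_def by (intro Bochner_Integration.integral_cong refl arg_cong[of _ _ F] ipath_cong) (auto simp: y_def)
  moreover have "E 0 = expectation (\<lambda>\<omega>. F (ipath \<mu> T N (\<lambda>k. c k * X (0, k) \<omega>)))"
    unfolding E_def by (simp add: y_def)
  ultimately show ?thesis by simp
qed

end


section \<open>Pathwise analysis of the queue\<close>

text \<open>Such a function is the pointwise limit of its samples at the next point, strictly to the
  right, of the grid of mesh \<open>1 / (k + 1)\<close>; each sampled function depends on
  \<open>x\<close> through a floor only.\<close>

lemma borel_measurable_right_continuous:
  fixes f :: "real \<Rightarrow> real"
  assumes "\<And>x. (f \<longlongrightarrow> f x) (at_right x)"
  shows "f \<in> borel_measurable borel"
proof (rule borel_measurable_LIMSEQ_metric)
  fix k :: nat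
  have "(\<lambda>x::real. \<lfloor>x * real (Suc k)\<rfloor>) \<in> measurable borel (count_space UNIV)" by measurable
  then show "(\<lambda>x. f ((of_int \<lfloor>x * real (Suc k)\<rfloor> + 1) / real (Suc k))) \<in> borel_measurable borel"
    by (rule measurable_compose) simp
next
  fix x :: real
  define u where "u k = (of_int \<lfloor>x * real (Suc k)\<rfloor> + 1) / real (Suc k)" for k
  have u: "x < u k" "u k \<le> x + 1 / real (Suc k)" for k
  proof -
    have "x * real (Suc k) < of_int \<lfloor>x * real (Suc k)\<rfloor> + 1" by linarith
    then show "x < u k" unfolding u_def by (subst pos_less_divide_eq) auto
    have "of_int \<lfloor>x * real (Suc k)\<rfloor> + 1 \<le> (x + 1 / real (Suc k)) * real (Suc k)"
      using of_int_floor_le[of "x * real (Suc k)"] by (simp add: distrib_right)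
    then show "u k \<le> x + 1 / real (Suc k)" unfolding u_def by (subst pos_divide_le_eq) auto
  qed
  have "u \<longlonglongrightarrow> x"
  proof (rule tendsto_sandwich[of "\<lambda>_. x" _ _ "\<lambda>k. x + 1 / real (Suc k)"])
    show "(\<lambda>k. x + 1 / real (Suc k)) \<longlonglongrightarrow> x"
      using tendsto_add[OF tendsto_const lim_inverse_n', of x, THEN LIMSEQ_Suc] by simp
  qed (use u in \<open>auto intro!: always_eventually less_imp_le\<close>)
  then have "filterlim u (at_right x) sequentially"
    using u by (auto simp: filterlim_at intro!: always_eventually)
  then show "(\<lambda>k. f ((of_int \<lfloor>x * real (Suc k)\<rfloor> + 1) / real (Suc k))) \<longlonglongrightarrow> f x"
    using filterlim_compose[OF assms] unfolding u_def by fast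
qed

lemma cadlag_on_at_right:
  assumes "cadlag_on {0..} f" "0 \<le> t"
  shows "(f \<longlongrightarrow> f t) (at_right t)"
proof -
  have "{0..} \<inter> {t<..} = {t<..}" using assms(2) by auto
  moreover have "(f \<longlongrightarrow> f t) (at t within {0..} \<inter> {t<..})"
    using assms by (simp add: cadlag_on_def)
  ultimately show ?thesis by simp
qed

lemma cadlag_on_at_left:
  assumes "cadlag_on {0..} f" "0 < t"
  shows "\<exists>l. (f \<longlongrightarrow> l) (at_left t)"
proof -
  have "at t within ({0..} \<inter> {..<t}) = at_left t"
    by (rule at_within_nhd[of t "{0<..}"]) (use assms(2) in auto)
  moreover have "\<exists>l. (f \<longlongrightarrow> l) (at t within {0..} \<inter> {..<t})"
    using assms by (simp add: cadlag_on_def)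
  ultimately show ?thesis by simp
qed

lemma cadlag_extend_right:
  assumes "cadlag_on {0..} f"
  shows "((\<lambda>s. f (max 0 s)) \<longlongrightarrow> f (max 0 x)) (at_right x)"
proof (cases "x \<ge> 0")
  case True
  have "\<forall>\<^sub>F s in at_right x. f s = f (max 0 s)"
    using True by (auto simp: eventually_at_right_field intro!: exI[of _ "x + 1"])
  then show ?thesis
    using tendsto_cong[THEN iffD1, OF _ cadlag_on_at_right[OF assms True]] True by simp
next
  case False
  have "\<forall>\<^sub>F s in at_right x. f (max 0 x) = f (max 0 s)"
    using False by (auto simp: eventually_at_right_field intro!: exI[of _ 0])
  then show ?thesis by (rule tendsto_cong[THEN iffD1]) simp
qed

section \<open>Counting paths and integrals against them\<close>

definition counting_path :: "(real \<Rightarrow> nat) \<Rightarrow> bool" where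
  "counting_path c \<longleftrightarrow> c 0 = 0 \<and> mono_on {0..} c \<and> cadlag_on {0..} (\<lambda>t. real (c t))"

lemma counting_path_mono: "counting_path c \<Longrightarrow> 0 \<le> s \<Longrightarrow> s \<le> t \<Longrightarrow> c s \<le> c t"
  by (auto simp: counting_path_def mono_on_def)

lemma counting_path_right:
  assumes "counting_path c" "0 \<le> t"
  shows "\<exists>e>0. \<forall>s\<in>{t..<t + e}. c s = c t"
proof -
  have "((\<lambda>t. real (c t)) \<longlongrightarrow> real (c t)) (at_right t)"
    using assms by (auto simp: counting_path_def intro: cadlag_on_at_right)
  from tendstoD[OF this, of 1] obtain b where b: "b > t" "\<And>y. t < y \<Longrightarrow> y < b \<Longrightarrow> \<bar>real (c y) - real (c t)\<bar> < 1"
    by (auto simp: eventually_at_right_field dist_real_def)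
  have *: "c s = c t" if "s \<in> {t..<t + (b - t)}" for s
    using b(2)[of s] that by (cases "s = t") auto
  show ?thesis
    by (rule exI[of _ "b - t"], intro conjI ballI *) (use b(1) in auto)
qed

text \<open>The jump time \<open>u\<close> is the infimum of the times at which the final value has
  been reached. Since the path is constant on a short interval to the right of \<open>u\<close>, the
  infimum is attained.\<close>

lemma counting_path_jump:
  assumes c: "counting_path c" and t: "0 \<le> t'" "t' \<le> t" "c t \<le> c t' + 1"
  obtains u where "t' \<le> u" "u \<le> t" "\<And>v. t' \<le> v \<Longrightarrow> v < u \<Longrightarrow> c v = c t'" "c u = c t"
proof (cases "c t = c t'")
  case True
  then show ?thesis by (intro that[of t']) (use t in auto)
next
  case False
  then have ct: "c t = c t' + 1" using counting_path_mono[OF c t(1,2)] t(3) by simp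
  define V where "V = {v \<in> {t'..t}. c v = c t}"
  define u where "u = Inf V"
  have V: "t \<in> V" "V \<subseteq> {t'..t}" "bdd_below V" using t by (auto simp: V_def)
  have u: "t' \<le> u" "u \<le> t" using V unfolding u_def
    by (auto intro!: cInf_greatest cInf_lower)
  have before: "c v = c t'" if "t' \<le> v" "v < u" for v
  proof -
    have "v \<notin> V" using that cInf_lower[OF _ V(3), of v] by (auto simp: u_def)
    then have "c v \<noteq> c t" using that u by (auto simp: V_def)
    moreover have "c v \<le> c t" "c t' \<le> c v" using that u t counting_path_mono[OF c] by auto
    ultimately show ?thesis using ct by simp
  qed
  have "0 \<le> u" using u t by simp
  then obtain e where e: "e > 0" "\<forall>s\<in>{u..<u + e}. c s = c u"
    using counting_path_right[OF c] by blast
  obtain v where v: "v \<in> V" "v < u + e"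
    using cInf_lessD[of V "u + e"] V e(1) by (auto simp: u_def)
  then have uv: "u \<le> v" using cInf_lower[OF _ V(3)] by (auto simp: u_def)
  have "c v = c u" by (rule bspec[OF e(2)]) (use v(2) uv in auto)
  then have "c u = c t" using v(1) by (simp add: V_def)
  then show ?thesis using that u before by blast
qed

context
  fixes c :: "real \<Rightarrow> nat"
  assumes c: "counting_path c"
begin

abbreviation (input) "\<nu> \<equiv> interval_measure (\<lambda>s. real (c (max 0 s)))"

lemma emeasure_counting: "0 \<le> s \<Longrightarrow> s \<le> t \<Longrightarrow> emeasure \<nu> {s<..t} = ennreal (real (c t) - real (c s))"
proof -
  assume st: "0 \<le> s" "s \<le> t"
  have "emeasure \<nu> {s<..t} = ennreal (real (c (max 0 t)) - real (c (max 0 s)))"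
  proof (rule emeasure_interval_measure_Ioc[OF st(2)])
    show "real (c (max 0 x)) \<le> real (c (max 0 y))" if "x \<le> y" for x y
      using counting_path_mono[OF c, of "max 0 x" "max 0 y"] that by auto
    show "continuous (at_right a) (\<lambda>s. real (c (max 0 s)))" for a
      using cadlag_extend_right[of "\<lambda>t. real (c t)" a] c by (simp add: continuous_within counting_path_def)
  qed
  then show ?thesis using st by simp
qed

text \<open>Half-open intervals \<open>{s<..v}\<close> with \<open>v < u\<close> have as measure the
  increment of \<open>c\<close>, which is zero, and countably many of them exhaust the open
  interval.\<close>

lemma null_open_interval:
  assumes "0 \<le> s" "\<And>v. s \<le> v \<Longrightarrow> v < u \<Longrightarrow> c v = c s"
  shows "emeasure \<nu> {s<..<u} = 0"
proof (cases "s < u")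
  case True
  have "{s<..<u} = (\<Union>k. {s<..u - (u - s) / real (Suc k)})"
  proof safe
    fix x assume x: "x \<in> {s<..<u}"
    then obtain k :: nat where k: "(u - s) / (u - x) < real k"
      using reals_Archimedean2 by blast
    have "(u - s) < real (Suc k) * (u - x)"
      using k x by (simp add: field_simps)
    then have "(u - s) / real (Suc k) \<le> u - x" by (simp add: field_simps)
    then show "x \<in> (\<Union>k. {s<..u - (u - s) / real (Suc k)})"
      using x by (auto intro!: exI[of _ k])
  next
    fix x k assume "x \<in> {s<..u - (u - s) / real (Suc k)}"
    moreover have "(u - s) / real (Suc k) > 0" using True by simp
    ultimately show "x \<in> {s<..<u}" by auto
  qed
  moreover have "emeasure \<nu> (\<Union>k. {s<..u - (u - s) / real (Suc k)}) = 0"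
  proof (rule emeasure_UN_eq_0)
    fix k
    have "u - (u - s) / real (Suc k) < u" using True by simp
    moreover have "s \<le> u - (u - s) / real (Suc k)"
      using divide_left_mono[of 1 "real (Suc k)" "u - s"] True by simp
    ultimately show "emeasure \<nu> {s<..u - (u - s) / real (Suc k)} = 0"
      using emeasure_counting[OF assms(1), of "u - (u - s) / real (Suc k)"]
        assms(2)[of "u - (u - s) / real (Suc k)"] by simp
  qed auto
  ultimately show ?thesis by simp
qed auto

text \<open>On \<open>{t'<..t}\<close> the measure is carried by the single point \<open>u\<close>,
  with mass equal to the increment of \<open>c\<close>, so the integrand may be replaced there by
  its value at \<open>u\<close>.\<close>

lemma stieltjes_integral_increment:
  assumes t: "0 \<le> t'" "t' \<le> u" "u \<le> t"
    and jump: "\<And>v. t' \<le> v \<Longrightarrow> v < u \<Longrightarrow> c v = c t'" "c u = c t"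
    and g: "(\<lambda>s. indicator {0<..} s * g s) \<in> borel_measurable borel" "\<And>s. 0 \<le> g s" "\<And>s. g s \<le> 1"
  shows "stieltjes_integral c t g = stieltjes_integral c t' g + (real (c t) - real (c t')) * g u"
proof -
  have gs: "set_integrable \<nu> {0<..r} g" if "0 \<le> r" for r
    unfolding set_integrable_def
  proof (rule Bochner_Integration.integrable_bound)
    show "integrable \<nu> (indicator {0<..r} :: real \<Rightarrow> real)"
      using emeasure_counting[of 0 r] that by (intro integrable_real_indicator) auto
    have "(\<lambda>x. indicator {0<..r} x *\<^sub>R g x) = (\<lambda>x. indicator {..r} x * (indicator {0<..} x * g x))"
      by (auto simp: fun_eq_iff indicator_def)
    moreover have "(\<lambda>x. indicator {..r} x * (indicator {0<..} x * g x)) \<in> borel_measurable \<nu>"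
    proof (rule borel_measurable_times)
      show "(\<lambda>x. indicator {0<..} x * g x) \<in> borel_measurable \<nu>"
        using g(1) by (simp cong: measurable_cong_sets)
    qed auto
    ultimately show "(\<lambda>x. indicator {0<..r} x *\<^sub>R g x) \<in> borel_measurable \<nu>" by simp
  qed (use g in \<open>auto simp: indicator_def\<close>)
  have sub: "set_integrable \<nu> {t'<..t} g"
    by (rule set_integrable_subset[OF gs[of t]]) (use t in auto)
  have "stieltjes_integral c t g = (LINT s:{0<..t'} \<union> {t'<..t}|\<nu>. g s)"
    unfolding stieltjes_integral_def using t by (simp add: ivl_disj_un)
  also have "\<dots> = stieltjes_integral c t' g + (LINT s:{t'<..t}|\<nu>. g s)"
    unfolding stieltjes_integral_def by (rule set_integral_Un) (use gs[of t'] sub t in auto)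
  also have "(LINT s:{t'<..t}|\<nu>. g s) = (LINT s:{t'<..t}|\<nu>. g u)"
    unfolding set_lebesgue_integral_def
  proof (rule integral_cong_AE)
    have null: "{t'<..<u} \<union> {u<..t} \<in> null_sets \<nu>"
      using null_open_interval[OF t(1) jump(1)] emeasure_counting[of u t] t jump(2)
      by (intro null_sets.Un) (auto simp: null_sets_def)
    then show "AE s in \<nu>. indicator {t'<..t} s *\<^sub>R g s = indicator {t'<..t} s *\<^sub>R g u"
    proof (rule AE_I'[OF _ subsetI])
      fix x assume x: "x \<in> {x \<in> space \<nu>. indicator {t'<..t} x *\<^sub>R g x \<noteq> indicator {t'<..t} x *\<^sub>R g u}"
      then have "x \<in> {t'<..t}" "x \<noteq> u" by (auto simp: indicator_def split: if_splits)
      then show "x \<in> {t'<..<u} \<union> {u<..t}" by auto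
    qed
    show "(\<lambda>x. indicator {t'<..t} x *\<^sub>R g x) \<in> borel_measurable \<nu>"
      using sub by (auto simp: set_integrable_def)
  qed auto
  also have "\<dots> = (real (c t) - real (c t')) * g u"
  proof -
    have "c t' \<le> c t" using counting_path_mono[OF c] t by auto
    then show ?thesis
      using emeasure_counting[of t' t] t by (simp add: set_lebesgue_integral_def measure_def)
  qed
  finally show ?thesis .
qed

lemma stieltjes_integral_0: "stieltjes_integral c 0 g = 0"
  by (simp add: stieltjes_integral_def set_lebesgue_integral_def)

lemma stieltjes_integral_nonneg: "(\<And>s. 0 \<le> g s) \<Longrightarrow> 0 \<le> stieltjes_integral c t g"
  unfolding stieltjes_integral_def set_lebesgue_integral_def by (rule integral_nonneg_AE) auto

end

lemma stieltjes_integral_eq_0: "(\<And>s. 0 < s \<Longrightarrow> s \<le> t \<Longrightarrow> g s = 0) \<Longrightarrow> stieltjes_integral c t g = 0"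
  unfolding stieltjes_integral_def set_lebesgue_integral_def
  by (intro integral_eq_zero_AE AE_I2) (auto simp: indicator_def)

definition busy :: "(real \<Rightarrow> real) \<Rightarrow> real \<Rightarrow> real \<Rightarrow> real" where
  "busy l x = (\<lambda>s. if Lim (at_left s) l \<ge> x then 1 else 0)"

lemma busy_bounds: "0 \<le> busy l x s" "busy l x s \<le> 1" by (auto simp: busy_def)

text \<open>The left limit at \<open>s\<close> is the limit of the values at
  \<open>s - 1 / (k + 1)\<close>. It is known to exist only for positive times, hence the
  indicator.\<close>

lemma busy_measurable:
  assumes l: "cadlag_on {0..} l"
  shows "(\<lambda>s. indicator {0<..} s * busy l x s) \<in> borel_measurable borel"
proof -
  have ml: "(\<lambda>s. l (max 0 s)) \<in> borel_measurable borel"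
    by (rule borel_measurable_right_continuous[OF cadlag_extend_right[OF l]])
  define h where "h s = indicator {0<..} s * Lim (at_left s) l" for s :: real
  have "h \<in> borel_measurable borel"
  proof (rule borel_measurable_LIMSEQ_metric)
    fix k :: nat
    show "(\<lambda>s. indicator {0<..} s * l (max 0 (s - 1 / real (Suc k)))) \<in> borel_measurable borel"
      by (intro borel_measurable_times measurable_compose[OF _ ml]) auto
  next
    fix s :: real
    show "(\<lambda>k. indicator {0<..} s * l (max 0 (s - 1 / real (Suc k)))) \<longlonglongrightarrow> h s"
    proof (cases "s > 0")
      case True
      obtain y where y: "(l \<longlongrightarrow> y) (at_left s)" using cadlag_on_at_left[OF l True] by auto
      then have Ly: "Lim (at_left s) l = y" by (intro tendsto_Lim) auto
      have "(\<lambda>k. max 0 (s - 1 / real (Suc k))) \<longlonglongrightarrow> max 0 (s - 0)"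
        by (intro tendsto_max tendsto_diff tendsto_const LIMSEQ_Suc[OF lim_inverse_n'])
      then have "filterlim (\<lambda>k. max 0 (s - 1 / real (Suc k))) (at_left s) sequentially"
        using True by (auto simp: filterlim_at max_def intro!: always_eventually)
      then have "(\<lambda>k. l (max 0 (s - 1 / real (Suc k)))) \<longlonglongrightarrow> y"
        by (rule filterlim_compose[OF y])
      then show ?thesis using True Ly by (simp add: h_def)
    qed (simp add: h_def)
  qed
  then have "(\<lambda>s. indicator {0<..} s * (if h s \<ge> x then 1 else 0 :: real)) \<in> borel_measurable borel"
    by measurable
  moreover have "(\<lambda>s. indicator {0<..} s * (if h s \<ge> x then 1 else 0 :: real)) = (\<lambda>s. indicator {0<..} s * busy l x s)"
    by (auto simp: fun_eq_iff busy_def h_def indicator_def)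
  ultimately show ?thesis by simp
qed

definition cell_incr :: "(nat \<Rightarrow> real \<Rightarrow> nat) \<Rightarrow> real \<Rightarrow> nat \<Rightarrow> nat \<Rightarrow> nat \<Rightarrow> real" where
  "cell_incr c T N i k = real (c i (grid T N (Suc k))) - real (c i (grid T N k))"

section \<open>Deterministic study of one outcome of the queue\<close>

locale queue_path =
  fixes n :: nat and c :: "nat \<Rightarrow> real \<Rightarrow> nat" and l :: "real \<Rightarrow> real"
  assumes n: "n > 0" and c: "\<And>i. counting_path (c i)" and l: "cadlag_on {0..} l"
    and eq: "\<And>t. t \<ge> 0 \<Longrightarrow>
      (\<lambda>i. stieltjes_integral (c (Suc i)) t (busy l (real (Suc i) / real n)))
        sums (real n * (real (c 0 t) / real n - l t))"
begin

definition Q :: "real \<Rightarrow> real" where "Q t = real n * l t"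

definition served :: "nat \<Rightarrow> real \<Rightarrow> real" where
  "served i t = stieltjes_integral (c (Suc i)) t (busy l (real (Suc i) / real n))"

lemma served_sums: "t \<ge> 0 \<Longrightarrow> (\<lambda>i. served i t) sums (real (c 0 t) - Q t)"
  using eq[of t] n by (simp add: served_def Q_def right_diff_distrib)

lemma served_nonneg: "0 \<le> served i t"
  unfolding served_def by (rule stieltjes_integral_nonneg[OF c busy_bounds(1)])

lemma Q_le: "t \<ge> 0 \<Longrightarrow> Q t \<le> real (c 0 t)"
  using sums_le[OF _ sums_zero served_sums] served_nonneg by (metis diff_ge_0_iff_ge)

lemma c_mono: "0 \<le> s \<Longrightarrow> s \<le> t \<Longrightarrow> c i s \<le> c i t"
  by (rule counting_path_mono[OF c])

text \<open>The queue never exceeds the number of arrivals, hence never reaches the level at which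
  clock \<open>Suc i\<close> becomes active. The series of services is therefore a finite sum, of a
  length that serves all times up to \<open>T\<close>.\<close>

lemma served_eq_0:
  assumes "t \<le> T" "c 0 T \<le> m" "m \<le> i"
  shows "served i t = 0"
  unfolding served_def
proof (rule stieltjes_integral_eq_0)
  fix s assume s: "0 < s" "s \<le> t"
  obtain y where y: "(l \<longlongrightarrow> y) (at_left s)" using cadlag_on_at_left[OF l s(1)] by auto
  have "y \<le> real (c 0 T) / real n"
  proof (rule tendsto_upperbound[OF y])
    show "\<forall>\<^sub>F u in at_left s. l u \<le> real (c 0 T) / real n"
      unfolding eventually_at_left_field
    proof (intro exI[of _ 0] conjI allI impI s(1))
      fix u assume u: "0 < u" "u < s"
      have "Q u \<le> real (c 0 u)" using Q_le u by simp
      also have "\<dots> \<le> real (c 0 T)" using c_mono[of u T 0] u s assms by simp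
      finally show "l u \<le> real (c 0 T) / real n" using n by (simp add: Q_def field_simps)
    qed
  qed simp
  also have "\<dots> < real (Suc i) / real n" using assms n by (simp add: divide_strict_right_mono)
  finally have "y < real (Suc i) / real n" .
  moreover have "Lim (at_left s) l = y" using y by (intro tendsto_Lim) auto
  ultimately show "busy l (real (Suc i) / real n) s = 0" by (simp add: busy_def)
qed

lemma Q_eq:
  assumes "0 \<le> t" "t \<le> T" "c 0 T \<le> m"
  shows "Q t = real (c 0 t) - (\<Sum>i<m. served i t)"
proof -
  have "(\<lambda>i. served i t) sums (\<Sum>i<m. served i t)"
    by (rule sums_finite) (use served_eq_0[OF assms(2,3)] in auto)
  then show ?thesis using served_sums[OF assms(1)] sums_unique2 by fastforce
qed

lemma served_increment:
  assumes "0 \<le> t'" "t' \<le> u" "u \<le> t"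
    and "\<And>v. t' \<le> v \<Longrightarrow> v < u \<Longrightarrow> c (Suc i) v = c (Suc i) t'" "c (Suc i) u = c (Suc i) t"
  shows "served i t = served i t' + (real (c (Suc i) t) - real (c (Suc i) t')) * busy l (real (Suc i) / real n) u"
  unfolding served_def
  by (rule stieltjes_integral_increment[OF c assms busy_measurable[OF l] busy_bounds])

lemma served_constant:
  assumes "0 \<le> t'" "t' \<le> t" "c (Suc i) t' = c (Suc i) t"
  shows "served i t = served i t'"
  using served_increment[of t' t' t i] assms by simp

lemma Q_constant:
  assumes t: "0 \<le> t'" "t' \<le> t" "t \<le> T" "c 0 T \<le> m" and const: "\<And>i. i \<le> m \<Longrightarrow> c i t' = c i t"
  shows "Q t = Q t'"
proof -
  have "served i t = served i t'" if "i < m" for i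
    using served_constant[OF t(1,2) const] that by simp
  then show ?thesis using Q_eq[of t T m] Q_eq[of t' T m] t const[of 0] by simp
qed

text \<open>There is no tick, one arrival, or one tick of a single service clock. In the last case
  the customer leaves exactly if the index of the clock is at most the queue length at time
  \<open>t'\<close>, which is what evaluating the active clocks at the beginning predicts.\<close>

lemma single_jump:
  assumes t: "0 \<le> t'" "t' \<le> t" "t \<le> T" and m: "c 0 T \<le> m"
    and one: "(\<Sum>i\<le>m. c i t - c i t') \<le> 1" and q: "Q t' = real q"
  shows "Q t = Q t' + (real (c 0 t) - real (c 0 t')) - (\<Sum>i\<in>{1..q}. real (c i t) - real (c i t'))"
proof (cases "\<exists>j\<le>m. c j t \<noteq> c j t'")
  case False
  have qm: "q \<le> m"
    using q Q_le[of t'] c_mono[of t' T 0] t m by simp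
  have "Q t = Q t'" by (rule Q_constant[OF t m]) (use False in auto)
  moreover have "(\<Sum>i\<in>{1..q}. real (c i t) - real (c i t')) = 0" using False qm by (intro sum.neutral) auto
  ultimately show ?thesis using False by simp
next
  case True
  have qm: "q \<le> m"
    using q Q_le[of t'] c_mono[of t' T 0] t m by simp
  obtain j where j: "j \<le> m" "c j t \<noteq> c j t'" using True by auto
  have le: "c i t' \<le> c i t" for i using c_mono t by simp
  have split: "(\<Sum>i\<le>m. c i t - c i t') = (c j t - c j t') + (\<Sum>i\<in>{..m} - {j}. c i t - c i t')"
    using j(1) by (intro sum.remove) auto
  have cj: "c j t = c j t' + 1" using split one le[of j] j(2) by linarith
  have ci: "c i t = c i t'" if "i \<le> m" "i \<noteq> j" for i
  proof -
    have "(\<Sum>i\<in>{..m} - {j}. c i t - c i t') = 0" using split one cj by linarith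
    then have "c i t - c i t' = 0" using that by simp
    then show ?thesis using le[of i] by simp
  qed
  show ?thesis
  proof (cases j)
    case 0
    have "served i t = served i t'" if "i < m" for i
      using served_constant[OF t(1,2), of i] ci[of "Suc i"] that 0 by simp
    moreover have "(\<Sum>i\<in>{1..q}. real (c i t) - real (c i t')) = 0"
      using ci qm 0 by (intro sum.neutral) auto
    ultimately show ?thesis using Q_eq[of t T m] Q_eq[of t' T m] t m by simp
  next
    case (Suc j')
    have cle: "c j t \<le> c j t' + 1" using cj by simp
    obtain u where u: "t' \<le> u" "u \<le> t" "\<And>v. t' \<le> v \<Longrightarrow> v < u \<Longrightarrow> c j v = c j t'" "c j u = c j t"
    proof (rule counting_path_jump[OF c[of j] t(1,2) cle])
      fix u assume a: "t' \<le> u" "u \<le> t" "\<And>v. t' \<le> v \<Longrightarrow> v < u \<Longrightarrow> c j v = c j t'" "c j u = c j t"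
      show thesis by (rule that[OF a])
    qed
    have ut: "t' < u" using u(1,4) cj by (cases "t' = u") auto
    have Qv: "Q v = Q t'" if v: "t' \<le> v" "v < u" for v
    proof (rule Q_constant[OF t(1) v(1) _ m])
      fix i assume i: "i \<le> m"
      show "c i t' = c i v"
      proof (cases "i = j")
        case False
        have "c i t' \<le> c i v" "c i v \<le> c i t" using c_mono t v u by auto
        then show ?thesis using ci[OF i False] by simp
      qed (use u(3)[OF v] in simp)
    qed (use v u t in simp)
    \<comment> \<open>The queue keeps its initial value until the tick, so the left limit that
      decides whether clock \<open>j\<close> is active equals \<open>l t'\<close>.\<close>
    have "(l \<longlongrightarrow> l t') (at_left u)"
    proof (rule tendsto_eventually)
      show "\<forall>\<^sub>F v in at_left u. l v = l t'"
        unfolding eventually_at_left_field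
      proof (intro exI[of _ t'] conjI allI impI ut)
        fix v assume "t' < v" "v < u"
        then show "l v = l t'" using Qv[of v] n by (simp add: Q_def)
      qed
    qed
    then have "Lim (at_left u) l = l t'" by (intro tendsto_Lim) auto
    then have busy: "busy l (real (Suc j') / real n) u = (if j \<le> q then 1 else 0)"
      using q n Suc by (auto simp: busy_def Q_def field_simps)
    have sj: "served j' t = served j' t' + (if j \<le> q then 1 else 0)"
    proof -
      have "served j' t = served j' t' + (real (c (Suc j') t) - real (c (Suc j') t')) * busy l (real (Suc j') / real n) u"
        using u(3,4) unfolding Suc by (intro served_increment[OF t(1) u(1,2)])
      then show ?thesis using cj busy Suc by simp
    qed
    have si: "served i t = served i t'" if "i < m" "i \<noteq> j'" for i
      using served_constant[OF t(1,2), of i] ci[of "Suc i"] that Suc by simp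
    have "(\<Sum>i<m. served i t) = (\<Sum>i<m. served i t') + (if j \<le> q then 1 else 0)"
    proof -
      have j': "j' \<in> {..<m}" using j(1) Suc by simp
      have "(\<Sum>i\<in>{..<m} - {j'}. served i t) = (\<Sum>i\<in>{..<m} - {j'}. served i t')"
        by (intro sum.cong) (use si in auto)
      then show ?thesis
        using sum.remove[OF _ j', of "\<lambda>i. served i t"] sum.remove[OF _ j', of "\<lambda>i. served i t'"] sj by simp
    qed
    moreover have "(\<Sum>i\<in>{1..q}. real (c i t) - real (c i t')) = (if j \<le> q then 1 else 0)"
    proof -
      have "(\<Sum>i\<in>{1..q}. real (c i t) - real (c i t')) = (\<Sum>i\<in>{1..q}. if i = j then 1 else 0)"
        using ci cj qm by (intro sum.cong) auto
      then show ?thesis using Suc by simp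
    qed
    ultimately show ?thesis using Q_eq[of t T m] Q_eq[of t' T m] t m ci[of 0] Suc by simp
  qed
qed

text \<open>With one tick in total, arrivals and departures together change the queue by at most 1.
  Being a natural number propagates from cell to cell and makes the floor in the Euler scheme
  exact.\<close>

lemma single_jump_bounds:
  assumes t: "0 \<le> t'" "t' \<le> t" "t \<le> T" and m: "c 0 T \<le> m"
    and one: "(\<Sum>i\<le>m. c i t - c i t') \<le> 1" and q: "Q t' = real q"
  shows "\<bar>Q t - Q t'\<bar> \<le> 1" "\<exists>q'. Q t = real q'"
proof -
  define D0 D where "D0 = c 0 t - c 0 t'" and "D = (\<Sum>i\<in>{1..q}. c i t - c i t')"
  have le: "c i t' \<le> c i t" for i using c_mono t by simp
  have qm: "q \<le> m"
    using q Q_le[of t'] c_mono[of t' T 0] t m by simp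
  have "{..m} = insert 0 {1..m}" by auto
  then have "(\<Sum>i\<le>m. c i t - c i t') = D0 + (\<Sum>i\<in>{1..m}. c i t - c i t')" by (simp add: D0_def)
  moreover have "D \<le> (\<Sum>i\<in>{1..m}. c i t - c i t')"
    unfolding D_def using qm by (intro sum_mono2) auto
  ultimately have D: "D0 + D \<le> 1" using one by linarith
  \<comment> \<open>If the queue is empty the sum defining \<open>D\<close> is empty too; otherwise
    \<open>D\<close> is at most 1. So the new length cannot become negative.\<close>
  have "D \<le> q" using D by (cases q) (auto simp: D_def)
  have Qt: "Q t = real q + real D0 - real D"
    using single_jump[OF assms] le unfolding q by (simp add: D0_def D_def of_nat_diff)
  show "\<bar>Q t - Q t'\<bar> \<le> 1" using Qt q D by (simp add: abs_le_iff)
  show "\<exists>q'. Q t = real q'"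
    using Qt \<open>D \<le> q\<close> by (intro exI[of _ "q + D0 - D"]) (simp add: of_nat_diff)
qed

lemma Q_0: "Q 0 = 0"
proof -
  have "served i 0 = 0" for i by (simp add: served_def stieltjes_integral_0[OF c])
  moreover have "c 0 0 = 0" using c[of 0] by (simp add: counting_path_def)
  ultimately show ?thesis using served_sums[of 0] sums_unique2[OF sums_zero] by fastforce
qed

context
  fixes T :: real and N m :: nat
  assumes T: "T > 0" and N: "N > 0" and m: "c 0 T \<le> m"
    and good: "\<And>k. k < N \<Longrightarrow> (\<Sum>i\<le>m. cell_incr c T N i k) \<le> 1"
begin

lemma good_sub:
  assumes "k < N" "grid T N k \<le> t'" "t' \<le> t" "t \<le> grid T N (Suc k)"
  shows "(\<Sum>i\<le>m. c i t - c i t') \<le> 1"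
proof -
  have g: "0 \<le> grid T N k" using T by (rule grid_nonneg)
  have "real (\<Sum>i\<le>m. c i t - c i t') \<le> (\<Sum>i\<le>m. cell_incr c T N i k)"
    unfolding of_nat_sum
  proof (rule sum_mono)
    fix i
    have "c i (grid T N k) \<le> c i t'" "c i t' \<le> c i t" "c i t \<le> c i (grid T N (Suc k))"
      using c_mono assms g by auto
    then show "real (c i t - c i t') \<le> cell_incr c T N i k" by (simp add: cell_incr_def of_nat_diff)
  qed
  also have "\<dots> \<le> 1" by (rule good[OF assms(1)])
  finally show ?thesis by (metis of_nat_1 of_nat_le_iff)
qed

lemma Q_grid_nat: "k \<le> N \<Longrightarrow> \<exists>q. Q (grid T N k) = real q"
proof (induction k)
  case (Suc k)
  then obtain q where q: "Q (grid T N k) = real q" by auto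
  show ?case
    by (rule single_jump_bounds(2)[OF grid_nonneg[OF T] grid_mono[OF T] grid_le[OF T Suc.prems] m _ q])
       (use Suc.prems good_sub[of k "grid T N k" "grid T N (Suc k)"] grid_mono[OF T, of k "Suc k" N] in auto)
qed (use Q_0 in \<open>auto intro: exI[of _ 0]\<close>)

text \<open>Induction over the cells: each step is \<open>single_jump\<close>, whose
  \<open>q\<close> is the floor used by \<open>euler\<close> because the queue length is a natural
  number.\<close>

lemma Q_grid_euler: "k \<le> N \<Longrightarrow> Q (grid T N k) = euler (cell_incr c T N) k"
proof (induction k)
  case (Suc k)
  then obtain q where q: "Q (grid T N k) = real q" using Q_grid_nat[of k] by auto
  have "(\<Sum>i\<le>m. c i (grid T N (Suc k)) - c i (grid T N k)) \<le> 1"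
    using Suc.prems by (intro good_sub[of k]) (auto intro: grid_mono[OF T])
  then have "Q (grid T N (Suc k)) = Q (grid T N k) + cell_incr c T N 0 k - (\<Sum>i\<in>{1..q}. cell_incr c T N i k)"
    unfolding cell_incr_def using single_jump[OF grid_nonneg[OF T] grid_mono[OF T] grid_le[OF T Suc.prems] m _ q] by simp
  moreover have "Q (grid T N k) = euler (cell_incr c T N) k" using Suc by simp
  moreover from this have "q = nat \<lfloor>euler (cell_incr c T N) k\<rfloor>" using q by (metis floor_of_nat nat_int)
  ultimately show ?case by simp
qed (simp add: Q_0)

lemma active_grid: "k \<le> N \<Longrightarrow> real (nat \<lfloor>euler (cell_incr c T N) k\<rfloor>) = Q (grid T N k)"
  using Q_grid_nat[of k] Q_grid_euler[of k] by (metis floor_of_nat nat_int)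

text \<open>Since the scheme agrees with the queue at the grid points, its noise is the discrete
  counterpart of the increment of the compensated queue.\<close>

lemma noise_grid:
  assumes "k < N"
  shows "noise a b (cell_incr c T N) k = Q (grid T N (Suc k)) - Q (grid T N k) - a + b * Q (grid T N k)"
proof -
  have "Q (grid T N (Suc k)) = euler (cell_incr c T N) (Suc k)" "Q (grid T N k) = euler (cell_incr c T N) k"
    using assms Q_grid_euler by auto
  moreover have "real (nat \<lfloor>euler (cell_incr c T N) k\<rfloor>) = euler (cell_incr c T N) k"
    using active_grid[of k] Q_grid_euler[of k] assms by simp
  ultimately show ?thesis by (simp add: noise_def sum_subtractf)
qed

lemma Q_cell:
  assumes k: "k < N" and t: "grid T N k \<le> t" "t \<le> grid T N (Suc k)"
  shows "\<bar>Q t - Q (grid T N k)\<bar> \<le> 1" "\<bar>Q t - Q (grid T N (Suc k))\<bar> \<le> 1" "0 \<le> Q t"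
proof -
  obtain q where q: "Q (grid T N k) = real q" using Q_grid_nat[of k] k by auto
  have g: "0 \<le> grid T N k" "grid T N (Suc k) \<le> T" using T k by (auto intro: grid_nonneg grid_le)
  note sj = single_jump_bounds[OF g(1) t(1) order_trans[OF t(2) g(2)] m good_sub[OF k order_refl t] q]
  show "\<bar>Q t - Q (grid T N k)\<bar> \<le> 1" by (rule sj)
  obtain q' where q': "Q t = real q'" using sj(2) by auto
  show "0 \<le> Q t" using q' by simp
  have t0: "0 \<le> t" using g t by simp
  show "\<bar>Q t - Q (grid T N (Suc k))\<bar> \<le> 1"
    using single_jump_bounds(1)[OF t0 t(2) g(2) m good_sub[OF k t(1,2) order_refl] q'] by (simp add: abs_minus_commute)
qed

lemma Q_bounds: "t \<in> {0..T} \<Longrightarrow> 0 \<le> Q t \<and> Q t \<le> real m"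
proof -
  assume t: "t \<in> {0..T}"
  obtain j where "j < N" "grid T N j \<le> t" "t \<le> grid T N (Suc j)" by (rule grid_cell[OF T N t])
  then have "0 \<le> Q t" using Q_cell(3) by auto
  moreover have "Q t \<le> real (c 0 t)" using Q_le t by simp
  moreover have "c 0 t \<le> m" using c_mono[of t T 0] t m by simp
  ultimately show ?thesis by simp
qed

end

end

section \<open>Discretization error along a fixed path\<close>

lemma exp_minus_quadratic: "0 \<le> x \<Longrightarrow> 0 \<le> exp (- x) - 1 + x \<and> exp (- x) - 1 + x \<le> x\<^sup>2" for x :: real
proof -
  assume x: "0 \<le> x"
  have "exp (- x) = inverse (exp x)" by (rule exp_minus)
  also have "\<dots> \<le> inverse (1 + x)" using x by (intro le_imp_inverse_le) (auto simp: exp_ge_add_one_self)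
  also have "\<dots> \<le> 1 - x + x\<^sup>2"
  proof -
    have "1 \<le> (1 - x + x\<^sup>2) * (1 + x)" using x by (simp add: algebra_simps power2_eq_square)
    then show ?thesis using x by (simp add: field_simps)
  qed
  finally show ?thesis using exp_ge_add_one_self[of "- x"] by simp
qed

lemma exp_minus_one_le: "\<bar>x\<bar> \<le> d \<Longrightarrow> \<bar>1 - exp x\<bar> \<le> d * exp d" for x d :: real
proof -
  assume xd: "\<bar>x\<bar> \<le> d"
  have "\<bar>exp x - 1\<bar> \<le> exp \<bar>x\<bar> - 1"
    using exp_ge_add_one_self[of x] exp_ge_add_one_self[of "- x"] zero_le_power2[of "exp x - 1"]
    by (cases "x \<ge> 0") (auto simp: abs_if exp_minus field_simps power2_eq_square)
  also have "exp \<bar>x\<bar> - 1 \<le> \<bar>x\<bar> * exp \<bar>x\<bar>"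
    using exp_ge_add_one_self[of "- \<bar>x\<bar>"] by (simp add: exp_minus field_simps)
  also have "\<dots> \<le> d * exp d" using xd by (intro mult_mono) auto
  finally show ?thesis by (simp add: abs_minus_commute)
qed

lemma fluid_limit_bounds:
  assumes "lam > 0" "\<mu> > 0" "0 \<le> t"
  shows "0 \<le> fluid_limit lam \<mu> t" "fluid_limit lam \<mu> t \<le> lam / \<mu>"
  using assms by (auto simp: fluid_limit_def Let_def divide_right_mono mult_left_le)

lemma fluid_limit_lipschitz:
  assumes "lam > 0" "\<mu> > 0" "0 \<le> s" "0 \<le> t"
  shows "\<bar>fluid_limit lam \<mu> t - fluid_limit lam \<mu> s\<bar> \<le> lam * \<bar>t - s\<bar>"
proof -
  have main: "\<bar>fluid_limit lam \<mu> t - fluid_limit lam \<mu> s\<bar> \<le> lam * \<bar>t - s\<bar>" if "0 \<le> s" "s \<le> t" for s t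
  proof -
    have "fluid_limit lam \<mu> t - fluid_limit lam \<mu> s = lam / \<mu> * (exp (- \<mu> * s) * (1 - exp (- \<mu> * (t - s))))"
      by (simp add: fluid_limit_def Let_def algebra_simps flip: exp_add)
    moreover have "0 \<le> 1 - exp (- \<mu> * (t - s))" "1 - exp (- \<mu> * (t - s)) \<le> \<mu> * (t - s)"
      using assms that exp_ge_add_one_self[of "- \<mu> * (t - s)"] by (auto simp: mult_nonneg_nonneg)
    moreover have "exp (- \<mu> * s) \<le> 1" using assms that by simp
    ultimately have *: "fluid_limit lam \<mu> t - fluid_limit lam \<mu> s = lam / \<mu> * (exp (- \<mu> * s) * (1 - exp (- \<mu> * (t - s))))"
      "0 \<le> exp (- \<mu> * s) * (1 - exp (- \<mu> * (t - s)))"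
      "exp (- \<mu> * s) * (1 - exp (- \<mu> * (t - s))) \<le> 1 * (\<mu> * (t - s))"
      by (blast, simp, intro mult_mono) auto
    have "lam / \<mu> * (exp (- \<mu> * s) * (1 - exp (- \<mu> * (t - s)))) \<le> lam / \<mu> * (1 * (\<mu> * (t - s)))"
      using *(3) assms by (intro mult_left_mono) auto
    moreover have "0 \<le> lam / \<mu> * (exp (- \<mu> * s) * (1 - exp (- \<mu> * (t - s))))"
      using assms by (intro mult_nonneg_nonneg[OF _ *(2)]) simp
    ultimately have "0 \<le> fluid_limit lam \<mu> t - fluid_limit lam \<mu> s"
      "fluid_limit lam \<mu> t - fluid_limit lam \<mu> s \<le> lam / \<mu> * (1 * (\<mu> * (t - s)))"
      unfolding *(1) by auto
    then show ?thesis using assms that by simp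
  qed
  show ?thesis
    using main[of s t] main[of t s] assms by (cases "s \<le> t") (auto simp: abs_minus_commute)
qed

text \<open>Discrete variation of constants. The increment of
  \<open>exp (\<mu> t) * (Q t - n * fluid limit)\<close> over one cell differs from the weighted
  noise by a multiple of \<open>exp (- \<eta>) - 1 + \<eta>\<close> with
  \<open>\<eta> = \<mu> * \<delta>\<close>. This is quadratic in the cell length, so the sum over
  all cells is only linear in \<open>\<delta>\<close>.\<close>

lemma scheme_path_close:
  fixes lam \<mu> T n M0 :: real and N :: nat and Q :: "real \<Rightarrow> real" and \<xi> :: "nat \<Rightarrow> real"
  defines "\<rho> \<equiv> lam / \<mu>" and "K \<equiv> exp (\<mu> * T)" and "\<delta> \<equiv> T / real N"
  defines "C1 \<equiv> exp (\<mu> * T) * \<mu>\<^sup>2 * T * (M0 + n * (lam / \<mu>))"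
  assumes pos: "lam > 0" "\<mu> > 0" "T > 0" "n > 0" "N > 0"
    and Q: "\<And>t. t \<in> {0..T} \<Longrightarrow> 0 \<le> Q t \<and> Q t \<le> M0" "Q 0 = 0"
    and cell: "\<And>k t. k < N \<Longrightarrow> grid T N k \<le> t \<Longrightarrow> t \<le> grid T N (Suc k) \<Longrightarrow>
      \<bar>Q t - Q (grid T N k)\<bar> \<le> 1 \<and> \<bar>Q t - Q (grid T N (Suc k))\<bar> \<le> 1"
    and \<xi>: "\<And>k. k < N \<Longrightarrow> \<xi> k = Q (grid T N (Suc k)) - Q (grid T N k) - lam * n * \<delta> + \<mu> * \<delta> * Q (grid T N k)"
  shows "k \<le> N \<Longrightarrow> \<bar>(\<Sum>j<k. exp (\<mu> * grid T N (Suc j)) * \<xi> j)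
      - exp (\<mu> * grid T N k) * (Q (grid T N k) - n * fluid_limit lam \<mu> (grid T N k))\<bar> \<le> C1 * \<delta>"
    and "t \<in> {0..T} \<Longrightarrow> \<bar>(Q t - n * fluid_limit lam \<mu> t)
      - ipath \<mu> T N (\<lambda>j. exp (\<mu> * grid T N (Suc j)) * \<xi> j) t\<bar>
        \<le> 1 + (n * lam + \<mu> * K * (M0 + n * \<rho>) + C1) * \<delta>"
proof -
  define \<eta> where "\<eta> = \<mu> * \<delta>"
  define G where "G t = exp (\<mu> * t) * (Q t - n * fluid_limit lam \<mu> t)" for t
  define S where "S k = (\<Sum>j<k. exp (\<mu> * grid T N (Suc j)) * \<xi> j)" for k
  have \<delta>: "\<delta> > 0" "real N * \<delta> = T" "\<delta> \<le> T" using pos by (auto simp: \<delta>_def field_simps)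
  have \<rho>: "\<rho> > 0" "\<mu> * \<rho> = lam" using pos by (auto simp: \<rho>_def)
  have M0: "M0 \<ge> 0" using Q(1)[of 0] pos by auto
  have gs: "grid T N (Suc k) = grid T N k + \<delta>" for k by (simp add: grid_Suc \<delta>_def)
  have wK: "exp (\<mu> * grid T N k) \<le> K" if "k \<le> N" for k
    unfolding K_def using grid_le[OF pos(3) that] pos by simp
  have incr: "\<bar>exp (\<mu> * grid T N (Suc k)) * \<xi> k - (G (grid T N (Suc k)) - G (grid T N k))\<bar> \<le> K * \<eta>\<^sup>2 * (M0 + n * \<rho>)"
    if k: "k < N" for k
  proof -
    let ?t = "grid T N k"
    have e1: "exp (\<mu> * (?t + \<delta>)) = exp (\<mu> * ?t) * exp \<eta>" "exp (- \<mu> * (?t + \<delta>)) = exp (- \<mu> * ?t) * exp (- \<eta>)"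
      by (simp_all add: \<eta>_def algebra_simps flip: exp_add)
    have fl: "fluid_limit lam \<mu> (?t + \<delta>) = \<rho> - \<rho> * exp (- \<mu> * ?t) * exp (- \<eta>)"
      "fluid_limit lam \<mu> ?t = \<rho> - \<rho> * exp (- \<mu> * ?t)"
      using e1(2) by (simp_all add: fluid_limit_def Let_def \<rho>_def)
    have lam: "lam * n * \<delta> = n * \<rho> * \<eta>" using \<rho> by (simp add: \<eta>_def algebra_simps)
    have ee: "exp \<eta> * exp (- \<eta>) = 1" by (simp flip: exp_add)
    \<comment> \<open>The exponentials are abbreviated by letters so that the algebra uses nothing
      about them but \<open>e * f = 1\<close>.\<close>
    define x y e f q q' where "x = exp (\<mu> * ?t)" and "y = exp (- \<mu> * ?t)" and "e = exp \<eta>" and "f = exp (- \<eta>)"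
      and "q = Q ?t" and "q' = Q (?t + \<delta>)"
    have ef: "e * f = 1" using ee by (simp add: e_def f_def)
    have "exp (\<mu> * grid T N (Suc k)) * \<xi> k - (G (grid T N (Suc k)) - G ?t)
        = x * e * (q' - q - n * \<rho> * \<eta> + \<eta> * q) - (x * e * (q' - n * (\<rho> - \<rho> * y * f)) - x * (q - n * (\<rho> - \<rho> * y)))"
      unfolding \<xi>[OF k] gs G_def fl e1 lam x_def[symmetric] y_def[symmetric] e_def[symmetric] f_def[symmetric] q_def[symmetric] q'_def[symmetric]
      by (simp add: \<eta>_def)
    also have "\<dots> = x * e * (\<eta> * q - q - n * \<rho> * \<eta> + n * \<rho>) + x * (q - n * \<rho>) + (x * n * \<rho> * y - x * n * \<rho> * y * (e * f))"
      by (simp add: algebra_simps)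
    also have "\<dots> = x * e * (\<eta> * q - q - n * \<rho> * \<eta> + n * \<rho>) + x * (e * f) * (q - n * \<rho>)"
      unfolding ef by simp
    also have "\<dots> = (x * e) * (f - 1 + \<eta>) * (q - n * \<rho>)" by (simp add: algebra_simps)
    finally have eq: "exp (\<mu> * grid T N (Suc k)) * \<xi> k - (G (grid T N (Suc k)) - G ?t) = (x * e) * (f - 1 + \<eta>) * (q - n * \<rho>)" .
    have xe: "0 \<le> x * e" "x * e \<le> K" using wK[of "Suc k"] k e1(1) gs[of k] by (auto simp: x_def e_def)
    have f: "0 \<le> f - 1 + \<eta>" "f - 1 + \<eta> \<le> \<eta>\<^sup>2" unfolding f_def using exp_minus_quadratic[of \<eta>] \<delta> pos by (auto simp: \<eta>_def)
    have q: "\<bar>q - n * \<rho>\<bar> \<le> M0 + n * \<rho>"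
    proof -
      have "0 \<le> q \<and> q \<le> M0" unfolding q_def
        using Q(1)[of ?t] grid_nonneg[OF pos(3)] grid_le[OF pos(3), of k N] k by auto
      moreover have "0 \<le> n * \<rho>" using pos \<rho> by simp
      ultimately show ?thesis by linarith
    qed
    have "\<bar>(x * e) * (f - 1 + \<eta>) * (q - n * \<rho>)\<bar> = (x * e) * (f - 1 + \<eta>) * \<bar>q - n * \<rho>\<bar>"
      by (simp only: abs_mult[of "(x * e) * (f - 1 + \<eta>)"] abs_of_nonneg[OF mult_nonneg_nonneg[OF xe(1) f(1)]])
    also have "\<dots> \<le> K * \<eta>\<^sup>2 * (M0 + n * \<rho>)"
      using xe f q by (intro mult_mono) auto
    finally show ?thesis unfolding eq .
  qed
  have G0: "G 0 = 0" using Q(2) by (simp add: G_def fluid_limit_def)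
  have SG: "\<bar>S k - G (grid T N k)\<bar> \<le> C1 * \<delta>" if k: "k \<le> N" for k
  proof -
    have "G (grid T N k) = (\<Sum>j<k. G (grid T N (Suc j)) - G (grid T N j))"
      using sum_lessThan_telescope[of "\<lambda>j. G (grid T N j)" k] G0 by simp
    then have "\<bar>S k - G (grid T N k)\<bar> = \<bar>\<Sum>j<k. exp (\<mu> * grid T N (Suc j)) * \<xi> j - (G (grid T N (Suc j)) - G (grid T N j))\<bar>"
      by (simp add: S_def sum_subtractf)
    also have "\<dots> \<le> (\<Sum>j<k. K * \<eta>\<^sup>2 * (M0 + n * \<rho>))"
      by (rule order_trans[OF sum_abs sum_mono]) (use incr k in auto)
    also have "\<dots> \<le> real N * (K * \<eta>\<^sup>2 * (M0 + n * \<rho>))"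
      using k M0 pos \<rho> by (auto simp: K_def intro!: mult_right_mono mult_nonneg_nonneg)
    also have "\<dots> = (real N * \<delta>) * (K * \<mu>\<^sup>2 * (M0 + n * \<rho>)) * \<delta>" by (simp add: \<eta>_def power2_eq_square)
    also have "\<dots> = C1 * \<delta>" unfolding \<delta>(2) C1_def K_def \<rho>_def by (simp add: mult_ac)
    finally show ?thesis .
  qed
  then show "k \<le> N \<Longrightarrow> \<bar>(\<Sum>j<k. exp (\<mu> * grid T N (Suc j)) * \<xi> j)
      - exp (\<mu> * grid T N k) * (Q (grid T N k) - n * fluid_limit lam \<mu> (grid T N k))\<bar> \<le> C1 * \<delta>"
    unfolding S_def G_def .
  assume t: "t \<in> {0..T}"
  have C1: "0 \<le> C1 * \<delta>" using SG[of 0] by simp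
  \<comment> \<open>Three contributions: the motion of the queue (at most 1) and of the fluid limit
    between \<open>t\<close> and the grid point, the change of the exponential factor, and the
    accumulated error of the scheme. Only the jump of size 1 does not vanish with the mesh.\<close>
  have main: "\<bar>(Q t - n * fluid_limit lam \<mu> t) - exp (- \<mu> * t) * S k\<bar>
      \<le> 1 + (n * lam + \<mu> * K * (M0 + n * \<rho>) + C1) * \<delta>"
    if k: "k \<le> N" and near: "\<bar>t - grid T N k\<bar> \<le> \<delta>" "\<bar>Q t - Q (grid T N k)\<bar> \<le> 1" for k
  proof -
    let ?s = "grid T N k"
    define g where "g = Q ?s - n * fluid_limit lam \<mu> ?s"
    have s: "0 \<le> ?s" "?s \<le> T" using grid_nonneg[OF pos(3)] grid_le[OF pos(3) k] by auto
    have fb: "0 \<le> fluid_limit lam \<mu> ?s" "fluid_limit lam \<mu> ?s \<le> \<rho>"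
      unfolding \<rho>_def using fluid_limit_bounds[OF pos(1,2) s(1)] by auto
    have "0 \<le> n * fluid_limit lam \<mu> ?s" "n * fluid_limit lam \<mu> ?s \<le> n * \<rho>"
      using fb pos by (auto intro: mult_left_mono)
    then have gb: "\<bar>g\<bar> \<le> M0 + n * \<rho>" using Q(1)[of ?s] s M0 by (auto simp: g_def abs_le_iff)
    have a1: "\<bar>(Q t - n * fluid_limit lam \<mu> t) - g\<bar> \<le> 1 + n * lam * \<delta>"
    proof -
      have "\<bar>n * fluid_limit lam \<mu> t - n * fluid_limit lam \<mu> ?s\<bar> = n * \<bar>fluid_limit lam \<mu> t - fluid_limit lam \<mu> ?s\<bar>"
        using pos by (simp add: abs_mult flip: right_diff_distrib)
      also have "\<dots> \<le> n * (lam * \<bar>t - ?s\<bar>)"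
        using fluid_limit_lipschitz[OF pos(1,2) s(1), of t] t pos by (intro mult_left_mono) auto
      also have "\<dots> \<le> n * (lam * \<delta>)" using near(1) pos by (intro mult_left_mono) auto
      finally show ?thesis using near(2) unfolding g_def by (simp add: mult.assoc)
    qed
    have a2: "\<bar>g - exp (- \<mu> * t) * G ?s\<bar> \<le> \<mu> * K * (M0 + n * \<rho>) * \<delta>"
    proof -
      have "exp (- \<mu> * t) * G ?s = exp (\<mu> * (?s - t)) * g"
        by (simp add: G_def g_def algebra_simps flip: exp_add)
      then have "\<bar>g - exp (- \<mu> * t) * G ?s\<bar> = \<bar>1 - exp (\<mu> * (?s - t))\<bar> * \<bar>g\<bar>"
        by (simp flip: abs_mult) (simp add: algebra_simps)
      also have "\<dots> \<le> ((\<mu> * \<delta>) * exp (\<mu> * \<delta>)) * (M0 + n * \<rho>)"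
      proof (intro mult_mono exp_minus_one_le gb)
        show "\<bar>\<mu> * (?s - t)\<bar> \<le> \<mu> * \<delta>" using near(1) pos by (simp add: abs_mult abs_minus_commute)
      qed (use \<delta> pos in auto)
      also have "\<dots> \<le> ((\<mu> * \<delta>) * K) * (M0 + n * \<rho>)"
        using \<delta> pos M0 \<rho> by (intro mult_right_mono mult_left_mono) (auto simp: K_def)
      finally show ?thesis by (simp add: mult_ac)
    qed
    have a3: "\<bar>exp (- \<mu> * t) * G ?s - exp (- \<mu> * t) * S k\<bar> \<le> C1 * \<delta>"
    proof -
      have "\<bar>exp (- \<mu> * t) * G ?s - exp (- \<mu> * t) * S k\<bar> = exp (- \<mu> * t) * \<bar>S k - G ?s\<bar>"
        by (simp add: abs_mult abs_minus_commute flip: right_diff_distrib)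
      also have "\<dots> \<le> 1 * (C1 * \<delta>)"
        using SG[OF k] C1 t pos by (intro mult_mono) auto
      finally show ?thesis by simp
    qed
    have "\<bar>(Q t - n * fluid_limit lam \<mu> t) - exp (- \<mu> * t) * S k\<bar>
        \<le> (1 + n * lam * \<delta>) + \<mu> * K * (M0 + n * \<rho>) * \<delta> + C1 * \<delta>"
      using a1 a2 a3 by linarith
    then show ?thesis by (simp add: algebra_simps)
  qed
  show "\<bar>(Q t - n * fluid_limit lam \<mu> t) - ipath \<mu> T N (\<lambda>j. exp (\<mu> * grid T N (Suc j)) * \<xi> j) t\<bar>
        \<le> 1 + (n * lam + \<mu> * K * (M0 + n * \<rho>) + C1) * \<delta>"
  proof (rule ipath_close[OF pos(3,5) t])
    fix j assume j: "j < N" "grid T N j \<le> t" "t \<le> grid T N (Suc j)"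
    show "\<bar>Q t - n * fluid_limit lam \<mu> t - exp (- \<mu> * t) * (\<Sum>k<j. exp (\<mu> * grid T N (Suc k)) * \<xi> k)\<bar>
          \<le> 1 + (n * lam + \<mu> * K * (M0 + n * \<rho>) + C1) * \<delta> \<and>
        \<bar>Q t - n * fluid_limit lam \<mu> t - exp (- \<mu> * t) * (\<Sum>k<Suc j. exp (\<mu> * grid T N (Suc k)) * \<xi> k)\<bar>
          \<le> 1 + (n * lam + \<mu> * K * (M0 + n * \<rho>) + C1) * \<delta>"
      using main[of j] main[of "Suc j"] cell[OF j] j gs[of j] unfolding S_def by auto
  qed
qed


section \<open>The queue on dyadic grids\<close>

lemma poisson_like_cong_AE:
  assumes "AE \<omega> in M. X \<omega> = Y \<omega>" "Y \<in> borel_measurable M" "poisson_like M v X"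
  shows "poisson_like M v Y"
proof -
  have [measurable]: "X \<in> borel_measurable M" "Y \<in> borel_measurable M"
    using assms by (auto simp: poisson_like_def)
  have ae: "AE \<omega> in M. X \<omega> ^ j = Y \<omega> ^ j" for j using assms(1) by eventually_elim simp
  have "(\<integral>\<omega>. X \<omega> ^ j \<partial>M) = (\<integral>\<omega>. Y \<omega> ^ j \<partial>M)" for j by (rule integral_cong_AE) (use ae in auto)
  from this[of 1] this[of 2] this[of 4] integrable_cong_AE[of "\<lambda>\<omega>. X \<omega> ^ 4" M "\<lambda>\<omega>. Y \<omega> ^ 4"] ae
  show ?thesis using assms(2,3) by (simp add: poisson_like_def)
qed

locale queue_on_interval = rescaled_queue M lam \<mu> n A S L
  for M :: "'a measure" and lam \<mu> :: real and n :: nat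
    and A :: "real \<Rightarrow> 'a \<Rightarrow> nat" and S :: "nat \<Rightarrow> real \<Rightarrow> 'a \<Rightarrow> nat" and L :: "real \<Rightarrow> 'a \<Rightarrow> real" +
  fixes T :: real
  assumes pos: "lam > 0" "\<mu> > 0" "n > 0" "T > 0"
begin

definition clock :: "nat \<Rightarrow> real \<Rightarrow> 'a \<Rightarrow> nat" where
  "clock i = (if i = 0 then A else S i)"

definition rate :: "nat \<Rightarrow> real" where
  "rate i = (if i = 0 then lam * real n else \<mu>)"

lemma rate_pos: "rate i > 0" using pos by (simp add: rate_def)

lemma clock_poisson: "poisson_process M (rate i) (clock i)"
  using arrivals services[of i] by (auto simp: clock_def rate_def)

lemma clock_measurable: "0 \<le> t \<Longrightarrow> clock i t \<in> measurable M (count_space UNIV)"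
  using poisson_process.measurable_N[OF clock_poisson] .

lemma AE_counting: "AE \<omega> in M. \<forall>i. counting_path (\<lambda>t. clock i t \<omega>)"
  unfolding AE_all_countable counting_path_def
  using poisson_process.counting_paths[OF clock_poisson] by simp

lemma AE_queue_path: "AE \<omega> in M. queue_path n (\<lambda>i t. clock i t \<omega>) (\<lambda>t. L t \<omega>)"
  using AE_counting equation AE_space
proof eventually_elim
  case (elim \<omega>)
  show ?case
    by unfold_locales (use elim pos cadlag_L[of \<omega>] in \<open>auto simp: busy_def clock_def\<close>)
qed

definition inc :: "nat \<Rightarrow> 'a \<Rightarrow> nat \<Rightarrow> nat \<Rightarrow> real" where
  "inc N \<omega> = cell_incr (\<lambda>i t. clock i t \<omega>) T N"

lemma inc_eq: "inc N \<omega> i k = real (clock i (grid T N (Suc k)) \<omega>) - real (clock i (grid T N k) \<omega>)"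
  by (simp add: inc_def cell_incr_def)

lemma clock_measurable_real: "0 \<le> t \<Longrightarrow> (\<lambda>\<omega>. real (clock i t \<omega>)) \<in> borel_measurable M"
  by (rule measurable_compose[OF clock_measurable]) auto

lemma inc_measurable: "(\<lambda>\<omega>. inc N \<omega> i k) \<in> borel_measurable M"
  unfolding inc_eq using clock_measurable_real grid_nonneg pos by (intro borel_measurable_diff) auto

text \<open>Between the clocks, independence of the processes is pushed through the evaluation at
  the grid points; within one clock it is independence of increments.\<close>

lemma inc_indep: "indep_vars (\<lambda>_. borel) (\<lambda>(i, k) \<omega>. inc N \<omega> i k) (UNIV \<times> {..<N})"
proof (rule indep_vars_nested[where J="\<lambda>_. {..<N}" and N="\<lambda>_. borel"
      and X="\<lambda>(i, k) \<omega>. inc N \<omega> i k", simplified])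
  fix i
  interpret C: poisson_process M "rate i" "clock i" by (rule clock_poisson)
  have "mono (grid T N)" using grid_mono pos by (auto simp: mono_def)
  then show "indep_vars (\<lambda>_. borel) (\<lambda>k \<omega>. inc N \<omega> i k) {..<N}"
    using C.indep_increments_N unfolding indep_increments_def inc_eq by simp
next
  define Y where "Y f = (\<lambda>k\<in>{..<N}. real (f (grid T N (Suc k))) - real (f (grid T N k)))" for f :: "real \<Rightarrow> nat"
  have g: "grid T N k \<in> {0..}" for k using grid_nonneg pos by auto
  have "Y \<in> measurable (PiM {0..} (\<lambda>_. count_space UNIV)) (PiM {..<N} (\<lambda>_. borel))"
    unfolding Y_def
  proof (rule measurable_restrict)
    fix k
    have "(\<lambda>f. real (f (grid T N k))) \<in> borel_measurable (PiM {0..} (\<lambda>_. count_space UNIV))" for k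
      by (rule measurable_compose[OF measurable_component_singleton[OF g]]) auto
    then show "(\<lambda>f. real (f (grid T N (Suc k))) - real (f (grid T N k))) \<in> borel_measurable (PiM {0..} (\<lambda>_. count_space UNIV))"
      by (intro borel_measurable_diff)
  qed
  then have "indep_vars (\<lambda>_. PiM {..<N} (\<lambda>_. borel)) (\<lambda>i \<omega>. Y (\<lambda>t\<in>{0..}. (if i = 0 then A else S i) t \<omega>)) UNIV"
    by (intro indep_vars_compose2[OF independence])
  moreover have "Y (\<lambda>t\<in>{0..}. (if i = 0 then A else S i) t \<omega>) = (\<lambda>k\<in>{..<N}. inc N \<omega> i k)" for i \<omega>
    unfolding Y_def inc_eq clock_def using g by (intro restrict_ext) auto
  ultimately show "indep_vars (\<lambda>i. PiM {..<N} (\<lambda>_. borel)) (\<lambda>i \<omega>. \<lambda>k\<in>{..<N}. inc N \<omega> i k) UNIV"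
    by simp
qed

text \<open>The Poisson law is assumed for a difference of natural numbers, which is truncated at 0.
  Almost sure monotonicity identifies it with the real difference used everywhere else.\<close>

lemma clock_increment_law:
  assumes "0 \<le> s" "s < t"
  shows "(\<lambda>\<omega>. clock i t \<omega> - clock i s \<omega>) \<in> measurable M (count_space UNIV)"
    "distr M (count_space UNIV) (\<lambda>\<omega>. clock i t \<omega> - clock i s \<omega>) = measure_pmf (poisson_pmf (rate i * (t - s)))"
    "AE \<omega> in M. real (clock i t \<omega> - clock i s \<omega>) = real (clock i t \<omega>) - real (clock i s \<omega>)"
proof -
  have "clock i t \<in> measurable M (count_space UNIV)" "clock i s \<in> measurable M (count_space UNIV)"
    using clock_measurable assms by auto
  then show "(\<lambda>\<omega>. clock i t \<omega> - clock i s \<omega>) \<in> measurable M (count_space UNIV)" by measurable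
  show "distr M (count_space UNIV) (\<lambda>\<omega>. clock i t \<omega> - clock i s \<omega>) = measure_pmf (poisson_pmf (rate i * (t - s)))"
    by (rule poisson_process.poisson_increments[OF clock_poisson assms])
  show "AE \<omega> in M. real (clock i t \<omega> - clock i s \<omega>) = real (clock i t \<omega>) - real (clock i s \<omega>)"
    using AE_counting
  proof eventually_elim
    case (elim \<omega>)
    then have "clock i s \<omega> \<le> clock i t \<omega>" using counting_path_mono assms by (meson less_imp_le)
    then show ?case by (simp add: of_nat_diff)
  qed
qed

lemma clock_increment_poisson_like:
  assumes "0 \<le> s" "s < t"
  shows "poisson_like M (rate i * (t - s)) (\<lambda>\<omega>. (real (clock i t \<omega>) - real (clock i s \<omega>)) - rate i * (t - s))"
proof (rule poisson_like_cong_AE)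
  show "poisson_like M (rate i * (t - s)) (\<lambda>\<omega>. real (clock i t \<omega> - clock i s \<omega>) - rate i * (t - s))"
    by (rule poisson_like_centred_poisson[OF clock_increment_law(1,2)]) (use assms rate_pos in auto)
  show "AE \<omega> in M. real (clock i t \<omega> - clock i s \<omega>) - rate i * (t - s)
      = real (clock i t \<omega>) - real (clock i s \<omega>) - rate i * (t - s)"
    using clock_increment_law(3)[OF assms, of i] by eventually_elim simp
  show "(\<lambda>\<omega>. real (clock i t \<omega>) - real (clock i s \<omega>) - rate i * (t - s)) \<in> borel_measurable M"
    using clock_measurable_real assms by (intro borel_measurable_diff) auto
qed

lemma inc_law:
  assumes "N > 0"
  shows "distr M borel (\<lambda>\<omega>. inc N \<omega> i k) = distr (measure_pmf (poisson_pmf (rate i * (T / real N)))) borel real"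
proof -
  let ?s = "grid T N k" and ?t = "grid T N (Suc k)"
  have st: "0 \<le> ?s" "?s < ?t" "?t - ?s = T / real N" using grid_nonneg pos assms by (auto simp: grid_Suc)
  note law = clock_increment_law[OF st(1,2), of i]
  have [measurable]: "(\<lambda>\<omega>. clock i ?t \<omega> - clock i ?s \<omega>) \<in> measurable M (count_space UNIV)" by (rule law(1))
  have "distr M borel (\<lambda>\<omega>. inc N \<omega> i k) = distr M borel (\<lambda>\<omega>. real (clock i ?t \<omega> - clock i ?s \<omega>))"
    by (rule distr_cong_AE[OF refl]) (use law(3) inc_measurable[of N i k] in \<open>auto simp: inc_eq\<close>)
  also have "\<dots> = distr (distr M (count_space UNIV) (\<lambda>\<omega>. clock i ?t \<omega> - clock i ?s \<omega>)) borel real"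
    by (subst distr_distr) (auto simp: o_def)
  finally show ?thesis unfolding law(2) st(3) .
qed

lemma inc_poisson_like:
  assumes "N > 0"
  shows "poisson_like M (rate i * (T / N)) (\<lambda>\<omega>. inc N \<omega> i k - rate i * (T / N))"
proof -
  have st: "0 \<le> grid T N k" "grid T N k < grid T N (Suc k)" "grid T N (Suc k) - grid T N k = T / N"
    using grid_nonneg pos assms by (auto simp: grid_Suc)
  show ?thesis using clock_increment_poisson_like[OF st(1,2), of i] unfolding st(3) inc_eq .
qed

text \<open>Second factorial moment: an integer \<open>Y > 1\<close> satisfies
  \<open>1 \<le> Y * (Y - 1)\<close>, and the expectation of that product is the square of the mean
  since variance and mean coincide.\<close>

lemma two_jumps_prob:
  assumes N: "N > 0" and k: "k < N"
  shows "prob {\<omega> \<in> space M. (\<Sum>i\<le>m. inc N \<omega> i k) > 1} \<le> ((\<Sum>i\<le>m. rate i) * (T / N)) ^ 2"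
proof -
  define v where "v = (\<Sum>i\<le>m. rate i * (T / N))"
  define Y where "Y \<omega> = (\<Sum>i\<le>m. inc N \<omega> i k)" for \<omega>
  have mY[measurable]: "Y \<in> borel_measurable M" unfolding Y_def[abs_def] using inc_measurable by auto
  have "poisson_like M (\<Sum>p\<in>{..m} \<times> {k}. rate (fst p) * (T / N))
      (\<lambda>\<omega>. \<Sum>p\<in>{..m} \<times> {k}. (\<lambda>(i, k) \<omega>. inc N \<omega> i k) p \<omega> - rate (fst p) * (T / N))"
  proof (rule poisson_like_sum)
    have "indep_vars (\<lambda>_. borel) (\<lambda>(i, k) \<omega>. inc N \<omega> i k) ({..m} \<times> {k})"
      by (rule indep_vars_subset[OF inc_indep]) (use k in auto)
    then show "indep_vars (\<lambda>_. borel) (\<lambda>p \<omega>. (\<lambda>(i, k) \<omega>. inc N \<omega> i k) p \<omega> - rate (fst p) * (T / N)) ({..m} \<times> {k})"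
      by (rule indep_vars_compose2) auto
  qed (use inc_poisson_like[OF N] in auto)
  moreover have "(\<Sum>p\<in>{..m} \<times> {k}. f p) = (\<Sum>i\<le>m. f (i, k))" for f :: "nat \<times> nat \<Rightarrow> real"
    by (rule sum.reindex_bij_witness[of _ "\<lambda>i. (i, k)" fst]) auto
  ultimately have pl: "poisson_like M v (\<lambda>\<omega>. Y \<omega> - v)"
    by (simp add: v_def Y_def[abs_def] sum_subtractf)
  note i = poisson_like_integrable[OF pl]
  have eq: "Y \<omega> * (Y \<omega> - 1) = (Y \<omega> - v) ^ 2 + (2 * v - 1) * (Y \<omega> - v) + (v\<^sup>2 - v)" for \<omega>
    by (simp add: power2_eq_square algebra_simps)
  have iY: "integrable M (\<lambda>\<omega>. Y \<omega> * (Y \<omega> - 1))" unfolding eq using i by simp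
  have EY: "expectation (\<lambda>\<omega>. Y \<omega> * (Y \<omega> - 1)) = v ^ 2"
    unfolding eq using i pl by (simp add: poisson_like_def prob_space)
  have nat: "AE \<omega> in M. \<exists>q. Y \<omega> = real q"
    using AE_counting
  proof eventually_elim
    case (elim \<omega>)
    have "Y \<omega> = real (\<Sum>i\<le>m. clock i (grid T N (Suc k)) \<omega> - clock i (grid T N k) \<omega>)"
    proof -
      have "clock i (grid T N k) \<omega> \<le> clock i (grid T N (Suc k)) \<omega>" for i
        using counting_path_mono[of "\<lambda>t. clock i t \<omega>"] elim grid_nonneg[OF pos(4)] grid_mono[OF pos(4), of k "Suc k"] by simp
      then show ?thesis by (simp add: Y_def inc_eq of_nat_diff)
    qed
    then show ?case by blast
  qed
  have "prob {\<omega> \<in> space M. Y \<omega> > 1} = expectation (indicator {\<omega> \<in> space M. Y \<omega> > 1})" by simp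
  also have "\<dots> \<le> expectation (\<lambda>\<omega>. Y \<omega> * (Y \<omega> - 1))"
  proof (rule integral_mono_AE[OF _ iY])
    show "integrable M (indicator {\<omega> \<in> space M. Y \<omega> > 1} :: 'a \<Rightarrow> real)" by (intro integrable_real_indicator) (auto simp: emeasure_eq_measure)
    show "AE \<omega> in M. indicator {\<omega> \<in> space M. Y \<omega> > 1} \<omega> \<le> Y \<omega> * (Y \<omega> - 1)"
      using nat
    proof eventually_elim
      case (elim \<omega>)
      then obtain q where q: "Y \<omega> = real q" by auto
      show ?case
      proof (cases "q \<ge> 2")
        case True
        then have "1 * 1 \<le> real q * (real q - 1)" by (intro mult_mono) auto
        then show ?thesis using q by (simp add: indicator_def)
      next
        case False
        then have "q = 0 \<or> q = 1" by auto
        then show ?thesis using q by (auto simp: indicator_def)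
      qed
    qed
  qed
  finally have "prob {\<omega> \<in> space M. Y \<omega> > 1} \<le> v ^ 2" unfolding EY .
  then show ?thesis by (simp only: v_def Y_def sum_distrib_right)
qed

text \<open>There are \<open>2^j\<close> cells, each bad with probability of order
  \<open>4^(-j)\<close>, so the bad events are summable along dyadic grids. The statement covers all
  levels \<open>m\<close> at once because \<open>m\<close> will later be the random number of
  arrivals.\<close>

lemma AE_eventually_good: "AE \<omega> in M. \<forall>m. \<forall>\<^sub>F j in sequentially. \<forall>k<2^j. (\<Sum>i\<le>m. inc (2^j) \<omega> i k) \<le> 1"
  unfolding AE_all_countable
proof
  fix m
  define r where "r = (\<Sum>i\<le>m. rate i)"
  define E where "E j = (\<Union>k<2^j. {\<omega> \<in> space M. (\<Sum>i\<le>m. inc (2^j) \<omega> i k) > 1})" for j :: nat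
  have [measurable]: "{\<omega> \<in> space M. (\<Sum>i\<le>m. inc (2^j) \<omega> i k) > 1} \<in> sets M" for j k
    using inc_measurable by measurable
  have mE: "E j \<in> sets M" for j unfolding E_def by auto
  have bound: "prob (E j) \<le> (r * T) ^ 2 * (1 / 2) ^ j" for j
  proof -
    have "prob (E j) \<le> (\<Sum>k<2^j. prob {\<omega> \<in> space M. (\<Sum>i\<le>m. inc (2^j) \<omega> i k) > 1})"
      unfolding E_def by (rule finite_measure_subadditive_finite) auto
    also have "\<dots> \<le> (\<Sum>k<(2::nat)^j. (r * (T / real (2^j))) ^ 2)"
      unfolding r_def by (intro sum_mono two_jumps_prob) auto
    also have "\<dots> = (r * T) ^ 2 * (1 / 2) ^ j"
      by (simp add: power2_eq_square power_divide field_simps)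
    finally show ?thesis .
  qed
  have "summable (\<lambda>j. prob (E j))"
    by (rule summable_comparison_test'[of "\<lambda>j. (r * T) ^ 2 * (1 / 2) ^ j" 0])
       (use bound in \<open>auto intro!: summable_mult summable_geometric\<close>)
  then have "AE \<omega> in M. \<forall>\<^sub>F j in sequentially. \<omega> \<in> space M - E j"
    by (intro borel_cantelli_AE1 mE) (auto simp: emeasure_eq_measure)
  then show "AE \<omega> in M. \<forall>\<^sub>F j in sequentially. \<forall>k<2^j. (\<Sum>i\<le>m. inc (2^j) \<omega> i k) \<le> 1"
  proof eventually_elim
    case (elim \<omega>)
    then show ?case by (rule eventually_mono) (auto simp: E_def not_less)
  qed
qed

end

context queue_on_interval
begin

abbreviation "gain N k \<equiv> exp (\<mu> * grid T N (Suc k))"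

abbreviation "cnoise N \<omega> k \<equiv> noise (lam * real n * (T / real N)) (\<mu> * (T / real N)) (inc N \<omega>) k"

text \<open>A bound, uniform in the mesh, for the total noise: every service clock with index at most the
  number of arrivals contributes all its ticks.\<close>

definition load :: "'a \<Rightarrow> real" where
  "load \<omega> = real (clock 0 T \<omega>) + lam * real n * T + (\<Sum>i\<in>{1..clock 0 T \<omega>}. real (clock i T \<omega>) + \<mu> * T)"

text \<open>A form of Wald's identity. The sum over a random number of clocks is rewritten as a
  series of products of an indicator of the arrivals with an independent clock, and monotone
  convergence reduces its mean to the mean number of arrivals.\<close>

lemma load_integrable: "integrable M load"
proof -
  define a where "a \<omega> = real (clock 0 T \<omega>)" for \<omega>
  define s where "s i \<omega> = real (clock i T \<omega>) + \<mu> * T" for i \<omega>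
  have T: "0 \<le> T" "0 < T" using pos by auto
  have mean: "integrable M (\<lambda>\<omega>. real (clock i T \<omega>))" "expectation (\<lambda>\<omega>. real (clock i T \<omega>)) = rate i * T" for i
  proof -
    have "AE \<omega> in M. (real (clock i T \<omega>) - real (clock i 0 \<omega>)) - rate i * (T - 0) = real (clock i T \<omega>) - rate i * T"
      using AE_counting by eventually_elim (auto simp: counting_path_def)
    then have "poisson_like M (rate i * T) (\<lambda>\<omega>. real (clock i T \<omega>) - rate i * T)"
      using poisson_like_cong_AE[OF _ _ clock_increment_poisson_like[of 0 T i]] T clock_measurable_real[OF T(1)] by simp
    then have pl: "poisson_like M (rate i * T) (\<lambda>\<omega>. real (clock i T \<omega>) - rate i * T)" .
    then have "integrable M (\<lambda>\<omega>. (real (clock i T \<omega>) - rate i * T) + rate i * T)"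
      using poisson_like_integrable(1)[OF pl] by (intro Bochner_Integration.integrable_add) auto
    then show i: "integrable M (\<lambda>\<omega>. real (clock i T \<omega>))" by simp
    have "expectation (\<lambda>\<omega>. real (clock i T \<omega>) - rate i * T) = 0" using pl by (simp add: poisson_like_def)
    then show "expectation (\<lambda>\<omega>. real (clock i T \<omega>)) = rate i * T" using i by (simp add: prob_space)
  qed
  have ma[measurable]: "a \<in> borel_measurable M" and ms[measurable]: "s i \<in> borel_measurable M" for i
    unfolding a_def[abs_def] s_def[abs_def] using clock_measurable_real[OF T(1)] by auto
  have ind: "indep_var borel a borel (s i)" if "1 \<le> i" for i
  proof -
    let ?P = "PiM {0..} (\<lambda>_. count_space UNIV) :: (real \<Rightarrow> nat) measure"
    have m: "(\<lambda>f. real (f j T) + x) \<in> borel_measurable (PiM {j} (\<lambda>_. ?P))" for j :: nat and x :: real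
    proof -
      have 1: "(\<lambda>g. g T) \<in> measurable ?P (count_space UNIV)"
        by (rule measurable_component_singleton) (use T in simp)
      have 2: "(\<lambda>f. f j) \<in> measurable (PiM {j} (\<lambda>_. ?P)) ?P"
        by (rule measurable_component_singleton) simp
      have "(\<lambda>f. real (f j T)) \<in> borel_measurable (PiM {j} (\<lambda>_. ?P))"
        by (rule measurable_compose[OF measurable_compose[OF 2 1]]) simp
      then show ?thesis by simp
    qed
    have "indep_var (PiM {0} (\<lambda>_. ?P)) (\<lambda>\<omega>. \<lambda>j\<in>{0}. \<lambda>t\<in>{0..}. (if j = 0 then A else S j) t \<omega>)
        (PiM {i} (\<lambda>_. ?P)) (\<lambda>\<omega>. \<lambda>j\<in>{i}. \<lambda>t\<in>{0..}. (if j = 0 then A else S j) t \<omega>)"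
      by (rule indep_var_restrict[OF independence]) (use that in auto)
    from indep_var_compose[OF this m[of 0 0] m[of i "\<mu> * T"]] show ?thesis
      using that T by (simp add: o_def a_def[abs_def] s_def[abs_def] clock_def)
  qed
  have s_nn: "0 \<le> s i \<omega>" for i \<omega> using T pos by (simp add: s_def)
  \<comment> \<open>Clock \<open>i\<close> is independent of the arrivals, so its mean
    \<open>2 * \<mu> * T\<close> factors out; one half of it comes from the compensator.\<close>
  have term_eq: "(\<integral>\<^sup>+\<omega>. ennreal (indicator {real i..} (a \<omega>) * s i \<omega>) \<partial>M)
      = (\<integral>\<^sup>+\<omega>. ennreal (indicator {real i..} (a \<omega>)) * ennreal (2 * \<mu> * T) \<partial>M)" if i: "1 \<le> i" for i
  proof -
    have "(\<integral>\<^sup>+\<omega>. ennreal (indicator {real i..} (a \<omega>) * s i \<omega>) \<partial>M)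
        = (\<integral>\<^sup>+\<omega>. \<integral>\<^sup>+\<omega>'. ennreal (indicator {real i..} (a \<omega>) * s i \<omega>') \<partial>M \<partial>M)"
      using indep_var_nn_integral_iterated[OF ind[OF i], of "\<lambda>p. ennreal (indicator {real i..} (fst p) * snd p)"] by simp
    also have "\<dots> = (\<integral>\<^sup>+\<omega>. ennreal (indicator {real i..} (a \<omega>)) * ennreal (2 * \<mu> * T) \<partial>M)"
    proof (rule nn_integral_cong)
      fix \<omega>
      have "(\<integral>\<^sup>+\<omega>'. ennreal (s i \<omega>') \<partial>M) = ennreal (expectation (s i))"
        by (rule nn_integral_eq_integral) (use mean s_nn in \<open>auto simp: s_def[abs_def]\<close>)
      also have "expectation (s i) = 2 * \<mu> * T"
        using mean[of i] i by (simp add: s_def[abs_def] prob_space rate_def)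
      finally show "(\<integral>\<^sup>+\<omega>'. ennreal (indicator {real i..} (a \<omega>) * s i \<omega>') \<partial>M)
          = ennreal (indicator {real i..} (a \<omega>)) * ennreal (2 * \<mu> * T)"
        by (simp add: ennreal_mult s_nn nn_integral_cmult)
    qed
    finally show ?thesis .
  qed
  \<comment> \<open>The random upper limit is encoded by indicators of \<open>i\<close> being at
    most the number of arrivals.\<close>
  have count: "(\<Sum>i. ennreal (indicator {real (Suc i)..} (a \<omega>) * x (Suc i))) = ennreal (\<Sum>i\<in>{1..clock 0 T \<omega>}. x i)"
    if "\<And>i. 0 \<le> x i" for \<omega> and x :: "nat \<Rightarrow> real"
  proof -
    have "(\<Sum>i. ennreal (indicator {real (Suc i)..} (a \<omega>) * x (Suc i)))
        = (\<Sum>i<clock 0 T \<omega>. ennreal (indicator {real (Suc i)..} (a \<omega>) * x (Suc i)))"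
      by (rule suminf_finite) (auto simp: a_def indicator_def)
    also have "\<dots> = (\<Sum>i<clock 0 T \<omega>. ennreal (x (Suc i)))"
      by (rule sum.cong) (auto simp: a_def indicator_def)
    also have "\<dots> = ennreal (\<Sum>i<clock 0 T \<omega>. x (Suc i))" using that by (simp add: sum_ennreal)
    also have "(\<Sum>i<clock 0 T \<omega>. x (Suc i)) = (\<Sum>i\<in>{1..clock 0 T \<omega>}. x i)"
      by (rule sum.reindex_bij_witness[of _ "\<lambda>i. i - 1" Suc]) auto
    finally show ?thesis .
  qed
  define R where "R \<omega> = (\<Sum>i\<in>{1..clock 0 T \<omega>}. s i \<omega>)" for \<omega>
  have mR: "R \<in> borel_measurable M"
  proof -
    have "(\<lambda>\<omega>. \<Sum>i\<in>{1..nat \<lfloor>a \<omega>\<rfloor>}. s i \<omega>) \<in> borel_measurable M"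
      using measurable_random_sum[of a M "\<lambda>\<omega> i. s i \<omega>"] by simp
    then show ?thesis by (simp add: R_def[abs_def] a_def)
  qed
  have "(\<integral>\<^sup>+\<omega>. ennreal (R \<omega>) \<partial>M) = (\<integral>\<^sup>+\<omega>. (\<Sum>i. ennreal (indicator {real (Suc i)..} (a \<omega>) * s (Suc i) \<omega>)) \<partial>M)"
    unfolding R_def by (intro nn_integral_cong count[symmetric] s_nn)
  also have "\<dots> = (\<Sum>i. \<integral>\<^sup>+\<omega>. ennreal (indicator {real (Suc i)..} (a \<omega>) * s (Suc i) \<omega>) \<partial>M)"
    by (rule nn_integral_suminf) measurable
  also have "\<dots> = (\<Sum>i. \<integral>\<^sup>+\<omega>. ennreal (indicator {real (Suc i)..} (a \<omega>) * (2 * \<mu> * T)) \<partial>M)"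
  proof (rule suminf_cong)
    fix i
    show "(\<integral>\<^sup>+\<omega>. ennreal (indicator {real (Suc i)..} (a \<omega>) * s (Suc i) \<omega>) \<partial>M)
        = (\<integral>\<^sup>+\<omega>. ennreal (indicator {real (Suc i)..} (a \<omega>) * (2 * \<mu> * T)) \<partial>M)"
      using term_eq[of "Suc i"] T pos by (simp add: ennreal_mult)
  qed
  also have "\<dots> = (\<integral>\<^sup>+\<omega>. (\<Sum>i. ennreal (indicator {real (Suc i)..} (a \<omega>) * (2 * \<mu> * T))) \<partial>M)"
    by (rule nn_integral_suminf[symmetric]) measurable
  also have "\<dots> = (\<integral>\<^sup>+\<omega>. ennreal (a \<omega> * (2 * \<mu> * T)) \<partial>M)"
  proof (rule nn_integral_cong)
    fix \<omega>
    show "(\<Sum>i. ennreal (indicator {real (Suc i)..} (a \<omega>) * (2 * \<mu> * T))) = ennreal (a \<omega> * (2 * \<mu> * T))"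
    proof -
      have "(\<Sum>i. ennreal (indicator {real (Suc i)..} (a \<omega>) * (2 * \<mu> * T))) = ennreal (\<Sum>i\<in>{1..clock 0 T \<omega>}. 2 * \<mu> * T)"
        by (rule count) (use T pos in simp)
      also have "(\<Sum>i\<in>{1..clock 0 T \<omega>}. 2 * \<mu> * T) = a \<omega> * (2 * \<mu> * T)" by (simp add: a_def)
      finally show ?thesis .
    qed
  qed
  also have "\<dots> < \<infinity>"
  proof -
    have "integrable M (\<lambda>\<omega>. a \<omega> * (2 * \<mu> * T))" using mean[of 0] by (simp add: a_def[abs_def])
    then show ?thesis using T pos by (simp add: nn_integral_eq_integral a_def)
  qed
  finally have fin: "(\<integral>\<^sup>+\<omega>. ennreal (R \<omega>) \<partial>M) < \<infinity>" .
  have "AE \<omega> in M. 0 \<le> R \<omega>" by (simp add: R_def sum_nonneg s_nn)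
  then have "integrable M R" using fin by (rule integrableI_nonneg[OF mR])
  then have "integrable M (\<lambda>\<omega>. a \<omega> + lam * real n * T + R \<omega>)"
    using mean[of 0] by (simp add: a_def[abs_def])
  then show ?thesis by (simp add: load_def[abs_def] a_def R_def s_def)
qed

lemma inc_nonneg:
  assumes "\<forall>i. counting_path (\<lambda>t. clock i t \<omega>)"
  shows "0 \<le> inc N \<omega> i k"
  using counting_path_mono[of "\<lambda>t. clock i t \<omega>" "grid T N k" "grid T N (Suc k)"] assms
    grid_nonneg[OF pos(4)] grid_mono[OF pos(4), of k "Suc k"] by (simp add: inc_eq)

lemma sum_inc:
  assumes "\<forall>i. counting_path (\<lambda>t. clock i t \<omega>)"
  shows "(\<Sum>k<j. inc N \<omega> i k) = real (clock i (grid T N j) \<omega>)"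
  unfolding inc_eq sum_lessThan_telescope[of "\<lambda>k. real (clock i (grid T N k) \<omega>)"]
  using assms by (simp add: counting_path_def)

text \<open>Enlarging the set of active clocks to all indices up to the total number of arrivals
  makes it the same in every cell. The increments of each clock then telescope over the grid and the
  mesh disappears from the bound.\<close>

lemma noise_le_load:
  assumes c: "\<forall>i. counting_path (\<lambda>t. clock i t \<omega>)" and N: "N > 0"
  shows "(\<Sum>k<N. \<bar>cnoise N \<omega> k\<bar>) \<le> load \<omega>" "k \<le> N \<Longrightarrow> real (nat \<lfloor>euler (inc N \<omega>) k\<rfloor>) \<le> load \<omega>"
proof -
  define m where "m = clock 0 T \<omega>"
  define \<delta> where "\<delta> = T / real N"
  have \<delta>: "0 \<le> \<delta>" "real N * \<delta> = T" using pos N by (auto simp: \<delta>_def)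
  have active: "real (nat \<lfloor>euler (inc N \<omega>) k\<rfloor>) \<le> real m" if k: "k \<le> N" for k
  proof -
    have "real (nat \<lfloor>euler (inc N \<omega>) k\<rfloor>) \<le> (\<Sum>j<k. inc N \<omega> 0 j)"
      by (rule nat_floor_euler_le_arrivals) (rule inc_nonneg[OF c])
    also have "\<dots> = real (clock 0 (grid T N k) \<omega>)" by (rule sum_inc[OF c])
    also have "\<dots> \<le> real m"
      unfolding m_def using counting_path_mono[of "\<lambda>t. clock 0 t \<omega>"] c grid_nonneg[OF pos(4)] grid_le[OF pos(4) k] by simp
    finally show ?thesis .
  qed
  have s_nn: "0 \<le> (\<Sum>i\<in>{1..m}. real (clock i T \<omega>) + \<mu> * T)"
    using pos by (intro sum_nonneg) auto
  have "real m \<le> load \<omega>" using s_nn pos by (simp add: load_def m_def)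
  then show "k \<le> N \<Longrightarrow> real (nat \<lfloor>euler (inc N \<omega>) k\<rfloor>) \<le> load \<omega>" using active[of k] by linarith
  have "\<bar>cnoise N \<omega> k\<bar> \<le> inc N \<omega> 0 k + lam * real n * \<delta> + (\<Sum>i\<in>{1..m}. inc N \<omega> i k + \<mu> * \<delta>)" if k: "k < N" for k
  proof -
    let ?q = "nat \<lfloor>euler (inc N \<omega>) k\<rfloor>"
    have q: "?q \<le> m" using active[of k] k by simp
    have "\<bar>\<Sum>i\<in>{1..?q}. inc N \<omega> i k - \<mu> * \<delta>\<bar> \<le> (\<Sum>i\<in>{1..?q}. inc N \<omega> i k + \<mu> * \<delta>)"
      using inc_nonneg[OF c, of N _ k] \<delta> pos
      by (intro order_trans[OF sum_abs sum_mono]) (auto simp: abs_le_iff add_nonneg_nonneg mult_nonneg_nonneg)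
    also have "\<dots> \<le> (\<Sum>i\<in>{1..m}. inc N \<omega> i k + \<mu> * \<delta>)"
      using inc_nonneg[OF c, of N _ k] \<delta> pos q
      by (intro sum_mono2) (auto simp: add_nonneg_nonneg mult_nonneg_nonneg)
    finally have "\<bar>\<Sum>i\<in>{1..?q}. inc N \<omega> i k - \<mu> * \<delta>\<bar> \<le> (\<Sum>i\<in>{1..m}. inc N \<omega> i k + \<mu> * \<delta>)" .
    moreover have "0 \<le> lam * real n * \<delta>" using \<delta> pos by simp
    ultimately show ?thesis
      using inc_nonneg[OF c, of N 0 k] unfolding noise_def \<delta>_def[symmetric] by linarith
  qed
  then have "(\<Sum>k<N. \<bar>cnoise N \<omega> k\<bar>) \<le> (\<Sum>k<N. inc N \<omega> 0 k + lam * real n * \<delta> + (\<Sum>i\<in>{1..m}. inc N \<omega> i k + \<mu> * \<delta>))"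
    by (intro sum_mono) auto
  also have "\<dots> = (\<Sum>k<N. inc N \<omega> 0 k) + lam * real n * (real N * \<delta>) + (\<Sum>i\<in>{1..m}. (\<Sum>k<N. inc N \<omega> i k) + \<mu> * (real N * \<delta>))"
    by (simp add: sum.distrib sum.swap[of _ "{..<N}"] sum_distrib_left mult_ac)
  also have "\<dots> = load \<omega>"
    unfolding sum_inc[OF c] \<delta>(2) load_def m_def using grid_last[OF N, of T] by simp
  finally show "(\<Sum>k<N. \<bar>cnoise N \<omega> k\<bar>) \<le> load \<omega>" .
qed

text \<open>Time average of the failure of the variation of constants formula for the scheme. It
  links the number of active servers, and hence the conditional variance, to the weighted
  noise.\<close>

definition scheme_error :: "nat \<Rightarrow> 'a \<Rightarrow> real" where
  "scheme_error N \<omega> = T / real N * (\<Sum>k<N. \<bar>real (nat \<lfloor>euler (inc N \<omega>) k\<rfloor>) - real n * fluid_limit lam \<mu> (grid T N k)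
     - exp (- \<mu> * grid T N k) * (\<Sum>j<k. gain N j * cnoise N \<omega> j)\<bar>)"

definition mesh_const :: "real \<Rightarrow> real" where
  "mesh_const m = real n * lam + \<mu> * exp (\<mu> * T) * (m + real n * (lam / \<mu>))
     + exp (\<mu> * T) * \<mu>\<^sup>2 * T * (m + real n * (lam / \<mu>))"

text \<open>Almost surely, on fine grids the scheme follows the queue exactly.\<close>

lemma AE_scheme_close:
  "AE \<omega> in M. \<forall>\<^sub>F j in sequentially.
     (\<forall>t\<in>{0..T}. \<bar>(real n * L t \<omega> - real n * fluid_limit lam \<mu> t)
        - ipath \<mu> T (2^j) (\<lambda>k. gain (2^j) k * cnoise (2^j) \<omega> k) t\<bar>
        \<le> 1 + mesh_const (real (clock 0 T \<omega>)) * (T / 2^j)) \<and>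
     scheme_error (2^j) \<omega> \<le> T * mesh_const (real (clock 0 T \<omega>)) * (T / 2^j)"
  using AE_eventually_good AE_queue_path
proof eventually_elim
  case (elim \<omega>)
  interpret q: queue_path n "\<lambda>i t. clock i t \<omega>" "\<lambda>t. L t \<omega>" by (rule elim(2))
  \<comment> \<open>The almost sure event holds for every level, so the level may be chosen
    separately for each outcome.\<close>
  define m where "m = clock 0 T \<omega>"
  from elim(1) have "\<forall>\<^sub>F j in sequentially. \<forall>k<2^j. (\<Sum>i\<le>m. inc (2^j) \<omega> i k) \<le> 1" by blast
  then show ?case
  proof (rule eventually_mono)
    fix j :: nat
    define N where "N = (2::nat)^j"
    assume g: "\<forall>k<2^j. (\<Sum>i\<le>m. inc (2^j) \<omega> i k) \<le> 1"
    have N: "N > 0" by (simp add: N_def)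
    have good: "(\<Sum>i\<le>m. cell_incr (\<lambda>i t. clock i t \<omega>) T N i k) \<le> 1" if "k < N" for k
      using g that by (simp add: N_def inc_def)
    have le: "clock 0 T \<omega> \<le> m" by (simp add: m_def)
    note ctx = pos(4) N le good
    have n: "0 < real n" using pos by simp
    have noise: "cnoise N \<omega> k = q.Q (grid T N (Suc k)) - q.Q (grid T N k) - lam * real n * (T / real N)
        + \<mu> * (T / real N) * q.Q (grid T N k)" if "k < N" for k
      unfolding inc_def by (rule q.noise_grid[OF ctx that])
    have cell: "\<bar>q.Q t - q.Q (grid T N k)\<bar> \<le> 1 \<and> \<bar>q.Q t - q.Q (grid T N (Suc k))\<bar> \<le> 1"
      if "k < N" "grid T N k \<le> t" "t \<le> grid T N (Suc k)" for k t
      using q.Q_cell[OF ctx that] by simp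
    have bnd: "0 \<le> q.Q t \<and> q.Q t \<le> real m" if "t \<in> {0..T}" for t
      by (rule q.Q_bounds[OF ctx that])
    have close1: "\<bar>(\<Sum>j<k. gain N j * cnoise N \<omega> j)
        - exp (\<mu> * grid T N k) * (q.Q (grid T N k) - real n * fluid_limit lam \<mu> (grid T N k))\<bar>
        \<le> exp (\<mu> * T) * \<mu>\<^sup>2 * T * (real m + real n * (lam / \<mu>)) * (T / real N)" if "k \<le> N" for k
      by (rule scheme_path_close(1)[OF pos(1,2,4) n N]) (assumption | rule bnd q.Q_0 cell noise that)+
    have close2: "\<bar>(q.Q t - real n * fluid_limit lam \<mu> t) - ipath \<mu> T N (\<lambda>k. gain N k * cnoise N \<omega> k) t\<bar>
        \<le> 1 + mesh_const (real m) * (T / real N)" if "t \<in> {0..T}" for t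
      unfolding mesh_const_def
      by (rule scheme_path_close(2)[OF pos(1,2,4) n N]) (assumption | rule bnd q.Q_0 cell noise that)+
    have mc: "0 \<le> \<mu> * exp (\<mu> * T) * (real m + real n * (lam / \<mu>))" "0 \<le> real n * lam"
      using pos by auto
    have "\<bar>(real n * L t \<omega> - real n * fluid_limit lam \<mu> t) - ipath \<mu> T N (\<lambda>k. gain N k * cnoise N \<omega> k) t\<bar>
        \<le> 1 + mesh_const (real m) * (T / real N)" if "t \<in> {0..T}" for t
      using close2[OF that] unfolding q.Q_def .
    moreover have "scheme_error N \<omega> \<le> T * mesh_const (real m) * (T / real N)"
    proof -
      let ?C = "exp (\<mu> * T) * \<mu>\<^sup>2 * T * (real m + real n * (lam / \<mu>))"
      have term_le: "\<bar>real (nat \<lfloor>euler (inc N \<omega>) k\<rfloor>) - real n * fluid_limit lam \<mu> (grid T N k)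
          - exp (- \<mu> * grid T N k) * (\<Sum>j<k. gain N j * cnoise N \<omega> j)\<bar> \<le> ?C * (T / real N)" if k: "k < N" for k
      proof -
        let ?t = "grid T N k"
        let ?S = "\<Sum>j<k. gain N j * cnoise N \<omega> j"
        have act: "real (nat \<lfloor>euler (inc N \<omega>) k\<rfloor>) = q.Q ?t"
          unfolding inc_def using q.active_grid[OF ctx, of k] k by simp
        have ee: "exp (- \<mu> * ?t) * exp (\<mu> * ?t) = 1" by (simp flip: exp_add)
        have "\<bar>q.Q ?t - real n * fluid_limit lam \<mu> ?t - exp (- \<mu> * ?t) * ?S\<bar>
            = \<bar>exp (- \<mu> * ?t) * (exp (\<mu> * ?t) * (q.Q ?t - real n * fluid_limit lam \<mu> ?t) - ?S)\<bar>"
          using ee by (simp only: right_diff_distrib mult.assoc[symmetric] mult_1)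
        also have "\<dots> = exp (- \<mu> * ?t) * \<bar>?S - exp (\<mu> * ?t) * (q.Q ?t - real n * fluid_limit lam \<mu> ?t)\<bar>"
          by (simp add: abs_mult abs_minus_commute)
        also have "\<dots> \<le> 1 * (?C * (T / real N))"
          using close1[of k] k pos grid_nonneg[OF pos(4), of N k] by (intro mult_mono) auto
        finally show ?thesis unfolding act by simp
      qed
      have "scheme_error N \<omega> \<le> T / real N * (\<Sum>k<N. ?C * (T / real N))"
        unfolding scheme_error_def using term_le pos by (intro mult_left_mono sum_mono) auto
      also have "\<dots> = T * ?C * (T / real N)" using N by simp
      also have "\<dots> \<le> T * mesh_const (real m) * (T / real N)"
        using mc pos by (intro mult_right_mono mult_left_mono) (auto simp: mesh_const_def)
      finally show ?thesis .
    qed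
    ultimately show "(\<forall>t\<in>{0..T}. \<bar>(real n * L t \<omega> - real n * fluid_limit lam \<mu> t)
        - ipath \<mu> T (2^j) (\<lambda>k. gain (2^j) k * cnoise (2^j) \<omega> k) t\<bar>
        \<le> 1 + mesh_const (real (clock 0 T \<omega>)) * (T / 2^j)) \<and>
      scheme_error (2^j) \<omega> \<le> T * mesh_const (real (clock 0 T \<omega>)) * (T / 2^j)"
      unfolding N_def m_def by simp
  qed
qed

end

lemma cadlag_on_restrict_scale:
  assumes f: "cadlag_on {0..} f" and g: "continuous_on UNIV g"
  shows "cadlag_on {0..T} (\<lambda>t\<in>{0..T}. c * (f t - g t) :: real)"
proof -
  have g': "(g \<longlongrightarrow> g t) (at t within S)" for t S
  proof -
    have "continuous (at t within S) g"
      using g by (simp add: continuous_on_eq_continuous_at continuous_at_imp_continuous_at_within)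
    then show ?thesis by (simp add: continuous_within)
  qed
  have cong: "((\<lambda>t\<in>{0..T}. c * (f t - g t)) \<longlongrightarrow> l) (at t within {0..T} \<inter> S)"
    if "((\<lambda>t. c * (f t - g t)) \<longlongrightarrow> l) (at t within {0..T} \<inter> S)" for l t S
    by (rule Lim_transform_eventually[OF that]) (auto simp: eventually_at_filter intro!: always_eventually)
  have sub: "(f \<longlongrightarrow> l) (at t within {0..T} \<inter> S)" if "(f \<longlongrightarrow> l) (at t within {0..} \<inter> S)" for l t S
    by (rule tendsto_within_subset[OF that]) auto
  show ?thesis
    unfolding cadlag_on_def
  proof (intro conjI ballI)
    fix t assume t: "t \<in> {0..T}"
    have "(f \<longlongrightarrow> f t) (at t within {0..} \<inter> {t<..})" using f t by (simp add: cadlag_on_def)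
    then have "((\<lambda>t. c * (f t - g t)) \<longlongrightarrow> c * (f t - g t)) (at t within {0..T} \<inter> {t<..})"
      by (intro tendsto_intros sub g')
    then show "((\<lambda>t\<in>{0..T}. c * (f t - g t)) \<longlongrightarrow> (\<lambda>t\<in>{0..T}. c * (f t - g t)) t) (at t within {0..T} \<inter> {t<..})"
      using cong t by simp
  next
    fix t assume t: "t \<in> {0..T}"
    then obtain l where "(f \<longlongrightarrow> l) (at t within {0..} \<inter> {..<t})" using f by (auto simp: cadlag_on_def)
    then have "((\<lambda>t. c * (f t - g t)) \<longlongrightarrow> c * (l - g t)) (at t within {0..T} \<inter> {..<t})"
      by (intro tendsto_intros sub g')
    then show "\<exists>l. ((\<lambda>t\<in>{0..T}. c * (f t - g t)) \<longlongrightarrow> l) (at t within {0..T} \<inter> {..<t})"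
      using cong by blast
  qed
qed

lemma ipath_scale: "t \<in> {0..T} \<Longrightarrow> ipath \<mu> T N (\<lambda>k. y k / s) t = ipath \<mu> T N y t / s"
  by (simp add: ipath_def flip: sum_divide_distrib)

lemma ipath_abs_le:
  assumes "\<mu> > 0" "t \<in> {0..T}"
  shows "\<bar>ipath \<mu> T N y t\<bar> \<le> (\<Sum>k<N. \<bar>y k\<bar>)"
  using ipath_diff_le[OF assms, of N y "\<lambda>_. 0"] assms(2) by (simp add: ipath_def)

section \<open>Expectations in the limit of vanishing mesh\<close>

text \<open>The difference need not converge, as an error up to \<open>c\<close> persists. Dominated
  convergence is therefore applied to the excess of the difference over \<open>c\<close>, which does
  tend to 0.\<close>

lemma (in prob_space) expectation_diff_limit:
  fixes V :: "'a \<Rightarrow> real"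
  assumes V: "V \<in> borel_measurable M" and W: "\<And>j. W j \<in> borel_measurable M" "\<And>j. integrable M (W j)"
    and dom: "integrable M D" "\<And>j. AE \<omega> in M. \<bar>V \<omega> - W j \<omega>\<bar> \<le> D \<omega>"
    and lim: "AE \<omega> in M. \<exists>e. e \<longlonglongrightarrow> 0 \<and> (\<forall>\<^sub>F j in sequentially. \<bar>V \<omega> - W j \<omega>\<bar> \<le> c + e j)"
    and c: "c \<ge> 0"
  shows "integrable M V" "\<exists>\<epsilon>. \<epsilon> \<longlonglongrightarrow> 0 \<and> (\<forall>j. \<bar>expectation V - expectation (W j)\<bar> \<le> c + \<epsilon> j)"
proof -
  note [measurable] = V W(1)
  have iD: "integrable M (\<lambda>\<omega>. V \<omega> - W j \<omega>)" for j
    by (rule Bochner_Integration.integrable_bound[OF dom(1)]) (use dom(2)[of j] in auto)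
  have "integrable M (\<lambda>\<omega>. (V \<omega> - W 0 \<omega>) + W 0 \<omega>)" by (intro Bochner_Integration.integrable_add iD W)
  then show iV: "integrable M V" by simp
  define E where "E j \<omega> = max 0 (\<bar>V \<omega> - W j \<omega>\<bar> - c)" for j \<omega>
  have mE[measurable]: "E j \<in> borel_measurable M" for j unfolding E_def[abs_def] by measurable
  have lim0: "(\<lambda>j. expectation (E j)) \<longlonglongrightarrow> expectation (\<lambda>_. 0)"
  proof (rule integral_dominated_convergence[OF _ _ dom(1)])
    show "AE \<omega> in M. (\<lambda>j. E j \<omega>) \<longlonglongrightarrow> 0"
      using lim
    proof eventually_elim
      case (elim \<omega>)
      then obtain e where e: "e \<longlonglongrightarrow> 0" "\<forall>\<^sub>F j in sequentially. \<bar>V \<omega> - W j \<omega>\<bar> \<le> c + e j" by auto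
      show ?case
      proof (rule tendsto_sandwich[of "\<lambda>_. 0" _ _ "\<lambda>j. \<bar>e j\<bar>"])
        show "\<forall>\<^sub>F j in sequentially. E j \<omega> \<le> \<bar>e j\<bar>"
          using e(2) by eventually_elim (auto simp: E_def)
        show "(\<lambda>j. \<bar>e j\<bar>) \<longlonglongrightarrow> 0" using e(1) by (rule tendsto_rabs_zero)
      qed (auto simp: E_def)
    qed
    show "AE \<omega> in M. norm (E j \<omega>) \<le> D \<omega>" for j
      using dom(2)[of j] by eventually_elim (use c in \<open>auto simp: E_def\<close>)
  qed auto
  have iE: "integrable M (E j)" for j
    by (rule Bochner_Integration.integrable_bound[OF dom(1) mE])
       (use dom(2)[of j] in eventually_elim, use c in \<open>auto simp: E_def\<close>)
  have "\<bar>expectation V - expectation (W j)\<bar> \<le> c + expectation (E j)" for j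
  proof -
    have "\<bar>expectation V - expectation (W j)\<bar> = \<bar>expectation (\<lambda>\<omega>. V \<omega> - W j \<omega>)\<bar>"
      using iV W(2) by simp
    also have "\<dots> \<le> expectation (\<lambda>\<omega>. \<bar>V \<omega> - W j \<omega>\<bar>)" by (rule integral_abs_bound)
    also have "\<dots> \<le> expectation (\<lambda>\<omega>. c + E j \<omega>)"
      using iD iE by (intro integral_mono) (auto simp: E_def)
    also have "\<dots> = c + expectation (E j)" using iE by (simp add: prob_space)
    finally show ?thesis .
  qed
  then show "\<exists>\<epsilon>. \<epsilon> \<longlonglongrightarrow> 0 \<and> (\<forall>j. \<bar>expectation V - expectation (W j)\<bar> \<le> c + \<epsilon> j)"
    using lim0 by (intro exI[of _ "\<lambda>j. expectation (E j)"]) simp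
qed

context queue_on_interval
begin

text \<open>One grid that is fine enough for \<open>m\<close> equal to the number of arrivals has at
  most one jump in every cell, and the deterministic bounds on the queue apply there. In particular
  nonnegativity is derived, not assumed.\<close>

lemma AE_queue_bounds: "AE \<omega> in M. \<forall>t\<in>{0..T}. 0 \<le> real n * L t \<omega> \<and> real n * L t \<omega> \<le> real (clock 0 T \<omega>)"
  using AE_eventually_good AE_queue_path
proof eventually_elim
  case (elim \<omega>)
  interpret q: queue_path n "\<lambda>i t. clock i t \<omega>" "\<lambda>t. L t \<omega>" by (rule elim(2))
  define m where "m = clock 0 T \<omega>"
  from elim(1) have "\<forall>\<^sub>F j in sequentially. \<forall>k<2^j. (\<Sum>i\<le>m. inc (2^j) \<omega> i k) \<le> 1" by blast
  then obtain j where g: "\<forall>k<2^j. (\<Sum>i\<le>m. inc (2^j) \<omega> i k) \<le> 1"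
    using eventually_happens[of _ sequentially] by auto
  have N: "(2::nat)^j > 0" by simp
  have good: "(\<Sum>i\<le>m. cell_incr (\<lambda>i t. clock i t \<omega>) T (2^j) i k) \<le> 1" if "k < 2^j" for k
    using g that by (simp add: inc_def)
  have le: "clock 0 T \<omega> \<le> m" by (simp add: m_def)
  show ?case
    using q.Q_bounds[OF pos(4) N le good] unfolding q.Q_def m_def by blast
qed

lemma gain_le: "k < N \<Longrightarrow> 0 \<le> gain N k \<and> gain N k \<le> exp (\<mu> * T)"
  using grid_le[OF pos(4), of "Suc k" N] pos by simp

lemma cnoise_measurable: "(\<lambda>\<omega>. cnoise N \<omega> k) \<in> borel_measurable M"
  by (rule noise_measurable) (rule inc_measurable)

lemma gain_noise_le:
  assumes "\<forall>i. counting_path (\<lambda>t. clock i t \<omega>)" "N > 0" "k \<le> N"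
  shows "(\<Sum>j<k. \<bar>gain N j * cnoise N \<omega> j\<bar>) \<le> exp (\<mu> * T) * load \<omega>"
proof -
  have "(\<Sum>j<k. \<bar>gain N j * cnoise N \<omega> j\<bar>) \<le> (\<Sum>j<N. \<bar>gain N j * cnoise N \<omega> j\<bar>)"
    using assms(3) by (intro sum_mono2) auto
  also have "\<dots> \<le> (\<Sum>j<N. exp (\<mu> * T) * \<bar>cnoise N \<omega> j\<bar>)"
    using gain_le by (intro sum_mono) (auto simp: abs_mult intro!: mult_right_mono)
  also have "\<dots> \<le> exp (\<mu> * T) * load \<omega>"
    using noise_le_load(1)[OF assms(1,2)] by (simp add: mult_left_mono flip: sum_distrib_left)
  finally show ?thesis .
qed

lemma clock_le_load: "real (clock 0 T \<omega>) \<le> load \<omega>"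
proof -
  have "0 \<le> (\<Sum>i\<in>{1..clock 0 T \<omega>}. real (clock i T \<omega>) + \<mu> * T)"
    using pos by (intro sum_nonneg) auto
  then show ?thesis using pos by (simp add: load_def)
qed

definition scheme_path :: "nat \<Rightarrow> 'a \<Rightarrow> real \<Rightarrow> real" where
  "scheme_path N \<omega> = ipath \<mu> T N (\<lambda>k. gain N k / sqrt (real n) * cnoise N \<omega> k)"

lemma scheme_path_eq: "t \<in> {0..T} \<Longrightarrow>
    scheme_path N \<omega> t = ipath \<mu> T N (\<lambda>k. gain N k * cnoise N \<omega> k) t / sqrt (real n)"
  unfolding scheme_path_def by (simp flip: ipath_scale)

text \<open>After scaling, one jump of the queue has size \<open>1 / sqrt n\<close>; it is the only
  pathwise error that remains on fine grids. The multiples of \<open>load\<close> dominate all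
  differences, uniformly in the grid.\<close>

lemma queue_scheme_expectation:
  assumes F: "F \<in> Sigma_class T"
  shows "\<exists>\<epsilon>. \<epsilon> \<longlonglongrightarrow> 0 \<and> (\<forall>j. \<bar>expectation (\<lambda>\<omega>. F (sample_path T (Z_n lam \<mu> n L) \<omega>))
    - expectation (\<lambda>\<omega>. F (scheme_path (2^j) \<omega>))\<bar> \<le> 1 / sqrt (real n) + \<epsilon> j)"
proof -
  let ?s = "sqrt (real n)" and ?K = "exp (\<mu> * T)" and ?Z = "\<lambda>\<omega>. sample_path T (Z_n lam \<mu> n L) \<omega>"
  have s: "?s > 0" "?s * ?s = real n" using pos by auto
  have T0: "0 \<le> T" using pos by simp
  have Z: "?Z \<omega> t = (real n * L t \<omega> - real n * fluid_limit lam \<mu> t) / ?s" if "t \<in> {0..T}" for t \<omega>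
    using that s by (simp add: sample_path_def Z_n_def field_simps)
  have fc: "continuous_on UNIV (fluid_limit lam \<mu>)"
    unfolding fluid_limit_def[abs_def] Let_def by (intro continuous_intros)
  have ZD: "?Z \<omega> \<in> D_space T" if "\<omega> \<in> space M" for \<omega>
    unfolding D_space_def sample_path_def Z_n_def
    using cadlag_on_restrict_scale[OF cadlag_L[OF that] fc, of T ?s] by simp
  have SD: "scheme_path N \<omega> \<in> D_space T" for N \<omega> unfolding scheme_path_def by (rule ipath_D)
  \<comment> \<open>A common bound for the rescaled queue, its fluid limit and the scheme.\<close>
  define D where "D \<omega> = (load \<omega> + real n * (lam / \<mu>) + ?K * load \<omega>) / ?s" for \<omega>
  have iD: "integrable M D" unfolding D_def[abs_def] using load_integrable by simp
  have mV: "(\<lambda>\<omega>. F (?Z \<omega>)) \<in> borel_measurable M"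
    unfolding sample_path_def
  proof (rule Sigma_class_measurable[OF F])
    show "Z_n lam \<mu> n L t \<in> borel_measurable M" if "t \<in> {0..T}" for t
      unfolding Z_n_def[abs_def] using measurable_L[of t] that by (intro borel_measurable_times borel_measurable_diff) auto
  qed (use ZD in \<open>simp add: sample_path_def\<close>)
  have mW: "(\<lambda>\<omega>. F (scheme_path N \<omega>)) \<in> borel_measurable M" for N
    unfolding scheme_path_def by (rule Sigma_class_ipath_measurable[OF F]) (use cnoise_measurable in auto)
  have path_le: "AE \<omega> in M. \<forall>t\<in>{0..T}. \<bar>scheme_path N \<omega> t\<bar> \<le> ?K * load \<omega> / ?s \<and> \<bar>?Z \<omega> t - scheme_path N \<omega> t\<bar> \<le> D \<omega>"
    if N: "N > 0" for N
    using AE_counting AE_queue_bounds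
  proof eventually_elim
    case (elim \<omega>)
    show ?case
    proof
      fix t assume t: "t \<in> {0..T}"
      have 1: "\<bar>ipath \<mu> T N (\<lambda>k. gain N k * cnoise N \<omega> k) t\<bar> \<le> ?K * load \<omega>"
        by (rule order_trans[OF ipath_abs_le[OF pos(2) t] gain_noise_le[OF elim(1) N order_refl]])
      have f: "0 \<le> fluid_limit lam \<mu> t" "fluid_limit lam \<mu> t \<le> lam / \<mu>"
        using fluid_limit_bounds[OF pos(1,2)] t by auto
      have "0 \<le> real n * fluid_limit lam \<mu> t" "real n * fluid_limit lam \<mu> t \<le> real n * (lam / \<mu>)"
        using f mult_left_mono[OF f(2), of "real n"] by auto
      then have 2: "\<bar>(real n * L t \<omega> - real n * fluid_limit lam \<mu> t) - ipath \<mu> T N (\<lambda>k. gain N k * cnoise N \<omega> k) t\<bar>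
          \<le> load \<omega> + real n * (lam / \<mu>) + ?K * load \<omega>"
        using 1 elim(2) t clock_le_load[of \<omega>] by fastforce
      show "\<bar>scheme_path N \<omega> t\<bar> \<le> ?K * load \<omega> / ?s \<and> \<bar>?Z \<omega> t - scheme_path N \<omega> t\<bar> \<le> D \<omega>"
        unfolding Z[OF t] scheme_path_eq[OF t] D_def diff_divide_distrib[symmetric]
        using 1 2 s by (simp add: divide_right_mono)
    qed
  qed
  have iW: "integrable M (\<lambda>\<omega>. F (scheme_path N \<omega>))" if N: "N > 0" for N
  proof (rule Bochner_Integration.integrable_bound[OF _ mW])
    show "integrable M (\<lambda>\<omega>. \<bar>F (ipath \<mu> T N (\<lambda>_. 0))\<bar> + ?K * load \<omega> / ?s)" using load_integrable by simp
    show "AE \<omega> in M. norm (F (scheme_path N \<omega>)) \<le> norm (\<bar>F (ipath \<mu> T N (\<lambda>_. 0))\<bar> + ?K * load \<omega> / ?s)"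
      using path_le[OF N]
    proof eventually_elim
      case (elim \<omega>)
      have "\<bar>F (scheme_path N \<omega>) - F (ipath \<mu> T N (\<lambda>_. 0))\<bar> \<le> ?K * load \<omega> / ?s"
        by (rule Sigma_class_lipschitz[OF F pos(4) SD ipath_D]) (use elim in \<open>auto simp: ipath_def\<close>)
      then show ?case by auto
    qed
  qed
  show ?thesis
  proof (rule expectation_diff_limit(2)[OF mV mW _ iD])
    show "integrable M (\<lambda>\<omega>. F (scheme_path (2^j) \<omega>))" for j by (rule iW) simp
    fix j :: nat
    have "AE \<omega> in M. \<forall>t\<in>{0..T}. \<bar>?Z \<omega> t - scheme_path (2^j) \<omega> t\<bar> \<le> D \<omega>"
      using path_le[OF zero_less_power[OF zero_less_numeral]] by eventually_elim auto
    then show "AE \<omega> in M. \<bar>F (?Z \<omega>) - F (scheme_path (2^j) \<omega>)\<bar> \<le> D \<omega>"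
      using AE_space by eventually_elim (intro Sigma_class_lipschitz[OF F pos(4) ZD SD], auto)
  next
    show "AE \<omega> in M. \<exists>e. e \<longlonglongrightarrow> 0 \<and> (\<forall>\<^sub>F j in sequentially. \<bar>F (?Z \<omega>) - F (scheme_path (2^j) \<omega>)\<bar> \<le> 1 / ?s + e j)"
      using AE_scheme_close AE_space
    proof eventually_elim
      case (elim \<omega>)
      let ?e = "\<lambda>j. mesh_const (real (clock 0 T \<omega>)) * (T / 2^j) / ?s"
      have "(\<lambda>j. mesh_const (real (clock 0 T \<omega>)) * (T * (1 / 2) ^ j) / ?s) \<longlonglongrightarrow> mesh_const (real (clock 0 T \<omega>)) * (T * 0) / ?s"
        by (intro tendsto_intros LIMSEQ_power_zero) (use s in auto)
      then have e: "?e \<longlonglongrightarrow> 0" by (simp add: power_one_over field_simps)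
      have "\<forall>\<^sub>F j in sequentially. \<bar>F (?Z \<omega>) - F (scheme_path (2^j) \<omega>)\<bar> \<le> 1 / ?s + ?e j"
        using elim(1)
      proof eventually_elim
        case (elim j)
        show ?case
        proof (rule Sigma_class_lipschitz[OF F pos(4) ZD[OF \<open>\<omega> \<in> space M\<close>] SD])
          fix t assume t: "t \<in> {0..T}"
          have "\<bar>(real n * L t \<omega> - real n * fluid_limit lam \<mu> t)
              - ipath \<mu> T (2^j) (\<lambda>k. gain (2^j) k * cnoise (2^j) \<omega> k) t\<bar> / ?s
              \<le> (1 + mesh_const (real (clock 0 T \<omega>)) * (T / 2^j)) / ?s"
            using elim t s by (intro divide_right_mono) auto
          then show "\<bar>?Z \<omega> t - scheme_path (2^j) \<omega> t\<bar> \<le> 1 / ?s + ?e j"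
            unfolding Z[OF t] scheme_path_eq[OF t] diff_divide_distrib[symmetric]
            using s by (simp add: add_divide_distrib)
        qed
      qed
      then show ?case using e by blast
    qed
  qed (use s in auto)
qed

lemma scheme_error_measurable: "scheme_error N \<in> borel_measurable M"
proof -
  have [measurable]: "(\<lambda>\<omega>. euler (inc N \<omega>) k) \<in> borel_measurable M" for k
    by (rule euler_measurable) (rule inc_measurable)
  note [measurable] = cnoise_measurable
  show ?thesis unfolding scheme_error_def[abs_def] by measurable
qed

text \<open>The pathwise bound has a random constant that depends on the arrivals, so convergence of
  the means again goes through domination by \<open>load\<close>.\<close>

lemma scheme_error_limit: "(\<lambda>j. expectation (scheme_error (2^j))) \<longlonglongrightarrow> 0"
proof -
  let ?K = "exp (\<mu> * T)"
  have "(\<lambda>j. expectation (scheme_error (2^j))) \<longlonglongrightarrow> expectation (\<lambda>_. 0)"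
  proof (rule integral_dominated_convergence[where w="\<lambda>\<omega>. T * (load \<omega> + real n * (lam / \<mu>) + ?K * load \<omega>)"])
    show "integrable M (\<lambda>\<omega>. T * (load \<omega> + real n * (lam / \<mu>) + ?K * load \<omega>))" using load_integrable by simp
    show "AE \<omega> in M. (\<lambda>j. scheme_error (2^j) \<omega>) \<longlonglongrightarrow> 0"
      using AE_scheme_close
    proof eventually_elim
      case (elim \<omega>)
      let ?c = "mesh_const (real (clock 0 T \<omega>))"
      show ?case
      proof (rule tendsto_sandwich[of "\<lambda>_. 0" _ _ "\<lambda>j. T * ?c * (T / 2^j)"])
        have "(\<lambda>j. T * ?c * (T * (1 / 2) ^ j)) \<longlonglongrightarrow> T * ?c * (T * 0)"
          by (intro tendsto_intros LIMSEQ_power_zero) auto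
        then show "(\<lambda>j. T * ?c * (T / 2^j)) \<longlonglongrightarrow> 0" by (simp add: power_one_over field_simps)
        show "\<forall>\<^sub>F j in sequentially. scheme_error (2^j) \<omega> \<le> T * ?c * (T / 2^j)"
          using elim by (rule eventually_mono) auto
      qed (use pos in \<open>auto simp: scheme_error_def intro!: sum_nonneg always_eventually\<close>)
    qed
    fix j :: nat
    define N where "N = (2::nat)^j"
    have N: "N > 0" by (simp add: N_def)
    show "AE \<omega> in M. norm (scheme_error (2^j) \<omega>) \<le> T * (load \<omega> + real n * (lam / \<mu>) + ?K * load \<omega>)"
      using AE_counting unfolding N_def[symmetric]
    proof eventually_elim
      case (elim \<omega>)
      have "\<bar>real (nat \<lfloor>euler (inc N \<omega>) k\<rfloor>) - real n * fluid_limit lam \<mu> (grid T N k)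
          - exp (- \<mu> * grid T N k) * (\<Sum>j<k. gain N j * cnoise N \<omega> j)\<bar>
          \<le> load \<omega> + real n * (lam / \<mu>) + ?K * load \<omega>" if k: "k < N" for k
      proof -
        have 1: "real (nat \<lfloor>euler (inc N \<omega>) k\<rfloor>) \<le> load \<omega>" using noise_le_load(2)[OF elim N, of k] k by simp
        have f: "0 \<le> fluid_limit lam \<mu> (grid T N k)" "fluid_limit lam \<mu> (grid T N k) \<le> lam / \<mu>"
          using fluid_limit_bounds[OF pos(1,2)] grid_nonneg[OF pos(4)] by auto
        then have 2: "0 \<le> real n * fluid_limit lam \<mu> (grid T N k)"
            "real n * fluid_limit lam \<mu> (grid T N k) \<le> real n * (lam / \<mu>)"
          using mult_left_mono[OF f(2), of "real n"] by auto
        have "\<bar>\<Sum>j<k. gain N j * cnoise N \<omega> j\<bar> \<le> ?K * load \<omega>"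
          using sum_abs[of "\<lambda>j. gain N j * cnoise N \<omega> j" "{..<k}"] gain_noise_le[OF elim N, of k] k by linarith
        then have "exp (- \<mu> * grid T N k) * \<bar>\<Sum>j<k. gain N j * cnoise N \<omega> j\<bar> \<le> 1 * (?K * load \<omega>)"
          using pos grid_nonneg[OF pos(4), of N k] by (intro mult_mono) auto
        then have 3: "\<bar>exp (- \<mu> * grid T N k) * (\<Sum>j<k. gain N j * cnoise N \<omega> j)\<bar> \<le> ?K * load \<omega>"
          by (simp add: abs_mult)
        show ?thesis using 1 2 3 by linarith
      qed
      then have "scheme_error N \<omega> \<le> T / real N * (\<Sum>k<N. load \<omega> + real n * (lam / \<mu>) + ?K * load \<omega>)"
        unfolding scheme_error_def using pos by (intro mult_left_mono sum_mono) auto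
      also have "\<dots> = T * (load \<omega> + real n * (lam / \<mu>) + ?K * load \<omega>)" using N by simp
      finally have "scheme_error N \<omega> \<le> T * (load \<omega> + real n * (lam / \<mu>) + ?K * load \<omega>)" .
      moreover have "0 \<le> scheme_error N \<omega>" using pos by (auto simp: scheme_error_def intro!: mult_nonneg_nonneg sum_nonneg)
      ultimately show ?case by simp
    qed
  qed (use scheme_error_measurable in auto)
  then show ?thesis by simp
qed

end


section \<open>The limit process\<close>

lemma (in prob_space) normal_moments:
  assumes D: "distributed M lborel X (normal_density 0 \<sigma>)" and \<sigma>: "\<sigma> > 0"
  shows "integrable M (\<lambda>\<omega>. X \<omega> ^ 4)" "expectation X = 0" "expectation (\<lambda>\<omega>. X \<omega> ^ 2) = \<sigma>\<^sup>2"
    "expectation (\<lambda>\<omega>. \<bar>X \<omega>\<bar> ^ 3) \<le> 2 * \<sigma> ^ 3"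
proof -
  have X[measurable]: "X \<in> borel_measurable M"
    using distributed_measurable[OF D] by simp
  have i: "integrable M (\<lambda>\<omega>. X \<omega> ^ k)" for k
    using distributed_integrable[OF D, of "\<lambda>x. x ^ k"] integrable_normal_moment[OF \<sigma>, of 0 k] by simp
  have e: "expectation (\<lambda>\<omega>. X \<omega> ^ k) = (\<integral>x. normal_density 0 \<sigma> x * (x - 0) ^ k \<partial>lborel)" for k
    using distributed_integral[OF D, of "\<lambda>x. x ^ k"] by simp
  show "integrable M (\<lambda>\<omega>. X \<omega> ^ 4)" by (rule i)
  show "expectation X = 0" using e[of 1] integral_normal_moment_odd[OF \<sigma>, of 0 0] by simp
  show 2: "expectation (\<lambda>\<omega>. X \<omega> ^ 2) = \<sigma>\<^sup>2"
    using e[of 2] integral_normal_moment_even[OF \<sigma>, of 0 1] by (simp add: fact_numeral)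
  have 4: "expectation (\<lambda>\<omega>. X \<omega> ^ 4) = 3 * \<sigma> ^ 4"
    using e[of 4] integral_normal_moment_even[OF \<sigma>, of 0 2] by (simp add: fact_numeral power2_eq_square power4_eq_xxxx)
  \<comment> \<open>Weighting the arithmetic-geometric mean inequality by \<open>\<sigma>\<close>
    makes it homogeneous, so the second and fourth moments yield a multiple of
    \<open>\<sigma> ^ 3\<close>.\<close>
  have le: "\<bar>x\<bar> ^ 3 \<le> (\<sigma> * x ^ 2 + x ^ 4 / \<sigma>) / 2" for x :: real
  proof -
    have "0 \<le> \<bar>x\<bar>^2 * (\<sigma> - \<bar>x\<bar>) ^ 2 / \<sigma>" using \<sigma> by simp
    also have "\<bar>x\<bar>^2 * (\<sigma> - \<bar>x\<bar>) ^ 2 = \<sigma>^2 * \<bar>x\<bar>^2 + \<bar>x\<bar>^4 - 2 * \<sigma> * \<bar>x\<bar>^3"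
      by (simp only: power2_eq_square power3_eq_cube power4_eq_xxxx) (simp add: algebra_simps)
    also have "\<dots> / \<sigma> = \<sigma> * x ^ 2 + x ^ 4 / \<sigma> - 2 * \<bar>x\<bar>^3"
      using \<sigma> by (simp add: field_simps power2_eq_square)
    finally show ?thesis by simp
  qed
  have "expectation (\<lambda>\<omega>. \<bar>X \<omega>\<bar> ^ 3) \<le> expectation (\<lambda>\<omega>. (\<sigma> * X \<omega> ^ 2 + X \<omega> ^ 4 / \<sigma>) / 2)"
    using i[of 2] i[of 4] integrable_abs[OF i[of 3]] le by (intro integral_mono) (auto simp: power_abs)
  also have "\<dots> = (\<sigma> * \<sigma>\<^sup>2 + 3 * \<sigma> ^ 4 / \<sigma>) / 2" using 2 4 i[of 2] i[of 4] by simp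
  also have "\<dots> = 2 * \<sigma> ^ 3" using \<sigma> by (simp add: power2_eq_square power3_eq_cube power4_eq_xxxx)
  finally show "expectation (\<lambda>\<omega>. \<bar>X \<omega>\<bar> ^ 3) \<le> 2 * \<sigma> ^ 3" .
qed

section \<open>Brownian integrals of step functions\<close>

context brownian_motion
begin

lemma increment_square:
  assumes "0 \<le> s" "0 \<le> t"
  shows "integrable M (\<lambda>\<omega>. (B t \<omega> - B s \<omega>) ^ 2)" "expectation (\<lambda>\<omega>. (B t \<omega> - B s \<omega>) ^ 2) = \<bar>t - s\<bar>"
proof -
  have main: "integrable M (\<lambda>\<omega>. (B t \<omega> - B s \<omega>) ^ 2) \<and> expectation (\<lambda>\<omega>. (B t \<omega> - B s \<omega>) ^ 2) = t - s"
    if "0 \<le> s" "s < t" for s t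
  proof -
    have m: "(\<lambda>\<omega>. B t \<omega> - B s \<omega>) \<in> borel_measurable M"
      using measurable_B[of s] measurable_B[of t] that by simp
    note n = normal_moments[OF normal_increments[OF that]]
    have "integrable M (\<lambda>\<omega>. (B t \<omega> - B s \<omega>) ^ 2)"
      by (rule integrable_power_le4[OF m n(1)]) (use that in auto)
    then show ?thesis using n(3) that by simp
  qed
  have sym: "(B t \<omega> - B s \<omega>) ^ 2 = (B s \<omega> - B t \<omega>) ^ 2" for \<omega> by (rule power2_commute)
  consider "s < t" | "s = t" | "t < s" by linarith
  then show "integrable M (\<lambda>\<omega>. (B t \<omega> - B s \<omega>) ^ 2)" "expectation (\<lambda>\<omega>. (B t \<omega> - B s \<omega>) ^ 2) = \<bar>t - s\<bar>"
    using main[of s t] main[of t s] assms sym by (cases; simp)+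
qed

lemma increment_measurable: "0 \<le> s \<Longrightarrow> 0 \<le> t \<Longrightarrow> (\<lambda>\<omega>. B t \<omega> - B s \<omega>) \<in> borel_measurable M"
  using measurable_B by simp

text \<open>Polarization writes the product of two increments through four squared increments, whose
  means are lengths; their combination is the length of the overlap of the two intervals.\<close>

lemma increment_covariance:
  assumes "0 \<le> x" "x \<le> y" "0 \<le> u" "u \<le> v"
  shows "expectation (\<lambda>\<omega>. (B y \<omega> - B x \<omega>) * (B v \<omega> - B u \<omega>))
    = (\<integral>s. indicator {x<..y} s * indicator {u<..v} s \<partial>lborel)"
proof -
  have eq: "(B y \<omega> - B x \<omega>) * (B v \<omega> - B u \<omega>) = ((B y \<omega> - B u \<omega>) ^ 2 + (B v \<omega> - B x \<omega>) ^ 2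
      - (B y \<omega> - B v \<omega>) ^ 2 - (B x \<omega> - B u \<omega>) ^ 2) / 2" for \<omega>
    by (simp add: power2_eq_square algebra_simps)
  have "expectation (\<lambda>\<omega>. (B y \<omega> - B x \<omega>) * (B v \<omega> - B u \<omega>)) = (\<bar>y - u\<bar> + \<bar>v - x\<bar> - \<bar>y - v\<bar> - \<bar>x - u\<bar>) / 2"
    unfolding eq using increment_square assms by simp
  also have "\<dots> = max 0 (min y v - max x u)" using assms by (auto simp: abs_if max_def min_def)
  also have "\<dots> = measure lborel {max x u<..min y v}"
    by (cases "max x u \<le> min y v") (auto simp: max_def)
  also have "\<dots> = (\<integral>s. indicator {max x u<..min y v} s \<partial>lborel)" by simp
  also have "\<dots> = (\<integral>s. indicator {x<..y} s * indicator {u<..v} s \<partial>lborel)"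
    by (rule Bochner_Integration.integral_cong) (auto simp: indicator_def)
  finally show ?thesis .
qed

text \<open>A step function together with its Brownian integral, built one interval at a time. The
  intervals may overlap, so step functions on different partitions can be combined without a common
  refinement.\<close>

inductive step_pair :: "(real \<Rightarrow> real) \<Rightarrow> ('a \<Rightarrow> real) \<Rightarrow> bool" where
  zero: "step_pair (\<lambda>_. 0) (\<lambda>_. 0)"
| add: "step_pair \<phi> Y \<Longrightarrow> 0 \<le> x \<Longrightarrow> x \<le> y \<Longrightarrow>
    step_pair (\<lambda>s. \<phi> s + c * indicator {x<..y} s) (\<lambda>\<omega>. Y \<omega> + c * (B y \<omega> - B x \<omega>))"

lemma step_pair_square_integrable:
  assumes "step_pair \<phi> Y"
  shows "\<phi> \<in> borel_measurable borel \<and> integrable lborel (\<lambda>s. \<phi> s ^ 2) \<and>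
    Y \<in> borel_measurable M \<and> integrable M (\<lambda>\<omega>. Y \<omega> ^ 2)"
  using assms
proof induction
  case (add \<phi> Y x y c)
  have [measurable]: "\<phi> \<in> borel_measurable borel" "Y \<in> borel_measurable M"
    "(\<lambda>\<omega>. B y \<omega> - B x \<omega>) \<in> borel_measurable M"
    using add increment_measurable by auto
  have i: "integrable lborel (\<lambda>s. \<phi> s ^ 2)" "integrable M (\<lambda>\<omega>. Y \<omega> ^ 2)"
    "integrable M (\<lambda>\<omega>. (B y \<omega> - B x \<omega>) ^ 2)" "integrable lborel (\<lambda>s. indicator {x<..y} s ^ 2 :: real)"
  proof -
    have "(\<lambda>s. indicator {x<..y} s ^ 2 :: real) = indicator {x<..y}" by (auto simp: indicator_def)
    then show "integrable lborel (\<lambda>s. indicator {x<..y} s ^ 2 :: real)"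
      using add by (simp add: integrable_real_indicator)
  qed (use add increment_square in auto)
  have "integrable lborel (\<lambda>s. \<phi> s ^ 2 + c\<^sup>2 * indicator {x<..y} s ^ 2 + 2 * c * (\<phi> s * indicator {x<..y} s))"
    by (intro Bochner_Integration.integrable_add integrable_mult_right i integrable_mult_of_squares) auto
  moreover have "integrable M (\<lambda>\<omega>. Y \<omega> ^ 2 + c\<^sup>2 * (B y \<omega> - B x \<omega>) ^ 2 + 2 * c * (Y \<omega> * (B y \<omega> - B x \<omega>)))"
    by (intro Bochner_Integration.integrable_add integrable_mult_right i integrable_mult_of_squares) auto
  ultimately show ?case by (auto simp: power2_sum power_mult_distrib mult_ac)
qed auto

text \<open>Both sides are bilinear; induction on the two pairs in turn reduces the claim to two
  intervals, which is \<open>increment_covariance\<close>.\<close>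

lemma step_pair_isometry:
  assumes "step_pair \<phi> Y" "step_pair \<phi>' Y'"
  shows "expectation (\<lambda>\<omega>. Y \<omega> * Y' \<omega>) = (\<integral>s. \<phi> s * \<phi>' s \<partial>lborel)"
  using assms(2)
proof induction
  case (add \<phi>' Y' u v d)
  have base: "step_pair (indicator {x<..y}) (\<lambda>\<omega>. B y \<omega> - B x \<omega>)" if "0 \<le> x" "x \<le> y" for x y
    using step_pair.add[OF zero that, of 1] by simp
  have i: "integrable M (\<lambda>\<omega>. Y \<omega> * Y' \<omega>)" "integrable lborel (\<lambda>s. \<phi> s * \<phi>' s)"
    if "step_pair \<phi> Y" "step_pair \<phi>' Y'" for \<phi> \<phi>' Y Y'
    using step_pair_square_integrable[OF that(1)] step_pair_square_integrable[OF that(2)]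
    by (auto intro!: integrable_mult_of_squares)
  note b = base[OF add(2,3)]
  have "expectation (\<lambda>\<omega>. Y \<omega> * (B v \<omega> - B u \<omega>)) = (\<integral>s. \<phi> s * indicator {u<..v} s \<partial>lborel)"
    using assms(1)
  proof induction
    case (add \<phi> Y x y c)
    have "expectation (\<lambda>\<omega>. (Y \<omega> + c * (B y \<omega> - B x \<omega>)) * (B v \<omega> - B u \<omega>))
        = expectation (\<lambda>\<omega>. Y \<omega> * (B v \<omega> - B u \<omega>) + c * ((B y \<omega> - B x \<omega>) * (B v \<omega> - B u \<omega>)))"
      by (simp add: algebra_simps)
    also have "\<dots> = expectation (\<lambda>\<omega>. Y \<omega> * (B v \<omega> - B u \<omega>)) + c * expectation (\<lambda>\<omega>. (B y \<omega> - B x \<omega>) * (B v \<omega> - B u \<omega>))"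
      using i(1)[OF add(1) b] i(1)[OF base[OF add(2,3)] b] by simp
    also have "\<dots> = (\<integral>s. \<phi> s * indicator {u<..v} s \<partial>lborel) + c * (\<integral>s. indicator {x<..y} s * indicator {u<..v} s \<partial>lborel)"
      using add increment_covariance[OF add(2,3) \<open>0 \<le> u\<close> \<open>u \<le> v\<close>] by simp
    also have "\<dots> = (\<integral>s. \<phi> s * indicator {u<..v} s + c * (indicator {x<..y} s * indicator {u<..v} s) \<partial>lborel)"
      using i(2)[OF add(1) b] i(2)[OF base[OF add(2,3)] b] by simp
    also have "\<dots> = (\<integral>s. (\<phi> s + c * indicator {x<..y} s) * indicator {u<..v} s \<partial>lborel)"
      by (simp add: algebra_simps)
    finally show ?case .
  qed simp
  moreover have "expectation (\<lambda>\<omega>. Y \<omega> * (Y' \<omega> + d * (B v \<omega> - B u \<omega>)))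
      = expectation (\<lambda>\<omega>. Y \<omega> * Y' \<omega>) + d * expectation (\<lambda>\<omega>. Y \<omega> * (B v \<omega> - B u \<omega>))"
    using i(1)[OF assms(1) add(1)] i(1)[OF assms(1) b]
    by (simp only: distrib_left mult.left_commute[of _ d]) simp
  moreover have "(\<integral>s. \<phi> s * (\<phi>' s + d * indicator {u<..v} s) \<partial>lborel)
      = (\<integral>s. \<phi> s * \<phi>' s \<partial>lborel) + d * (\<integral>s. \<phi> s * indicator {u<..v} s \<partial>lborel)"
    using i(2)[OF assms(1) add(1)] i(2)[OF assms(1) b]
    by (simp only: distrib_left mult.left_commute[of _ d]) simp
  ultimately show ?case using add.IH by simp
qed simp

lemma step_pair_nn_isometry:
  assumes "step_pair \<phi> Y"
  shows "(\<integral>\<^sup>+\<omega>. ennreal (Y \<omega> ^ 2) \<partial>M) = (\<integral>\<^sup>+s. ennreal (\<phi> s ^ 2) \<partial>lborel)"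
  using step_pair_square_integrable[OF assms] step_pair_isometry[OF assms assms]
  by (simp add: nn_integral_eq_integral power2_eq_square)

lemma step_pair_add_step:
  assumes p: "mono p" "range p \<subseteq> {0..t}" and Y: "step_pair \<phi> Y"
  shows "step_pair (\<lambda>s. \<phi> s + c * step_fun k p a s) (\<lambda>\<omega>. Y \<omega> + c * step_integral B k p a \<omega>)"
proof (induction k)
  case 0
  show ?case using Y by (simp add: step_fun_def step_integral_def)
next
  case (Suc k)
  have "0 \<le> p k" "p k \<le> p (Suc k)" using subsetD[OF p(2) rangeI, of k] monoD[OF p(1), of k "Suc k"] by auto
  from step_pair.add[OF Suc this, of "c * a k"] show ?case
    by (simp add: step_fun_def step_integral_def algebra_simps)
qed

lemma step_fun_outside:
  assumes "range p \<subseteq> {0..t}" "s \<notin> {0..t}"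
  shows "step_fun k p a s = 0"
proof -
  have "p j \<in> {0..t}" for j by (rule subsetD[OF assms(1) rangeI])
  then have "s \<notin> {p j<..p (Suc j)}" for j
    using assms(2) by (metis atLeastAtMost_iff greaterThanAtMost_iff less_imp_le order_trans)
  then show ?thesis unfolding step_fun_def by simp
qed

lemma step_fun_measurable: "step_fun k p a \<in> borel_measurable borel"
  unfolding step_fun_def[abs_def] by measurable

end

section \<open>Approximation of the limit process on a grid\<close>

locale limit_on_interval = limit_process M lam \<mu> T B Z
  for M :: "'a measure" and lam \<mu> T :: real and B :: "real \<Rightarrow> 'a \<Rightarrow> real" and Z :: "real \<Rightarrow> 'a \<Rightarrow> real" +
  assumes pos: "lam > 0" "\<mu> > 0" "T > 0"
begin

definition kernel :: "real \<Rightarrow> real \<Rightarrow> real" where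
  "kernel t u = exp (- \<mu> * (t - u)) * sqrt (h_fun lam \<mu> u)"

lemma kernel_measurable: "kernel t \<in> borel_measurable borel"
  unfolding kernel_def[abs_def] h_fun_def by measurable

text \<open>Because the exponential factorizes, the part of the integral for \<open>Z t\<close> up
  to time \<open>s\<close> is a multiple of \<open>Z s\<close>.\<close>

lemma kernel_shift: "kernel t u = exp (- \<mu> * (t - s)) * kernel s u"
  by (simp add: kernel_def algebra_simps flip: exp_add mult.assoc)

lemma Z_measurable: "t \<in> {0..T} \<Longrightarrow> Z t \<in> borel_measurable M"
  using wiener_Z by (simp add: is_wiener_integral_def)

text \<open>What remains after subtracting the multiple of \<open>Z s\<close> is the integral of the
  kernel over \<open>{s<..t}\<close>, and there the kernel is within \<open>\<kappa>\<close> of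
  \<open>c\<close>. As \<open>Z t\<close> and \<open>Z s\<close> are known only as mean square
  limits with unrelated step functions, the isometry is applied to the approximations and the limit
  is taken last. The factor 9 comes from splitting a square into three parts twice.\<close>

lemma increment_approx:
  assumes st: "0 \<le> s" "s < t" "t \<le> T" and \<kappa>: "\<And>u. s < u \<Longrightarrow> u \<le> t \<Longrightarrow> \<bar>kernel t u - c\<bar> \<le> \<kappa>"
  shows "(\<integral>\<^sup>+\<omega>. ennreal ((Z t \<omega> - exp (- \<mu> * (t - s)) * Z s \<omega> - c * (B t \<omega> - B s \<omega>))\<^sup>2) \<partial>M)
    \<le> ennreal (9 * \<kappa>\<^sup>2 * (t - s))" (is "?I \<le> _")
proof -
  define e where "e = exp (- \<mu> * (t - s))"
  have e: "0 \<le> e" "e \<le> 1" using pos st by (auto simp: e_def)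
  have t: "t \<in> {0..T}" and s: "s \<in> {0..T}" using st by auto
  note mZ[measurable] = Z_measurable[OF t] Z_measurable[OF s]
  obtain k p a where kpa: "\<And>m. mono (p m)" "\<And>m. range (p m) \<subseteq> {0..t}"
    "(\<lambda>m. \<integral>\<^sup>+u\<in>{0..t}. ennreal ((kernel t u - step_fun (k m) (p m) (a m) u)\<^sup>2) \<partial>lborel) \<longlonglongrightarrow> 0"
    "(\<lambda>m. \<integral>\<^sup>+\<omega>. ennreal ((Z t \<omega> - step_integral B (k m) (p m) (a m) \<omega>)\<^sup>2) \<partial>M) \<longlonglongrightarrow> 0"
    using wiener_Z[OF t] unfolding is_wiener_integral_def kernel_def by blast
  obtain k' p' a' where kpa': "\<And>m. mono (p' m)" "\<And>m. range (p' m) \<subseteq> {0..s}"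
    "(\<lambda>m. \<integral>\<^sup>+u\<in>{0..s}. ennreal ((kernel s u - step_fun (k' m) (p' m) (a' m) u)\<^sup>2) \<partial>lborel) \<longlonglongrightarrow> 0"
    "(\<lambda>m. \<integral>\<^sup>+\<omega>. ennreal ((Z s \<omega> - step_integral B (k' m) (p' m) (a' m) \<omega>)\<^sup>2) \<partial>M) \<longlonglongrightarrow> 0"
    using wiener_Z[OF s] unfolding is_wiener_integral_def kernel_def by blast
  define f f' where "f m = step_fun (k m) (p m) (a m)" and "f' m = step_fun (k' m) (p' m) (a' m)" for m
  define J J' where "J m = step_integral B (k m) (p m) (a m)" and "J' m = step_integral B (k' m) (p' m) (a' m)" for m
  define \<phi> where "\<phi> m u = ((0 + 1 * f m u) + (- e) * f' m u) + (- c) * indicator {s<..t} u" for m u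
  define Y where "Y m \<omega> = ((0 + 1 * J m \<omega>) + (- e) * J' m \<omega>) + (- c) * (B t \<omega> - B s \<omega>)" for m \<omega>
  have sp: "step_pair (\<phi> m) (Y m)" for m
    unfolding \<phi>_def[abs_def] Y_def[abs_def] f_def f'_def J_def J'_def
    using st by (intro step_pair.add step_pair_add_step[OF kpa(1,2)] step_pair_add_step[OF kpa'(1,2)] step_pair.zero) auto
  have sJ: "step_pair (\<lambda>u. 0 + 1 * f m u) (\<lambda>\<omega>. 0 + 1 * J m \<omega>)" "step_pair (\<lambda>u. 0 + 1 * f' m u) (\<lambda>\<omega>. 0 + 1 * J' m \<omega>)" for m
    unfolding f_def f'_def J_def J'_def
    by (intro step_pair_add_step[OF kpa(1,2)] step_pair_add_step[OF kpa'(1,2)] step_pair.zero)+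
  have [measurable]: "J m \<in> borel_measurable M" "J' m \<in> borel_measurable M" "Y m \<in> borel_measurable M"
      "\<phi> m \<in> borel_measurable borel" for m
    using step_pair_square_integrable[OF sJ(1)] step_pair_square_integrable[OF sJ(2)]
      step_pair_square_integrable[OF sp] by auto
  have [measurable]: "f m \<in> borel_measurable borel" "f' m \<in> borel_measurable borel" for m
    unfolding f_def f'_def by (rule step_fun_measurable)+
  note [measurable] = kernel_measurable
  have three: "(x + y + z)\<^sup>2 \<le> 3 * x\<^sup>2 + 3 * y\<^sup>2 + 3 * z\<^sup>2" for x y z :: real
    using zero_le_power2[of "x - y"] zero_le_power2[of "y - z"] zero_le_power2[of "x - z"]
    by (simp add: power2_eq_square algebra_simps)
  have esq: "(e * x)\<^sup>2 \<le> x\<^sup>2" for x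
    using e by (simp add: power_mult_distrib mult_le_cancel_right1 power_le_one mult_left_le_one_le)
  define x x' where "x m = (\<integral>\<^sup>+u\<in>{0..t}. ennreal ((kernel t u - f m u)\<^sup>2) \<partial>lborel)"
    and "x' m = (\<integral>\<^sup>+u\<in>{0..s}. ennreal ((kernel s u - f' m u)\<^sup>2) \<partial>lborel)" for m
  define X X' where "X m = (\<integral>\<^sup>+\<omega>. ennreal ((Z t \<omega> - J m \<omega>)\<^sup>2) \<partial>M)"
    and "X' m = (\<integral>\<^sup>+\<omega>. ennreal ((Z s \<omega> - J' m \<omega>)\<^sup>2) \<partial>M)" for m
  have Y_le: "(\<integral>\<^sup>+\<omega>. ennreal ((Y m \<omega>)\<^sup>2) \<partial>M) \<le> 3 * x m + 3 * x' m + ennreal (3 * \<kappa>\<^sup>2 * (t - s))" for m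
  proof -
    have pw: "ennreal ((\<phi> m u)\<^sup>2) \<le> 3 * (ennreal ((kernel t u - f m u)\<^sup>2) * indicator {0..t} u)
        + 3 * (ennreal ((kernel s u - f' m u)\<^sup>2) * indicator {0..s} u) + ennreal (3 * \<kappa>\<^sup>2) * indicator {s<..t} u" for u
    proof -
      \<comment> \<open>Outside \<open>{0..t}\<close> everything vanishes, up to time
        \<open>s\<close> the two kernels cancel by \<open>kernel_shift\<close>, and on
        \<open>{s<..t}\<close> the kernel is compared with \<open>c\<close>.\<close>
      consider "u \<notin> {0..t}" | "u \<in> {0..s}" | "u \<in> {s<..t}" using st by force
      then show ?thesis
      proof cases
        case 1
        then have "f m u = 0" "f' m u = 0"
          unfolding f_def f'_def using step_fun_outside[OF kpa(2)] step_fun_outside[OF kpa'(2)] st by auto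
        moreover have "u \<notin> {s<..t}" using 1 st by auto
        ultimately have "\<phi> m u = 0" by (simp add: \<phi>_def)
        then show ?thesis by simp
      next
        case 2
        have "\<phi> m u = - (kernel t u - f m u) + e * (kernel s u - f' m u) + 0"
          using 2 kernel_shift[of t u s] by (simp add: \<phi>_def e_def algebra_simps)
        then have "(\<phi> m u)\<^sup>2 \<le> 3 * (kernel t u - f m u)\<^sup>2 + 3 * (e * (kernel s u - f' m u))\<^sup>2"
          using three[of "- (kernel t u - f m u)" "e * (kernel s u - f' m u)" 0] by (simp add: power2_commute)
        also have "\<dots> \<le> 3 * (kernel t u - f m u)\<^sup>2 + 3 * (kernel s u - f' m u)\<^sup>2"
          using esq by simp
        finally have "ennreal ((\<phi> m u)\<^sup>2) \<le> ennreal (3 * (kernel t u - f m u)\<^sup>2 + 3 * (kernel s u - f' m u)\<^sup>2)"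
          by (rule ennreal_leI)
        then show ?thesis using 2 st by (simp add: ennreal_plus ennreal_mult)
      next
        case 3
        then have f': "f' m u = 0" unfolding f'_def using step_fun_outside[OF kpa'(2)] by auto
        have "\<phi> m u = - (kernel t u - f m u) + (kernel t u - c) + 0"
          using 3 f' by (simp add: \<phi>_def)
        then have "(\<phi> m u)\<^sup>2 \<le> 3 * (kernel t u - f m u)\<^sup>2 + 3 * (kernel t u - c)\<^sup>2"
          using three[of "- (kernel t u - f m u)" "kernel t u - c" 0] by (simp add: power2_commute)
        also have "(kernel t u - c)\<^sup>2 \<le> \<kappa>\<^sup>2"
          using \<kappa>[of u] 3 by (intro power2_le_iff_abs_le[THEN iffD2]) auto
        finally have "ennreal ((\<phi> m u)\<^sup>2) \<le> ennreal (3 * (kernel t u - f m u)\<^sup>2 + 3 * \<kappa>\<^sup>2)"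
          by (intro ennreal_leI) simp
        then show ?thesis using 3 st by (simp add: ennreal_plus ennreal_mult)
      qed
    qed
    have "(\<integral>\<^sup>+\<omega>. ennreal ((Y m \<omega>)\<^sup>2) \<partial>M) = (\<integral>\<^sup>+u. ennreal ((\<phi> m u)\<^sup>2) \<partial>lborel)"
      by (rule step_pair_nn_isometry[OF sp])
    also have "\<dots> \<le> (\<integral>\<^sup>+u. 3 * (ennreal ((kernel t u - f m u)\<^sup>2) * indicator {0..t} u)
        + 3 * (ennreal ((kernel s u - f' m u)\<^sup>2) * indicator {0..s} u) + ennreal (3 * \<kappa>\<^sup>2) * indicator {s<..t} u \<partial>lborel)"
      by (rule nn_integral_mono) (rule pw)
    also have "\<dots> = 3 * x m + 3 * x' m + ennreal (3 * \<kappa>\<^sup>2) * emeasure lborel {s<..t}"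
      unfolding x_def x'_def by (simp add: nn_integral_add nn_integral_cmult)
    also have "ennreal (3 * \<kappa>\<^sup>2) * emeasure lborel {s<..t} = ennreal (3 * \<kappa>\<^sup>2 * (t - s))"
      using st by (simp add: ennreal_mult)
    finally show ?thesis .
  qed
  have main: "?I \<le> 3 * X m + 3 * X' m + 3 * (3 * x m + 3 * x' m + ennreal (3 * \<kappa>\<^sup>2 * (t - s)))" for m
  proof -
    have pw: "ennreal ((Z t \<omega> - exp (- \<mu> * (t - s)) * Z s \<omega> - c * (B t \<omega> - B s \<omega>))\<^sup>2)
        \<le> 3 * ennreal ((Z t \<omega> - J m \<omega>)\<^sup>2) + 3 * ennreal ((Z s \<omega> - J' m \<omega>)\<^sup>2) + 3 * ennreal ((Y m \<omega>)\<^sup>2)" for \<omega>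
    proof -
      have "Z t \<omega> - exp (- \<mu> * (t - s)) * Z s \<omega> - c * (B t \<omega> - B s \<omega>)
          = (Z t \<omega> - J m \<omega>) + e * (- (Z s \<omega> - J' m \<omega>)) + Y m \<omega>"
        by (simp add: Y_def e_def algebra_simps)
      then have "(Z t \<omega> - exp (- \<mu> * (t - s)) * Z s \<omega> - c * (B t \<omega> - B s \<omega>))\<^sup>2
          \<le> 3 * (Z t \<omega> - J m \<omega>)\<^sup>2 + 3 * (e * (- (Z s \<omega> - J' m \<omega>)))\<^sup>2 + 3 * (Y m \<omega>)\<^sup>2"
        using three by presburger
      also have "\<dots> \<le> 3 * (Z t \<omega> - J m \<omega>)\<^sup>2 + 3 * (Z s \<omega> - J' m \<omega>)\<^sup>2 + 3 * (Y m \<omega>)\<^sup>2"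
        using esq[of "- (Z s \<omega> - J' m \<omega>)"] by (simp add: power2_commute)
      finally have "ennreal ((Z t \<omega> - exp (- \<mu> * (t - s)) * Z s \<omega> - c * (B t \<omega> - B s \<omega>))\<^sup>2)
          \<le> ennreal (3 * (Z t \<omega> - J m \<omega>)\<^sup>2 + 3 * (Z s \<omega> - J' m \<omega>)\<^sup>2 + 3 * (Y m \<omega>)\<^sup>2)"
        by (rule ennreal_leI)
      then show ?thesis by (simp add: ennreal_plus ennreal_mult)
    qed
    have "?I \<le> (\<integral>\<^sup>+\<omega>. 3 * ennreal ((Z t \<omega> - J m \<omega>)\<^sup>2) + 3 * ennreal ((Z s \<omega> - J' m \<omega>)\<^sup>2) + 3 * ennreal ((Y m \<omega>)\<^sup>2) \<partial>M)"
      by (rule nn_integral_mono) (rule pw)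
    also have "\<dots> = 3 * X m + 3 * X' m + 3 * (\<integral>\<^sup>+\<omega>. ennreal ((Y m \<omega>)\<^sup>2) \<partial>M)"
      unfolding X_def X'_def by (simp add: nn_integral_add nn_integral_cmult)
    also have "\<dots> \<le> 3 * X m + 3 * X' m + 3 * (3 * x m + 3 * x' m + ennreal (3 * \<kappa>\<^sup>2 * (t - s)))"
      using Y_le by (intro add_left_mono mult_left_mono) auto
    finally show ?thesis .
  qed
  have lims: "X \<longlonglongrightarrow> 0" "X' \<longlonglongrightarrow> 0" "x \<longlonglongrightarrow> 0" "x' \<longlonglongrightarrow> 0"
    using kpa kpa' unfolding X_def[abs_def] X'_def[abs_def] x_def[abs_def] x'_def[abs_def] f_def f'_def J_def J'_def by auto
  have "(\<lambda>m. 3 * X m + 3 * X' m + 3 * (3 * x m + 3 * x' m + ennreal (3 * \<kappa>\<^sup>2 * (t - s))))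
      \<longlonglongrightarrow> 3 * 0 + 3 * 0 + 3 * (3 * 0 + 3 * 0 + ennreal (3 * \<kappa>\<^sup>2 * (t - s)))"
    by (intro tendsto_add ennreal_tendsto_cmult tendsto_const lims) auto
  then have "?I \<le> 3 * 0 + 3 * 0 + 3 * (3 * 0 + 3 * 0 + ennreal (3 * \<kappa>\<^sup>2 * (t - s)))"
    by (rule LIMSEQ_le_const) (use main in auto)
  also have "\<dots> = ennreal 3 * ennreal (3 * \<kappa>\<^sup>2 * (t - s))" by simp
  also have "\<dots> = ennreal (9 * \<kappa>\<^sup>2 * (t - s))" using st by (subst ennreal_mult[symmetric]) auto
  finally show ?thesis .
qed

lemma Z_0: "AE \<omega> in M. Z 0 \<omega> = 0"
proof -
  have 0: "0 \<in> {0..T}" using pos by simp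
  obtain k p a where kpa: "\<And>m. range (p m) \<subseteq> {0..0::real}"
    "(\<lambda>m. \<integral>\<^sup>+\<omega>. ennreal ((Z 0 \<omega> - step_integral B (k m) (p m) (a m) \<omega>)\<^sup>2) \<partial>M) \<longlonglongrightarrow> 0"
    using wiener_Z[OF 0] unfolding is_wiener_integral_def by blast
  have "p m j = 0" for m j using subsetD[OF kpa(1) rangeI, of m j] by simp
  then have "step_integral B (k m) (p m) (a m) \<omega> = 0" for m \<omega>
    by (simp add: step_integral_def)
  then have "(\<integral>\<^sup>+\<omega>. ennreal ((Z 0 \<omega>)\<^sup>2) \<partial>M) = 0"
    using kpa(2) by (simp add: LIMSEQ_const_iff)
  then show ?thesis
    using Z_measurable[OF 0] by (subst (asm) nn_integral_0_iff_AE) (auto elim: eventually_mono)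
qed

definition kernel_const :: real where
  "kernel_const = \<mu> * sqrt (2 * lam) + lam * \<mu> / sqrt lam"

lemma h_fun_bounds: "0 \<le> u \<Longrightarrow> lam \<le> h_fun lam \<mu> u \<and> h_fun lam \<mu> u \<le> 2 * lam"
  using pos by (simp add: h_fun_def mult_le_cancel_left1 mult_left_mono)

lemma one_minus_exp_le: "0 \<le> x \<Longrightarrow> 0 \<le> 1 - exp (- x) \<and> 1 - exp (- x) \<le> x" for x :: real
  using exp_ge_add_one_self[of "- x"] by simp

lemma kernel_const_nonneg: "0 \<le> kernel_const"
  using pos by (simp add: kernel_const_def)

text \<open>The two summands of \<open>kernel_const\<close> come from the exponential and from the
  square root of \<open>h_fun\<close>. The latter is Lipschitz because \<open>h_fun\<close> stays
  above \<open>lam\<close>, which bounds the sum of two roots from below.\<close>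

lemma kernel_close:
  assumes "0 \<le> s" "s \<le> u" "u \<le> t"
  shows "\<bar>kernel t u - sqrt (h_fun lam \<mu> s)\<bar> \<le> kernel_const * (t - s)"
proof -
  define g where "g = exp (- \<mu> * (t - u))"
  have hu: "lam \<le> h_fun lam \<mu> u" "h_fun lam \<mu> u \<le> 2 * lam" and hs: "lam \<le> h_fun lam \<mu> s"
    using h_fun_bounds assms by auto
  have "0 \<le> \<mu> * (t - u)" using pos assms by simp
  from one_minus_exp_le[OF this] have "0 \<le> 1 - g" "1 - g \<le> \<mu> * (t - u)" by (auto simp: g_def)
  moreover have "\<mu> * (t - u) \<le> \<mu> * (t - s)" using pos assms by simp
  ultimately have g2: "0 \<le> 1 - g" "1 - g \<le> \<mu> * (t - s)" by linarith+
  then have "(1 - g) * sqrt (h_fun lam \<mu> u) \<le> (\<mu> * (t - s)) * sqrt (2 * lam)" and g1: "0 \<le> 1 - g"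
    using hu pos by (auto intro!: mult_mono simp del: le_diff_eq diff_le_eq)
  then have 1: "\<bar>g * sqrt (h_fun lam \<mu> u) - sqrt (h_fun lam \<mu> u)\<bar> \<le> \<mu> * sqrt (2 * lam) * (t - s)"
  proof -
    have "\<bar>g * sqrt (h_fun lam \<mu> u) - sqrt (h_fun lam \<mu> u)\<bar> = (1 - g) * sqrt (h_fun lam \<mu> u)"
      using g1 hu pos by (simp add: abs_if algebra_simps mult_left_le_one_le)
    then show ?thesis using \<open>(1 - g) * sqrt (h_fun lam \<mu> u) \<le> (\<mu> * (t - s)) * sqrt (2 * lam)\<close> by (simp add: mult_ac)
  qed
  have 2: "\<bar>sqrt (h_fun lam \<mu> u) - sqrt (h_fun lam \<mu> s)\<bar> \<le> lam * \<mu> / sqrt lam * (t - s)"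
  proof -
    define A C where "A = sqrt (h_fun lam \<mu> u)" and "C = sqrt (h_fun lam \<mu> s)"
    have AC: "sqrt lam \<le> A" "0 \<le> C" "0 < sqrt lam" using hu hs pos by (auto simp: A_def C_def)
    have "(A - C) * (A + C) = h_fun lam \<mu> u - h_fun lam \<mu> s"
      using hu hs pos by (simp add: A_def C_def algebra_simps)
    also have "\<dots> = lam * (exp (- \<mu> * s) * (1 - exp (- (\<mu> * (u - s)))))"
      by (simp add: h_fun_def algebra_simps flip: exp_add)
    finally have eq: "(A - C) * (A + C) = lam * (exp (- \<mu> * s) * (1 - exp (- (\<mu> * (u - s)))))" .
    have "0 \<le> \<mu> * (u - s)" using pos assms by simp
    note om = one_minus_exp_le[OF this]
    have "exp (- \<mu> * s) * (1 - exp (- (\<mu> * (u - s)))) \<le> 1 * (\<mu> * (t - s))"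
    proof (intro mult_mono)
      have "\<mu> * (u - s) \<le> \<mu> * (t - s)" using assms pos by simp
      then show "1 - exp (- (\<mu> * (u - s))) \<le> \<mu> * (t - s)" using om by linarith
    qed (use om assms pos in auto)
    then have le: "(A - C) * (A + C) \<le> lam * (\<mu> * (t - s))" "0 \<le> (A - C) * (A + C)"
      unfolding eq using pos om by (auto intro!: mult_left_mono)
    have "0 \<le> A - C" using le(2) AC by (simp add: zero_le_mult_iff)
    have "\<bar>A - C\<bar> * sqrt lam \<le> \<bar>A - C\<bar> * (A + C)" using AC by (intro mult_left_mono) auto
    also have "\<dots> = (A - C) * (A + C)" using \<open>0 \<le> A - C\<close> by simp
    also have "\<dots> \<le> lam * (\<mu> * (t - s))" by (rule le)
    finally have "\<bar>A - C\<bar> \<le> lam * (\<mu> * (t - s)) / sqrt lam" using AC by (simp add: pos_le_divide_eq)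
    then show ?thesis by (simp add: A_def C_def mult_ac)
  qed
  have "kernel t u = g * sqrt (h_fun lam \<mu> u)" by (simp add: kernel_def g_def)
  then show ?thesis using 1 2 unfolding kernel_const_def distrib_right by linarith
qed

text \<open>The martingale form of the limit: the integral of
  \<open>exp (\<mu> s) * sqrt (h_fun lam \<mu> s)\<close> against Brownian motion, free of the
  drift.\<close>

definition X :: "real \<Rightarrow> 'a \<Rightarrow> real" where "X t \<omega> = exp (\<mu> * t) * Z t \<omega>"

definition dB :: "nat \<Rightarrow> nat \<Rightarrow> 'a \<Rightarrow> real" where
  "dB N k \<omega> = B (grid T N (Suc k)) \<omega> - B (grid T N k) \<omega>"

text \<open>The exponential is taken at the right end of the cell to agree with the weight
  \<open>gain\<close> of the queue scheme.\<close>

definition wt :: "nat \<Rightarrow> nat \<Rightarrow> real" where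
  "wt N k = exp (\<mu> * grid T N (Suc k)) * sqrt (h_fun lam \<mu> (grid T N k))"

definition err :: "nat \<Rightarrow> nat \<Rightarrow> 'a \<Rightarrow> real" where
  "err N k \<omega> = \<bar>X (grid T N (Suc k)) \<omega> - X (grid T N k) \<omega> - wt N k * dB N k \<omega>\<bar>"

lemma grid_in: "k \<le> N \<Longrightarrow> grid T N k \<in> {0..T}"
  using grid_nonneg[OF pos(3)] grid_le[OF pos(3)] by auto

lemma X_measurable: "t \<in> {0..T} \<Longrightarrow> X t \<in> borel_measurable M"
  unfolding X_def[abs_def] using Z_measurable by simp

lemma dB_measurable: "dB N k \<in> borel_measurable M"
  unfolding dB_def[abs_def] using increment_measurable grid_nonneg pos by simp

text \<open>Replacing the kernel by a constant costs order \<open>\<delta>\<close> pointwise, hence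
  order \<open>\<delta> * sqrt \<delta>\<close> in mean per cell; after summation over the cells a
  factor \<open>sqrt \<delta>\<close> is left.\<close>

lemma err_expectation:
  assumes k: "k < N"
  defines "\<delta> \<equiv> T / real N"
  shows "integrable M (err N k)" "expectation (err N k) \<le> exp (\<mu> * T) * (3 * (kernel_const + 1) * \<delta> * sqrt \<delta>)"
proof -
  let ?s = "grid T N k" and ?t = "grid T N (Suc k)"
  have N: "N > 0" using k by simp
  have \<delta>: "\<delta> > 0" "?t - ?s = \<delta>" using pos N by (auto simp: \<delta>_def grid_Suc)
  have st: "0 \<le> ?s" "?s < ?t" "?t \<le> T" using grid_in[of k N] grid_in[of "Suc k" N] k \<delta> by auto
  define c where "c = sqrt (h_fun lam \<mu> ?s)"
  \<comment> \<open>The added 1 makes \<open>\<kappa>\<close> strictly positive from the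
    nonnegativity of \<open>kernel_const\<close> alone, as the division by \<open>r\<close> below
    requires.\<close>
  define \<kappa> where "\<kappa> = (kernel_const + 1) * \<delta>"
  have \<kappa>: "\<kappa> > 0" using \<delta> kernel_const_nonneg by (simp add: \<kappa>_def)
  define U where "U \<omega> = Z ?t \<omega> - exp (- \<mu> * (?t - ?s)) * Z ?s \<omega> - c * (B ?t \<omega> - B ?s \<omega>)" for \<omega>
  have mU[measurable]: "U \<in> borel_measurable M"
    unfolding U_def[abs_def] using Z_measurable[OF grid_in] increment_measurable[of ?s ?t] st k by simp
  have "(\<integral>\<^sup>+\<omega>. ennreal ((U \<omega>)\<^sup>2) \<partial>M) \<le> ennreal (9 * \<kappa>\<^sup>2 * (?t - ?s))"
    unfolding U_def
  proof (rule increment_approx[OF st])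
    fix u assume u: "?s < u" "u \<le> ?t"
    have "\<bar>kernel ?t u - c\<bar> \<le> kernel_const * (?t - ?s)" unfolding c_def using kernel_close[OF st(1)] u by simp
    also have "\<dots> \<le> \<kappa>" using \<delta> by (simp add: \<kappa>_def)
    finally show "\<bar>kernel ?t u - c\<bar> \<le> \<kappa>" .
  qed
  then have le: "(\<integral>\<^sup>+\<omega>. ennreal ((U \<omega>)\<^sup>2) \<partial>M) \<le> ennreal (9 * \<kappa>\<^sup>2 * \<delta>)" unfolding \<delta>(2) .
  have iU2: "integrable M (\<lambda>\<omega>. (U \<omega>)\<^sup>2)"
    by (rule integrableI_nonneg) (use le_less_trans[OF le] in auto)
  have eU2: "expectation (\<lambda>\<omega>. (U \<omega>)\<^sup>2) \<le> 9 * \<kappa>\<^sup>2 * \<delta>"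
    using le iU2 \<delta> by (simp add: nn_integral_eq_integral)
  have iU: "integrable M U" by (rule square_integrable_imp_integrable[OF mU iU2])
  \<comment> \<open>The square root of the second moment bound, the optimal weight for passing from
    the second to the first absolute moment.\<close>
  define r where "r = 3 * \<kappa> * sqrt \<delta>"
  have r: "r > 0" "r * r = 9 * \<kappa>\<^sup>2 * \<delta>" using \<kappa> \<delta> by (auto simp: r_def power2_eq_square)
  have amgm: "\<bar>x\<bar> \<le> (r + x\<^sup>2 / r) / 2" for x
  proof -
    have "0 \<le> (r - \<bar>x\<bar>)\<^sup>2 / r" using r by simp
    also have "\<dots> = r + x\<^sup>2 / r - 2 * \<bar>x\<bar>" using r(1) by (simp add: power2_diff diff_divide_distrib add_divide_distrib) (simp add: power2_eq_square)
    finally show ?thesis by simp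
  qed
  have "expectation (\<lambda>\<omega>. \<bar>U \<omega>\<bar>) \<le> expectation (\<lambda>\<omega>. (r + (U \<omega>)\<^sup>2 / r) / 2)"
    using iU iU2 amgm by (intro integral_mono) auto
  also have "\<dots> = (r + expectation (\<lambda>\<omega>. (U \<omega>)\<^sup>2) / r) / 2" using iU2 by (simp add: prob_space)
  also have "\<dots> \<le> (r + (r * r) / r) / 2" using eU2 r by (intro divide_right_mono add_left_mono) auto
  also have "\<dots> = r" using r(1) by simp
  finally have eU: "expectation (\<lambda>\<omega>. \<bar>U \<omega>\<bar>) \<le> r" .
  have err: "err N k \<omega> = exp (\<mu> * ?t) * \<bar>U \<omega>\<bar>" for \<omega>
  proof -
    have e: "exp (\<mu> * ?t) * exp (- \<mu> * (?t - ?s)) = exp (\<mu> * ?s)"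
      by (simp add: algebra_simps flip: exp_add)
    have "exp (\<mu> * ?t) * U \<omega> = X ?t \<omega> - (exp (\<mu> * ?t) * exp (- \<mu> * (?t - ?s))) * Z ?s \<omega> - wt N k * dB N k \<omega>"
      unfolding U_def X_def wt_def dB_def c_def by (simp only: right_diff_distrib mult.assoc)
    then have "X ?t \<omega> - X ?s \<omega> - wt N k * dB N k \<omega> = exp (\<mu> * ?t) * U \<omega>"
      unfolding e X_def by simp
    then show ?thesis by (simp add: err_def abs_mult)
  qed
  show "integrable M (err N k)" unfolding err[abs_def] using iU by simp
  have "expectation (err N k) = exp (\<mu> * ?t) * expectation (\<lambda>\<omega>. \<bar>U \<omega>\<bar>)" unfolding err[abs_def] by simp
  also have "\<dots> \<le> exp (\<mu> * T) * r" using eU st pos r by (intro mult_mono) auto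
  finally show "expectation (err N k) \<le> exp (\<mu> * T) * (3 * (kernel_const + 1) * \<delta> * sqrt \<delta>)"
    by (simp add: r_def \<kappa>_def mult_ac)
qed

end

section \<open>Running maxima and Doob's inequality\<close>

primrec runmax :: "(nat \<Rightarrow> real) \<Rightarrow> nat \<Rightarrow> real" where
  "runmax s 0 = 0"
| "runmax s (Suc k) = max (runmax s k) (s (Suc k))"

lemma runmax_nonneg: "0 \<le> runmax s k"
  by (induction k) auto

lemma runmax_ge: "1 \<le> j \<Longrightarrow> j \<le> k \<Longrightarrow> s j \<le> runmax s k"
  by (induction k) (auto simp: le_Suc_eq max.coboundedI1 max.coboundedI2)

lemma runmax_le_sum: "s 0 = 0 \<Longrightarrow> runmax s k \<le> (\<Sum>j<k. \<bar>s (Suc j) - s j\<bar>)"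
proof -
  assume s: "s 0 = 0"
  have "runmax s k \<le> (\<Sum>j<k. \<bar>s (Suc j) - s j\<bar>) \<and> s k \<le> (\<Sum>j<k. \<bar>s (Suc j) - s j\<bar>)"
    using s by (induction k) auto
  then show ?thesis by simp
qed

lemma runmax_cong: "(\<And>j. j \<le> k \<Longrightarrow> s j = s' j) \<Longrightarrow> runmax s k = runmax s' k"
  by (induction k) auto

text \<open>A pathwise form of Doob's maximal inequality: the sum on the right-hand side has mean zero
  for a martingale.\<close>

lemma runmax_square_le:
  "s 0 = 0 \<Longrightarrow> runmax s k ^ 2 \<le> 4 * s k ^ 2 - 4 * (\<Sum>j<k. runmax s j * (s (Suc j) - s j))"
proof -
  assume s0: "s 0 = 0"
  have "runmax s k ^ 2 \<le> 2 * runmax s k * s k - 2 * (\<Sum>j<k. runmax s j * (s (Suc j) - s j))"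
  proof (induction k)
    case (Suc k)
    let ?m = "runmax s k" and ?S = "\<Sum>j<k. runmax s j * (s (Suc j) - s j)"
    show ?case
    proof (cases "s (Suc k) \<le> ?m")
      case True
      then have "runmax s (Suc k) = ?m" by simp
      then show ?thesis using Suc by (simp add: algebra_simps)
    next
      case False
      then have eq: "runmax s (Suc k) = s (Suc k)" by simp
      \<comment> \<open>When a new maximum is reached, the induction step reduces to the
        nonnegativity of this square.\<close>
      have "0 \<le> (s (Suc k) - ?m)\<^sup>2" by simp
      then have "2 * ?m * s (Suc k) \<le> s (Suc k) ^ 2 + ?m ^ 2" by (simp add: power2_diff mult_ac)
      then show ?thesis using Suc unfolding eq by (simp add: algebra_simps power2_eq_square)
    qed
  qed simp
  \<comment> \<open>Young's inequality, weighted so that half of the squared maximum can be absorbed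
    on the left.\<close>
  moreover have "2 * runmax s k * s k \<le> runmax s k ^ 2 / 2 + 2 * s k ^ 2"
  proof -
    have "0 \<le> (runmax s k - 2 * s k)\<^sup>2 / 2" by simp
    then show ?thesis by (simp add: power2_diff power_mult_distrib field_simps)
  qed
  ultimately show ?thesis by linarith
qed

lemma runmax_measurable:
  assumes "\<And>j. j \<le> k \<Longrightarrow> (\<lambda>\<omega>. s \<omega> j) \<in> borel_measurable M"
  shows "(\<lambda>\<omega>. runmax (s \<omega>) k) \<in> borel_measurable M"
  using assms by (induction k) auto

text \<open>In the pathwise inequality each product of the current maximum with the next increment
  has mean zero, because the maximum depends on the earlier increments only. Square integrability of
  the maximum follows from the same inequality.\<close>

lemma (in prob_space) doob_runmax:
  fixes D :: "nat \<Rightarrow> 'a \<Rightarrow> real"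
  assumes ind: "indep_vars (\<lambda>_. borel) D {..<N}"
    and sq: "\<And>k. k < N \<Longrightarrow> integrable M (\<lambda>\<omega>. D k \<omega> ^ 2)" and mean: "\<And>k. k < N \<Longrightarrow> expectation (D k) = 0"
    and var: "\<And>k. k < N \<Longrightarrow> expectation (\<lambda>\<omega>. D k \<omega> ^ 2) = v k"
  shows "integrable M (\<lambda>\<omega>. runmax (\<lambda>j. \<Sum>i<j. D i \<omega>) N ^ 2)"
    "expectation (\<lambda>\<omega>. runmax (\<lambda>j. \<Sum>i<j. D i \<omega>) N ^ 2) \<le> 4 * (\<Sum>k<N. v k)"
proof -
  have mD: "D k \<in> borel_measurable M" if "k < N" for k using ind that by (auto simp: indep_vars_def2)
  have iD: "integrable M (D k)" if "k < N" for k
    using square_integrable_imp_integrable[OF mD sq] that by blast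
  define S where "S k \<omega> = (\<Sum>i<k. D i \<omega>)" for k \<omega>
  \<comment> \<open>Any integrable function of the first \<open>k\<close> increments is orthogonal
    to increment \<open>k\<close>; this is used for the partial sums and for the running
    maxima.\<close>
  have past: "has_bochner_integral M (\<lambda>\<omega>. f (\<lambda>i\<in>{..<k}. D i \<omega>) * D k \<omega>) 0"
    if k: "k < N" and f: "f \<in> borel_measurable (PiM {..<k} (\<lambda>_. borel))" "integrable M (\<lambda>\<omega>. f (\<lambda>i\<in>{..<k}. D i \<omega>))"
    for f k
  proof -
    have "indep_var (PiM {..<k} (\<lambda>_. borel)) (\<lambda>\<omega>. \<lambda>i\<in>{..<k}. D i \<omega>) (PiM {k} (\<lambda>_. borel)) (\<lambda>\<omega>. \<lambda>i\<in>{k}. D i \<omega>)"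
      by (rule indep_var_restrict[OF ind]) (use k in auto)
    from indep_var_compose[OF this f(1), of "\<lambda>g. g k" borel]
    have iv: "indep_var borel (\<lambda>\<omega>. f (\<lambda>i\<in>{..<k}. D i \<omega>)) borel (D k)"
      by (simp add: o_def)
    show ?thesis
      using indep_var_integrable[OF iv f(2) iD[OF k]] indep_var_lebesgue_integral[OF iv f(2) iD[OF k]] mean[OF k]
      by (simp add: has_bochner_integral_iff)
  qed
  have mc: "(\<lambda>r. \<Sum>i<j. r i) \<in> borel_measurable (PiM {..<k} (\<lambda>_. borel :: real measure))" if "j \<le> k" for j k :: nat
    using that by (intro borel_measurable_sum measurable_component_singleton) auto
  have S2: "integrable M (\<lambda>\<omega>. S k \<omega> ^ 2) \<and> expectation (\<lambda>\<omega>. S k \<omega> ^ 2) = (\<Sum>i<k. v i)" if "k \<le> N" for k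
    using that
  proof (induction k)
    case (Suc k)
    then have k: "k < N" and IH: "integrable M (\<lambda>\<omega>. S k \<omega> ^ 2)" "expectation (\<lambda>\<omega>. S k \<omega> ^ 2) = (\<Sum>i<k. v i)" by auto
    have "has_bochner_integral M (\<lambda>\<omega>. S k \<omega> * D k \<omega>) 0"
    proof -
      have "integrable M (S k)" unfolding S_def[abs_def]
        by (intro Bochner_Integration.integrable_sum iD) (use k in auto)
      then show ?thesis using past[OF k mc[OF order_refl]] by (simp add: S_def[abs_def])
    qed
    then have "has_bochner_integral M (\<lambda>\<omega>. S k \<omega> ^ 2 + D k \<omega> ^ 2 + 2 * (S k \<omega> * D k \<omega>)) ((\<Sum>i<k. v i) + v k + 2 * 0)"
      using IH sq[OF k] var[OF k]
      by (intro has_bochner_integral_add has_bochner_integral_mult_right) (auto simp: has_bochner_integral_iff)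
    moreover have "S (Suc k) \<omega> ^ 2 = S k \<omega> ^ 2 + D k \<omega> ^ 2 + 2 * (S k \<omega> * D k \<omega>)" for \<omega>
      by (simp add: S_def power2_sum algebra_simps)
    ultimately show ?case by (simp add: has_bochner_integral_iff)
  qed (simp add: S_def)
  define R where "R k \<omega> = runmax (\<lambda>j. S j \<omega>) k" for k \<omega>
  have mS: "S k \<in> borel_measurable M" if "k \<le> N" for k unfolding S_def[abs_def] using mD that by auto
  have mR: "R k \<in> borel_measurable M" if "k \<le> N" for k
    unfolding R_def[abs_def] by (rule runmax_measurable) (use mS that in auto)
  have iR: "integrable M (R k)" if "k \<le> N" for k
  proof (rule Bochner_Integration.integrable_bound[OF _ mR[OF that]])
    show "integrable M (\<lambda>\<omega>. \<Sum>j<k. \<bar>D j \<omega>\<bar>)"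
      by (intro Bochner_Integration.integrable_sum integrable_abs iD) (use that in auto)
    have "R k \<omega> \<le> (\<Sum>j<k. \<bar>D j \<omega>\<bar>)" for \<omega>
      unfolding R_def using runmax_le_sum[of "\<lambda>j. S j \<omega>" k] by (simp add: S_def)
    then show "AE \<omega> in M. norm (R k \<omega>) \<le> norm (\<Sum>j<k. \<bar>D j \<omega>\<bar>)"
      using runmax_nonneg by (intro AE_I2) (auto simp: R_def intro: order_trans[OF _ abs_ge_self])
  qed
  have RD: "has_bochner_integral M (\<lambda>\<omega>. R k \<omega> * D k \<omega>) 0" if k: "k < N" for k
  proof -
    have eq: "runmax (\<lambda>j. \<Sum>i<j. (\<lambda>i\<in>{..<k}. D i \<omega>) i) k = R k \<omega>" for \<omega>
      unfolding R_def S_def by (rule runmax_cong) (auto intro!: sum.cong)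
    have "(\<lambda>r. runmax (\<lambda>j. \<Sum>i<j. r i) k) \<in> borel_measurable (PiM {..<k} (\<lambda>_. borel :: real measure))"
      by (rule runmax_measurable) (rule mc)
    from past[OF k this] show ?thesis unfolding eq using iR k by simp
  qed
  have sumRD: "has_bochner_integral M (\<lambda>\<omega>. \<Sum>j<N. R j \<omega> * D j \<omega>) (\<Sum>j<N. 0)"
    by (intro has_bochner_integral_sum RD) auto
  have bound: "R N \<omega> ^ 2 \<le> 4 * S N \<omega> ^ 2 - 4 * (\<Sum>j<N. R j \<omega> * D j \<omega>)" for \<omega>
    unfolding R_def using runmax_square_le[of "\<lambda>j. S j \<omega>" N] by (simp add: S_def)
  have iB: "integrable M (\<lambda>\<omega>. 4 * S N \<omega> ^ 2 - 4 * (\<Sum>j<N. R j \<omega> * D j \<omega>))"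
    using S2[of N] sumRD by (auto simp: has_bochner_integral_iff)
  have iR2: "integrable M (\<lambda>\<omega>. R N \<omega> ^ 2)"
    by (rule Bochner_Integration.integrable_bound[OF iB])
       (use mR[of N] bound in \<open>auto intro: order_trans[OF _ abs_ge_self]\<close>)
  then show "integrable M (\<lambda>\<omega>. runmax (\<lambda>j. \<Sum>i<j. D i \<omega>) N ^ 2)" by (simp add: R_def S_def)
  have "expectation (\<lambda>\<omega>. R N \<omega> ^ 2) \<le> expectation (\<lambda>\<omega>. 4 * S N \<omega> ^ 2 - 4 * (\<Sum>j<N. R j \<omega> * D j \<omega>))"
    by (rule integral_mono[OF iR2 iB bound])
  also have "\<dots> = 4 * (\<Sum>k<N. v k)"
    using S2[of N] sumRD by (subst Bochner_Integration.integral_diff) (auto simp: has_bochner_integral_iff)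
  finally show "expectation (\<lambda>\<omega>. runmax (\<lambda>j. \<Sum>i<j. D i \<omega>) N ^ 2) \<le> 4 * (\<Sum>k<N. v k)" by (simp add: R_def S_def)
qed

context limit_on_interval
begin

lemma dB_moments:
  assumes N: "N > 0"
  shows "distributed M lborel (dB N k) (normal_density 0 (sqrt (T / real N)))"
    "integrable M (\<lambda>\<omega>. dB N k \<omega> ^ 4)" "expectation (dB N k) = 0" "expectation (\<lambda>\<omega>. dB N k \<omega> ^ 2) = T / real N"
    "integrable M (\<lambda>\<omega>. dB N k \<omega> ^ 2)" "integrable M (dB N k)"
proof -
  have st: "0 \<le> grid T N k" "grid T N k < grid T N (Suc k)" "grid T N (Suc k) - grid T N k = T / real N" "T / real N > 0"
    using grid_nonneg pos N by (auto simp: grid_Suc)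
  show d: "distributed M lborel (dB N k) (normal_density 0 (sqrt (T / real N)))"
    using normal_increments[OF st(1,2)] unfolding st(3) dB_def .
  have s: "sqrt (T / real N) > 0" using st by simp
  note n = normal_moments[OF d s]
  show i: "integrable M (\<lambda>\<omega>. dB N k \<omega> ^ 4)" "expectation (dB N k) = 0" "expectation (\<lambda>\<omega>. dB N k \<omega> ^ 2) = T / real N"
    using n st by auto
  show "integrable M (\<lambda>\<omega>. dB N k \<omega> ^ 2)" "integrable M (dB N k)"
    using integrable_power_le4[OF dB_measurable i(1), of 2] integrable_power_le4[OF dB_measurable i(1), of 1] by auto
qed

lemma dB_indep: "indep_vars (\<lambda>_. borel) (dB N) {..<N}"
proof -
  have "mono (grid T N)" using grid_mono pos by (auto simp: mono_def)
  then show ?thesis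
    using indep_increments_B unfolding indep_increments_def dB_def[abs_def] by simp
qed

lemma wt_bounds: "k < N \<Longrightarrow> 0 \<le> wt N k \<and> wt N k \<le> exp (\<mu> * T) * sqrt (2 * lam)"
  using grid_in[of "Suc k" N] grid_in[of k N] pos h_fun_bounds[of "grid T N k"]
  by (auto simp: wt_def intro!: mult_mono)

text \<open>A running maximum bounds only from above, so both signs are taken; the last sum covers
  the distance between \<open>X\<close> and its weighted Brownian sum at the grid points.\<close>

definition envelope :: "nat \<Rightarrow> 'a \<Rightarrow> real" where
  "envelope N \<omega> = runmax (\<lambda>j. \<Sum>i<j. wt N i * dB N i \<omega>) N + runmax (\<lambda>j. \<Sum>i<j. - (wt N i * dB N i \<omega>)) N
     + (\<Sum>k<N. err N k \<omega>)"

definition mesh_error :: "nat \<Rightarrow> real" where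
  "mesh_error N = T * (exp (\<mu> * T) * (3 * (kernel_const + 1) * sqrt (T / real N)))"

lemma sum_err_expectation:
  assumes N: "N > 0"
  shows "integrable M (\<lambda>\<omega>. \<Sum>k<N. err N k \<omega>)" "expectation (\<lambda>\<omega>. \<Sum>k<N. err N k \<omega>) \<le> mesh_error N"
proof -
  have i: "integrable M (err N k)" if "k < N" for k using err_expectation that by blast
  then show "integrable M (\<lambda>\<omega>. \<Sum>k<N. err N k \<omega>)" by (intro Bochner_Integration.integrable_sum) auto
  have "expectation (\<lambda>\<omega>. \<Sum>k<N. err N k \<omega>) = (\<Sum>k<N. expectation (err N k))"
    by (rule Bochner_Integration.integral_sum) (use i in auto)
  also have "\<dots> \<le> (\<Sum>k<N. exp (\<mu> * T) * (3 * (kernel_const + 1) * (T / real N) * sqrt (T / real N)))"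
    using err_expectation by (intro sum_mono) auto
  also have "\<dots> = mesh_error N" using N by (simp add: mesh_error_def)
  finally show "expectation (\<lambda>\<omega>. \<Sum>k<N. err N k \<omega>) \<le> mesh_error N" .
qed

definition envelope_bound :: real where
  "envelope_bound = 2 * (1 + 4 * ((exp (\<mu> * T) * sqrt (2 * lam))\<^sup>2 * T)) + mesh_error 1"

lemma envelope_expectation:
  assumes N: "N > 0"
  shows "integrable M (envelope N)" "expectation (envelope N) \<le> envelope_bound" "0 \<le> envelope N \<omega>"
proof -
  let ?W = "exp (\<mu> * T) * sqrt (2 * lam)"
  \<comment> \<open>The sign \<open>c\<close>, which is 1 or -1, treats both running maxima at once.
    The second moment bound is turned into a first moment bound by \<open>x \<le> 1 + x ^ 2\<close>,
    and it is uniform in \<open>N\<close>.\<close>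
  have half: "integrable M (\<lambda>\<omega>. runmax (\<lambda>j. \<Sum>i<j. D i \<omega>) N) \<and> expectation (\<lambda>\<omega>. runmax (\<lambda>j. \<Sum>i<j. D i \<omega>) N) \<le> 1 + 4 * (?W\<^sup>2 * T)"
    if D: "\<And>k. D k = (\<lambda>\<omega>. (c * wt N k) * dB N k \<omega>)" and c: "c\<^sup>2 = 1" for D c
  proof -
    have ind: "indep_vars (\<lambda>_. borel) D {..<N}"
      unfolding D by (rule indep_vars_compose2[OF dB_indep]) auto
    have d: "integrable M (\<lambda>\<omega>. D k \<omega> ^ 2)" "expectation (D k) = 0" "expectation (\<lambda>\<omega>. D k \<omega> ^ 2) = wt N k ^ 2 * (T / N)" for k
      unfolding D using dB_moments[OF N, of k] c by (auto simp: power_mult_distrib)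
    note doob = doob_runmax[OF ind d]
    let ?R = "\<lambda>\<omega>. runmax (\<lambda>j. \<Sum>i<j. D i \<omega>) N"
    have m: "?R \<in> borel_measurable M"
      by (rule runmax_measurable) (auto simp: D dB_measurable intro!: borel_measurable_sum borel_measurable_times)
    have iR: "integrable M ?R" by (rule square_integrable_imp_integrable[OF m doob(1)])
    have "expectation ?R \<le> expectation (\<lambda>\<omega>. 1 + ?R \<omega> ^ 2)"
    proof (rule integral_mono[OF iR])
      fix \<omega>
      have "0 \<le> (1 - ?R \<omega>)\<^sup>2 + ?R \<omega> ^ 2 + 1" by simp
      then show "?R \<omega> \<le> 1 + ?R \<omega> ^ 2" by (simp add: power2_diff)
    qed (use doob(1) in simp)
    also have "\<dots> = 1 + expectation (\<lambda>\<omega>. ?R \<omega> ^ 2)" using doob(1) by (simp add: prob_space)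
    also have "\<dots> \<le> 1 + 4 * (\<Sum>k<N. wt N k ^ 2 * (T / N))" using doob(2) by simp
    also have "\<dots> \<le> 1 + 4 * (\<Sum>k<N. ?W\<^sup>2 * (T / N))"
      using wt_bounds pos by (intro add_left_mono mult_left_mono sum_mono mult_right_mono power_mono) auto
    also have "\<dots> = 1 + 4 * (?W\<^sup>2 * T)" using N by simp
    finally show ?thesis using iR by simp
  qed
  note h1 = half[of "\<lambda>k \<omega>. wt N k * dB N k \<omega>" 1, simplified]
  note h2 = half[of "\<lambda>k \<omega>. - (wt N k * dB N k \<omega>)" "-1", simplified]
  note e = sum_err_expectation[OF N]
  show i: "integrable M (envelope N)"
    unfolding envelope_def[abs_def] using h1 h2 e by simp
  have "mesh_error N \<le> mesh_error 1"
    unfolding mesh_error_def using pos N kernel_const_nonneg by (intro mult_left_mono) (auto simp: divide_le_eq)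
  then show "expectation (envelope N) \<le> envelope_bound"
    unfolding envelope_def[abs_def] envelope_bound_def using h1 h2 e by simp
  show "0 \<le> envelope N \<omega>"
    unfolding envelope_def by (intro add_nonneg_nonneg runmax_nonneg sum_nonneg) (simp add: err_def)
qed

lemma X_grid_approx:
  assumes Z0: "Z 0 \<omega> = 0" and k: "k \<le> N"
  shows "\<bar>X (grid T N k) \<omega> - (\<Sum>i<k. wt N i * dB N i \<omega>)\<bar> \<le> (\<Sum>i<N. err N i \<omega>)"
    "X (grid T N k) \<omega> = (\<Sum>i<k. X (grid T N (Suc i)) \<omega> - X (grid T N i) \<omega>)"
proof -
  show eq: "X (grid T N k) \<omega> = (\<Sum>i<k. X (grid T N (Suc i)) \<omega> - X (grid T N i) \<omega>)"
    using sum_lessThan_telescope[of "\<lambda>i. X (grid T N i) \<omega>" k] Z0 by (simp add: X_def)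
  have "\<bar>X (grid T N k) \<omega> - (\<Sum>i<k. wt N i * dB N i \<omega>)\<bar> = \<bar>\<Sum>i<k. (X (grid T N (Suc i)) \<omega> - X (grid T N i) \<omega>) - wt N i * dB N i \<omega>\<bar>"
    unfolding eq sum_subtractf by simp
  also have "\<dots> \<le> (\<Sum>i<k. err N i \<omega>)" unfolding err_def by (rule sum_abs)
  also have "\<dots> \<le> (\<Sum>i<N. err N i \<omega>)" using k by (intro sum_mono2) (auto simp: err_def)
  finally show "\<bar>X (grid T N k) \<omega> - (\<Sum>i<k. wt N i * dB N i \<omega>)\<bar> \<le> (\<Sum>i<N. err N i \<omega>)" .
qed

lemma X_grid_le_envelope:
  assumes Z0: "Z 0 \<omega> = 0" and k: "k \<le> N"
  shows "\<bar>X (grid T N k) \<omega>\<bar> \<le> envelope N \<omega>"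
proof (cases "k = 0")
  case True
  then show ?thesis
    using Z0 by (simp add: X_def envelope_def runmax_nonneg err_def sum_nonneg)
next
  case False
  let ?S = "\<Sum>i<k. wt N i * dB N i \<omega>"
  have "?S \<le> runmax (\<lambda>j. \<Sum>i<j. wt N i * dB N i \<omega>) N"
    using runmax_ge[of k N "\<lambda>j. \<Sum>i<j. wt N i * dB N i \<omega>"] False k by simp
  moreover have "- ?S \<le> runmax (\<lambda>j. \<Sum>i<j. - (wt N i * dB N i \<omega>)) N"
    using runmax_ge[of k N "\<lambda>j. \<Sum>i<j. - (wt N i * dB N i \<omega>)"] False k by (simp add: sum_negf)
  ultimately show ?thesis
    using X_grid_approx(1)[OF assms] runmax_nonneg[of "\<lambda>j. \<Sum>i<j. wt N i * dB N i \<omega>" N]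
      runmax_nonneg[of "\<lambda>j. \<Sum>i<j. - (wt N i * dB N i \<omega>)" N] unfolding envelope_def by linarith
qed

lemma X_continuous: "\<omega> \<in> space M \<Longrightarrow> continuous_on {0..T} (\<lambda>t. X t \<omega>)"
  unfolding X_def by (intro continuous_intros continuous_Z)

lemma X_uniform:
  assumes \<omega>: "\<omega> \<in> space M" and \<eta>: "\<eta> > 0"
  shows "\<forall>\<^sub>F j in sequentially. \<forall>s\<in>{0..T}. \<forall>t\<in>{0..T}. \<bar>s - t\<bar> \<le> T / 2 ^ j \<longrightarrow> \<bar>X s \<omega> - X t \<omega>\<bar> < \<eta>"
proof -
  have "uniformly_continuous_on {0..T} (\<lambda>t. X t \<omega>)"
    by (rule compact_uniformly_continuous[OF X_continuous[OF \<omega>]]) simp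
  then obtain d where d: "d > 0" "\<And>s t. s \<in> {0..T} \<Longrightarrow> t \<in> {0..T} \<Longrightarrow> \<bar>s - t\<bar> < d \<Longrightarrow> \<bar>X s \<omega> - X t \<omega>\<bar> < \<eta>"
    unfolding uniformly_continuous_on_def dist_real_def using \<eta> by metis
  have "(\<lambda>j. T * (1 / 2) ^ j) \<longlonglongrightarrow> T * 0"
    by (intro tendsto_intros LIMSEQ_power_zero) auto
  then have "(\<lambda>j. T / 2 ^ j) \<longlonglongrightarrow> 0" by (simp add: power_one_over)
  then have "\<forall>\<^sub>F j in sequentially. T / 2 ^ j < d" using d(1) by (rule order_tendstoD)
  then show ?thesis by eventually_elim (use d(2) in force)
qed

text \<open>The dominating variable is the lower limit of the envelopes along dyadic grids: Fatou's
  lemma bounds its mean, and continuity of the paths makes it dominate every time in the interval,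
  not only the grid points.\<close>

lemma sup_integrable: "\<exists>D. integrable M D \<and> (AE \<omega> in M. \<forall>t\<in>{0..T}. \<bar>X t \<omega>\<bar> \<le> D \<omega>)"
proof -
  define U where "U \<omega> = liminf (\<lambda>j. ennreal (envelope (2^j) \<omega>))" for \<omega>
  have N: "(2::nat)^j > 0" for j by simp
  note env = envelope_expectation[OF N]
  have [measurable]: "envelope (2^j) \<in> borel_measurable M" for j using env(1) by auto
  have mU[measurable]: "U \<in> borel_measurable M" unfolding U_def[abs_def] by measurable
  have "(\<integral>\<^sup>+\<omega>. U \<omega> \<partial>M) \<le> liminf (\<lambda>j. \<integral>\<^sup>+\<omega>. ennreal (envelope (2^j) \<omega>) \<partial>M)"
    unfolding U_def by (rule nn_integral_liminf) measurable
  also have "\<dots> \<le> liminf (\<lambda>j::nat. ennreal envelope_bound)"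
    by (intro Liminf_mono always_eventually allI)
       (use env in \<open>simp add: nn_integral_eq_integral ennreal_leI\<close>)
  also have "\<dots> = ennreal envelope_bound" by (simp add: Liminf_const)
  finally have fin: "(\<integral>\<^sup>+\<omega>. U \<omega> \<partial>M) \<le> ennreal envelope_bound" .
  have "(\<integral>\<^sup>+\<omega>. U \<omega> \<partial>M) \<noteq> \<infinity>" using fin by (auto simp: top_unique)
  then have AE_fin: "AE \<omega> in M. U \<omega> \<noteq> \<infinity>" by (rule nn_integral_PInf_AE[OF mU])
  define D where "D \<omega> = enn2real (U \<omega>)" for \<omega>
  have mD: "D \<in> borel_measurable M" unfolding D_def[abs_def] by measurable
  have "(\<integral>\<^sup>+\<omega>. ennreal (D \<omega>) \<partial>M) = (\<integral>\<^sup>+\<omega>. U \<omega> \<partial>M)"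
    by (rule nn_integral_cong_AE) (use AE_fin in eventually_elim, simp add: D_def ennreal_enn2real_if)
  then have iD: "integrable M D"
    using fin by (intro integrableI_nonneg mD) (auto simp: D_def intro: le_less_trans)
  have "AE \<omega> in M. \<forall>t\<in>{0..T}. \<bar>X t \<omega>\<bar> \<le> D \<omega>"
    using AE_fin Z_0 AE_space
  proof eventually_elim
    case (elim \<omega>)
    show ?case
    proof
      fix t assume t: "t \<in> {0..T}"
      have "ennreal \<bar>X t \<omega>\<bar> \<le> U \<omega>"
        unfolding U_def le_Liminf_iff
      proof (intro allI impI)
        \<comment> \<open>Uniform continuity provides, on every fine grid, a grid point at which the
          path still exceeds \<open>z\<close> in absolute value, and the envelope dominates it
          there.\<close>
        fix y assume y: "y < ennreal \<bar>X t \<omega>\<bar>"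
        then obtain z where z: "y = ennreal z" "0 \<le> z" by (cases y) auto
        then have zX: "z < \<bar>X t \<omega>\<bar>" using y by (simp add: ennreal_less_iff)
        from X_uniform[OF \<open>\<omega> \<in> space M\<close>, of "\<bar>X t \<omega>\<bar> - z"] zX
        have "\<forall>\<^sub>F j in sequentially. \<forall>s\<in>{0..T}. \<forall>t'\<in>{0..T}. \<bar>s - t'\<bar> \<le> T / 2 ^ j \<longrightarrow> \<bar>X s \<omega> - X t' \<omega>\<bar> < \<bar>X t \<omega>\<bar> - z"
          by simp
        then show "\<forall>\<^sub>F j in sequentially. y < ennreal (envelope (2^j) \<omega>)"
        proof (rule eventually_mono)
          fix j :: nat
          assume u: "\<forall>s\<in>{0..T}. \<forall>t'\<in>{0..T}. \<bar>s - t'\<bar> \<le> T / 2 ^ j \<longrightarrow> \<bar>X s \<omega> - X t' \<omega>\<bar> < \<bar>X t \<omega>\<bar> - z"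
          obtain k where k: "k < 2^j" "grid T (2^j) k \<le> t" "t \<le> grid T (2^j) (Suc k)"
            by (rule grid_cell[OF pos(3) N t])
          have "\<bar>grid T (2^j) k - t\<bar> \<le> T / 2 ^ j" using k grid_Suc[of T "2^j" k] by simp
          then have "\<bar>X (grid T (2^j) k) \<omega> - X t \<omega>\<bar> < \<bar>X t \<omega>\<bar> - z"
            using u grid_in[of k "2^j"] k(1) t by simp
          moreover have "\<bar>X (grid T (2^j) k) \<omega>\<bar> \<le> envelope (2^j) \<omega>"
            by (rule X_grid_le_envelope[OF elim(2)]) (use k in simp)
          ultimately have "z < envelope (2^j) \<omega>" by linarith
          then show "y < ennreal (envelope (2^j) \<omega>)" using z by (simp add: ennreal_less_iff)
        qed
      qed
      then show "\<bar>X t \<omega>\<bar> \<le> D \<omega>"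
        using elim(1) by (cases "U \<omega>") (auto simp: D_def)
    qed
  qed
  then show ?thesis using iD by blast
qed

definition gauss_path :: "nat \<Rightarrow> 'a \<Rightarrow> real \<Rightarrow> real" where
  "gauss_path N \<omega> = ipath \<mu> T N (\<lambda>k. wt N k * dB N k \<omega>)"

text \<open>Two comparisons through \<open>P\<close>, the interpolation of the exact grid values.
  From \<open>Z\<close> to \<open>P\<close> uniform continuity and the integrable bound on the
  supremum are used, without a rate; from \<open>P\<close> to \<open>gauss_path\<close> the
  Lipschitz property and the summed mean errors suffice.\<close>

lemma limit_expectation:
  assumes F: "F \<in> Sigma_class T"
  shows "\<exists>\<epsilon>. \<epsilon> \<longlonglongrightarrow> 0 \<and> (\<forall>j. \<bar>expectation (\<lambda>\<omega>. F (sample_path T Z \<omega>))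
    - expectation (\<lambda>\<omega>. F (gauss_path (2^j) \<omega>))\<bar> \<le> \<epsilon> j)"
proof -
  obtain D where D: "integrable M D" "AE \<omega> in M. \<forall>t\<in>{0..T}. \<bar>X t \<omega>\<bar> \<le> D \<omega>" using sup_integrable by blast
  define P where "P N \<omega> = ipath \<mu> T N (\<lambda>k. X (grid T N (Suc k)) \<omega> - X (grid T N k) \<omega>)" for N \<omega>
  have ZD: "sample_path T Z \<omega> \<in> D_space T" if "\<omega> \<in> space M" for \<omega>
  proof -
    have "sample_path T Z \<omega> \<in> W_space T"
      unfolding W_space_def sample_path_def using continuous_Z[OF that] by (auto cong: continuous_on_cong_simp)
    then show ?thesis using W_space_subset_D_space by blast
  qed
  have mV: "(\<lambda>\<omega>. F (sample_path T Z \<omega>)) \<in> borel_measurable M"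
    unfolding sample_path_def
    by (rule Sigma_class_measurable[OF F]) (use Z_measurable ZD in \<open>auto simp: sample_path_def\<close>)
  have mP: "(\<lambda>\<omega>. F (P N \<omega>)) \<in> borel_measurable M" for N
    unfolding P_def by (rule Sigma_class_ipath_measurable[OF F]) (use X_measurable grid_in in auto)
  have mG: "(\<lambda>\<omega>. F (gauss_path N \<omega>)) \<in> borel_measurable M" for N
    unfolding gauss_path_def by (rule Sigma_class_ipath_measurable[OF F]) (use dB_measurable in auto)
  have close: "\<bar>sample_path T Z \<omega> t - P N \<omega> t\<bar> \<le> b"
    if N: "N > 0" and Z0: "Z 0 \<omega> = 0" and t: "t \<in> {0..T}"
      and b: "\<And>s. s \<in> {0..T} \<Longrightarrow> \<bar>t - s\<bar> \<le> T / real N \<Longrightarrow> \<bar>X t \<omega> - X s \<omega>\<bar> \<le> b" for N \<omega> t b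
    unfolding P_def
  proof (rule ipath_close[OF pos(3) N t])
    fix j assume j: "j < N" "grid T N j \<le> t" "t \<le> grid T N (Suc j)"
    have main: "\<bar>sample_path T Z \<omega> t - exp (- \<mu> * t) * (\<Sum>i<k. X (grid T N (Suc i)) \<omega> - X (grid T N i) \<omega>)\<bar> \<le> b"
      if k: "k \<le> N" "\<bar>t - grid T N k\<bar> \<le> T / real N" for k
    proof -
      have "exp (- \<mu> * t) * exp (\<mu> * t) = 1" by (simp flip: exp_add)
      then have "Z t \<omega> = exp (- \<mu> * t) * X t \<omega>" by (simp add: X_def flip: mult.assoc)
      then have "\<bar>sample_path T Z \<omega> t - exp (- \<mu> * t) * X (grid T N k) \<omega>\<bar> = exp (- \<mu> * t) * \<bar>X t \<omega> - X (grid T N k) \<omega>\<bar>"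
        using t by (simp add: sample_path_def abs_mult flip: right_diff_distrib)
      also have "\<dots> \<le> 1 * b"
        using b[OF grid_in[OF k(1)] k(2)] t pos by (intro mult_mono) auto
      finally show ?thesis using X_grid_approx(2)[OF Z0 k(1)] by simp
    qed
    show "\<bar>sample_path T Z \<omega> t - exp (- \<mu> * t) * (\<Sum>k<j. X (grid T N (Suc k)) \<omega> - X (grid T N k) \<omega>)\<bar> \<le> b \<and>
      \<bar>sample_path T Z \<omega> t - exp (- \<mu> * t) * (\<Sum>k<Suc j. X (grid T N (Suc k)) \<omega> - X (grid T N k) \<omega>)\<bar> \<le> b"
      using main[of j] main[of "Suc j"] j grid_Suc[of T N j] by auto
  qed
  have iX: "integrable M (X t)" if "t \<in> {0..T}" for t
    by (rule Bochner_Integration.integrable_bound[OF D(1) X_measurable[OF that]])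
       (use D(2) in eventually_elim, use that in \<open>force intro: order_trans[OF _ abs_ge_self]\<close>)
  have iP: "integrable M (\<lambda>\<omega>. F (P N \<omega>))" for N
    unfolding P_def by (rule ipath_integrable[OF F pos(3,2)]) (use iX grid_in in auto)
  have iG: "integrable M (\<lambda>\<omega>. F (gauss_path N \<omega>))" if "N > 0" for N
    unfolding gauss_path_def by (rule ipath_integrable[OF F pos(3,2)]) (use dB_moments(6)[OF that] in auto)
  have "\<exists>\<epsilon>. \<epsilon> \<longlonglongrightarrow> 0 \<and> (\<forall>j. \<bar>expectation (\<lambda>\<omega>. F (sample_path T Z \<omega>)) - expectation (\<lambda>\<omega>. F (P (2^j) \<omega>))\<bar> \<le> 0 + \<epsilon> j)"
  proof (rule expectation_diff_limit(2)[OF mV mP iP, where D="\<lambda>\<omega>. 2 * D \<omega>"])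
    show "integrable M (\<lambda>\<omega>. 2 * D \<omega>)" using D(1) by simp
    fix j :: nat
    show "AE \<omega> in M. \<bar>F (sample_path T Z \<omega>) - F (P (2^j) \<omega>)\<bar> \<le> 2 * D \<omega>"
      using D(2) Z_0 AE_space
    proof eventually_elim
      case (elim \<omega>)
      have PD: "P (2^j) \<omega> \<in> D_space T" unfolding P_def by (rule ipath_D)
      show ?case
      proof (rule Sigma_class_lipschitz[OF F pos(3) ZD[OF elim(3)] PD])
        fix t assume t: "t \<in> {0..T}"
        show "\<bar>sample_path T Z \<omega> t - P (2^j) \<omega> t\<bar> \<le> 2 * D \<omega>"
        proof (rule close[OF _ elim(2) t])
          fix s assume "s \<in> {0..T}"
          then have "\<bar>X s \<omega>\<bar> \<le> D \<omega>" "\<bar>X t \<omega>\<bar> \<le> D \<omega>" using elim(1) t by auto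
          then show "\<bar>X t \<omega> - X s \<omega>\<bar> \<le> 2 * D \<omega>" by linarith
        qed simp
      qed
    qed
  next
    show "AE \<omega> in M. \<exists>e. e \<longlonglongrightarrow> 0 \<and> (\<forall>\<^sub>F j in sequentially. \<bar>F (sample_path T Z \<omega>) - F (P (2^j) \<omega>)\<bar> \<le> 0 + e j)"
      using Z_0 AE_space
    proof eventually_elim
      case (elim \<omega>)
      define e where "e j = \<bar>F (sample_path T Z \<omega>) - F (P (2^j) \<omega>)\<bar>" for j :: nat
      have PD: "P (2^j) \<omega> \<in> D_space T" for j unfolding P_def by (rule ipath_D)
      have "e \<longlonglongrightarrow> 0"
      proof (rule order_tendstoI)
        fix \<eta> :: real assume \<eta>: "0 < \<eta>"
        then have "\<forall>\<^sub>F j in sequentially. \<forall>s\<in>{0..T}. \<forall>t\<in>{0..T}. \<bar>s - t\<bar> \<le> T / 2 ^ j \<longrightarrow> \<bar>X s \<omega> - X t \<omega>\<bar> < \<eta> / 2"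
          by (intro X_uniform[OF elim(2)]) simp
        then show "\<forall>\<^sub>F j in sequentially. e j < \<eta>"
        proof (rule eventually_mono)
          fix j :: nat
          assume u: "\<forall>s\<in>{0..T}. \<forall>t\<in>{0..T}. \<bar>s - t\<bar> \<le> T / 2 ^ j \<longrightarrow> \<bar>X s \<omega> - X t \<omega>\<bar> < \<eta> / 2"
          have "e j \<le> \<eta> / 2"
            unfolding e_def
          proof (rule Sigma_class_lipschitz[OF F pos(3) ZD[OF elim(2)] PD])
            fix t assume t: "t \<in> {0..T}"
            show "\<bar>sample_path T Z \<omega> t - P (2^j) \<omega> t\<bar> \<le> \<eta> / 2"
            proof (rule close[OF _ elim(1) t])
              fix s assume "s \<in> {0..T}" "\<bar>t - s\<bar> \<le> T / real (2^j)"
              then show "\<bar>X t \<omega> - X s \<omega>\<bar> \<le> \<eta> / 2" using u t by (simp add: less_imp_le)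
            qed simp
          qed
          then show "e j < \<eta>" using \<eta> by simp
        qed
      qed (auto simp: e_def intro!: always_eventually)
      then show ?case by (intro exI[of _ e]) (simp add: e_def)
    qed
  qed simp
  then obtain \<epsilon> where \<epsilon>: "\<epsilon> \<longlonglongrightarrow> 0"
    "\<And>j. \<bar>expectation (\<lambda>\<omega>. F (sample_path T Z \<omega>)) - expectation (\<lambda>\<omega>. F (P (2^j) \<omega>))\<bar> \<le> \<epsilon> j" by auto
  have PG: "\<bar>expectation (\<lambda>\<omega>. F (P N \<omega>)) - expectation (\<lambda>\<omega>. F (gauss_path N \<omega>))\<bar> \<le> mesh_error N" if N: "N > 0" for N
  proof -
    have "\<bar>expectation (\<lambda>\<omega>. F (P N \<omega>)) - expectation (\<lambda>\<omega>. F (gauss_path N \<omega>))\<bar>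
        = \<bar>expectation (\<lambda>\<omega>. F (P N \<omega>) - F (gauss_path N \<omega>))\<bar>"
      using iP iG[OF N] by simp
    also have "\<dots> \<le> expectation (\<lambda>\<omega>. \<bar>F (P N \<omega>) - F (gauss_path N \<omega>)\<bar>)" by (rule integral_abs_bound)
    also have "\<dots> \<le> expectation (\<lambda>\<omega>. \<Sum>k<N. err N k \<omega>)"
    proof (rule integral_mono)
      show "\<bar>F (P N \<omega>) - F (gauss_path N \<omega>)\<bar> \<le> (\<Sum>k<N. err N k \<omega>)" for \<omega>
        unfolding P_def gauss_path_def err_def by (rule Sigma_class_ipath_lipschitz[OF F pos(3,2)])
    qed (use iP iG[OF N] sum_err_expectation[OF N] in auto)
    also have "\<dots> \<le> mesh_error N" by (rule sum_err_expectation[OF N])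
    finally show ?thesis .
  qed
  have "(\<lambda>j. mesh_error (2^j)) \<longlonglongrightarrow> 0"
  proof -
    have "(\<lambda>j. T * (exp (\<mu> * T) * (3 * (kernel_const + 1) * sqrt (T * (1 / 2) ^ j)))) \<longlonglongrightarrow>
        T * (exp (\<mu> * T) * (3 * (kernel_const + 1) * sqrt (T * 0)))"
      by (intro tendsto_intros LIMSEQ_power_zero) auto
    then show ?thesis by (simp add: mesh_error_def power_one_over)
  qed
  then have "(\<lambda>j. \<epsilon> j + mesh_error (2^j)) \<longlonglongrightarrow> 0 + 0" by (intro tendsto_add \<epsilon>(1))
  moreover have "\<bar>expectation (\<lambda>\<omega>. F (sample_path T Z \<omega>)) - expectation (\<lambda>\<omega>. F (gauss_path (2^j) \<omega>))\<bar> \<le> \<epsilon> j + mesh_error (2^j)" for j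
    using \<epsilon>(2)[of j] PG[of "2^j"] by simp
  ultimately show ?thesis by (intro exI[of _ "\<lambda>j. \<epsilon> j + mesh_error (2^j)"]) simp
qed

end


section \<open>Comparison of the two schemes\<close>

text \<open>The first summand collects the mismatch of the variances, the second the third moments
  of the queue noise; both are independent of \<open>n\<close> and of the grid once
  \<open>1 / sqrt n\<close> has been taken out.\<close>

definition lindeberg_const :: "real \<Rightarrow> real \<Rightarrow> real \<Rightarrow> real" where
  "lindeberg_const lam \<mu> T =
     (2 + T) / 2 * (exp (\<mu> * T) ^ 2 * \<mu> * (T * (1 + exp (\<mu> * T) ^ 2 * (lam * T * (1 + \<mu> * T)))))
     + T * (exp (\<mu> * T) ^ 3 * (lam * T * (1 + \<mu> * T)))"

text \<open>Contributions that vanish with the mesh for fixed \<open>n\<close>: the squared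
  conditional variances of the queue noise, of order \<open>1 / N\<close>, and the third moments of
  the Gaussian increments, of order \<open>1 / sqrt N\<close>.\<close>

definition lindeberg_rest :: "real \<Rightarrow> real \<Rightarrow> real \<Rightarrow> real \<Rightarrow> real \<Rightarrow> real" where
  "lindeberg_rest lam \<mu> T n N =
     T * (2 * exp (\<mu> * T) ^ 3 * ((2 * (lam * n * T)\<^sup>2 + 2 * (\<mu> * T)\<^sup>2 * (lam * n * T + (lam * n * T)\<^sup>2)) / N))
     + T * ((exp (\<mu> * T) * sqrt (2 * lam)) ^ 3 * (2 * T * sqrt (T / N)))"

text \<open>The bound of \<open>lindeberg\<close> is summed over the cells. The conditional variance
  differs from the Gaussian one through \<open>active k - n * fluid limit\<close>, which is the
  weighted noise plus the summand of the scheme error. By orthogonality the weighted noise has mean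
  absolute value of order \<open>sqrt n\<close>, and the factor \<open>1 / n\<close> in the squared
  weights turns this into the rate.\<close>

lemma (in euler_space) lindeberg_bound:
  fixes lam \<mu> T n :: real
  defines "gain \<equiv> \<lambda>k. exp (\<mu> * grid T N (Suc k))"
  assumes F: "F \<in> Sigma_class T"
    and pos': "lam > 0" "\<mu> > 0" "T > 0" "n \<ge> 1" "N > 0"
    and par: "\<delta> = T / real N" "a = lam * n * (T / real N)" "b = \<mu> * (T / real N)"
  shows "\<bar>expectation (\<lambda>\<omega>. F (ipath \<mu> T N (\<lambda>k. gain k / sqrt n * xi k \<omega>)))
      - expectation (\<lambda>\<omega>. F (ipath \<mu> T N (\<lambda>k. gain k * sqrt (h_fun lam \<mu> (grid T N k)) * X (0, k) \<omega>)))\<bar>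
    \<le> lindeberg_const lam \<mu> T / sqrt n
      + (2 + T) / 2 * (exp (\<mu> * T) ^ 2 * \<mu>) * expectation (\<lambda>\<omega>. T / real N * (\<Sum>k<N. \<bar>active k \<omega> - n * fluid_limit lam \<mu> (grid T N k)
          - exp (- \<mu> * grid T N k) * (\<Sum>j<k. gain j * xi j \<omega>)\<bar>))
      + lindeberg_rest lam \<mu> T n (real N)"
proof -
  define K where "K = exp (\<mu> * T)"
  define W where "W = K * sqrt (2 * lam)"
  define V where "V = lam * T * (1 + \<mu> * T)"
  define E where "E k \<omega> = \<bar>active k \<omega> - n * fluid_limit lam \<mu> (grid T N k)
          - exp (- \<mu> * grid T N k) * (\<Sum>j<k. gain j * xi j \<omega>)\<bar>" for k \<omega>
  define S where "S k \<omega> = (\<Sum>j<k. gain j * xi j \<omega>)" for k \<omega>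
  define w where "w k = gain k / sqrt n" for k
  define c where "c k = gain k * sqrt (h_fun lam \<mu> (grid T N k))" for k
  have K: "1 \<le> K" using pos' by (simp add: K_def)
  have W: "0 \<le> W" using K pos' by (simp add: W_def)
  have Na: "real N * a = lam * n * T" "real N * b = \<mu> * T" using pos' par by auto
  have \<delta>': "real N * \<delta> = T" using pos' par by simp
  have s: "sqrt n \<ge> 1" "sqrt n * sqrt n = n" using pos' by auto
  have t: "0 \<le> grid T N k" "k \<le> N \<Longrightarrow> grid T N k \<le> T" for k
    using grid_nonneg grid_le pos' by auto
  have gain: "0 < gain k" "k < N \<Longrightarrow> gain k \<le> K" for k
    using t[of "Suc k"] pos' by (auto simp: gain_def K_def)
  \<comment> \<open>The last identity is what matches the variances: the arrivals contribute
    \<open>lam\<close> and the services \<open>\<mu>\<close> times the fluid limit.\<close>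
  have h: "0 < h_fun lam \<mu> (grid T N k)" "h_fun lam \<mu> (grid T N k) \<le> 2 * lam"
    "h_fun lam \<mu> (grid T N k) = lam + \<mu> * fluid_limit lam \<mu> (grid T N k)" for k
  proof -
    have e: "exp (- \<mu> * grid T N k) \<le> 1" "0 < exp (- \<mu> * grid T N k)" using t[of k] pos' by auto
    have "0 < 2 - exp (- \<mu> * grid T N k)" "2 - exp (- \<mu> * grid T N k) \<le> 2" using e by linarith+
    then show "0 < h_fun lam \<mu> (grid T N k)" "h_fun lam \<mu> (grid T N k) \<le> 2 * lam"
      unfolding h_fun_def using pos' mult_left_mono[of "2 - exp (- \<mu> * grid T N k)" 2 lam] by (auto simp: mult.commute)
    show "h_fun lam \<mu> (grid T N k) = lam + \<mu> * fluid_limit lam \<mu> (grid T N k)"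
      using pos' by (simp add: h_fun_def fluid_limit_def Let_def field_simps)
  qed
  have iE: "integrable P (E k)" if "k < N" for k
  proof -
    have "integrable P (\<lambda>\<omega>. \<Sum>j<k. gain j * xi j \<omega>)"
      by (intro Bochner_Integration.integrable_sum integrable_mult_right xi_integrable) (use that in auto)
    then show ?thesis unfolding E_def[abs_def] using active_moments(1)[of k] that by simp
  qed
  have Evar: "expectation (var k) \<le> a + b * (lam * n * T)"
    "expectation (\<lambda>\<omega>. var k \<omega> ^ 2) \<le> 2 * a\<^sup>2 + 2 * b\<^sup>2 * (lam * n * T + (lam * n * T)\<^sup>2)" if k: "k < N" for k
  proof -
    have ka: "real k * a \<le> lam * n * T" "0 \<le> real k * a"
      using k pos unfolding Na(1)[symmetric] by (auto intro!: mult_right_mono)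
    show "expectation (var k) \<le> a + b * (lam * n * T)"
    proof -
      have "b * (real k * a) \<le> b * (lam * n * T)" using ka(1) pos by (intro mult_left_mono) auto
      then show ?thesis using var_moments(3)[OF k] by linarith
    qed
    have "(real k * a)\<^sup>2 \<le> (lam * n * T)\<^sup>2" using ka by (intro power_mono) auto
    then have "2 * b\<^sup>2 * (real k * a + (real k * a)\<^sup>2) \<le> 2 * b\<^sup>2 * (lam * n * T + (lam * n * T)\<^sup>2)"
      using ka by (intro mult_left_mono add_mono) auto
    then show "expectation (\<lambda>\<omega>. var k \<omega> ^ 2) \<le> 2 * a\<^sup>2 + 2 * b\<^sup>2 * (lam * n * T + (lam * n * T)\<^sup>2)"
      using var_moments(4)[OF k] by simp
  qed
  \<comment> \<open>Summed over the grid, the bound on the mean variances is \<open>n * V\<close>,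
    free of \<open>N\<close>.\<close>
  have NV: "real N * (a + b * (lam * n * T)) = n * V"
    unfolding distrib_left Na(1) mult.assoc[symmetric] Na(2) by (simp add: V_def algebra_simps)
  have ES: "integrable P (S k)" "expectation (\<lambda>\<omega>. \<bar>S k \<omega>\<bar>) \<le> sqrt n * (1 + K\<^sup>2 * V)" if k: "k < N" for k
  proof -
    have sq: "integrable P (\<lambda>\<omega>. S k \<omega> ^ 2)" "expectation (\<lambda>\<omega>. S k \<omega> ^ 2) = (\<Sum>j<k. gain j ^ 2 * expectation (var j))"
      unfolding S_def using weighted_noise_square[of k gain] k by auto
    have mS: "S k \<in> borel_measurable P" unfolding S_def[abs_def] using xi_measurable k by auto
    show iS: "integrable P (S k)" by (rule square_integrable_imp_integrable[OF mS sq(1)])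
    have "(\<Sum>j<k. gain j ^ 2 * expectation (var j)) \<le> (\<Sum>j<k. K\<^sup>2 * (a + b * (lam * n * T)))"
    proof (rule sum_mono)
      fix j assume j: "j \<in> {..<k}"
      have "0 \<le> expectation (var j)"
        using pos by (intro integral_nonneg_AE AE_I2) (simp add: var_def active_def)
      then show "gain j ^ 2 * expectation (var j) \<le> K\<^sup>2 * (a + b * (lam * n * T))"
        using gain[of j] j k Evar(1)[of j] by (intro mult_mono power_mono) auto
    qed
    also have "\<dots> \<le> real N * (K\<^sup>2 * (a + b * (lam * n * T)))"
      using k pos pos' by (auto intro!: mult_right_mono mult_nonneg_nonneg add_nonneg_nonneg)
    also have "\<dots> = K\<^sup>2 * (n * V)" by (simp only: mult.left_commute[of "real N" "K\<^sup>2"] NV)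
    finally have le: "expectation (\<lambda>\<omega>. S k \<omega> ^ 2) \<le> K\<^sup>2 * (n * V)" unfolding sq(2) .
    \<comment> \<open>The weight \<open>sqrt n\<close> balances the two terms, since the second
      moment of \<open>S k\<close> is of order \<open>n\<close>.\<close>
    have amgm: "\<bar>x\<bar> \<le> sqrt n + x\<^sup>2 / sqrt n" for x
    proof -
      have "2 * \<bar>x\<bar> * sqrt n \<le> x\<^sup>2 + n" using sum_squares_bound[of "\<bar>x\<bar>" "sqrt n"] pos' by simp
      moreover have "\<bar>x\<bar> * sqrt n \<le> 2 * \<bar>x\<bar> * sqrt n" using s by simp
      ultimately have "\<bar>x\<bar> * sqrt n \<le> n + x\<^sup>2" by linarith
      also have "n + x\<^sup>2 = (sqrt n + x\<^sup>2 / sqrt n) * sqrt n"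
        using s by (simp add: distrib_right)
      finally have "\<bar>x\<bar> * sqrt n \<le> (sqrt n + x\<^sup>2 / sqrt n) * sqrt n" .
      then show ?thesis using s by (simp only: mult_le_cancel_right_pos)
    qed
    have "expectation (\<lambda>\<omega>. \<bar>S k \<omega>\<bar>) \<le> expectation (\<lambda>\<omega>. sqrt n + S k \<omega> ^ 2 / sqrt n)"
      using iS sq(1) amgm by (intro integral_mono) auto
    also have "\<dots> = sqrt n + expectation (\<lambda>\<omega>. S k \<omega> ^ 2) / sqrt n" using sq(1) by (simp add: prob_space)
    also have "\<dots> \<le> sqrt n + K\<^sup>2 * (n * V) / sqrt n" using le s by (intro add_left_mono divide_right_mono) auto
    also have "\<dots> = sqrt n * (1 + K\<^sup>2 * V)"
      using s by (simp add: field_simps)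
    finally show "expectation (\<lambda>\<omega>. \<bar>S k \<omega>\<bar>) \<le> sqrt n * (1 + K\<^sup>2 * V)" .
  qed
  define B where "B k = expectation (\<lambda>\<omega>. (2 + T) / 2 * \<bar>(w k)\<^sup>2 * var k \<omega> - (c k)\<^sup>2 * \<delta>\<bar>
        + T * (w k ^ 3 * (var k \<omega> + 2 * var k \<omega> ^ 2) + c k ^ 3 * (2 * sqrt \<delta> ^ 3)))" for k
  define u where "u = (2 + T) / 2 * (K\<^sup>2 * \<mu>)"
  have u: "u \<ge> 0" using pos' by (simp add: u_def)
  have Bk: "B k \<le> u * (\<delta> * expectation (E k)) + u * (\<delta> * (1 + K\<^sup>2 * V) / sqrt n)
      + T * (K ^ 3 / (n * sqrt n) * (a + b * (lam * n * T)))
      + T * (2 * K ^ 3 * (2 * a\<^sup>2 + 2 * b\<^sup>2 * (lam * n * T + (lam * n * T)\<^sup>2)))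
      + T * (W ^ 3 * (2 * sqrt \<delta> ^ 3))" if k: "k < N" for k
  proof -
    have wk: "0 \<le> w k" "w k ^ 3 \<le> K ^ 3 / (n * sqrt n)"
    proof -
      show "0 \<le> w k" using gain[of k] s by (simp add: w_def)
      have "w k ^ 3 = gain k ^ 3 / (n * sqrt n)"
        using s(2) by (simp add: w_def power_divide power3_eq_cube)
      also have "\<dots> \<le> K ^ 3 / (n * sqrt n)"
        using gain[of k] k s pos' by (intro divide_right_mono power_mono) auto
      finally show "w k ^ 3 \<le> K ^ 3 / (n * sqrt n)" .
    qed
    \<comment> \<open>For the quadratic term the gain in \<open>n\<close> is given up, because that
      term disappears with the mesh.\<close>
    have ns: "1 \<le> n * sqrt n" using s pos' mult_mono[of 1 n 1 "sqrt n"] by simp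
    then have wk2: "w k ^ 3 \<le> K ^ 3"
      using wk(2) K divide_left_mono[of 1 "n * sqrt n" "K ^ 3"] by simp
    have ck: "0 \<le> c k" "c k ^ 3 \<le> W ^ 3"
    proof -
      show "0 \<le> c k" using gain[of k] h[of k] by (simp add: c_def)
      have "c k \<le> W" unfolding c_def W_def
        using gain[of k] k h[of k] pos' K by (intro mult_mono) auto
      then show "c k ^ 3 \<le> W ^ 3" using \<open>0 \<le> c k\<close> by (intro power_mono)
    qed
    \<comment> \<open>Both variances are proportional to \<open>\<delta>\<close> and their arrival
      parts cancel; the rest is bounded by \<open>E k\<close>, the scheme error in cell
      \<open>k\<close>, and the weighted noise \<open>S k\<close>.\<close>
    have diff: "\<bar>(w k)\<^sup>2 * var k \<omega> - (c k)\<^sup>2 * \<delta>\<bar> \<le> K\<^sup>2 * \<mu> * \<delta> / n * (E k \<omega> + \<bar>S k \<omega>\<bar>)" for \<omega>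
    proof -
      have "(w k)\<^sup>2 * var k \<omega> - (c k)\<^sup>2 * \<delta> = (gain k)\<^sup>2 * (\<mu> * \<delta> / n) * (active k \<omega> - n * fluid_limit lam \<mu> (grid T N k))"
      proof -
        have "(w k)\<^sup>2 = (gain k)\<^sup>2 / n" using pos' by (simp add: w_def power_divide)
        moreover have "(c k)\<^sup>2 = (gain k)\<^sup>2 * (lam + \<mu> * fluid_limit lam \<mu> (grid T N k))"
          using h[of k] by (simp add: c_def power_mult_distrib)
        moreover have "var k \<omega> = lam * n * \<delta> + \<mu> * \<delta> * active k \<omega>" unfolding var_def using par by simp
        ultimately show ?thesis using pos' by (simp add: field_simps)
      qed
      then have "\<bar>(w k)\<^sup>2 * var k \<omega> - (c k)\<^sup>2 * \<delta>\<bar> = (gain k)\<^sup>2 * (\<mu> * \<delta> / n) * \<bar>active k \<omega> - n * fluid_limit lam \<mu> (grid T N k)\<bar>"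
        using pos pos' by (simp add: abs_mult)
      also have "\<dots> \<le> K\<^sup>2 * (\<mu> * \<delta> / n) * (E k \<omega> + \<bar>S k \<omega>\<bar>)"
      proof (intro mult_mono)
        have "\<bar>exp (- \<mu> * grid T N k) * S k \<omega>\<bar> \<le> 1 * \<bar>S k \<omega>\<bar>"
          unfolding abs_mult using t[of k] pos' by (intro mult_right_mono) auto
        then show "\<bar>active k \<omega> - n * fluid_limit lam \<mu> (grid T N k)\<bar> \<le> E k \<omega> + \<bar>S k \<omega>\<bar>"
          unfolding E_def S_def[symmetric] by linarith
        show "(gain k)\<^sup>2 \<le> K\<^sup>2" using gain[of k] k by (intro power_mono) auto
      qed (use pos pos' in auto)
      finally show ?thesis by (simp add: mult_ac)
    qed
    note v = var_moments[OF k]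
    have v0: "0 \<le> var k \<omega>" for \<omega> using pos by (simp add: var_def active_def)
    have "B k \<le> expectation (\<lambda>\<omega>. (2 + T) / 2 * (K\<^sup>2 * \<mu> * \<delta> / n * (E k \<omega> + \<bar>S k \<omega>\<bar>))
        + T * ((K ^ 3 / (n * sqrt n) * var k \<omega> + 2 * K ^ 3 * var k \<omega> ^ 2) + W ^ 3 * (2 * sqrt \<delta> ^ 3)))"
      unfolding B_def
    proof (rule integral_mono)
      fix \<omega>
      have "w k ^ 3 * (var k \<omega> + 2 * var k \<omega> ^ 2) \<le> K ^ 3 / (n * sqrt n) * var k \<omega> + K ^ 3 * (2 * var k \<omega> ^ 2)"
        unfolding distrib_left using wk wk2 v0 by (intro add_mono mult_right_mono) auto
      moreover have "c k ^ 3 * (2 * sqrt \<delta> ^ 3) \<le> W ^ 3 * (2 * sqrt \<delta> ^ 3)"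
        using ck pos by (intro mult_right_mono) auto
      ultimately show "(2 + T) / 2 * \<bar>(w k)\<^sup>2 * var k \<omega> - (c k)\<^sup>2 * \<delta>\<bar>
        + T * (w k ^ 3 * (var k \<omega> + 2 * var k \<omega> ^ 2) + c k ^ 3 * (2 * sqrt \<delta> ^ 3))
        \<le> (2 + T) / 2 * (K\<^sup>2 * \<mu> * \<delta> / n * (E k \<omega> + \<bar>S k \<omega>\<bar>))
        + T * ((K ^ 3 / (n * sqrt n) * var k \<omega> + 2 * K ^ 3 * var k \<omega> ^ 2) + W ^ 3 * (2 * sqrt \<delta> ^ 3))"
        using diff[of \<omega>] pos' by (intro add_mono mult_left_mono) auto
    qed (use v iE[OF k] ES[OF k] in auto)
    also have "\<dots> = (2 + T) / 2 * (K\<^sup>2 * \<mu> * \<delta> / n * (expectation (E k) + expectation (\<lambda>\<omega>. \<bar>S k \<omega>\<bar>)))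
        + T * ((K ^ 3 / (n * sqrt n) * expectation (var k) + 2 * K ^ 3 * expectation (\<lambda>\<omega>. var k \<omega> ^ 2)) + W ^ 3 * (2 * sqrt \<delta> ^ 3))"
      using v iE[OF k] ES[OF k] by (simp add: prob_space)
    also have "\<dots> \<le> (2 + T) / 2 * (K\<^sup>2 * \<mu> * \<delta> / n * (n * expectation (E k) + sqrt n * (1 + K\<^sup>2 * V)))
        + T * ((K ^ 3 / (n * sqrt n) * (a + b * (lam * n * T))
          + 2 * K ^ 3 * (2 * a\<^sup>2 + 2 * b\<^sup>2 * (lam * n * T + (lam * n * T)\<^sup>2))) + W ^ 3 * (2 * sqrt \<delta> ^ 3))"
    proof -
      have "0 \<le> expectation (E k)" by (intro integral_nonneg_AE AE_I2) (simp add: E_def)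
      then have "expectation (E k) \<le> n * expectation (E k)" using pos' by (simp add: mult_le_cancel_right1)
      then show ?thesis
        using Evar[OF k] ES[OF k] pos pos' K W s by (intro add_mono mult_left_mono) auto
    qed
    also have "\<dots> = u * (\<delta> * expectation (E k)) + u * (\<delta> * (1 + K\<^sup>2 * V) / sqrt n)
      + T * (K ^ 3 / (n * sqrt n) * (a + b * (lam * n * T)))
      + T * (2 * K ^ 3 * (2 * a\<^sup>2 + 2 * b\<^sup>2 * (lam * n * T + (lam * n * T)\<^sup>2)))
      + T * (W ^ 3 * (2 * sqrt \<delta> ^ 3))"
    proof -
      have kk: "K\<^sup>2 * \<mu> * \<delta> / n * (n * x + sqrt n * y) = K\<^sup>2 * \<mu> * (\<delta> * x) + K\<^sup>2 * \<mu> * (\<delta> * y / sqrt n)" for x y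
      proof -
        have "sqrt n / n = 1 / sqrt n" using s by (metis divide_divide_eq_left' div_self mult_eq_0_iff not_one_le_zero)
        then have "\<delta> / n * (sqrt n * y) = \<delta> * y / sqrt n" by (metis times_divide_times_eq mult.commute mult.right_neutral times_divide_eq_right)
        moreover have "\<delta> / n * (n * x) = \<delta> * x" using pos' by simp
        moreover have "K\<^sup>2 * \<mu> * \<delta> / n * (n * x + sqrt n * y) = K\<^sup>2 * \<mu> * (\<delta> / n * (n * x) + \<delta> / n * (sqrt n * y))"
          by (simp only: distrib_left mult.assoc times_divide_eq_right times_divide_eq_left)
        ultimately show ?thesis by (simp only: distrib_left)
      qed
      show ?thesis unfolding kk by (simp only: u_def distrib_left mult.assoc add.assoc)
    qed
    finally show ?thesis .
  qed
  have "\<bar>expectation (\<lambda>\<omega>. F (ipath \<mu> T N (\<lambda>k. w k * xi k \<omega>))) - expectation (\<lambda>\<omega>. F (ipath \<mu> T N (\<lambda>k. c k * X (0, k) \<omega>)))\<bar>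
      \<le> (\<Sum>k<N. B k)"
    unfolding B_def
    by (rule lindeberg[OF F pos'(3,2)]) (use gain h s in \<open>auto simp: w_def c_def less_imp_le\<close>)
  also have "\<dots> \<le> (\<Sum>k<N. u * (\<delta> * expectation (E k)) + u * (\<delta> * (1 + K\<^sup>2 * V) / sqrt n)
      + T * (K ^ 3 / (n * sqrt n) * (a + b * (lam * n * T)))
      + T * (2 * K ^ 3 * (2 * a\<^sup>2 + 2 * b\<^sup>2 * (lam * n * T + (lam * n * T)\<^sup>2)))
      + T * (W ^ 3 * (2 * sqrt \<delta> ^ 3)))"
    by (intro sum_mono) (use Bk in auto)
  also have "\<dots> = u * (\<delta> * (\<Sum>k<N. expectation (E k))) + u * ((real N * \<delta>) * (1 + K\<^sup>2 * V) / sqrt n)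
      + T * (K ^ 3 / (n * sqrt n) * (real N * (a + b * (lam * n * T))))
      + T * (2 * K ^ 3 * (real N * (2 * a\<^sup>2 + 2 * b\<^sup>2 * (lam * n * T + (lam * n * T)\<^sup>2))))
      + T * (W ^ 3 * (real N * (2 * sqrt \<delta> ^ 3)))"
    by (simp add: sum.distrib sum_distrib_left mult_ac)
  also have "\<dots> = u * (\<delta> * (\<Sum>k<N. expectation (E k))) + lindeberg_const lam \<mu> T / sqrt n + lindeberg_rest lam \<mu> T n (real N)"
  proof -
    have 1: "K ^ 3 / (n * sqrt n) * (n * V) = K ^ 3 * V / sqrt n" using pos' by simp
    have 2: "real N * (2 * a\<^sup>2 + 2 * b\<^sup>2 * y) = (2 * (lam * n * T)\<^sup>2 + 2 * (\<mu> * T)\<^sup>2 * y) / real N" for y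
      using pos' by (simp add: par power2_eq_square field_simps)
    have 3: "real N * (2 * sqrt \<delta> ^ 3) = 2 * T * sqrt (T / real N)"
    proof -
      have "real N * (2 * sqrt \<delta> ^ 3) = 2 * (real N * \<delta>) * sqrt \<delta>" using pos by (simp add: power3_eq_cube mult_ac)
      then show ?thesis unfolding \<delta>' by (simp add: par)
    qed
    show ?thesis
      unfolding NV \<delta>' 1 2 3 lindeberg_const_def lindeberg_rest_def u_def W_def K_def V_def
      by (simp add: add_divide_distrib mult_ac)
  qed
  also have "u * (\<delta> * (\<Sum>k<N. expectation (E k))) = u * expectation (\<lambda>\<omega>. T / real N * (\<Sum>k<N. E k \<omega>))"
  proof -
    have "expectation (\<lambda>\<omega>. \<Sum>k<N. E k \<omega>) = (\<Sum>k<N. expectation (E k))"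
      by (rule Bochner_Integration.integral_sum) (use iE in auto)
    then show ?thesis by (simp add: par)
  qed
  finally show ?thesis unfolding w_def c_def E_def u_def K_def by simp
qed

lemma lindeberg_rest_limit: "(\<lambda>j. lindeberg_rest lam \<mu> T n (2 ^ j)) \<longlonglongrightarrow> 0"
proof -
  define A where "A = 2 * (lam * n * T)\<^sup>2 + 2 * (\<mu> * T)\<^sup>2 * (lam * n * T + (lam * n * T)\<^sup>2)"
  have "(\<lambda>j. T * (2 * exp (\<mu> * T) ^ 3 * (A * (1 / 2) ^ j))
     + T * ((exp (\<mu> * T) * sqrt (2 * lam)) ^ 3 * (2 * T * sqrt (T * (1 / 2) ^ j))))
    \<longlonglongrightarrow> T * (2 * exp (\<mu> * T) ^ 3 * (A * 0)) + T * ((exp (\<mu> * T) * sqrt (2 * lam)) ^ 3 * (2 * T * sqrt (T * 0)))"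
    by (intro tendsto_intros LIMSEQ_power_zero) auto
  then show ?thesis by (simp add: lindeberg_rest_def A_def power_one_over)
qed

section \<open>Transfer of both schemes to one product space\<close>

lemma (in prob_space) indep_vars_reindex_inj:
  assumes ind: "indep_vars M' X (h ` I)" and h: "inj_on h I"
  shows "indep_vars (\<lambda>i. M' (h i)) (\<lambda>i. X (h i)) I"
  unfolding indep_vars_def2
proof (intro conjI ballI indep_setsI)
  fix i assume "i \<in> I"
  then show rv: "random_variable (M' (h i)) (X (h i))" using ind by (auto simp: indep_vars_def2)
  show "{X (h i) -` A \<inter> space M |A. A \<in> sets (M' (h i))} \<subseteq> events"
    using measurable_sets[OF rv] by auto
next
  fix A J assume J: "J \<noteq> {}" "J \<subseteq> I" "finite J"
    and A: "\<forall>j\<in>J. A j \<in> {X (h j) -` A \<inter> space M |A. A \<in> sets (M' (h j))}"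
  have hJ: "inj_on h J" using h J(2) by (rule inj_on_subset)
  define A' where "A' p = A (the_inv_into J h p)" for p
  have A': "A' (h j) = A j" if "j \<in> J" for j using hJ that by (simp add: A'_def the_inv_into_f_f)
  have "prob (\<Inter>j\<in>J. A j) = prob (\<Inter>p\<in>h ` J. A' p)" using A' by simp
  also have "\<dots> = (\<Prod>p\<in>h ` J. prob (A' p))"
  proof (rule indep_setsD)
    show "indep_sets (\<lambda>i. {X i -` A \<inter> space M |A. A \<in> sets (M' i)}) (h ` I)"
      using ind by (simp add: indep_vars_def2)
  qed (use J A A' in auto)
  also have "\<dots> = (\<Prod>j\<in>J. prob (A j))" using hJ A' by (simp add: prod.reindex)
  finally show "prob (\<Inter>j\<in>J. A j) = (\<Prod>j\<in>J. prob (A j))" .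
qed

text \<open>The canonical construction of independent variables with prescribed laws, as coordinates
  of the infinite product measure.\<close>

lemma PiM_UNIV_coordinates:
  fixes law :: "'i \<Rightarrow> real measure"
  assumes law: "\<And>i. prob_space (law i)" "\<And>i. sets (law i) = sets borel"
  shows "prob_space (PiM UNIV law)"
    and "prob_space.indep_vars (PiM UNIV law) (\<lambda>_. borel) (\<lambda>i x. x i) UNIV"
    and "distr (PiM UNIV law) borel (\<lambda>x. x i) = law i"
proof -
  interpret product_prob_space law UNIV
    by (intro product_prob_spaceI law)
  show "prob_space (PiM UNIV law)" by (rule prob_space_PiM[OF law(1)])
  then interpret P: prob_space "PiM UNIV law" .
  have d: "distr (PiM UNIV law) borel (\<lambda>x. x i) = law i" for i
  proof -
    have "distr (PiM UNIV law) borel (\<lambda>x. x i) = distr (PiM UNIV law) (law i) (\<lambda>x. x i)"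
      by (rule distr_cong) (use law in auto)
    then show ?thesis using PiM_component[of i] by simp
  qed
  then show "distr (PiM UNIV law) borel (\<lambda>x. x i) = law i" .
  have rv: "(\<lambda>x. x i) \<in> borel_measurable (PiM UNIV law)" for i
    using measurable_component_singleton[of i UNIV law] law(2)[of i] by (simp cong: measurable_cong_sets)
  have s: "sets (PiM UNIV law) = sets (PiM UNIV (\<lambda>_. borel :: real measure))"
    by (rule sets_PiM_cong) (use law in auto)
  show "prob_space.indep_vars (PiM UNIV law) (\<lambda>_. borel) (\<lambda>i x. x i) UNIV"
    by (subst P.indep_vars_iff_distr_eq_PiM'[OF _ rv]) (use distr_id2[OF s[symmetric]] in \<open>simp_all add: d restrict_def\<close>)
qed

lemma poisson_like_same_law:
  assumes "X \<in> borel_measurable M" "X' \<in> borel_measurable M'" "distr M borel X = distr M' borel X'"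
    and "poisson_like M' v (\<lambda>\<omega>. X' \<omega> - r)"
  shows "poisson_like M v (\<lambda>\<omega>. X \<omega> - r)"
proof -
  have e: "(\<integral>\<omega>. f (X \<omega>) \<partial>M) = (\<integral>\<omega>. f (X' \<omega>) \<partial>M')" "integrable M (\<lambda>\<omega>. f (X \<omega>)) \<longleftrightarrow> integrable M' (\<lambda>\<omega>. f (X' \<omega>))"
    if "f \<in> borel_measurable borel" for f :: "real \<Rightarrow> real"
    using integral_distr[OF assms(1) that] integral_distr[OF assms(2) that]
      integrable_distr_eq[OF assms(1) that] integrable_distr_eq[OF assms(2) that] assms(3) by auto
  show ?thesis
    using assms(1,4) e[of "\<lambda>x. x - r"] e[of "\<lambda>x. (x - r) ^ 2"] e[of "\<lambda>x. (x - r) ^ 4"]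
    by (simp add: poisson_like_def)
qed

lemma measurable_nat_floor: "(\<lambda>x::real. real (nat \<lfloor>x\<rfloor>)) \<in> borel_measurable borel"
  by measurable

text \<open>\<open>M\<close> and \<open>M'\<close> are unrelated, but each expectation depends only
  on the joint law of finitely many columns of increments. These laws are products, so both schemes
  can be realised on one product space, where the exchange argument applies.\<close>

lemma swap_queue_gauss:
  assumes q: "queue_on_interval M lam \<mu> n A S L T" and l: "limit_on_interval M' lam \<mu> T B Z"
    and F: "F \<in> Sigma_class T" and N: "N > 0"
  shows "\<bar>(\<integral>\<omega>. F (queue_on_interval.scheme_path lam \<mu> n A S T N \<omega>) \<partial>M)
      - (\<integral>\<omega>. F (limit_on_interval.gauss_path lam \<mu> T B N \<omega>) \<partial>M')\<bar>
    \<le> lindeberg_const lam \<mu> T / sqrt (real n)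
      + (2 + T) / 2 * (exp (\<mu> * T) ^ 2 * \<mu>) * (\<integral>\<omega>. queue_on_interval.scheme_error lam \<mu> n A S T N \<omega> \<partial>M)
      + lindeberg_rest lam \<mu> T (real n) (real N)"
proof -
  interpret q: queue_on_interval M lam \<mu> n A S L T by fact
  interpret l: limit_on_interval M' lam \<mu> T B Z by fact
  note pos = q.pos
  define \<delta> where "\<delta> = T / real N"
  have \<delta>: "\<delta> > 0" "sqrt \<delta> > 0" using pos N by (auto simp: \<delta>_def)
  \<comment> \<open>Row 0 carries the Brownian increments and row \<open>Suc i\<close> the
    increments of clock \<open>i\<close>, the layout expected by \<open>euler_space\<close>.\<close>
  define law where "law p = (case fst p of 0 \<Rightarrow> density lborel (normal_density 0 (sqrt \<delta>))
      | Suc i \<Rightarrow> distr (measure_pmf (poisson_pmf (q.rate i * \<delta>))) borel real)" for p :: "nat \<times> nat"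
  have law: "prob_space (law p)" "sets (law p) = sets borel" for p
  proof -
    have "prob_space (distr (measure_pmf p) borel real)" for p :: "nat pmf"
      by (rule prob_space.prob_space_distr[OF prob_space_measure_pmf]) simp
    then show "prob_space (law p)" "sets (law p) = sets borel"
      using prob_space_normal_density[OF \<delta>(2), of 0] by (auto simp: law_def split: nat.split)
  qed
  define P where "P = PiM UNIV law"
  note P = PiM_UNIV_coordinates[of law, OF law(1) law(2), folded P_def]
  interpret P: prob_space P by (rule P(1))
  have coord[measurable]: "(\<lambda>x. x p) \<in> borel_measurable P" for p
    using P(2) unfolding P.indep_vars_def2 by blast
  have rate: "q.rate i * \<delta> > 0" for i using q.rate_pos \<delta> by simp
  have pl: "poisson_like P (q.rate i * \<delta>) (\<lambda>x. x (Suc i, k) - q.rate i * \<delta>)" for i k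
  proof (rule poisson_like_same_law[OF coord, where M'="measure_pmf (poisson_pmf (q.rate i * \<delta>))" and X'=real])
    show "distr P borel (\<lambda>x. x (Suc i, k)) = distr (measure_pmf (poisson_pmf (q.rate i * \<delta>))) borel real"
      using P(3)[of "(Suc i, k)"] by (simp add: law_def)
    show "poisson_like (measure_pmf (poisson_pmf (q.rate i * \<delta>))) (q.rate i * \<delta>) (\<lambda>\<omega>. real \<omega> - q.rate i * \<delta>)"
      by (rule prob_space.poisson_like_centred_poisson[OF prob_space_measure_pmf, where N="\<lambda>k. k"])
        (use rate distr_id2[of "count_space UNIV" "measure_pmf (poisson_pmf (q.rate i * \<delta>))"] in auto)
  qed simp
  have normal: "distributed P lborel (\<lambda>x. x (0, k)) (normal_density 0 (sqrt \<delta>))" for k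
  proof -
    have "distr P lborel (\<lambda>x. x (0, k)) = distr P borel (\<lambda>x. x (0, k))" by (rule distr_cong) auto
    also have "\<dots> = density lborel (normal_density 0 (sqrt \<delta>))" using P(3)[of "(0, k)"] by (simp add: law_def)
    finally show ?thesis using coord[of "(0, k)"] by (auto simp: distributed_def)
  qed
  note nm = P.normal_moments[OF normal \<delta>(2)]
  have nonneg: "AE x in P. 0 \<le> x (Suc i, k)" for i k
  proof -
    have "AE y in distr P borel (\<lambda>x. x (Suc i, k)). 0 \<le> y"
    proof -
      have "law (Suc i, k) = distr (measure_pmf (poisson_pmf (q.rate i * \<delta>))) borel real" by (simp add: law_def)
      then show ?thesis unfolding P(3) by (simp only:) (subst AE_distr_iff, auto)
    qed
    then show ?thesis by (subst (asm) AE_distr_iff) auto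
  qed
  interpret e: euler_space P "\<lambda>p x. x p" N "lam * real n * (T / real N)" "\<mu> * (T / real N)" \<delta>
  proof
    show "P.indep_vars (\<lambda>_. borel) (\<lambda>p x. x p) (UNIV \<times> {..<N})"
      by (rule P.indep_vars_subset[OF P(2)]) simp
    show "AE \<omega> in P. \<forall>i k. k < N \<longrightarrow> 0 \<le> \<omega> (Suc i, k)"
      unfolding AE_all_countable using nonneg by auto
    show "poisson_like P (lam * real n * (T / real N)) (\<lambda>\<omega>. \<omega> (1, k) - lam * real n * (T / real N))" for k
      using pl[of 0 k] by (simp add: q.rate_def \<delta>_def)
    show "poisson_like P (\<mu> * (T / real N)) (\<lambda>\<omega>. \<omega> (Suc (Suc i), k) - \<mu> * (T / real N))" for i k
      using pl[of "Suc i" k] by (simp add: q.rate_def \<delta>_def)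
  qed (use nm \<delta> pos N in \<open>auto simp: \<delta>_def\<close>)
  let ?I = "UNIV \<times> {..<N} :: (nat \<times> nat) set"
  have I: "?I \<noteq> {}" using N by auto
  have indM: "q.indep_vars (\<lambda>_. borel) (\<lambda>p \<omega>. q.inc N \<omega> (fst p) (snd p)) ?I"
    using q.inc_indep[of N] by (simp add: case_prod_unfold)
  have indP: "P.indep_vars (\<lambda>_. borel) (\<lambda>p x. x (Suc (fst p), snd p)) ?I"
    by (rule P.indep_vars_reindex_inj[where h="\<lambda>p. (Suc (fst p), snd p)" and X="\<lambda>p x. x p" and M'="\<lambda>_. borel"])
      (auto intro!: P.indep_vars_subset[OF P(2)] inj_onI simp: prod_eq_iff)
  have law_eq: "distr M borel (\<lambda>\<omega>. q.inc N \<omega> (fst p) (snd p)) = distr P borel (\<lambda>x. x (Suc (fst p), snd p))" for p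
    using q.inc_law[OF N] P(3)[of "(Suc (fst p), snd p)"] by (simp add: law_def \<delta>_def)
  note transfer = indep_vars_transfer[OF q.prob_space_axioms P.prob_space_axioms I indM indP law_eq]
  \<comment> \<open>Up to time index \<open>k < N\<close> the scheme reads only columns below
    \<open>N\<close>, so it can be evaluated on the array restricted to \<open>?I\<close>.\<close>
  have noiseI: "noise a b (\<lambda>i j. (\<lambda>p\<in>?I. f p) (i, j)) k = noise a b (\<lambda>i j. f (i, j)) k" if "k < N" for a b f k
    by (rule noise_cong) (use that in auto)
  have eulerI: "euler (\<lambda>i j. (\<lambda>p\<in>?I. f p) (i, j)) k = euler (\<lambda>i j. f (i, j)) k" if "k < N" for f k
    by (rule euler_cong) (use that in auto)
  have mnoise: "(\<lambda>y. noise a b (\<lambda>i j. y (i, j)) k) \<in> borel_measurable (PiM ?I (\<lambda>_. borel))" if "k < N" for a b k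
    by (rule noise_measurable) (use that in \<open>auto intro!: measurable_component_singleton\<close>)
  have meuler: "(\<lambda>y. euler (\<lambda>i j. y (i, j)) k) \<in> borel_measurable (PiM ?I (\<lambda>_. borel))" if "k < N" for k
    by (rule euler_measurable) (use that in \<open>auto intro!: measurable_component_singleton\<close>)
  have E1: "(\<integral>\<omega>. F (q.scheme_path N \<omega>) \<partial>M) = (\<integral>x. F (ipath \<mu> T N (\<lambda>k. exp (\<mu> * grid T N (Suc k)) / sqrt (real n) * e.xi k x)) \<partial>P)"
  proof -
    \<comment> \<open>The integrand as a functional of the whole array of increments, the form to
      which \<open>transfer\<close> applies.\<close>
    define f where "f y = F (ipath \<mu> T N (\<lambda>k. exp (\<mu> * grid T N (Suc k)) / sqrt (real n)
        * noise (lam * real n * (T / real N)) (\<mu> * (T / real N)) (\<lambda>i j. y (i, j)) k))" for y :: "nat \<times> nat \<Rightarrow> real"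
    have mf: "f \<in> borel_measurable (PiM ?I (\<lambda>_. borel))"
      unfolding f_def[abs_def] by (rule Sigma_class_ipath_measurable[OF F]) (use mnoise in auto)
    have "f (\<lambda>p\<in>?I. q.inc N \<omega> (fst p) (snd p)) = F (q.scheme_path N \<omega>)" for \<omega>
      unfolding f_def q.scheme_path_def
      by (rule arg_cong[of _ _ F], rule ipath_cong) (use noiseI[of _ _ _ "\<lambda>p. q.inc N \<omega> (fst p) (snd p)"] in simp)
    moreover have "f (\<lambda>p\<in>?I. x (Suc (fst p), snd p)) = F (ipath \<mu> T N (\<lambda>k. exp (\<mu> * grid T N (Suc k)) / sqrt (real n) * e.xi k x))" for x
      unfolding f_def e.xi_def e.data_def[abs_def]
      by (rule arg_cong[of _ _ F], rule ipath_cong) (use noiseI[of _ _ _ "\<lambda>p. x (Suc (fst p), snd p)"] in simp)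
    ultimately show ?thesis using transfer[OF mf] by simp
  qed
  have E2: "(\<integral>\<omega>. q.scheme_error N \<omega> \<partial>M) = (\<integral>x. T / real N * (\<Sum>k<N. \<bar>e.active k x - real n * fluid_limit lam \<mu> (grid T N k)
          - exp (- \<mu> * grid T N k) * (\<Sum>j<k. exp (\<mu> * grid T N (Suc j)) * e.xi j x)\<bar>) \<partial>P)"
  proof -
    define f where "f y = T / real N * (\<Sum>k<N. \<bar>real (nat \<lfloor>euler (\<lambda>i j. y (i, j)) k\<rfloor>) - real n * fluid_limit lam \<mu> (grid T N k)
          - exp (- \<mu> * grid T N k) * (\<Sum>j<k. exp (\<mu> * grid T N (Suc j))
            * noise (lam * real n * (T / real N)) (\<mu> * (T / real N)) (\<lambda>i j. y (i, j)) j)\<bar>)" for y :: "nat \<times> nat \<Rightarrow> real"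
    have mf: "f \<in> borel_measurable (PiM ?I (\<lambda>_. borel))"
      unfolding f_def[abs_def]
    proof (intro borel_measurable_times borel_measurable_const borel_measurable_sum borel_measurable_abs borel_measurable_diff)
      fix k assume "k \<in> {..<N}"
      then have m: "(\<lambda>y. euler (\<lambda>i j. y (i, j)) k) \<in> borel_measurable (PiM ?I (\<lambda>_. borel))" using meuler by simp
      show "(\<lambda>y. real (nat \<lfloor>euler (\<lambda>i j. y (i, j)) k\<rfloor>)) \<in> borel_measurable (PiM ?I (\<lambda>_. borel))"
        by (rule measurable_compose[OF m measurable_nat_floor])
    qed (use mnoise in auto)
    have "f (\<lambda>p\<in>?I. q.inc N \<omega> (fst p) (snd p)) = q.scheme_error N \<omega>" for \<omega>
      unfolding f_def q.scheme_error_def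
      using noiseI[of _ _ _ "\<lambda>p. q.inc N \<omega> (fst p) (snd p)"] eulerI[of _ "\<lambda>p. q.inc N \<omega> (fst p) (snd p)"] by simp
    moreover have "f (\<lambda>p\<in>?I. x (Suc (fst p), snd p)) = T / real N * (\<Sum>k<N. \<bar>e.active k x - real n * fluid_limit lam \<mu> (grid T N k)
          - exp (- \<mu> * grid T N k) * (\<Sum>j<k. exp (\<mu> * grid T N (Suc j)) * e.xi j x)\<bar>)" for x
      unfolding f_def e.xi_def e.active_def e.data_def[abs_def]
      using noiseI[of _ _ _ "\<lambda>p. x (Suc (fst p), snd p)"] eulerI[of _ "\<lambda>p. x (Suc (fst p), snd p)"] by simp
    ultimately show ?thesis using transfer[OF mf] by simp
  qed
  have E3: "(\<integral>\<omega>. F (l.gauss_path N \<omega>) \<partial>M')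
      = (\<integral>x. F (ipath \<mu> T N (\<lambda>k. exp (\<mu> * grid T N (Suc k)) * sqrt (h_fun lam \<mu> (grid T N k)) * x (0, k))) \<partial>P)"
  proof -
    have J: "{..<N} \<noteq> {}" using N by auto
    have indP': "P.indep_vars (\<lambda>_. borel) (\<lambda>k x. x (0, k)) {..<N}"
      by (rule P.indep_vars_reindex_inj[where h="\<lambda>k. (0, k)" and X="\<lambda>p x. x p" and M'="\<lambda>_. borel"])
        (auto intro!: P.indep_vars_subset[OF P(2)] inj_onI)
    have law': "distr M' borel (l.dB N k) = distr P borel (\<lambda>x. x (0, k))" for k
    proof -
      have "distr M' borel (l.dB N k) = distr M' lborel (l.dB N k)" by (rule distr_cong) auto
      also have "\<dots> = density lborel (normal_density 0 (sqrt \<delta>))"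
        using l.dB_moments(1)[OF N, of k] by (simp add: distributed_def \<delta>_def)
      finally show ?thesis using P(3)[of "(0, k)"] by (simp add: law_def)
    qed
    define f where "f y = F (ipath \<mu> T N (\<lambda>k. l.wt N k * y k))" for y
    have mf: "f \<in> borel_measurable (PiM {..<N} (\<lambda>_. borel))"
      unfolding f_def[abs_def]
      by (rule Sigma_class_ipath_measurable[OF F]) (auto intro!: borel_measurable_times measurable_component_singleton)
    have "f (\<lambda>k\<in>{..<N}. y k) = f y" for y
      unfolding f_def by (rule arg_cong[of _ _ F], rule ipath_cong) simp
    then show ?thesis
      using indep_vars_transfer[OF l.prob_space_axioms P.prob_space_axioms J l.dB_indep indP' law' mf]
      by (simp add: f_def l.gauss_path_def l.wt_def)
  qed
  show ?thesis
    unfolding E1 E2 E3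
    by (rule e.lindeberg_bound[OF F pos(1,2,4) _ N]) (use pos in \<open>auto simp: \<delta>_def\<close>)
qed

lemma lindeberg_const_nonneg: "lam > 0 \<Longrightarrow> \<mu> > 0 \<Longrightarrow> T > 0 \<Longrightarrow> 0 \<le> lindeberg_const lam \<mu> T"
  by (simp add: lindeberg_const_def)

text \<open>The estimate holds on every dyadic grid; letting the mesh vanish at fixed
  \<open>n\<close> removes the scheme error, the rest terms and both approximation errors. The
  summand 1 of the constant is the interpolation error of one jump.\<close>

lemma queue_limit_distance:
  assumes q: "queue_on_interval M lam \<mu> n A S L T" and l: "limit_on_interval M' lam \<mu> T B Z"
    and F: "F \<in> Sigma_class T"
  shows "\<bar>(\<integral>\<omega>. F (sample_path T (Z_n lam \<mu> n L) \<omega>) \<partial>M) - (\<integral>\<omega>. F (sample_path T Z \<omega>) \<partial>M')\<bar>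
    \<le> (1 + lindeberg_const lam \<mu> T) / sqrt (real n)"
proof -
  interpret q: queue_on_interval M lam \<mu> n A S L T by fact
  interpret l: limit_on_interval M' lam \<mu> T B Z by fact
  obtain \<epsilon> where \<epsilon>: "\<epsilon> \<longlonglongrightarrow> 0" "\<And>j. \<bar>(\<integral>\<omega>. F (sample_path T (Z_n lam \<mu> n L) \<omega>) \<partial>M)
      - (\<integral>\<omega>. F (q.scheme_path (2^j) \<omega>) \<partial>M)\<bar> \<le> 1 / sqrt (real n) + \<epsilon> j"
    using q.queue_scheme_expectation[OF F] by blast
  obtain \<epsilon>' where \<epsilon>': "\<epsilon>' \<longlonglongrightarrow> 0" "\<And>j. \<bar>(\<integral>\<omega>. F (sample_path T Z \<omega>) \<partial>M')
      - (\<integral>\<omega>. F (l.gauss_path (2^j) \<omega>) \<partial>M')\<bar> \<le> \<epsilon>' j"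
    using l.limit_expectation[OF F] by blast
  define c where "c = (2 + T) / 2 * (exp (\<mu> * T) ^ 2 * \<mu>)"
  define r where "r j = (1 / sqrt (real n) + \<epsilon> j) + (lindeberg_const lam \<mu> T / sqrt (real n)
      + c * (\<integral>\<omega>. q.scheme_error (2^j) \<omega> \<partial>M) + lindeberg_rest lam \<mu> T (real n) (2^j)) + \<epsilon>' j" for j
  have le: "\<bar>(\<integral>\<omega>. F (sample_path T (Z_n lam \<mu> n L) \<omega>) \<partial>M) - (\<integral>\<omega>. F (sample_path T Z \<omega>) \<partial>M')\<bar> \<le> r j" for j
    using \<epsilon>(2)[of j] \<epsilon>'(2)[of j] swap_queue_gauss[OF q l F, of "2^j"] unfolding r_def c_def by simp
  have "r \<longlonglongrightarrow> (1 / sqrt (real n) + 0) + (lindeberg_const lam \<mu> T / sqrt (real n) + c * 0 + 0) + 0"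
    unfolding r_def by (intro tendsto_intros \<epsilon> \<epsilon>' q.scheme_error_limit lindeberg_rest_limit)
  then have "\<bar>(\<integral>\<omega>. F (sample_path T (Z_n lam \<mu> n L) \<omega>) \<partial>M) - (\<integral>\<omega>. F (sample_path T Z \<omega>) \<partial>M')\<bar>
      \<le> (1 / sqrt (real n) + 0) + (lindeberg_const lam \<mu> T / sqrt (real n) + c * 0 + 0) + 0"
    by (rule LIMSEQ_le_const) (use le in auto)
  then show ?thesis by (simp add: add_divide_distrib)
qed

theorem theorem2p2:
  fixes lam \<mu> T :: real
  assumes "lam > 0" and "\<mu> > 0" and "T > 0"
  shows "\<exists>c>0. \<forall>n::nat. n \<ge> 3 \<longrightarrow>
    (\<forall>(M :: 'a measure) A S L (M' :: 'b measure) B Z.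
       rescaled_queue M lam \<mu> n A S L \<longrightarrow> limit_process M' lam \<mu> T B Z \<longrightarrow>
       dist_Sigma T M (Z_n lam \<mu> n L) M' Z
         \<le> ereal (c * ln (real n) / (ln (ln (real n)) * sqrt (real n))))"
proof (intro exI conjI allI impI)
  show c: "1 + lindeberg_const lam \<mu> T > 0" using lindeberg_const_nonneg[OF assms] by simp
  fix n :: nat and M :: "'a measure" and A S L and M' :: "'b measure" and B Z
  assume n: "3 \<le> n" and q: "rescaled_queue M lam \<mu> n A S L" and l: "limit_process M' lam \<mu> T B Z"
  have q': "queue_on_interval M lam \<mu> n A S L T"
    using q n assms by (auto simp: queue_on_interval_def queue_on_interval_axioms_def)
  have l': "limit_on_interval M' lam \<mu> T B Z"
    using l assms by (auto simp: limit_on_interval_def limit_on_interval_axioms_def)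
  \<comment> \<open>Here \<open>n \<ge> 3\<close> enters: beyond Euler's number the logarithm
    exceeds 1, so the iterated logarithm is positive and at most \<open>ln n\<close>, and the factor
    multiplied in below is at least 1.\<close>
  have "exp 1 < real n" using e_less_272 n by simp
  then have ln1: "1 < ln (real n)" using n by (metis exp_gt_zero ln_exp ln_less_cancel_iff order.strict_trans)
  have lnln: "0 < ln (ln (real n))" "ln (ln (real n)) \<le> ln (real n)"
    using ln1 ln_le_minus_one[of "ln (real n)"] by auto
  have "(1 + lindeberg_const lam \<mu> T) / sqrt (real n)
      \<le> (1 + lindeberg_const lam \<mu> T) / sqrt (real n) * (ln (real n) / ln (ln (real n)))"
    using mult_left_mono[of 1 "ln (real n) / ln (ln (real n))" "(1 + lindeberg_const lam \<mu> T) / sqrt (real n)"] c lnln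
    by simp
  also have "\<dots> = (1 + lindeberg_const lam \<mu> T) * ln (real n) / (ln (ln (real n)) * sqrt (real n))"
    by (simp add: mult_ac)
  finally have rate: "(1 + lindeberg_const lam \<mu> T) / sqrt (real n)
      \<le> (1 + lindeberg_const lam \<mu> T) * ln (real n) / (ln (ln (real n)) * sqrt (real n))" .
  show "dist_Sigma T M (Z_n lam \<mu> n L) M' Z
      \<le> ereal ((1 + lindeberg_const lam \<mu> T) * ln (real n) / (ln (ln (real n)) * sqrt (real n)))"
    unfolding dist_Sigma_def
    by (rule SUP_least) (use queue_limit_distance[OF q' l'] rate in \<open>auto intro: order_trans\<close>)
qed

end
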